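(* Let $Q$ be a finite quiver, $n\ge 2$, and let $A=\mathcal{D}(\Phi_n,n-2)$, with $\Phi_n\in\mathbb{C}Q$ a homogeneous superpotential of degree $n$, be $n$-Calabi-Yau and $2$-Koszul. Let $\mathcal{A}$ be a zeroPBW deformation of $A$, given by maps $\theta_1,\theta_0$, with $\theta_1=0$. Then $\mathcal{A}$ is $n$-Calabi-Yau.
   Context: Quivers. $Q=(Q_0,Q_1)$ is a finite quiver with head and tail maps $h,t:Q_1\to Q_0$. A path is $p=a_r\cdots a_1$ with $h(a_i)=t(a_{i+1})$, of pathlength $|p|=r$; for each vertex $v$ there is a trivial path $e_v$ of length $0$. In the path algebra $\mathbb{C}Q$, $p\cdot q=pq$ if $h(q)=t(p)$ and $0$ otherwise. $S$ is the semisimple subalgebra spanned by trivial paths, $V$ the span of the arrows, $S^e=S\otimes_{\mathbb{C}}S^{op}$, and $\mathbb{C}Q=T_S(V)$, graded by pathlength with filtration $F^m=V^{\otimes_S m}\oplus\dots\oplus V\oplus S$. $I(X)$ is the two-sided ideal generated by $X$, $\langle X\rangle$ the $S^e$-submodule generated by $X$. Superpotentials. A homogeneous superpotential of degree $n$ is $\Phi_n=\sum_p c_p p\in V^{\otimes_S n}$ with $c_{aq}=(-1)^{n-1}c_{qa}$ for all arrows $a$ and paths $q$ (convention: the coefficient attached to a zero product of paths is $0$). For paths $p,q$, $\delta_q p=t$ if $p=qt$ and $\delta_q p=0$ otherwise, extended linearly. $\mathcal{D}(\Phi_n,k):=\mathbb{C}Q/I(\langle\delta_p\Phi_n:|p|=k\rangle)$.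 Calabi-Yau. Let $A^e=A\otimes_{\mathbb{C}}A^{op}$. For $m\ge2$, $A$ is $m$-Calabi-Yau if $A$ has a finite length resolution by finitely generated projective $A^e$-modules and $\mathrm{RHom}_{A^e}(A,A^e)[m]\cong A$ in $D(A^e)$ (Hom taken with respect to the outer structure on $A\otimes A$, with the $A^e$-structure on the result induced by the inner one). $2$-Koszul. Let $A=T_S(V)/I(R)$ with $R$ an $S^e$-submodule of $V\otimes_S V$. Set $K_0=S$, $K_1=V$, $K_i=\bigcap_{j+2+l=i}V^{\otimes j}\otimes_S R\otimes_S V^{\otimes l}$ for $i\ge 2$. Let $d_l(\alpha\otimes v_1\cdots v_i\otimes\beta)=\alpha v_1\otimes v_2\cdots v_i\otimes\beta$ and $d_r(\alpha\otimes v_1\cdots v_i\otimes\beta)=\alpha\otimes v_1\cdots v_{i-1}\otimes v_i\beta$. $A$ is $2$-Koszul if the complex $\cdots\to A\otimes_S K_2\otimes_S A\to A\otimes_S K_1\otimes_S A\to A\otimes_S K_0\otimes_S A\xrightarrow{\mu}A\to0$ with differential $d_l+(-1)^i d_r$ on $A\otimes_S K_i\otimes_S A$ and $\mu$ multiplication is exact. PBW deformations. Let $A=T_S(V)/I(R)$ with $R\subset V^{\otimes_S 2}$ (here $R=\langle\delta_p\Phi_n:|p|=n-2\rangle$), and let $P\subset F^2$ be an $S^e$-submodule whose image under the projection $F^2\to V^{\otimes_S 2}$ is $R$. The algebra $\mathcal{A}=T_S(V)/I(P)$ is filtered by the images of the $F^m$ and there is a natural surjective graded map $A\to\mathrm{gr}(\mathcal{A})$.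 $\mathcal{A}$ is a PBW deformation of $A$ if this map is an isomorphism. In that case $P\cap F^1=0$, so $P=\{r-\theta(r):r\in R\}$ for a unique $S^e$-module map $\theta=\theta_1+\theta_0$ with $\theta_1:R\to V$, $\theta_0:R\to S$. $\mathcal{A}$ is a zeroPBW deformation if it is a PBW deformation and the map $\psi(\theta_1)=\mathrm{id}\otimes\theta_1-\theta_1\otimes\mathrm{id}:(V\otimes_S R)\cap(R\otimes_S V)\to V\otimes_S V$ is zero. *)

theory Defs
  imports
    Complex_Main
    "Graph_Theory.Arc_Walk"
    "HOL-Library.Poly_Mapping"
    "HOL-Algebra.QuotRing"
    "HOL-Algebra.Module"
begin

section \<open>Complex vector spaces with a given basis\<close>

definition pscale :: "complex \<Rightarrow> ('b \<Rightarrow>\<^sub>0 complex) \<Rightarrow> ('b \<Rightarrow>\<^sub>0 complex)" where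
  "pscale c x = Poly_Mapping.map ((*) c) x"

lemma lookup_pscale [simp]: "Poly_Mapping.lookup (pscale c x) k = c * Poly_Mapping.lookup x k"
  unfolding pscale_def by transfer (auto simp: when_def)

interpretation pm: vector_space pscale
  by unfold_locales (auto intro!: poly_mapping_eqI simp: Poly_Mapping.lookup_add algebra_simps)

definition bas :: "'b \<Rightarrow> ('b \<Rightarrow>\<^sub>0 complex)" where
  "bas b = Poly_Mapping.single b 1"

definition lin_ext :: "('b \<Rightarrow> ('c \<Rightarrow>\<^sub>0 complex)) \<Rightarrow> ('b \<Rightarrow>\<^sub>0 complex) \<Rightarrow> ('c \<Rightarrow>\<^sub>0 complex)" where
  "lin_ext D x = (\<Sum>b\<in>Poly_Mapping.keys x. pscale (Poly_Mapping.lookup x b) (D b))"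

text \<open>
  Algebras over the complex numbers, and modules over arbitrary (non-commutative) rings, are
  carried by the record type of \<^theory>\<open>HOL-Algebra.Module\<close>. When such a record is used as a
  module only, its fields \<^const>\<open>mult\<close> and \<^const>\<open>one\<close> are irrelevant.

  \<open>basis_alg B f u\<close> is the algebra with basis \<open>B\<close> and unit \<open>u\<close> in which the product of the basis
  elements \<open>p\<close>, \<open>q\<close> is the basis element \<open>r\<close> if \<open>f p q = Some r\<close>, and zero if \<open>f p q = None\<close>.
\<close>

definition basis_alg ::
  "'b set \<Rightarrow> ('b \<Rightarrow> 'b \<Rightarrow> 'b option) \<Rightarrow> ('b \<Rightarrow>\<^sub>0 complex) \<Rightarrow> (complex, 'b \<Rightarrow>\<^sub>0 complex) module" where
  "basis_alg B f u =
     \<lparr> carrier = {x. Poly_Mapping.keys x \<subseteq> B},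
       mult = (\<lambda>x y. \<Sum>p\<in>Poly_Mapping.keys x. \<Sum>q\<in>Poly_Mapping.keys y.
                 (case f p q of None \<Rightarrow> 0
                  | Some r \<Rightarrow>
                      Poly_Mapping.single r (Poly_Mapping.lookup x p * Poly_Mapping.lookup y q))),
       one = u, zero = 0, add = (+), smult = pscale \<rparr>"

definition basis_vs :: "'b set \<Rightarrow> (complex, 'b \<Rightarrow>\<^sub>0 complex) module" where
  "basis_vs B = basis_alg B (\<lambda>_ _. None) 0"

text \<open>
  \<open>N\<close> is a submodule, or a two-sided ideal if \<open>M\<close> is an algebra; all representatives of \<open>X\<close> give the
  same coset.
\<close>

definition quotient_module :: "('r, 'x) module \<Rightarrow> 'x set \<Rightarrow> ('r, 'x set) module" where
  "quotient_module M N =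
     ring.extend (M Quot N) (module.fields (\<lambda>r X. \<Union>x\<in>X. N +>\<^bsub>M\<^esub> (r \<odot>\<^bsub>M\<^esub> x)))"


section \<open>Quivers and path algebras\<close>

text \<open>
  A finite quiver is a \<^locale>\<open>fin_digraph\<close>: loops and multiple arrows are allowed. A path is a triple
  (tail, arrows, head), where the arrows are listed in the order in which they are traversed; the
  path written \<open>a\<^sub>r \<cdots> a\<^sub>1\<close> has the list \<open>[a\<^sub>1, \<dots>, a\<^sub>r]\<close>.
\<close>

type_synonym ('v, 'e) qpath = "'v \<times> 'e list \<times> 'v"
type_synonym ('v, 'e) qelem = "('v, 'e) qpath \<Rightarrow>\<^sub>0 complex"

definition qpaths :: "('v, 'e) pre_digraph \<Rightarrow> ('v, 'e) qpath set" where
  "qpaths Q = {(u, p, v). pre_digraph.awalk Q u p v}"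

definition plen :: "('v, 'e) qpath \<Rightarrow> nat" where
  "plen p = length (fst (snd p))"

definition triv :: "'v \<Rightarrow> ('v, 'e) qpath" where
  "triv v = (v, [], v)"

definition arrow :: "('v, 'e) pre_digraph \<Rightarrow> 'e \<Rightarrow> ('v, 'e) qpath" where
  "arrow Q a = (tail Q a, [a], head Q a)"

text \<open>The product \<open>p \<cdot> q\<close> traverses \<open>q\<close> first and then \<open>p\<close>.\<close>

definition pcomp :: "('v, 'e) qpath \<Rightarrow> ('v, 'e) qpath \<Rightarrow> ('v, 'e) qpath option" where
  "pcomp p q = (case (p, q) of ((u, as, v), (u', bs, v')) \<Rightarrow>
     if v' = u then Some (u', bs @ as, v) else None)"

definition path_alg :: "('v, 'e) pre_digraph \<Rightarrow> (complex, ('v, 'e) qelem) module" where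
  "path_alg Q = basis_alg (qpaths Q) pcomp (\<Sum>v\<in>verts Q. bas (triv v))"

text \<open>
  \<open>\<complex>Q = T\<^sub>S(V)\<close>: the \<open>m\<close>-th tensor power of \<open>V\<close> over \<open>S\<close> is the span \<open>Vpow Q m\<close> of the paths of
  length \<open>m\<close>. As \<open>S\<close> is semisimple, for \<open>S\<close>-subbimodules \<open>X\<close>, \<open>Y\<close> of tensor powers of \<open>V\<close> the
  tensor product of \<open>X\<close> and \<open>Y\<close> over \<open>S\<close> is the subspace \<open>tprod Q X Y\<close> of \<open>\<complex>Q\<close> spanned by the
  products.
\<close>

definition Vpow :: "('v, 'e) pre_digraph \<Rightarrow> nat \<Rightarrow> ('v, 'e) qelem set" where
  "Vpow Q m = {x. Poly_Mapping.keys x \<subseteq> {p \<in> qpaths Q. plen p = m}}"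

abbreviation Salg :: "('v, 'e) pre_digraph \<Rightarrow> ('v, 'e) qelem set" where
  "Salg Q \<equiv> Vpow Q 0"

abbreviation Varr :: "('v, 'e) pre_digraph \<Rightarrow> ('v, 'e) qelem set" where
  "Varr Q \<equiv> Vpow Q 1"

definition Filt :: "('v, 'e) pre_digraph \<Rightarrow> nat \<Rightarrow> ('v, 'e) qelem set" where
  "Filt Q m = {x. Poly_Mapping.keys x \<subseteq> {p \<in> qpaths Q. plen p \<le> m}}"

definition hom_part :: "nat \<Rightarrow> ('v, 'e) qelem \<Rightarrow> ('v, 'e) qelem" where
  "hom_part m x = (\<Sum>p\<in>{p \<in> Poly_Mapping.keys x. plen p = m}.
     Poly_Mapping.single p (Poly_Mapping.lookup x p))"

definition tprod :: "('v, 'e) pre_digraph \<Rightarrow> ('v, 'e) qelem set \<Rightarrow> ('v, 'e) qelem set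
    \<Rightarrow> ('v, 'e) qelem set" where
  "tprod Q X Y = pm.span {x \<otimes>\<^bsub>path_alg Q\<^esub> y | x y. x \<in> X \<and> y \<in> Y}"

definition S_subbimodule :: "('v, 'e) pre_digraph \<Rightarrow> ('v, 'e) qelem set \<Rightarrow> bool" where
  "S_subbimodule Q X \<longleftrightarrow> X \<subseteq> carrier (path_alg Q) \<and> pm.subspace X \<and>
     (\<forall>s\<in>Salg Q. \<forall>t\<in>Salg Q. \<forall>x\<in>X. s \<otimes>\<^bsub>path_alg Q\<^esub> x \<otimes>\<^bsub>path_alg Q\<^esub> t \<in> X)"

definition S_generated :: "('v, 'e) pre_digraph \<Rightarrow> ('v, 'e) qelem set \<Rightarrow> ('v, 'e) qelem set" where
  "S_generated Q X = \<Inter>{Y. S_subbimodule Q Y \<and> X \<subseteq> Y}"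

definition S_bimodule_hom :: "('v, 'e) pre_digraph \<Rightarrow> ('v, 'e) qelem set \<Rightarrow> ('v, 'e) qelem set
    \<Rightarrow> (('v, 'e) qelem \<Rightarrow> ('v, 'e) qelem) \<Rightarrow> bool" where
  "S_bimodule_hom Q X Y f \<longleftrightarrow> f \<in> X \<rightarrow> Y \<and>
     (\<forall>x\<in>X. \<forall>y\<in>X. f (x + y) = f x + f y) \<and>
     (\<forall>s\<in>Salg Q. \<forall>t\<in>Salg Q. \<forall>x\<in>X.
        f (s \<otimes>\<^bsub>path_alg Q\<^esub> x \<otimes>\<^bsub>path_alg Q\<^esub> t) = s \<otimes>\<^bsub>path_alg Q\<^esub> f x \<otimes>\<^bsub>path_alg Q\<^esub> t)"

definition quiver_ideal :: "('v, 'e) pre_digraph \<Rightarrow> ('v, 'e) qelem set \<Rightarrow> ('v, 'e) qelem set" where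
  "quiver_ideal Q X = Idl\<^bsub>path_alg Q\<^esub> X"

definition quiver_quot :: "('v, 'e) pre_digraph \<Rightarrow> ('v, 'e) qelem set
    \<Rightarrow> (complex, ('v, 'e) qelem set) module" where
  "quiver_quot Q X = quotient_module (path_alg Q) (quiver_ideal Q X)"

definition qclass :: "('v, 'e) pre_digraph \<Rightarrow> ('v, 'e) qelem set \<Rightarrow> ('v, 'e) qelem
    \<Rightarrow> ('v, 'e) qelem set" where
  "qclass Q X x = quiver_ideal Q X +>\<^bsub>path_alg Q\<^esub> x"


section \<open>Superpotentials\<close>

text \<open>The coefficient of \<open>p \<cdot> q\<close> in \<open>x\<close>; it is zero if the product is zero.\<close>

definition pcoeff :: "('v, 'e) qelem \<Rightarrow> ('v, 'e) qpath \<Rightarrow> ('v, 'e) qpath \<Rightarrow> complex" where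
  "pcoeff x p q = (case pcomp p q of None \<Rightarrow> 0 | Some r \<Rightarrow> Poly_Mapping.lookup x r)"

definition superpotential :: "('v, 'e) pre_digraph \<Rightarrow> nat \<Rightarrow> ('v, 'e) qelem \<Rightarrow> bool" where
  "superpotential Q n \<Phi> \<longleftrightarrow> \<Phi> \<in> Vpow Q n \<and>
     (\<forall>a\<in>arcs Q. \<forall>q\<in>qpaths Q.
        pcoeff \<Phi> (arrow Q a) q = (- 1) ^ (n - 1) * pcoeff \<Phi> q (arrow Q a))"

text \<open>
  \<open>ldel q\<close> sends a path \<open>q t\<close> to \<open>t\<close>, and \<open>rdel q\<close> sends \<open>t q\<close> to \<open>t\<close>; in both inner sums there is
  at most one \<open>t\<close>.
\<close>

definition ldel :: "('v, 'e) qpath \<Rightarrow> ('v, 'e) qelem \<Rightarrow> ('v, 'e) qelem" where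
  "ldel q x = (\<Sum>p\<in>Poly_Mapping.keys x. \<Sum>t\<in>{t. pcomp q t = Some p}.
     Poly_Mapping.single t (Poly_Mapping.lookup x p))"

definition rdel :: "('v, 'e) qpath \<Rightarrow> ('v, 'e) qelem \<Rightarrow> ('v, 'e) qelem" where
  "rdel q x = (\<Sum>p\<in>Poly_Mapping.keys x. \<Sum>t\<in>{t. pcomp t q = Some p}.
     Poly_Mapping.single t (Poly_Mapping.lookup x p))"

definition superpot_rels :: "('v, 'e) pre_digraph \<Rightarrow> ('v, 'e) qelem \<Rightarrow> nat
    \<Rightarrow> ('v, 'e) qelem set" where
  "superpot_rels Q \<Phi> k = S_generated Q {ldel p \<Phi> | p. p \<in> qpaths Q \<and> plen p = k}"

definition superpot_alg :: "('v, 'e) pre_digraph \<Rightarrow> ('v, 'e) qelem \<Rightarrow> nat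
    \<Rightarrow> (complex, ('v, 'e) qelem set) module" where
  "superpot_alg Q \<Phi> k = quiver_quot Q (superpot_rels Q \<Phi> k)"


section \<open>Modules over non-commutative rings and their complexes\<close>

locale left_module = R?: ring R + M?: abelian_group M for R (structure) and M (structure) +
  assumes smult_closed:
      "\<lbrakk>a \<in> carrier R; x \<in> carrier M\<rbrakk> \<Longrightarrow> a \<odot>\<^bsub>M\<^esub> x \<in> carrier M"
    and smult_l_distr:
      "\<lbrakk>a \<in> carrier R; b \<in> carrier R; x \<in> carrier M\<rbrakk> \<Longrightarrow>
       (a \<oplus> b) \<odot>\<^bsub>M\<^esub> x = a \<odot>\<^bsub>M\<^esub> x \<oplus>\<^bsub>M\<^esub> b \<odot>\<^bsub>M\<^esub> x"
    and smult_r_distr: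
      "\<lbrakk>a \<in> carrier R; x \<in> carrier M; y \<in> carrier M\<rbrakk> \<Longrightarrow>
       a \<odot>\<^bsub>M\<^esub> (x \<oplus>\<^bsub>M\<^esub> y) = a \<odot>\<^bsub>M\<^esub> x \<oplus>\<^bsub>M\<^esub> a \<odot>\<^bsub>M\<^esub> y"
    and smult_assoc:
      "\<lbrakk>a \<in> carrier R; b \<in> carrier R; x \<in> carrier M\<rbrakk> \<Longrightarrow>
       (a \<otimes> b) \<odot>\<^bsub>M\<^esub> x = a \<odot>\<^bsub>M\<^esub> (b \<odot>\<^bsub>M\<^esub> x)"
    and smult_one: "x \<in> carrier M \<Longrightarrow> \<one> \<odot>\<^bsub>M\<^esub> x = x"

definition lmod_hom ::
  "('r, 'm) ring_scheme \<Rightarrow> ('r, 'x) module \<Rightarrow> ('r, 'y) module \<Rightarrow> ('x \<Rightarrow> 'y) \<Rightarrow> bool" where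
  "lmod_hom R M N f \<longleftrightarrow> f \<in> carrier M \<rightarrow> carrier N \<and>
     (\<forall>x\<in>carrier M. \<forall>y\<in>carrier M. f (x \<oplus>\<^bsub>M\<^esub> y) = f x \<oplus>\<^bsub>N\<^esub> f y) \<and>
     (\<forall>r\<in>carrier R. \<forall>x\<in>carrier M. f (r \<odot>\<^bsub>M\<^esub> x) = r \<odot>\<^bsub>N\<^esub> f x)"

definition regular_module :: "('r, 'm) ring_scheme \<Rightarrow> ('r, 'r) module" where
  "regular_module R = \<lparr> carrier = carrier R, mult = mult R, one = one R, zero = zero R,
     add = add R, smult = mult R \<rparr>"

definition free_module :: "('r, 'm) ring_scheme \<Rightarrow> nat \<Rightarrow> ('r, nat \<Rightarrow> 'r) module" where
  "free_module R k =
     \<lparr> carrier = {..<k} \<rightarrow>\<^sub>E carrier R, mult = undefined, one = undefined,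
       zero = (\<lambda>i\<in>{..<k}. \<zero>\<^bsub>R\<^esub>),
       add = (\<lambda>f g. \<lambda>i\<in>{..<k}. f i \<oplus>\<^bsub>R\<^esub> g i),
       smult = (\<lambda>r f. \<lambda>i\<in>{..<k}. r \<otimes>\<^bsub>R\<^esub> f i) \<rparr>"

text \<open>Finitely generated projective: a direct summand of a free module of finite rank.\<close>

definition fg_projective :: "('r, 'm) ring_scheme \<Rightarrow> ('r, 'x) module \<Rightarrow> bool" where
  "fg_projective R P \<longleftrightarrow> left_module R P \<and>
     (\<exists>k f g. lmod_hom R P (free_module R k) f \<and> lmod_hom R (free_module R k) P g \<and>
        (\<forall>x\<in>carrier P. g (f x) = x))"

definition fin_fgproj_resolution :: "('r, 'm) ring_scheme \<Rightarrow> ('r, 'x) module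
    \<Rightarrow> (nat \<Rightarrow> ('r, 'p) module) \<Rightarrow> (nat \<Rightarrow> 'p \<Rightarrow> 'p) \<Rightarrow> ('p \<Rightarrow> 'x) \<Rightarrow> bool" where
  "fin_fgproj_resolution R M P d \<epsilon> \<longleftrightarrow>
     left_module R M \<and> (\<forall>i. fg_projective R (P i)) \<and>
     (\<exists>N. \<forall>i>N. carrier (P i) = {\<zero>\<^bsub>P i\<^esub>}) \<and>
     (\<forall>i. lmod_hom R (P (Suc i)) (P i) (d i)) \<and> lmod_hom R (P 0) M \<epsilon> \<and>
     \<epsilon> ` carrier (P 0) = carrier M \<and>
     d 0 ` carrier (P 1) = {x \<in> carrier (P 0). \<epsilon> x = \<zero>\<^bsub>M\<^esub>} \<and>
     (\<forall>i. d (Suc i) ` carrier (P (Suc (Suc i)))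
            = {x \<in> carrier (P (Suc i)). d i x = \<zero>\<^bsub>P i\<^esub>})"

record ('r, 'x) cochain =
  cob :: "int \<Rightarrow> ('r, 'x) module"
  cdiff :: "int \<Rightarrow> 'x \<Rightarrow> 'x"

definition cochain_complex :: "('r, 'm) ring_scheme \<Rightarrow> ('r, 'x) cochain \<Rightarrow> bool" where
  "cochain_complex R C \<longleftrightarrow>
     (\<forall>i. left_module R (cob C i) \<and> lmod_hom R (cob C i) (cob C (i + 1)) (cdiff C i) \<and>
        (\<forall>x\<in>carrier (cob C i). cdiff C (i + 1) (cdiff C i x) = \<zero>\<^bsub>cob C (i + 2)\<^esub>))"

definition cobound :: "('r, 'x) cochain \<Rightarrow> int \<Rightarrow> 'x set" where
  "cobound C i = cdiff C (i - 1) ` carrier (cob C (i - 1))"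

definition cohomology :: "('r, 'x) cochain \<Rightarrow> int \<Rightarrow> ('r, 'x set) module" where
  "cohomology C i = quotient_module
     ((cob C i)\<lparr>carrier := {x \<in> carrier (cob C i). cdiff C i x = \<zero>\<^bsub>cob C (i + 1)\<^esub>}\<rparr>)
     (cobound C i)"

definition quasi_iso :: "('r, 'm) ring_scheme \<Rightarrow> ('r, 'x) cochain \<Rightarrow> ('r, 'y) cochain
    \<Rightarrow> (int \<Rightarrow> 'x \<Rightarrow> 'y) \<Rightarrow> bool" where
  "quasi_iso R C D f \<longleftrightarrow>
     cochain_complex R C \<and> cochain_complex R D \<and>
     (\<forall>i. lmod_hom R (cob C i) (cob D i) (f i)) \<and>
     (\<forall>i. \<forall>x\<in>carrier (cob C i). f (i + 1) (cdiff C i x) = cdiff D i (f i x)) \<and>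
     (\<forall>i. bij_betw (\<lambda>X. \<Union>x\<in>X. cobound D i +>\<^bsub>cob D i\<^esub> f i x)
            (carrier (cohomology C i)) (carrier (cohomology D i)))"

text \<open>
  Isomorphism in the derived category, as a roof of quasi-isomorphisms \<open>C \<leftarrow> Z \<rightarrow> D\<close>. The apex
  \<open>Z\<close> has to be carried by some fixed type, here that of \<open>C\<close>. This is no restriction below, where
  \<open>D\<close> is concentrated in a single degree: if \<open>C\<close> and \<open>D\<close> are isomorphic in the derived
  category, then a canonical truncation of \<open>C\<close>, a subcomplex of \<open>C\<close>, is the apex of a roof.
\<close>

definition derived_iso :: "('r, 'm) ring_scheme \<Rightarrow> ('r, 'x) cochain \<Rightarrow> ('r, 'y) cochain \<Rightarrow> bool" where
  "derived_iso R C D \<longleftrightarrow>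
     (\<exists>(Z :: ('r, 'x) cochain) f g. quasi_iso R Z C f \<and> quasi_iso R Z D g)"

definition shift_complex :: "int \<Rightarrow> ('r, 'x) cochain \<Rightarrow> ('r, 'x) cochain" where
  "shift_complex m C =
     \<lparr> cob = (\<lambda>i. cob C (i + m)),
       cdiff = (\<lambda>i x. if even m then cdiff C (i + m) x
                      else \<ominus>\<^bsub>cob C (i + m + 1)\<^esub> cdiff C (i + m) x) \<rparr>"

definition zero_submodule :: "('r, 'x) module \<Rightarrow> ('r, 'x) module" where
  "zero_submodule M = M\<lparr>carrier := {\<zero>\<^bsub>M\<^esub>}\<rparr>"

definition stalk_complex :: "('r, 'x) module \<Rightarrow> ('r, 'x) cochain" where
  "stalk_complex M =
     \<lparr> cob = (\<lambda>i. if i = 0 then M else zero_submodule M), cdiff = (\<lambda>i x. \<zero>\<^bsub>M\<^esub>) \<rparr>"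


section \<open>Calabi-Yau algebras\<close>

text \<open>
  The enveloping algebra of \<open>A\<close>, the tensor product of \<open>A\<close> and its opposite over the complex
  numbers: the free vector space on pairs modulo the bilinearity relations, with the product
  \<open>(a \<otimes> b)(c \<otimes> d) = ac \<otimes> db\<close>.
\<close>

definition env_rels :: "(complex, 'a) module \<Rightarrow> ('a \<times> 'a \<Rightarrow>\<^sub>0 complex) set" where
  "env_rels A = pm.span
     ({bas (a \<oplus>\<^bsub>A\<^esub> a', b) - bas (a, b) - bas (a', b) | a a' b.
         a \<in> carrier A \<and> a' \<in> carrier A \<and> b \<in> carrier A} \<union>
      {bas (a, b \<oplus>\<^bsub>A\<^esub> b') - bas (a, b) - bas (a, b') | a b b'.
         a \<in> carrier A \<and> b \<in> carrier A \<and> b' \<in> carrier A} \<union>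
      {bas (c \<odot>\<^bsub>A\<^esub> a, b) - pscale c (bas (a, b)) | c a b. a \<in> carrier A \<and> b \<in> carrier A} \<union>
      {bas (a, c \<odot>\<^bsub>A\<^esub> b) - pscale c (bas (a, b)) | c a b. a \<in> carrier A \<and> b \<in> carrier A})"

definition env_alg ::
  "(complex, 'a) module \<Rightarrow> (complex, ('a \<times> 'a \<Rightarrow>\<^sub>0 complex) set) module" where
  "env_alg A = quotient_module
     (basis_alg (carrier A \<times> carrier A)
        (\<lambda>(a, b) (c, d). Some (a \<otimes>\<^bsub>A\<^esub> c, d \<otimes>\<^bsub>A\<^esub> b)) (bas (\<one>\<^bsub>A\<^esub>, \<one>\<^bsub>A\<^esub>)))
     (env_rels A)"

text \<open>\<open>A\<close> as a left module over its enveloping algebra: \<open>(a \<otimes> b) x = a x b\<close>.\<close>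

definition env_act :: "(complex, 'a) module \<Rightarrow> ('a \<times> 'a \<Rightarrow>\<^sub>0 complex) set \<Rightarrow> 'a \<Rightarrow> 'a" where
  "env_act A Z x = (let z = (SOME z. z \<in> Z) in
     (\<Oplus>\<^bsub>A\<^esub>ab\<in>Poly_Mapping.keys z. Poly_Mapping.lookup z ab \<odot>\<^bsub>A\<^esub> (fst ab \<otimes>\<^bsub>A\<^esub> x \<otimes>\<^bsub>A\<^esub> snd ab)))"

definition diag_module ::
  "(complex, 'a) module \<Rightarrow> (('a \<times> 'a \<Rightarrow>\<^sub>0 complex) set, 'a) module" where
  "diag_module A = \<lparr> carrier = carrier A, mult = mult A, one = one A, zero = zero A, add = add A,
     smult = env_act A \<rparr>"

text \<open>The map \<open>a \<otimes> b \<mapsto> b \<otimes> a\<close>.\<close>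

definition env_flip :: "('a \<times> 'a \<Rightarrow>\<^sub>0 complex) set \<Rightarrow> ('a \<times> 'a \<Rightarrow>\<^sub>0 complex) set" where
  "env_flip Z = Poly_Mapping.map_key prod.swap ` Z"

text \<open>
  Homomorphisms from \<open>M\<close> to the enveloping algebra. The outer bimodule structure on \<open>A \<otimes> A\<close> is left
  multiplication in the enveloping algebra; the inner one, \<open>(a \<otimes> b) \<cdot> (x \<otimes> y) = x b \<otimes> a y\<close>, is right
  multiplication by the flip of \<open>a \<otimes> b\<close>.
\<close>

definition env_dual :: "(complex, 'a) module \<Rightarrow> (('a \<times> 'a \<Rightarrow>\<^sub>0 complex) set, 'x) module
    \<Rightarrow> (('a \<times> 'a \<Rightarrow>\<^sub>0 complex) set, 'x \<Rightarrow> ('a \<times> 'a \<Rightarrow>\<^sub>0 complex) set) module" where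
  "env_dual A M =
     \<lparr> carrier = {f \<in> extensional (carrier M).
                    lmod_hom (env_alg A) M (regular_module (env_alg A)) f},
       mult = undefined, one = undefined,
       zero = (\<lambda>m\<in>carrier M. \<zero>\<^bsub>env_alg A\<^esub>),
       add = (\<lambda>f g. \<lambda>m\<in>carrier M. f m \<oplus>\<^bsub>env_alg A\<^esub> g m),
       smult = (\<lambda>z f. \<lambda>m\<in>carrier M. f m \<otimes>\<^bsub>env_alg A\<^esub> env_flip z) \<rparr>"

definition env_dual_complex :: "(complex, 'a) module
    \<Rightarrow> (nat \<Rightarrow> (('a \<times> 'a \<Rightarrow>\<^sub>0 complex) set, 'x) module) \<Rightarrow> (nat \<Rightarrow> 'x \<Rightarrow> 'x)
    \<Rightarrow> (('a \<times> 'a \<Rightarrow>\<^sub>0 complex) set, 'x \<Rightarrow> ('a \<times> 'a \<Rightarrow>\<^sub>0 complex) set) cochain" where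
  "env_dual_complex A P d =
     \<lparr> cob = (\<lambda>i. if 0 \<le> i then env_dual A (P (nat i)) else zero_submodule (env_dual A (P 0))),
       cdiff = (\<lambda>i f. if 0 \<le> i then (\<lambda>p\<in>carrier (P (Suc (nat i))). f (d (nat i) p))
                      else \<zero>\<^bsub>env_dual A (P 0)\<^esub>) \<rparr>"

text \<open>
  \<open>RHom(A, A\<^sup>e)\<close> is computed by the given resolution. Finitely generated projective modules, being
  direct summands of free modules of finite rank, can be carried by the type of tuples.
\<close>

definition calabi_yau :: "nat \<Rightarrow> (complex, 'a) module \<Rightarrow> bool" where
  "calabi_yau m A \<longleftrightarrow>
     (\<exists>(P :: nat \<Rightarrow> (('a \<times> 'a \<Rightarrow>\<^sub>0 complex) set, nat \<Rightarrow> ('a \<times> 'a \<Rightarrow>\<^sub>0 complex) set) module) d \<epsilon>.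
        fin_fgproj_resolution (env_alg A) (diag_module A) P d \<epsilon> \<and>
        derived_iso (env_alg A) (shift_complex (int m) (env_dual_complex A P d))
          (stalk_complex (diag_module A)))"


section \<open>2-Koszul algebras\<close>

definition Kos :: "('v, 'e) pre_digraph \<Rightarrow> ('v, 'e) qelem set \<Rightarrow> nat \<Rightarrow> ('v, 'e) qelem set" where
  "Kos Q R i = (if i = 0 then Salg Q else if i = 1 then Varr Q
     else \<Inter>{tprod Q (tprod Q (Vpow Q j) R) (Vpow Q l) | j l. j + 2 + l = i})"

text \<open>
  \<open>A \<otimes>\<^sub>S K \<otimes>\<^sub>S A\<close> for \<open>A = \<complex>Q/I(R)\<close> and an \<open>S\<close>-subbimodule \<open>K\<close> of \<open>\<complex>Q\<close>: the free vector space on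
  triples modulo the trilinearity and \<open>S\<close>-balancing relations.
\<close>

definition free_tens :: "('v, 'e) pre_digraph \<Rightarrow> ('v, 'e) qelem set \<Rightarrow> ('v, 'e) qelem set
    \<Rightarrow> (complex, ('v, 'e) qelem set \<times> ('v, 'e) qelem \<times> ('v, 'e) qelem set \<Rightarrow>\<^sub>0 complex) module" where
  "free_tens Q R K = basis_vs (carrier (quiver_quot Q R) \<times> K \<times> carrier (quiver_quot Q R))"

definition tens_rels :: "('v, 'e) pre_digraph \<Rightarrow> ('v, 'e) qelem set \<Rightarrow> ('v, 'e) qelem set
    \<Rightarrow> (('v, 'e) qelem set \<times> ('v, 'e) qelem \<times> ('v, 'e) qelem set \<Rightarrow>\<^sub>0 complex) set" where
  "tens_rels Q R K = (let A = quiver_quot Q R; cA = carrier A in pm.span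
     ({bas (a \<oplus>\<^bsub>A\<^esub> a', k, b) - bas (a, k, b) - bas (a', k, b) | a a' k b.
         a \<in> cA \<and> a' \<in> cA \<and> k \<in> K \<and> b \<in> cA} \<union>
      {bas (a, k + k', b) - bas (a, k, b) - bas (a, k', b) | a k k' b.
         a \<in> cA \<and> k \<in> K \<and> k' \<in> K \<and> b \<in> cA} \<union>
      {bas (a, k, b \<oplus>\<^bsub>A\<^esub> b') - bas (a, k, b) - bas (a, k, b') | a k b b'.
         a \<in> cA \<and> k \<in> K \<and> b \<in> cA \<and> b' \<in> cA} \<union>
      {bas (c \<odot>\<^bsub>A\<^esub> a, k, b) - pscale c (bas (a, k, b)) | c a k b. a \<in> cA \<and> k \<in> K \<and> b \<in> cA} \<union>
      {bas (a, pscale c k, b) - pscale c (bas (a, k, b)) | c a k b. a \<in> cA \<and> k \<in> K \<and> b \<in> cA} \<union>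
      {bas (a, k, c \<odot>\<^bsub>A\<^esub> b) - pscale c (bas (a, k, b)) | c a k b. a \<in> cA \<and> k \<in> K \<and> b \<in> cA} \<union>
      {bas (a \<otimes>\<^bsub>A\<^esub> qclass Q R s, k, b) - bas (a, s \<otimes>\<^bsub>path_alg Q\<^esub> k, b) | a s k b.
         a \<in> cA \<and> s \<in> Salg Q \<and> k \<in> K \<and> b \<in> cA} \<union>
      {bas (a, k \<otimes>\<^bsub>path_alg Q\<^esub> s, b) - bas (a, k, qclass Q R s \<otimes>\<^bsub>A\<^esub> b) | a s k b.
         a \<in> cA \<and> s \<in> Salg Q \<and> k \<in> K \<and> b \<in> cA}))"

definition kos_tens :: "('v, 'e) pre_digraph \<Rightarrow> ('v, 'e) qelem set \<Rightarrow> nat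
    \<Rightarrow> (complex, (('v, 'e) qelem set \<times> ('v, 'e) qelem \<times> ('v, 'e) qelem set \<Rightarrow>\<^sub>0 complex) set) module"
  where
  "kos_tens Q R i = quotient_module (free_tens Q R (Kos Q R i)) (tens_rels Q R (Kos Q R i))"

text \<open>
  As \<open>k = \<Sum>\<^sub>a a \<cdot> ldel a k = \<Sum>\<^sub>a rdel a k \<cdot> a\<close> for every \<open>k\<close> in \<open>K\<^sub>i\<close>, \<open>i \<ge> 1\<close>, splitting off the first
  letter of \<open>k\<close> gives \<open>d\<^sub>l(\<alpha> \<otimes> k \<otimes> \<beta>) = \<Sum>\<^sub>a \<alpha>a \<otimes> ldel a k \<otimes> \<beta>\<close>, and splitting off the last one
  gives \<open>d\<^sub>r(\<alpha> \<otimes> k \<otimes> \<beta>) = \<Sum>\<^sub>a \<alpha> \<otimes> rdel a k \<otimes> a\<beta>\<close>. The elements \<open>ldel a k\<close> and \<open>rdel a k\<close> again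
  lie in \<open>K\<^sub>i\<^sub>-\<^sub>1\<close>.
\<close>

definition dl_gen :: "('v, 'e) pre_digraph \<Rightarrow> ('v, 'e) qelem set
    \<Rightarrow> ('v, 'e) qelem set \<times> ('v, 'e) qelem \<times> ('v, 'e) qelem set
    \<Rightarrow> (('v, 'e) qelem set \<times> ('v, 'e) qelem \<times> ('v, 'e) qelem set \<Rightarrow>\<^sub>0 complex)" where
  "dl_gen Q R = (\<lambda>(\<alpha>, k, \<beta>). \<Sum>a\<in>arcs Q.
     bas (\<alpha> \<otimes>\<^bsub>quiver_quot Q R\<^esub> qclass Q R (bas (arrow Q a)), ldel (arrow Q a) k, \<beta>))"

definition dr_gen :: "('v, 'e) pre_digraph \<Rightarrow> ('v, 'e) qelem set
    \<Rightarrow> ('v, 'e) qelem set \<times> ('v, 'e) qelem \<times> ('v, 'e) qelem set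
    \<Rightarrow> (('v, 'e) qelem set \<times> ('v, 'e) qelem \<times> ('v, 'e) qelem set \<Rightarrow>\<^sub>0 complex)" where
  "dr_gen Q R = (\<lambda>(\<alpha>, k, \<beta>). \<Sum>a\<in>arcs Q.
     bas (\<alpha>, rdel (arrow Q a) k, qclass Q R (bas (arrow Q a)) \<otimes>\<^bsub>quiver_quot Q R\<^esub> \<beta>))"

text \<open>\<open>kos_diff Q R i\<close> is the differential from degree \<open>Suc i\<close> to degree \<open>i\<close>.\<close>

definition kos_diff :: "('v, 'e) pre_digraph \<Rightarrow> ('v, 'e) qelem set \<Rightarrow> nat
    \<Rightarrow> (('v, 'e) qelem set \<times> ('v, 'e) qelem \<times> ('v, 'e) qelem set \<Rightarrow>\<^sub>0 complex) set
    \<Rightarrow> (('v, 'e) qelem set \<times> ('v, 'e) qelem \<times> ('v, 'e) qelem set \<Rightarrow>\<^sub>0 complex) set" where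
  "kos_diff Q R i X = (\<Union>x\<in>X. tens_rels Q R (Kos Q R i) +>\<^bsub>free_tens Q R (Kos Q R i)\<^esub>
     lin_ext (\<lambda>g. dl_gen Q R g + pscale ((- 1) ^ Suc i) (dr_gen Q R g)) x)"

text \<open>The multiplication \<open>\<alpha> \<otimes> s \<otimes> \<beta> \<mapsto> \<alpha> s \<beta>\<close> on degree \<open>0\<close>.\<close>

definition kos_aug :: "('v, 'e) pre_digraph \<Rightarrow> ('v, 'e) qelem set
    \<Rightarrow> (('v, 'e) qelem set \<times> ('v, 'e) qelem \<times> ('v, 'e) qelem set \<Rightarrow>\<^sub>0 complex) set
    \<Rightarrow> ('v, 'e) qelem set" where
  "kos_aug Q R X = (let A = quiver_quot Q R; x = (SOME x. x \<in> X) in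
     (\<Oplus>\<^bsub>A\<^esub>g\<in>Poly_Mapping.keys x. Poly_Mapping.lookup x g \<odot>\<^bsub>A\<^esub>
        (case g of (\<alpha>, s, \<beta>) \<Rightarrow> \<alpha> \<otimes>\<^bsub>A\<^esub> qclass Q R s \<otimes>\<^bsub>A\<^esub> \<beta>)))"

definition two_koszul :: "('v, 'e) pre_digraph \<Rightarrow> ('v, 'e) qelem set \<Rightarrow> bool" where
  "two_koszul Q R \<longleftrightarrow>
     S_subbimodule Q R \<and> R \<subseteq> Vpow Q 2 \<and>
     kos_aug Q R ` carrier (kos_tens Q R 0) = carrier (quiver_quot Q R) \<and>
     kos_diff Q R 0 ` carrier (kos_tens Q R 1) =
       {X \<in> carrier (kos_tens Q R 0). kos_aug Q R X = \<zero>\<^bsub>quiver_quot Q R\<^esub>} \<and>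
     (\<forall>i. kos_diff Q R (Suc i) ` carrier (kos_tens Q R (Suc (Suc i))) =
       {X \<in> carrier (kos_tens Q R (Suc i)). kos_diff Q R i X = \<zero>\<^bsub>kos_tens Q R i\<^esub>})"


section \<open>PBW deformations\<close>

definition alg_filt :: "('v, 'e) pre_digraph \<Rightarrow> ('v, 'e) qelem set \<Rightarrow> nat
    \<Rightarrow> ('v, 'e) qelem set set" where
  "alg_filt Q P m = qclass Q P ` Filt Q m"

definition alg_filt_below :: "('v, 'e) pre_digraph \<Rightarrow> ('v, 'e) qelem set \<Rightarrow> nat
    \<Rightarrow> ('v, 'e) qelem set set" where
  "alg_filt_below Q P m = (case m of 0 \<Rightarrow> {\<zero>\<^bsub>quiver_quot Q P\<^esub>} | Suc k \<Rightarrow> alg_filt Q P k)"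

definition gr_part :: "('v, 'e) pre_digraph \<Rightarrow> ('v, 'e) qelem set \<Rightarrow> nat
    \<Rightarrow> (complex, ('v, 'e) qelem set set) module" where
  "gr_part Q P m =
     quotient_module ((quiver_quot Q P)\<lparr>carrier := alg_filt Q P m\<rparr>) (alg_filt_below Q P m)"

text \<open>
  The natural graded map from \<open>\<complex>Q/I(R)\<close> to the associated graded algebra of \<open>\<complex>Q/I(P)\<close> sends, in
  degree \<open>m\<close>, the class of \<open>x\<close> in the \<open>m\<close>-th tensor power of \<open>V\<close> to the class of \<open>x\<close>.
\<close>

definition PBW_deformation :: "('v, 'e) pre_digraph \<Rightarrow> ('v, 'e) qelem set \<Rightarrow> ('v, 'e) qelem set
    \<Rightarrow> bool" where
  "PBW_deformation Q R P \<longleftrightarrow>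
     S_subbimodule Q P \<and> P \<subseteq> Filt Q 2 \<and> hom_part 2 ` P = R \<and>
     (\<forall>m. \<exists>\<phi>.
        (\<forall>x\<in>Vpow Q m. \<phi> (qclass Q R x) = alg_filt_below Q P m +>\<^bsub>quiver_quot Q P\<^esub> qclass Q P x) \<and>
        bij_betw \<phi> (qclass Q R ` Vpow Q m) (carrier (gr_part Q P m)))"

definition deformation_maps :: "('v, 'e) pre_digraph \<Rightarrow> ('v, 'e) qelem set \<Rightarrow> ('v, 'e) qelem set
    \<Rightarrow> (('v, 'e) qelem \<Rightarrow> ('v, 'e) qelem) \<Rightarrow> (('v, 'e) qelem \<Rightarrow> ('v, 'e) qelem) \<Rightarrow> bool" where
  "deformation_maps Q R P \<theta>\<^sub>1 \<theta>\<^sub>0 \<longleftrightarrow>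
     S_bimodule_hom Q R (Varr Q) \<theta>\<^sub>1 \<and> S_bimodule_hom Q R (Salg Q) \<theta>\<^sub>0 \<and>
     P = (\<lambda>r. r - (\<theta>\<^sub>1 r + \<theta>\<^sub>0 r)) ` R"

text \<open>
  \<open>id \<otimes> \<theta> - \<theta> \<otimes> id\<close>, where \<open>x = \<Sum>\<^sub>a a \<cdot> ldel a x\<close> with all \<open>ldel a x\<close> in \<open>R\<close> for \<open>x\<close> in \<open>V \<otimes>\<^sub>S R\<close>,
  and \<open>x = \<Sum>\<^sub>a rdel a x \<cdot> a\<close> with all \<open>rdel a x\<close> in \<open>R\<close> for \<open>x\<close> in \<open>R \<otimes>\<^sub>S V\<close>.
\<close>

definition psi :: "('v, 'e) pre_digraph \<Rightarrow> (('v, 'e) qelem \<Rightarrow> ('v, 'e) qelem)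
    \<Rightarrow> ('v, 'e) qelem \<Rightarrow> ('v, 'e) qelem" where
  "psi Q \<theta> x =
     (\<Sum>a\<in>arcs Q. bas (arrow Q a) \<otimes>\<^bsub>path_alg Q\<^esub> \<theta> (ldel (arrow Q a) x)) -
     (\<Sum>a\<in>arcs Q. \<theta> (rdel (arrow Q a) x) \<otimes>\<^bsub>path_alg Q\<^esub> bas (arrow Q a))"

definition zeroPBW_deformation :: "('v, 'e) pre_digraph \<Rightarrow> ('v, 'e) qelem set
    \<Rightarrow> ('v, 'e) qelem set \<Rightarrow> (('v, 'e) qelem \<Rightarrow> ('v, 'e) qelem)
    \<Rightarrow> (('v, 'e) qelem \<Rightarrow> ('v, 'e) qelem) \<Rightarrow> bool" where
  "zeroPBW_deformation Q R P \<theta>\<^sub>1 \<theta>\<^sub>0 \<longleftrightarrow>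
     PBW_deformation Q R P \<and> deformation_maps Q R P \<theta>\<^sub>1 \<theta>\<^sub>0 \<and>
     (\<forall>x \<in> tprod Q (Varr Q) R \<inter> tprod Q R (Varr Q). psi Q \<theta>\<^sub>1 x = 0)"

end

theory Submission
  imports Defs "HOL-Library.FuncSet"
begin

text \<open>
  The Koszul bimodule complex of the quadratic algebra \<open>A\<close> is rewritten with matrices over the enveloping
  algebra of \<open>CQ\<close>, so that the same matrices, corrected by terms of lower degree built from \<open>\<theta>\<^sub>0\<close>, define a
  complex over the deformation. By the PBW property every relation of the deformation has a leading form
  that is a relation of \<open>A\<close>; subtracting lifts of leading forms lowers the degree, so exactness of the Koszul
  complex and of its dual below the top degree passes from \<open>A\<close> to the deformation. In the top degree the
  Calabi-Yau property of \<open>A\<close> forces the coefficients \<open>ka\<close> of the superpotential in the basis of \<open>K\<^sub>n\<close> to be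
  nonzero, so that \<open>eta\<close>, the contraction with the superpotential, is onto; by the cyclic symmetry of the
  superpotential its kernel is the image of the dual differential, and the top cohomology is the deformation
  itself as a bimodule.
\<close>

text \<open>The modules in the statement are quotients of quotients, so computations are made one
  level up, in CQ tensor CQ modulo a subspace \<open>NN\<close>; passing from A to the deformation
  replaces \<open>I.NN\<close> by \<open>J.NN\<close> and keeps the matrices. That these matrices
  still form a complex is the point of \<open>CC_0\<close>. Since \<open>\<theta>\<^sub>1\<close> is
  zero, the square of the differential is congruent to a matrix \<open>CC\<close> of scalar
  multiples of idempotents; comparing the two groupings of three consecutive differentials, and
  using that \<open>J.NN\<close> contains nothing nonzero below degree two, shows that the scalars
  vanish. The Calabi-Yau hypothesis speaks of some unknown resolution, hence the comparison of
  resolutions. After that it is read in the lowest degrees only: degree zero matches the generators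
  of the top Koszul term with the vertices, and degree one gives, for every arrow, a functional on
  the term below the top. These are exact identities in CQ tensor CQ, not congruences modulo I(R),
  and so they survive the deformation.\<close>

abbreviation (input) Iff (infixr "<->" 25) where "A <-> B \<equiv> A = B"
abbreviation "lk \<equiv> Poly_Mapping.lookup"
abbreviation "ks \<equiv> Poly_Mapping.keys"
abbreviation "subsp \<equiv> pm.subspace"
abbreviation "rgm \<equiv> regular_module"
abbreviation "cr \<equiv> carrier"
abbreviation "qmod \<equiv> quotient_module"
abbreviation (input) add_on ("(_ +[_] _)" [65, 0, 66] 65) where "x +[M] y \<equiv> x \<oplus>\<^bsub>M\<^esub> y"
abbreviation (input) diff_on ("(_ -[_] _)" [65, 0, 66] 65) where "x -[M] y \<equiv> x \<ominus>\<^bsub>M\<^esub> y"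
abbreviation (input) neg_on ("(-[_] _)" [0, 81] 80) where "-[M] x \<equiv> \<ominus>\<^bsub>M\<^esub> x"
abbreviation (input) mult_on ("(_ *[_] _)" [70, 0, 71] 70) where "x *[M] y \<equiv> x \<otimes>\<^bsub>M\<^esub> y"
abbreviation (input) smult_on ("(_ *.[_] _)" [70, 0, 71] 70) where "a *.[M] x \<equiv> a \<odot>\<^bsub>M\<^esub> x"
abbreviation (input) zero_on ("0[_]") where "0[M] \<equiv> \<zero>\<^bsub>M\<^esub>"
abbreviation (input) one_on ("1[_]") where "1[M] \<equiv> \<one>\<^bsub>M\<^esub>"

lemmas sub_add = pm.subspace_add
lemmas sub_scale = pm.subspace_scale
lemmas sub_sum = pm.subspace_sum
lemmas sub_diff = pm.subspace_diff
lemmas sub_0 = pm.subspace_0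
lemmas sub_neg = pm.subspace_neg
lemmas sub_def = pm.subspace_def
lemmas pmI = poly_mapping_eqI
lemmas sc_diff = pm.scale_right_diff_distrib
lemmas sc_distl = pm.scale_left_distrib
lemmas sc_distr = pm.scale_right_distrib
lemmas sc_sum = pm.scale_sum_right
lemmas span_min = pm.span_minimal

section \<open>Linear and bilinear extension\<close>

text \<open>A predicate on arbitrary functions between based spaces: composite lambda terms are then
  proved linear by applying the rules collected in \<open>plin_intros\<close>.\<close>

definition plin :: "(('a \<Rightarrow>\<^sub>0 complex) => ('b \<Rightarrow>\<^sub>0 complex)) => bool" where
 "plin f <-> (ALL x y. f (x + y) = f x + f y) & (ALL c x. f (pscale c x) = pscale c (f x))"

lemma plinI: "(!!x y. f (x + y) = f x + f y) ==> (!!c x. f (pscale c x) = pscale c (f x)) ==> plin f"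
 by (simp add: plin_def)

lemma pl_add: "plin f ==> f (x + y) = f x + f y"
 and pl_sc: "plin f ==> f (pscale c x) = pscale c (f x)"
 by (simp_all add: plin_def)

lemma pl_zr: "plin f ==> f 0 = 0"
 using pl_sc[of f 0 0] by simp

lemma pl_minus: "plin f ==> f (- x) = - f x"
 using pl_sc[of f "-1" x] by simp

lemma pl_df: "plin f ==> f (x - y) = f x - f y"
 using pl_add[of f x "- y"] by (simp add: pl_minus)

lemma pl_sum: "plin f ==> f (sum g A) = (\<Sum>a\<in>A. f (g a))"
 by (induct A rule: infinite_finite_induct) (simp_all add: pl_add pl_zr)

lemma pl_o: "plin f ==> plin g ==> plin (%x. f (g x))"
 by (simp add: plin_def)

lemma pl_id [simp]: "plin (%x. x)"
 by (simp add: plin_def)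

lemma pl_plus: "plin f ==> plin g ==> plin (%x. f x + g x)"
 by (simp add: plin_def sc_distr)

lemma pl_sub: "plin f ==> plin g ==> plin (%x. f x - g x)"
 by (simp add: plin_def sc_diff)

lemma pl_pscale: "plin f ==> plin (%x. pscale c (f x))"
 by (simp add: plin_def sc_distr)

lemma pl_sum_fun: "(!!a. a:A ==> plin (f a)) ==> plin (%x. \<Sum>a\<in>A. f a x)"
 by (simp add: plin_def sum.distrib sc_sum)

lemma lk_bas: "lk (bas b) c = (if b = c then 1 else 0)"
 by (simp add: bas_def lookup_single)

lemma lk_bas_self [simp]: "lk (bas b) b = 1"
 by (simp add: lk_bas)

lemma keys_bas [simp]: "ks (bas b) = {b}"
 by (simp add: bas_def)

lemma single_pscale_bas: "Poly_Mapping.single b c = pscale c (bas b)"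
 by (rule pmI) (simp add: lookup_single lk_bas)

lemma keys_pscale: "ks (pscale c x) <= ks x"
 by (auto simp: in_keys_iff)

lemma pm_expand_superset:
 assumes "finite A" "ks x <= A"
 shows "x = (\<Sum>b\<in>A. pscale (lk x b) (bas b))"
proof (rule pmI)
 fix k
 have "(\<Sum>b\<in>A. lk x b * (if b = k then 1 else 0)) = (if k:A then lk x k else 0)"
  using assms(1) by (simp add: if_distrib[of "(*) _"] cong: if_cong)
 thus "lk x k = lk (\<Sum>b\<in>A. pscale (lk x b) (bas b)) k"
  using assms(2) by (auto simp: lookup_sum lk_bas in_keys_iff)
qed

lemma pm_expand: "x = (\<Sum>b\<in>ks x. pscale (lk x b) (bas b))"
 by (rule pm_expand_superset) auto

text \<open>Agreement is asked only on the support of the one vector \<open>x\<close>, so a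
  hypothesis on \<open>x\<close>, such as the length of its paths, is available for each basis
  element.\<close>

lemma pl_eqI:
 assumes "plin f" "plin g" "!!b. b:ks x ==> f (bas b) = g (bas b)"
 shows "f x = g x"
proof -
 have "f x = (\<Sum>b\<in>ks x. pscale (lk x b) (f (bas b)))"
  by (subst pm_expand[of x]) (simp add: pl_sum[OF assms(1)] pl_sc[OF assms(1)])
 also have "... = (\<Sum>b\<in>ks x. pscale (lk x b) (g (bas b)))"
  using assms(3) by (intro sum.cong) auto
 also have "... = g x"
  by (subst (3) pm_expand[of x]) (simp add: pl_sum[OF assms(2)] pl_sc[OF assms(2)])
 finally show ?thesis .
qed

lemma plin_in_subspace:
 assumes "plin f" "subsp N" "!!b. b:ks x ==> f (bas b):N"
 shows "f x:N"
proof -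
 have "f x = (\<Sum>b\<in>ks x. pscale (lk x b) (f (bas b)))"
  by (subst pm_expand[of x]) (simp add: pl_sum[OF assms(1)] pl_sc[OF assms(1)])
 thus ?thesis
  using assms by (simp add: sub_sum sub_scale)
qed

lemma lin_ext_superset:
 assumes "finite A" "ks x <= A"
 shows "lin_ext D x = (\<Sum>b\<in>A. pscale (lk x b) (D b))"
 unfolding lin_ext_def using assms by (intro sum.mono_neutral_left) (auto simp: in_keys_iff)

lemma pl_lin_ext [simp]: "plin (lin_ext D)"
proof (rule plinI)
 fix x y :: "'a \<Rightarrow>\<^sub>0 complex"
 let ?A = "ks x \<union> ks y"
 have "lin_ext D (x + y) = (\<Sum>b\<in>?A. pscale (lk (x + y) b) (D b))"
  by (rule lin_ext_superset) (simp_all add: keys_add)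
 also have "... = (\<Sum>b\<in>?A. pscale (lk x b) (D b)) + (\<Sum>b\<in>?A. pscale (lk y b) (D b))"
  by (simp only: Poly_Mapping.lookup_add sc_distl sum.distrib)
 also have "(\<Sum>b\<in>?A. pscale (lk x b) (D b)) = lin_ext D x"
  by (rule lin_ext_superset[symmetric]) simp_all
 also have "(\<Sum>b\<in>?A. pscale (lk y b) (D b)) = lin_ext D y"
  by (rule lin_ext_superset[symmetric]) simp_all
 finally show "lin_ext D (x + y) = lin_ext D x + lin_ext D y" .
next
 fix c and x :: "'a \<Rightarrow>\<^sub>0 complex"
 have "lin_ext D (pscale c x) = (\<Sum>b\<in>ks x. pscale (lk (pscale c x) b) (D b))"
  by (rule lin_ext_superset) (simp_all add: keys_pscale)
 also have "... = pscale c (lin_ext D x)"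
  by (simp add: lin_ext_def sc_sum)
 finally show "lin_ext D (pscale c x) = pscale c (lin_ext D x)" .
qed

lemma lin_ext_bas [simp]: "lin_ext D (bas b) = D b"
 by (simp add: lin_ext_def)

lemma lin_ext_zero [simp]: "lin_ext D 0 = 0"
 by (simp add: lin_ext_def)

lemma lin_ext_bas_id [simp]: "lin_ext bas x = x"
 using pl_eqI[of "lin_ext bas" "%x. x" x] by simp

lemma keys_lin_ext: "ks (lin_ext D x) <= (\<Union>b\<in>ks x. ks (D b))"
proof -
 have "ks (lin_ext D x)
   <= (\<Union>b\<in>ks x. ks (pscale (lk x b) (D b)))"
  unfolding lin_ext_def by (rule keys_sum)
 also have "... <= (\<Union>b\<in>ks x. ks (D b))"
  by (intro UN_mono subset_refl keys_pscale)
 finally show ?thesis .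
qed

definition sp_in :: "'a set => ('a \<Rightarrow>\<^sub>0 complex) set" where
 "sp_in B = {x. ks x <= B}"

lemma sub_sp_in [simp]: "subsp (sp_in B)"
 unfolding sub_def sp_in_def
 using order_trans[OF keys_add] by (auto dest: subsetD[OF keys_pscale])

lemma sp_in_bas [simp]: "bas b:sp_in B <-> b:B"
 by (simp add: sp_in_def)

lemma sp_in_i: "x:sp_in B <-> (ALL b. lk x b ~= 0 --> b:B)"
 by (auto simp: sp_in_def in_keys_iff)

lemma sp_in_mono: "x:sp_in A ==> A <= B ==> x:sp_in B"
 by (auto simp: sp_in_def)

lemma sp_in_span: "x:sp_in B ==> x:pm.span (bas ` B)"
proof -
 assume x: "x:sp_in B"
 have "(\<Sum>b\<in>ks x. pscale (lk x b) (bas b)):pm.span (bas ` B)"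
  using x by (intro pm.span_sum pm.span_scale pm.span_base) (auto simp: sp_in_def)
 thus ?thesis by (simp flip: pm_expand)
qed

lemma lin_ext_sp: "x:sp_in A ==> (!!b. b:A ==> D b:sp_in B) ==> lin_ext D x:sp_in B"
 using keys_lin_ext[of D x] by (fastforce simp: sp_in_def)

lemma pl_in_sub_sp:
 assumes "plin f" "subsp N" "x:sp_in A" "!!b. b:A ==> f (bas b):N"
 shows "f x:N"
 using plin_in_subspace[OF assms(1,2)] assms(3,4) by (auto simp: sp_in_def)

definition restr :: "'a set => ('a \<Rightarrow>\<^sub>0 complex) => ('a \<Rightarrow>\<^sub>0 complex)" where
 "restr S = lin_ext (%b. if b:S then bas b else 0)"

lemma pl_restr [simp]: "plin (restr S)"
 by (simp add: restr_def)

lemma restr_bas: "restr S (bas b) = (if b:S then bas b else 0)"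
 by (simp add: restr_def)

lemma lk_restr: "lk (restr S x) b = (if b:S then lk x b else 0)"
proof -
 have "lk (restr S x) b
   = (\<Sum>c\<in>ks x. if c = b then (if b:S then lk x b else 0) else 0)"
  unfolding restr_def lin_ext_def lookup_sum
  by (rule sum.cong) (auto simp: lk_bas)
 thus ?thesis by (auto simp: in_keys_iff)
qed

lemma restr_supp2: "x:sp_in A ==> restr S x:sp_in (A \<inter> S)"
 by (auto simp: sp_in_i lk_restr)

definition obas :: "'a option => ('a \<Rightarrow>\<^sub>0 complex)" where
 "obas o' = (case o' of None => 0 | Some r => bas r)"

lemma obas_simps [simp]: "obas None = 0" "obas (Some r) = bas r"
 by (simp_all add: obas_def)

text \<open>The value \<open>None\<close> stands for a zero product. Multiplication of paths, the
  enveloping product, the tensor of two vectors and the action on bimodules are all of this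
  form.\<close>

definition bmul :: "('a => 'b => 'c option) => ('a \<Rightarrow>\<^sub>0 complex) => ('b \<Rightarrow>\<^sub>0 complex) => ('c \<Rightarrow>\<^sub>0 complex)" where
 "bmul f x y = lin_ext (%p. lin_ext (%q. obas (f p q)) y) x"

lemma pl_bm_l [simp]: "plin (%x. bmul f x y)"
 unfolding bmul_def by (rule pl_lin_ext)

lemma pl_bm_r [simp]: "plin (%y. bmul f x y)"
proof -
 have eq: "bmul f x y = (\<Sum>b\<in>ks x. pscale (lk x b) (lin_ext (%q. obas (f b q)) y))" for y
  unfolding bmul_def lin_ext_def[of "%p. lin_ext (%q. obas (f p q)) y" x] ..
 show ?thesis unfolding eq
  by (intro pl_sum_fun pl_pscale pl_lin_ext)
qed

lemma pl_bm_right' [simp]: "plin (bmul f x)"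
 by (fact pl_bm_r)

lemma bm_bas [simp]: "bmul f (bas p) (bas q) = obas (f p q)"
 by (simp add: bmul_def)

lemmas bm_add_l = pl_add[OF pl_bm_l]
lemmas bm_add_r = pl_add[OF pl_bm_r]
lemmas bm_sc_l = pl_sc[OF pl_bm_l]
lemmas bm_sc_r = pl_sc[OF pl_bm_r]
lemmas bmul_zero_left [simp] = pl_zr[OF pl_bm_l]
lemmas bmul_zero_right [simp] = pl_zr[OF pl_bm_r]
lemmas bm_df_l = pl_df[OF pl_bm_l]
lemmas bm_df_r = pl_df[OF pl_bm_r]
lemmas bm_sum_l = pl_sum[OF pl_bm_l]
lemmas bm_sum_r = pl_sum[OF pl_bm_r]

lemma pl_bmulL: "plin h ==> plin (%x. bmul f (h x) y)"
 by (rule pl_o[OF pl_bm_l])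

lemma pl_bmulR: "plin h ==> plin (%x. bmul f y (h x))"
 by (rule pl_o[OF pl_bm_r])

lemma plin_lin_extI: "plin h ==> plin (%x. lin_ext D (h x))"
 by (rule pl_o[OF pl_lin_ext])

lemma plin_restrI: "plin h ==> plin (%x. restr D (h x))"
 by (rule pl_o[OF pl_restr])

lemmas plin_intros = pl_id pl_lin_ext pl_restr pl_bm_l pl_bm_r pl_bm_right'
 pl_bmulL pl_bmulR plin_lin_extI plin_restrI pl_plus pl_sub pl_pscale pl_sum_fun

lemma bilin_eqI:
 assumes "!!y. plin (%x. F x y)" "!!x. plin (F x)" "!!y. plin (%x. G x y)" "!!x. plin (G x)"
  "!!p q. p:ks x ==> q:ks y ==> F (bas p) (bas q) = G (bas p) (bas q)"
 shows "F x y = G x y"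
proof (rule pl_eqI[OF assms(1,3)])
 fix p assume "p:ks x"
 thus "F (bas p) y = G (bas p) y"
  by (rule pl_eqI[OF assms(2,4) assms(5)])
qed

lemma trilin_eqI:
 assumes "!!y z. plin (%x. F x y z)" "!!x z. plin (%y. F x y z)" "!!x y. plin (F x y)"
  "!!y z. plin (%x. G x y z)" "!!x z. plin (%y. G x y z)" "!!x y. plin (G x y)"
  "!!p q r. p:ks x ==> q:ks y ==> r:ks z ==>
    F (bas p) (bas q) (bas r) = G (bas p) (bas q) (bas r)"
 shows "F x y z = G x y z"
proof (rule pl_eqI[OF assms(1,4)])
 fix p assume "p:ks x"
 thus "F (bas p) y z = G (bas p) y z"
  by (rule bilin_eqI[of "F (bas p)" "G (bas p)", OF assms(2,3,5,6) assms(7)])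
qed

lemma bm_obas_l: "bmul f (obas o') (bas q) = obas (Option.bind o' (%p. f p q))"
 by (cases o') simp_all

lemma bmul_obas_right: "bmul f (bas p) (obas o') = obas (Option.bind o' (%q. f p q))"
 by (cases o') simp_all

lemma bm_as_gen:
 assumes "!!p q r. p:ks x ==> q:ks y ==> r:ks z ==>
   Option.bind (f p q) (%s. g s r) = Option.bind (h q r) (%s. k p s)"
 shows "bmul g (bmul f x y) z = bmul k x (bmul h y z)"
 by (rule trilin_eqI[of "%x y z. bmul g (bmul f x y) z" "%x y z. bmul k x (bmul h y z)"])
   (intro plin_intros | simp add: bm_obas_l bmul_obas_right assms)+

lemma keys_obas: "ks (obas o') = set_option o'"
 by (cases o') auto

lemma bm_sp:
 assumes "x:sp_in A" "y:sp_in B" "!!p q r. p:A ==> q:B ==> f p q = Some r ==> r:C"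
 shows "bmul f x y:sp_in C"
 unfolding bmul_def
 by (intro lin_ext_sp[OF assms(1)] lin_ext_sp[OF assms(2)]) (auto simp: sp_in_def keys_obas dest: assms(3))

lemma basis_alg_mult: "mult (basis_alg B f u) = bmul f"
proof (intro ext)
 fix x y
 have "mult (basis_alg B f u) x y = (\<Sum>p\<in>ks x. \<Sum>q\<in>ks y.
   (case f p q of None => 0 | Some r => Poly_Mapping.single r (lk x p * lk y q)))"
  by (simp only: basis_alg_def monoid.simps)
 also have "... = (\<Sum>p\<in>ks x. \<Sum>q\<in>ks y.
   pscale (lk x p) (pscale (lk y q) (obas (f p q))))"
  by (intro sum.cong refl) (simp add: single_pscale_bas split: option.splits)
 also have "... = bmul f x y"
  by (simp only: bmul_def lin_ext_def sc_sum)
 finally show "mult (basis_alg B f u) x y = bmul f x y" .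
qed

lemma basis_alg_s [simp]:
 "cr (basis_alg B f u) = sp_in B"
 "mult (basis_alg B f u) = bmul f"
 "one (basis_alg B f u) = u"
 "zero (basis_alg B f u) = 0"
 "add (basis_alg B f u) = (+)"
 "smult (basis_alg B f u) = pscale"
 by (rule trans[OF _ sp_in_def[symmetric]], simp add: basis_alg_def)
   (rule basis_alg_mult, simp_all add: basis_alg_def)

section \<open>Functionals given by their values on a basis\<close>

definition pairing :: "('a => complex) => ('a \<Rightarrow>\<^sub>0 complex) => complex" where
 "pairing g x = (\<Sum>b\<in>ks x. lk x b * g b)"

text \<open>A functional is viewed as a linear map into the line with basis vector
  \<open>()\<close>; this makes the rules for linear maps available for scalars.\<close>

lemma pr_lin_ext: "pairing g x = lk (lin_ext (%b. pscale (g b) (bas ())) x) ()"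
 by (simp add: pairing_def lin_ext_def lookup_sum)

lemma pr_add: "pairing g (x + y) = pairing g x + pairing g y"
 by (simp add: pr_lin_ext pl_add[OF pl_lin_ext] Poly_Mapping.lookup_add)

lemma pr_sc: "pairing g (pscale c x) = c * pairing g x"
 by (simp add: pr_lin_ext pl_sc[OF pl_lin_ext])

lemma pairing_zero [simp]: "pairing g 0 = 0"
 by (simp add: pairing_def)

lemma pr_sum: "pairing g (sum h A) = (\<Sum>a\<in>A. pairing g (h a))"
 by (induct A rule: infinite_finite_induct) (simp_all add: pr_add)

lemma pairing_bas [simp]: "pairing g (bas b) = g b"
 by (simp add: pairing_def)

lemma pl_pr: "plin h ==> plin (%x. pscale (pairing g (h x)) v)"
 by (simp add: plin_def pr_add pr_sc sc_distl)

lemma functional_pr: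
 fixes fi :: "('a \<Rightarrow>\<^sub>0 complex) => complex"
 assumes "!!x y. fi (x + y) = fi x + fi y" "!!c x. fi (pscale c x) = c * fi x"
 shows "fi x = pairing (%b. fi (bas b)) x"
proof -
 have "plin (%x. pscale (fi x) (bas ()))"
  by (simp add: plin_def assms sc_distl)
 from pl_eqI[OF this pl_pr[OF pl_id], of x "%b. fi (bas b)" "bas ()"]
 have "pscale (fi x) (bas ()) = pscale (pairing (%b. fi (bas b)) x) (bas ())" by simp
 from arg_cong[OF this, of "%z. lk z ()"] show ?thesis by simp
qed

declare split_paired_All [simp del] split_paired_Ex [simp del]

section \<open>Quotients by subspaces\<close>

definition qcos :: "('b \<Rightarrow>\<^sub>0 complex) set => ('b \<Rightarrow>\<^sub>0 complex) => ('b \<Rightarrow>\<^sub>0 complex) set" where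
 "qcos N x = (%n. n + x) ` N"

lemma qcos_eq_i:
 assumes "subsp N"
 shows "qcos N x = qcos N y <-> x - y:N"
proof
 assume "qcos N x = qcos N y"
 moreover have "x:qcos N x" using sub_0[OF assms] by (force simp: qcos_def)
 ultimately obtain n where "n:N" "x = n + y" by (auto simp: qcos_def)
 thus "x - y:N" by simp
next
 have sub: "qcos N x <= qcos N y" if "x - y:N" for x y
 proof
  fix z assume "z:qcos N x"
  then obtain n where n: "n:N" "z = n + x" by (auto simp: qcos_def)
  hence "n + (x - y):N" "z = (n + (x - y)) + y" using that sub_add[OF assms] by auto
  thus "z:qcos N y" unfolding qcos_def by blast
 qed
 assume "x - y:N"
 thus "qcos N x = qcos N y"
  using sub[of x y] sub[of y x] sub_neg[OF assms, of "x - y"] by auto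
qed

lemma qcos_self: "subsp N ==> x:qcos N x"
 using sub_0 by (force simp: qcos_def)

lemma qcos_mem: "z:qcos N x <-> z - x:N"
 by (force simp: qcos_def)

lemma qcos_eqI: "subsp N ==> x - y:N ==> qcos N x = qcos N y"
 by (simp add: qcos_eq_i)

lemma qcos_zr [simp]: "qcos N 0 = N"
 by (simp add: qcos_def)

lemma coset_basis_alg: "N +>\<^bsub>basis_alg B f u\<^esub> x = qcos N x"
 by (auto simp: a_r_coset_def r_coset_def qcos_def)

text \<open>Operations on cosets are unions over all representatives; such a union collapses to one
  value once the choice of the representative does not matter.\<close>

lemma UN_coset:
 assumes "subsp N" "!!y. y:qcos N x ==> F y = c"
 shows "(\<Union>y\<in>qcos N x. F y) = c"
 using assms(2) qcos_self[OF assms(1), of x] by auto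

context
 fixes B :: "'b set" and f :: "'b => 'b => 'b option" and u :: "'b \<Rightarrow>\<^sub>0 complex" and N :: "('b \<Rightarrow>\<^sub>0 complex) set"
 assumes sub: "subsp N"
begin

lemma quot_cr: "cr (qmod (basis_alg B f u) N) = qcos N ` sp_in B"
 by (auto simp: quotient_module_def ring.defs FactRing_def A_RCOSETS_def RCOSETS_def r_coset_def qcos_def)

lemma quot_add: "qcos N x +[qmod (basis_alg B f u) N] qcos N y = qcos N (x + y)"
proof -
 have "qcos N x +[qmod (basis_alg B f u) N] qcos N y = {a + b | a b. a:qcos N x & b:qcos N y}"
  by (auto simp: quotient_module_def ring.defs FactRing_def set_add_def set_mult_def)
 also have "... = qcos N (x + y)"
 proof (intro equalityI subsetI)
  fix z assume "z:{a + b | a b. a:qcos N x & b:qcos N y}"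
  then obtain a b where "z = a + b" "a - x:N" "b - y:N" by (auto simp: qcos_mem)
  thus "z:qcos N (x + y)"
   using sub_add[OF sub, of "a - x" "b - y"] by (simp add: qcos_mem algebra_simps)
 next
  fix z assume "z:qcos N (x + y)"
  hence "z - y:qcos N x" by (simp add: qcos_mem algebra_simps)
  moreover have "y:qcos N y" by (rule qcos_self[OF sub])
  ultimately show "z:{a + b | a b. a:qcos N x & b:qcos N y}"
   by (metis (mono_tags, lifting) diff_add_cancel mem_Collect_eq)
 qed
 finally show ?thesis .
qed

lemma quot_add_zero: "N +[qmod (basis_alg B f u) N] qcos N y = qcos N y"
 using quot_add[of 0 y] by simp

lemma quot_zr: "zero (qmod (basis_alg B f u) N) = qcos N 0"
 by (simp add: quotient_module_def ring.defs FactRing_def)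

lemma quot_one: "one (qmod (basis_alg B f u) N) = qcos N u"
 by (simp add: quotient_module_def ring.defs FactRing_def coset_basis_alg)

lemma quot_smult: "c *.[qmod (basis_alg B f u) N] qcos N x = qcos N (pscale c x)"
proof -
 have "qcos N (pscale c y) = qcos N (pscale c x)" if "y:qcos N x" for y
  using that sub_scale[OF sub, of "y - x" c]
  by (simp add: qcos_eq_i[OF sub] qcos_mem sc_diff)
 hence "(\<Union>y\<in>qcos N x. qcos N (pscale c y)) = qcos N (pscale c x)"
  by (rule UN_coset[OF sub])
 thus ?thesis
  by (simp add: quotient_module_def ring.defs module.defs coset_basis_alg)
qed

lemma quot_ab: "abelian_group (qmod (basis_alg B f u) N)"
proof (rule abelian_groupI)
 fix X assume "X:cr (qmod (basis_alg B f u) N)"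
 then obtain x where x: "x:sp_in B" "X = qcos N x" by (auto simp: quot_cr)
 hence "- x:sp_in B" by (simp add: sp_in_def)
 thus "EX y:cr (qmod (basis_alg B f u) N). y +[qmod (basis_alg B f u) N] X =
    0[qmod (basis_alg B f u) N]"
  using x by (intro bexI[of _ "qcos N (- x)"]) (auto simp: quot_cr quot_add quot_zr)
next
 show "0[qmod (basis_alg B f u) N]:cr (qmod (basis_alg B f u) N)"
  by (simp only: quot_zr quot_cr) (simp add: sp_in_def image_iff exI[of _ 0])
qed (auto simp: quot_cr quot_add quot_add_zero quot_zr ac_simps sub_add intro!: imageI)

context
 assumes idl: "!!x n. x:sp_in B ==> n:N ==> bmul f x n:N" "!!x n. x:sp_in B ==> n:N ==> bmul f n x:N"
  and NB: "N <= sp_in B"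
begin

lemma quot_mult:
 assumes "x:sp_in B" "y:sp_in B"
 shows "qcos N x *[qmod (basis_alg B f u) N] qcos N y = qcos N (bmul f x y)"
proof -
 have *: "qcos N (bmul f a b) = qcos N (bmul f x y)" if "a:qcos N x" "b:qcos N y" for a b
 proof -
  have n: "a - x:N" "b - y:N" using that by (auto simp: qcos_mem)
  have "b = (b - y) + y" by simp
  hence b: "b:sp_in B" using n(2) NB assms(2) sub_add[OF sub_sp_in] by (metis subsetD)
  have "bmul f a b - bmul f x y = bmul f (a - x) b + bmul f x (b - y)"
   by (simp add: bm_df_l bm_df_r)
  also have "... : N" using idl(2)[OF b n(1)] idl(1)[OF assms(1) n(2)] by (rule sub_add[OF sub])
  finally show ?thesis by (rule qcos_eqI[OF sub])
 qed
 have "qcos N x *[qmod (basis_alg B f u) N] qcos N y = (\<Union>a\<in>qcos N x. \<Union>b\<in>qcos N y. qcos N (bmul f a b))"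
  by (simp add: quotient_module_def ring.defs FactRing_def rcoset_mult_def coset_basis_alg)
 also have "... = qcos N (bmul f x y)"
  by (rule UN_coset[OF sub], rule UN_coset[OF sub], rule *)
 finally show ?thesis .
qed

lemma quot_ring:
 assumes cl: "!!p q r. p:B ==> q:B ==> f p q = Some r ==> r:B"
  and as: "!!p q r. p:B ==> q:B ==> r:B ==>
   Option.bind (f p q) (%s. f s r) = Option.bind (f q r) (%s. f p s)"
  and un: "u:sp_in B" "!!x. x:sp_in B ==> bmul f u x = x" "!!x. x:sp_in B ==> bmul f x u = x"
 shows "ring (qmod (basis_alg B f u) N)"
proof (rule ringI)
 have mc: "bmul f x y:sp_in B" if "x:sp_in B" "y:sp_in B" for x y
  using bm_sp[OF that cl] .
 have ass: "bmul f (bmul f x y) z = bmul f x (bmul f y z)"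
  if "x:sp_in B" "y:sp_in B" "z:sp_in B" for x y z
  by (rule bm_as_gen, rule as) (use that in \<open>auto simp: sp_in_def\<close>)
 show "Group.monoid (qmod (basis_alg B f u) N)"
  by (rule monoidI) (auto simp: quot_cr quot_one quot_mult mc ass un)
 show "(X +[qmod (basis_alg B f u) N] Y) *[qmod (basis_alg B f u) N] Z =
  X *[qmod (basis_alg B f u) N] Z +[qmod (basis_alg B f u) N] Y *[qmod (basis_alg B f u) N] Z"
  if "X:cr (qmod (basis_alg B f u) N)" "Y:cr (qmod (basis_alg B f u) N)"
   "Z:cr (qmod (basis_alg B f u) N)" for X Y Z
  using that by (auto simp: quot_cr quot_add quot_mult sub_add bm_add_l)
 show "Z *[qmod (basis_alg B f u) N] (X +[qmod (basis_alg B f u) N] Y) =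
  Z *[qmod (basis_alg B f u) N] X +[qmod (basis_alg B f u) N] Z *[qmod (basis_alg B f u) N] Y"
  if "X:cr (qmod (basis_alg B f u) N)" "Y:cr (qmod (basis_alg B f u) N)"
   "Z:cr (qmod (basis_alg B f u) N)" for X Y Z
  using that by (auto simp: quot_cr quot_add quot_mult sub_add bm_add_r)
qed (rule quot_ab)

end

end

section \<open>Paths\<close>

lemma pcomp_eq: "pcomp (u, as, v) (u', bs, v') = (if v' = u then Some (u', bs @ as, v) else None)"
 by (simp add: pcomp_def)

lemma pcomp_as: "Option.bind (pcomp p q) (%s. pcomp s r) = Option.bind (pcomp q r) (%s. pcomp p s)"
 by (cases p; cases q; cases r) (auto simp: pcomp_eq)

lemma plen_pcomp: "pcomp p q = Some r ==> plen r = plen p + plen q"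
 by (cases p; cases q) (auto simp: pcomp_eq plen_def split: if_splits)

definition ptail :: "('v, 'e) qpath => 'v" where "ptail p = fst p"
definition phead :: "('v, 'e) qpath => 'v" where "phead p = snd (snd p)"

lemma ptail_simps [simp]: "ptail (triv v) = v" "ptail (arrow Q a) = tail Q a"
 and phead_simps [simp]: "phead (triv v) = v" "phead (arrow Q a) = head Q a"
 by (simp_all add: ptail_def phead_def triv_def arrow_def)

lemma plen_simps [simp]: "plen (triv v) = 0" "plen (arrow Q a) = 1"
 by (simp_all add: plen_def triv_def arrow_def)

lemma pcomp_tr_l: "pcomp (triv v) p = (if phead p = v then Some p else None)"
 and pcomp_tr_r: "pcomp p (triv v) = (if ptail p = v then Some p else None)"
 by (cases p; auto simp: triv_def pcomp_eq ptail_def phead_def)+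

lemma pcomp_None_i: "pcomp p q = None <-> phead q ~= ptail p"
 by (cases p; cases q) (auto simp: pcomp_eq ptail_def phead_def)

lemma pcomp_ends: "pcomp p q = Some r ==> phead r = phead p & ptail r = ptail q & phead q = ptail p"
 by (cases p; cases q) (auto simp: pcomp_eq ptail_def phead_def split: if_splits)

lemma pcomp_cancel_l: "pcomp p q = Some r ==> pcomp p q' = Some r ==> q = q'"
 by (cases p; cases q; cases q') (auto simp: pcomp_eq split: if_splits)

lemma pcomp_cancel_r: "pcomp p q = Some r ==> pcomp p' q = Some r ==> p = p'"
 by (cases p; cases q; cases p') (auto simp: pcomp_eq split: if_splits)

lemma pcomp_assoc1: "pcomp p q = Some s ==> pcomp s r = Some t ==> EX s'. pcomp q r = Some s' & pcomp p s' = Some t"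
 using pcomp_as[of p q r] by (cases "pcomp q r") auto

lemma pcomp_assoc2: "pcomp q r = Some s ==> pcomp p s = Some t ==> EX s'. pcomp p q = Some s' & pcomp s' r = Some t"
 using pcomp_as[of p q r] by (cases "pcomp p q") auto

locale quiver = fin_digraph Q for Q :: "('v, 'e) pre_digraph"
begin

lemma qpaths_i: "(u, p, v):qpaths Q <-> awalk u p v"
 by (simp add: qpaths_def)

lemma triv_in [simp]: "triv v:qpaths Q <-> v:verts Q"
 by (simp add: triv_def qpaths_i awalk_def)

lemma arrow_in [simp]: "a:arcs Q ==> arrow Q a:qpaths Q"
 by (simp add: arrow_def qpaths_i awalk_def)

lemma pcomp_in: "p:qpaths Q ==> q:qpaths Q ==> pcomp p q = Some r ==> r:qpaths Q"
 by (cases p; cases q) (auto simp: pcomp_eq qpaths_i split: if_splits)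

lemma ends_in: "p:qpaths Q ==> ptail p:verts Q & phead p:verts Q"
 by (cases p) (auto simp: qpaths_i ptail_def phead_def)

lemma cas_split: "cas u (bs @ as) v <-> (EX w. cas u bs w & cas w as v)"
 by (induct bs arbitrary: u) auto

lemma pcomp_factor_r:
 assumes "pcomp p q = Some r" "r:qpaths Q" "p:qpaths Q"
 shows "q:qpaths Q"
proof -
 obtain u as v where p: "p = (u, as, v)" by (cases p)
 obtain u' bs where q: "q = (u', bs, u)" and r: "r = (u', bs @ as, v)"
  using assms(1) unfolding p by (cases q) (auto simp: pcomp_eq split: if_splits)
 have c: "cas u' (bs @ as) v" "u':verts Q" "set bs <= arcs Q" "cas u as v"
  using assms(2,3) unfolding p r by (auto simp: qpaths_i)
 obtain w where w: "cas u' bs w" "cas w as v" using c(1) cas_split by blast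
 have "w = u" using w(2) c(4) by (cases as) auto
 thus ?thesis using w c unfolding q by (simp add: qpaths_i awalk_def)
qed

lemma pcomp_factor_l:
 assumes "pcomp p q = Some r" "r:qpaths Q" "q:qpaths Q"
 shows "p:qpaths Q"
proof -
 obtain u as v where p: "p = (u, as, v)" by (cases p)
 obtain u' bs where q: "q = (u', bs, u)" and r: "r = (u', bs @ as, v)"
  using assms(1) unfolding p by (cases q) (auto simp: pcomp_eq split: if_splits)
 have c: "cas u' (bs @ as) v" "set as <= arcs Q" "cas u' bs u" "u:verts Q"
  using assms(2,3) ends_in[OF assms(3)] unfolding q r by (auto simp: qpaths_i awalk_def phead_def)
 obtain w where w: "cas u' bs w" "cas w as v" using c(1) cas_split by blast
 have uniq: "cas x cs y ==> cas x cs z ==> y = z" for x cs y z by (induct cs arbitrary: x) auto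
 have "w = u" using uniq[OF w(1) c(3)] .
 thus ?thesis using w c unfolding p by (simp add: qpaths_i awalk_def)
qed

lemma plen_0: "p:qpaths Q ==> plen p = 0 ==> p = triv (ptail p) & ptail p = phead p"
 by (cases p) (auto simp: qpaths_i plen_def triv_def ptail_def phead_def)

lemma split_last:
 assumes "p:qpaths Q" "plen p = Suc m"
 obtains a q where "a:arcs Q" "q:qpaths Q" "plen q = m" "pcomp (arrow Q a) q = Some p"
proof -
 obtain u cs v where p: "p = (u, cs, v)" by (cases p)
 then obtain bs a where cs: "cs = bs @ [a]" using assms(2) by (cases cs rule: rev_cases) (auto simp: plen_def)
 have aw: "awalk u cs v" using assms(1) by (simp add: p qpaths_i)
 hence a: "a:arcs Q" and c: "cas u (bs @ [a]) v" unfolding cs by auto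
 from c obtain w where w: "cas u bs w" "cas w [a] v" using cas_split by blast
 hence "pcomp (arrow Q a) (u, bs, w) = Some p" by (auto simp: p cs arrow_def pcomp_eq)
 moreover from this have "(u, bs, w):qpaths Q" using pcomp_factor_r a assms(1) arrow_in by blast
 moreover have "plen (u, bs, w) = m" using assms(2) by (simp add: plen_def p cs)
 ultimately show ?thesis using that a by blast
qed

lemma split_first:
 assumes "p:qpaths Q" "plen p = Suc m"
 obtains a q where "a:arcs Q" "q:qpaths Q" "plen q = m" "pcomp q (arrow Q a) = Some p"
proof -
 obtain u cs v where p: "p = (u, cs, v)" by (cases p)
 then obtain bs a where cs: "cs = a # bs" using assms(2) by (cases cs) (auto simp: plen_def)
 have aw: "awalk u cs v" using assms(1) by (simp add: p qpaths_i)
 hence a: "a:arcs Q" and w: "tail Q a = u" "cas (head Q a) bs v" unfolding cs by auto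
 hence "pcomp (head Q a, bs, v) (arrow Q a) = Some p" by (auto simp: p cs arrow_def pcomp_eq)
 moreover from this have "(head Q a, bs, v):qpaths Q" using pcomp_factor_l a assms(1) arrow_in by blast
 moreover have "plen (head Q a, bs, v) = m" using assms(2) by (simp add: plen_def p cs)
 ultimately show ?thesis using that a by blast
qed

lemma arrow_left_unique: "pcomp (arrow Q a) q = Some p ==> pcomp (arrow Q b) q' = Some p ==> a = b & q = q'"
 by (cases q; cases q') (auto simp: arrow_def pcomp_eq split: if_splits)

lemma arrow_right_unique: "pcomp q (arrow Q a) = Some p ==> pcomp q' (arrow Q b) = Some p ==> a = b & q = q'"
 by (cases q; cases q') (auto simp: arrow_def pcomp_eq split: if_splits)

lemma finite_paths: "finite {p:qpaths Q. plen p = m}"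
proof -
 have "{p:qpaths Q. plen p = m} <= verts Q \<times> {xs. set xs <= arcs Q & length xs = m} \<times> verts Q"
  by (auto simp: qpaths_i plen_def awalk_def) (metis awalk_def awlast_in_verts ends_in phead_def qpaths_i snd_conv)
 moreover have "finite (verts Q \<times> {xs. set xs <= arcs Q & length xs = m} \<times> verts Q)"
  by (intro finite_cartesian_product finite_lists_length_eq) auto
 ultimately show ?thesis by (rule finite_subset)
qed

abbreviation T :: "('v, 'e) qelem set" where "T \<equiv> sp_in (qpaths Q)"

definition unitT :: "('v, 'e) qelem" where "unitT = (\<Sum>v\<in>verts Q. bas (triv v))"

lemma path_alg_eq: "path_alg Q = basis_alg (qpaths Q) pcomp unitT"
 by (simp add: path_alg_def unitT_def)

lemma uT_in: "unitT:T"
 unfolding unitT_def by (rule sub_sum) simp_all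

lemma uT_l: "x:T ==> bmul pcomp unitT x = x"
proof (rule pl_eqI[of "bmul pcomp unitT" "%x. x"])
 fix p assume "x:T" "p:ks x"
 hence "phead p:verts Q" using ends_in[of p] by (auto simp: sp_in_def)
 moreover have "obas (pcomp (triv v) p) = (if v = phead p then bas p else 0)" for v
  by (simp add: pcomp_tr_l)
 ultimately show "bmul pcomp unitT (bas p) = bas p"
  by (simp add: unitT_def bm_sum_l)
qed simp_all

lemma uT_r: "x:T ==> bmul pcomp x unitT = x"
proof (rule pl_eqI[of "%x. bmul pcomp x unitT" "%x. x"])
 fix p assume "x:T" "p:ks x"
 hence "ptail p:verts Q" using ends_in[of p] by (auto simp: sp_in_def)
 moreover have "obas (pcomp p (triv v)) = (if v = ptail p then bas p else 0)" for v
  by (simp add: pcomp_tr_r)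
 ultimately show "bmul pcomp (bas p) unitT = bas p"
  by (simp add: unitT_def bm_sum_r)
qed simp_all

lemma T_mult: "x:T ==> y:T ==> bmul pcomp x y:T"
 by (rule bm_sp[OF _ _ pcomp_in])

lemma T_as: "bmul pcomp (bmul pcomp x y) z = bmul pcomp x (bmul pcomp y z)"
 by (rule bm_as_gen, rule pcomp_as)

lemma ring_path_alg: "ring (path_alg Q)"
proof (rule ringI)
 show "abelian_group (path_alg Q)"
  unfolding path_alg_eq
 proof (rule abelian_groupI)
  fix x assume "x:cr (basis_alg (qpaths Q) pcomp unitT)"
  thus "EX y:cr (basis_alg (qpaths Q) pcomp unitT). y +[basis_alg (qpaths Q) pcomp unitT] x = 0[basis_alg (qpaths Q) pcomp unitT]"
   by (intro bexI[of _ "- x"]) (auto simp: sp_in_def)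
 qed (simp_all add: sub_add sub_0 ac_simps)
 show "Group.monoid (path_alg Q)"
  unfolding path_alg_eq
  by (rule monoidI) (simp_all add: T_mult uT_in uT_l uT_r T_as)
qed (simp_all add: path_alg_eq bm_add_l bm_add_r)

section \<open>Two-sided ideals of the path algebra\<close>

definition gen_sp :: "('v, 'e) qelem set => ('v, 'e) qelem set" where
 "gen_sp X = {bmul pcomp (bmul pcomp (bas p) x) (bas q) | p x q. p:qpaths Q & x:X & q:qpaths Q}"

lemma gen_spI: "p:qpaths Q ==> x:X ==> q:qpaths Q ==> bmul pcomp (bmul pcomp (bas p) x) (bas q):gen_sp X"
 unfolding gen_sp_def by blast

lemma additive_subgroup_sub:
 assumes "ideal I (path_alg Q)"
 shows "subsp I" "I <= T"
proof -
 interpret I: ideal I "path_alg Q" by fact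
 show s: "I <= T" using I.a_subset by (simp add: path_alg_eq)
 show "subsp I"
 proof (rule pm.subspaceI)
  show "0:I" using additive_subgroup.zero_closed[OF I.is_additive_subgroup] by (simp add: path_alg_eq)
  show "x + y:I" if "x:I" "y:I" for x y using additive_subgroup.a_closed[OF I.is_additive_subgroup that] by (simp add: path_alg_eq)
  fix c x assume x: "x:I"
  \<comment> \<open>Scaling is multiplication by a multiple of the unit, so a ring ideal is a linear
    subspace.\<close>
  have "bmul pcomp (pscale c unitT) x:I"
   using I.I_l_closed[OF x, of "pscale c unitT"] uT_in by (simp add: path_alg_eq sub_scale)
  thus "pscale c x:I"
   using x s by (simp add: bm_sc_l uT_l subset_iff)
 qed
qed

text \<open>A path times a path is a path or zero, so the span of the elements p x q is already
  closed under multiplication from both sides. Linear arguments about the ideal can then be made on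
  these generators.\<close>

lemma quiver_ideal_span:
 assumes X: "X <= T"
 shows "quiver_ideal Q X = pm.span (gen_sp X)"
proof
 interpret ring "path_alg Q" by (rule ring_path_alg)
 have X': "X <= cr (path_alg Q)" using X by (simp add: path_alg_eq)
 have id: "ideal (quiver_ideal Q X) (path_alg Q)"
  unfolding quiver_ideal_def by (rule genideal_ideal[OF X'])
 have Xin: "X <= quiver_ideal Q X" unfolding quiver_ideal_def by (rule genideal_self[OF X'])
 show "pm.span (gen_sp X) <= quiver_ideal Q X"
 proof (rule span_min)
  show "subsp (quiver_ideal Q X)" using additive_subgroup_sub[OF id] by simp
  show "gen_sp X <= quiver_ideal Q X"
   using ideal.I_l_closed[OF id] ideal.I_r_closed[OF id] Xin
   by (fastforce simp: gen_sp_def path_alg_eq)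
 qed
 have TS: "pm.span (gen_sp X) <= T"
  by (rule span_min) (use X in \<open>auto simp: gen_sp_def intro!: T_mult\<close>)
 have lm: "bmul pcomp y x:pm.span (gen_sp X)" if "x:pm.span (gen_sp X)" "y:T" for x y
  using that(1)
 proof (induction rule: pm.span_induct_alt)
  case base thus ?case by (simp add: pm.span_zero)
 next
  case (step c x z)
  obtain p w q where g: "x = bmul pcomp (bmul pcomp (bas p) w) (bas q)" "p:qpaths Q" "w:X" "q:qpaths Q"
   using step(1) by (auto simp: gen_sp_def)
  have "bmul pcomp y x:pm.span (gen_sp X)"
  proof (rule pl_in_sub_sp[OF pl_bm_l pm.subspace_span that(2)])
   fix b assume b: "b:qpaths Q"
   have eq: "bmul pcomp (bas b) x = bmul pcomp (bmul pcomp (bmul pcomp (bas b) (bas p)) w) (bas q)"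
    by (simp only: g(1) T_as)
   show "bmul pcomp (bas b) x:pm.span (gen_sp X)"
   proof (cases "pcomp b p")
    case (Some r)
    hence "r:qpaths Q" using pcomp_in b g by blast
    thus ?thesis unfolding eq using g Some by (auto intro!: pm.span_base gen_spI)
   qed (simp only: eq, simp add: pm.span_zero)
  qed
  thus ?case using step(2) by (simp add: bm_add_r bm_sc_r pm.span_add pm.span_scale)
 qed
 have rm: "bmul pcomp x y:pm.span (gen_sp X)" if "x:pm.span (gen_sp X)" "y:T" for x y
  using that(1)
 proof (induction rule: pm.span_induct_alt)
  case base thus ?case by (simp add: pm.span_zero)
 next
  case (step c x z)
  obtain p w q where g: "x = bmul pcomp (bmul pcomp (bas p) w) (bas q)" "p:qpaths Q" "w:X" "q:qpaths Q"
   using step(1) by (auto simp: gen_sp_def)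
  have "bmul pcomp x y:pm.span (gen_sp X)"
  proof (rule pl_in_sub_sp[OF pl_bm_r pm.subspace_span that(2)])
   fix b assume b: "b:qpaths Q"
   have eq: "bmul pcomp x (bas b) = bmul pcomp (bmul pcomp (bas p) w) (bmul pcomp (bas q) (bas b))"
    by (simp only: g(1) T_as)
   show "bmul pcomp x (bas b):pm.span (gen_sp X)"
   proof (cases "pcomp q b")
    case (Some r)
    hence "r:qpaths Q" using pcomp_in b g by blast
    thus ?thesis unfolding eq using g Some by (auto intro!: pm.span_base gen_spI)
   qed (simp only: eq, simp add: pm.span_zero)
  qed
  thus ?case using step(2) by (simp add: bm_add_l bm_sc_l pm.span_add pm.span_scale)
 qed
 show "quiver_ideal Q X <= pm.span (gen_sp X)"
  unfolding quiver_ideal_def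
 proof (rule genideal_minimal)
  show "ideal (pm.span (gen_sp X)) (path_alg Q)"
  proof (rule idealI[OF ring_path_alg])
   show "subgroup (pm.span (gen_sp X)) (add_monoid (path_alg Q))"
   proof (rule group.subgroupI)
    show "Group.group (add_monoid (path_alg Q))" by (rule add.is_group)
    show "inv\<^bsub>add_monoid (path_alg Q)\<^esub> a:pm.span (gen_sp X)" if "a:pm.span (gen_sp X)" for a
    proof -
    have "- a:T" using that TS sub_neg[OF sub_sp_in] by blast
    hence " -[path_alg Q] a = - a"
    using that TS by (intro minus_equality) (auto simp: path_alg_eq)
    hence "inv\<^bsub>add_monoid (path_alg Q)\<^esub> a = - a" by (simp only: a_inv_def)
    thus ?thesis using that by (simp add: pm.span_neg)
    qed
   qed (use TS pm.span_zero in \<open>auto simp: path_alg_eq pm.span_add\<close>)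
  qed (use lm rm in \<open>auto simp: path_alg_eq\<close>)
  show "X <= pm.span (gen_sp X)"
  proof
   fix x assume x: "x:X"
   \<comment> \<open>Splitting the unit on both sides writes x as a sum of elements e_w x e_v, which
     are generators.\<close>
   have "x = bmul pcomp (bmul pcomp unitT x) unitT"
    using x X by (simp add: uT_l uT_r subset_iff)
   also have "... = (\<Sum>v\<in>verts Q. \<Sum>w\<in>verts Q. bmul pcomp (bmul pcomp (bas (triv w)) x) (bas (triv v)))"
    by (simp add: unitT_def bm_sum_l bm_sum_r)
   also have "... : pm.span (gen_sp X)"
    using x by (intro pm.span_sum pm.span_base gen_spI) simp_all
   finally show "x:pm.span (gen_sp X)" .
  qed
 qed
qed

end

section \<open>The enveloping algebra of a quotient of the path algebra\<close>

lemma quot_finsum: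
 assumes "subsp N" "finite S" "!!i. i:S ==> g i:sp_in B"
 shows "finsum (qmod (basis_alg B f u) N) (%i. qcos N (g i)) S = qcos N (sum g S)"
proof -
 interpret abelian_group "qmod (basis_alg B f u) N" by (rule quot_ab[OF assms(1)])
 show ?thesis using assms(2,3)
 proof (induction S rule: finite_induct)
  case empty thus ?case using quot_zr[OF assms(1), of B f u] by simp
 next
  case (insert i S)
  thus ?case
   by (subst finsum_insert) (auto simp: quot_cr[OF assms(1)] quot_add[OF assms(1)])
 qed
qed

definition ten :: "('a \<Rightarrow>\<^sub>0 complex) => ('b \<Rightarrow>\<^sub>0 complex) => ('a \<times> 'b \<Rightarrow>\<^sub>0 complex)" where
 "ten = bmul (%p q. Some (p, q))"

lemma pl_ten_l: "plin (%x. ten x y)" and plin_ten_right: "plin (%y. ten x y)" and plin_ten_right': "plin (ten x)"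
 by (simp_all add: ten_def)

lemma pl_tenL: "plin h ==> plin (%x. ten (h x) y)" and plin_tenR: "plin h ==> plin (%x. ten y (h x))"
 by (simp_all add: ten_def pl_bmulL pl_bmulR)

lemma ten_bas [simp]: "ten (bas p) (bas q) = bas (p, q)"
 by (simp add: ten_def)

lemma lk_ten: "lk (ten x y) (p, q) = lk x p * lk y q"
proof -
 \<comment> \<open>Scalars are read as multiples of \<open>bas ()\<close>, so that equality of two
   bilinear forms can be checked on basis vectors.\<close>
 have 1: "plin (%x. pscale (lk (ten x y) (p, q)) (bas ()))" for y
  by (simp add: plin_def pl_add[OF pl_ten_l] pl_sc[OF pl_ten_l] Poly_Mapping.lookup_add sc_distl)
 have 2: "plin (%x. pscale (lk x p * lk y q) (bas ()))" for y
  by (simp add: plin_def Poly_Mapping.lookup_add sc_distl ring_distribs)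
 have 3: "plin (%y. pscale (lk (ten x y) (p, q)) (bas ()))" for x
  by (simp add: plin_def pl_add[OF plin_ten_right] pl_sc[OF plin_ten_right] Poly_Mapping.lookup_add sc_distl)
 have 4: "plin (%y. pscale (lk x p * lk y q) (bas ()))" for x
  by (simp add: plin_def Poly_Mapping.lookup_add sc_distl ring_distribs)
 have "pscale (lk (ten x y) (p, q)) (bas ()) = pscale (lk x p * lk y q) (bas ())"
  by (rule bilin_eqI[OF 1 3 2 4]) (auto simp: lk_bas)
 from arg_cong[OF this, of "%z. lk z ()"] show ?thesis by simp
qed

text \<open>The multiplication table of the enveloping algebra of CQ in the basis of pairs of
  paths.\<close>

definition pc2 :: "('v, 'e) qpath \<times> ('v, 'e) qpath => ('v, 'e) qpath \<times> ('v, 'e) qpath => (('v, 'e) qpath \<times> ('v, 'e) qpath) option" where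
 "pc2 x y = Option.bind (pcomp (fst x) (fst y)) (%a. Option.bind (pcomp (snd y) (snd x)) (%b. Some (a, b)))"

definition pact :: "('v, 'e) qpath \<times> ('v, 'e) qpath => ('v, 'e) qpath => ('v, 'e) qpath option" where
 "pact x y = Option.bind (pcomp (fst x) y) (%s. pcomp s (snd x))"

abbreviation emul :: "(('v, 'e) qpath \<times> ('v, 'e) qpath \<Rightarrow>\<^sub>0 complex) => _ => _" (infixl "**" 70) where
 "emul \<equiv> bmul pc2"

abbreviation tmul :: "('v, 'e) qelem => ('v, 'e) qelem => ('v, 'e) qelem" (infixl "*." 70) where
 "tmul \<equiv> bmul pcomp"

definition eact :: "(('v, 'e) qpath \<times> ('v, 'e) qpath \<Rightarrow>\<^sub>0 complex) => ('v, 'e) qelem => ('v, 'e) qelem" where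
 "eact = bmul pact"

definition swp :: "('a \<times> 'a \<Rightarrow>\<^sub>0 complex) => ('a \<times> 'a \<Rightarrow>\<^sub>0 complex)" where
 "swp = lin_ext (%x. bas (prod.swap x))"

lemma pl_swp [simp]: "plin swp" by (simp add: swp_def)

lemma swp_bas [simp]: "swp (bas (p, q)) = bas (q, p)" by (simp add: swp_def)

lemma tmul_as: "x *. y *. z = x *. (y *. z)"
 by (rule bm_as_gen, rule pcomp_as)

lemma pc2_assoc: "Option.bind (pc2 p q) (%s. pc2 s r) = Option.bind (pc2 q r) (%s. pc2 p s)"
proof -
 have 1: "pcomp (fst p) (fst q) = None | (EX s. pcomp (fst p) (fst q) = Some s)" by (cases "pcomp (fst p) (fst q)") auto
 show ?thesis
  using pcomp_as[of "fst p" "fst q" "fst r"] pcomp_as[of "snd r" "snd q" "snd p"]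
  by (cases "pcomp (fst p) (fst q)"; cases "pcomp (fst q) (fst r)"; cases "pcomp (snd q) (snd p)"; cases "pcomp (snd r) (snd q)")
    (auto simp: pc2_def)
qed

lemma emul_as: "x ** y ** z = x ** (y ** z)"
 by (rule bm_as_gen, rule pc2_assoc)

lemma obas_pc2: "obas (pc2 (p, q) (p', q')) = ten (obas (pcomp p p')) (obas (pcomp q' q))"
 by (cases "pcomp p p'"; cases "pcomp q' q") (auto simp: pc2_def pl_zr[OF pl_ten_l] pl_zr[OF plin_ten_right])

lemma ten_emul: "ten a b ** ten c d = ten (a *. c) (d *. b)"
proof -
 have 2: "ten (bas p) (bas q) ** ten c d = ten (bas p *. c) (d *. bas q)" for p q c d
  by (rule bilin_eqI[of "%c d. ten (bas p) (bas q) ** ten c d" "%c d. ten (bas p *. c) (d *. bas q)"])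
    (intro pl_bmulR pl_tenL plin_tenR pl_bmulL pl_id | simp add: obas_pc2)+
 show ?thesis
  by (rule bilin_eqI[of "%a b. ten a b ** ten c d" "%a b. ten (a *. c) (d *. b)"])
    (intro pl_bmulR pl_tenL plin_tenR pl_bmulL pl_id | simp only: 2)+
qed

lemma swp_ten: "swp (ten a b) = ten b a"
 by (rule bilin_eqI[of "%a b. swp (ten a b)" "%a b. ten b a"])
   (intro pl_o[OF pl_swp] pl_ten_l plin_ten_right plin_ten_right' | simp)+

text \<open>Because the flip reverses products, right multiplication by flipped elements is a left
  action; this is how the inner bimodule structure acts on the dual.\<close>

lemma swp_emul: "swp (z ** w) = swp w ** swp z"
proof (rule bilin_eqI[of "%z w. swp (z ** w)" "%z w. swp w ** swp z"])
 fix p q :: "('a, 'b) qpath \<times> ('a, 'b) qpath"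
 show "swp (bas p ** bas q) = swp (bas q) ** swp (bas p)"
  by (cases p; cases q) (simp add: obas_pc2 swp_ten)
qed (intro pl_o[OF pl_swp] pl_bmulR pl_bmulL pl_swp pl_id pl_bm_l pl_bm_right')+

lemma swp_swp [simp]: "swp (swp z) = z"
 by (rule pl_eqI[of "%z. swp (swp z)" "%z. z"]) (intro pl_o[OF pl_swp] pl_swp pl_id | clarsimp)+

lemma swp_sp: "z:sp_in (A \<times> A) ==> swp z:sp_in (A \<times> A)"
 unfolding swp_def by (rule lin_ext_sp) auto

lemma lookup_swp: "lk (swp z) (p, q) = lk z (q, p)"
proof -
 have "lk (swp z) (p, q) = (\<Sum>b\<in>ks z. if b = (q, p) then lk z b else 0)"
  unfolding swp_def lin_ext_def lookup_sum by (rule sum.cong) (auto simp: lk_bas)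
 thus ?thesis by (auto simp: in_keys_iff)
qed

lemma pl_eact_l: "plin (%z. eact z x)" and plin_eact_right: "plin (eact z)"
 by (simp_all add: eact_def)

lemma eact_ten: "eact (ten a b) x = a *. x *. b"
proof (rule trilin_eqI[of "%a b x. eact (ten a b) x" "%a b x. a *. x *. b"])
 show "plin (%a. eact (ten a b) x)" "plin (%b. eact (ten a b) x)" "plin (eact (ten a b))" for a b x
  by (rule pl_o[OF pl_eact_l] pl_ten_l plin_ten_right plin_eact_right)+
 show "plin (%a. a *. x *. b)" "plin (%b. a *. x *. b)" "plin (%x. a *. x *. b)" for a b x
  by (rule pl_bmulL pl_bm_l pl_bm_r)+
qed (simp add: eact_def pact_def bm_obas_l)

lemma eact_emul: "eact (z ** w) x = eact z (eact w x)"
proof -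
 have b: "eact (bas p) x = bas (fst p) *. x *. bas (snd p)" for p x
  using eact_ten[of "bas (fst p)" "bas (snd p)" x] by simp
 show ?thesis
 proof (rule bilin_eqI[of "%z w. eact (z ** w) x" "%z w. eact z (eact w x)"])
  fix p q :: "('a, 'b) qpath \<times> ('a, 'b) qpath"
  have "bas p ** bas q = ten (bas (fst p) *. bas (fst q)) (bas (snd q) *. bas (snd p))"
   using ten_emul[of "bas (fst p)" "bas (snd p)" "bas (fst q)" "bas (snd q)"] by simp
  thus "eact (bas p ** bas q) x = eact (bas p) (eact (bas q) x)"
   by (simp only: eact_ten b tmul_as)
 qed (intro pl_o[OF pl_eact_l] pl_bm_l pl_bm_right' pl_eact_l pl_o[OF plin_eact_right])+
qed

definition rp :: "'a set => 'a" where "rp X = (SOME x. x:X)"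

lemma rp_qcos: "subsp N ==> rp (qcos N x) - x:N"
 using someI[of "%z. z:qcos N x" x] qcos_self[of N x] by (simp add: rp_def qcos_mem)

text \<open>A map into formal sums of classes is linear only modulo the bilinearity relations
  \<open>N\<close>. Induction over the support shows that, up to \<open>N\<close>, its values on the
  basis still determine it.\<close>

lemma approx_linear:
 assumes N: "subsp N" and x: "x:sp_in A"
  and add: "!!x y. x:sp_in A ==> y:sp_in A ==> F (x + y) - (F x + F y):N"
  and sc: "!!c x. x:sp_in A ==> F (pscale c x) - pscale c (F x):N"
 shows "F x - lin_ext (%p. F (bas p)) x:N"
proof -
 have z: "F 0:N" using sc[of 0 0] by (simp add: sp_in_def)
 have "F (\<Sum>p\<in>K. pscale (lk x p) (bas p)) - (\<Sum>p\<in>K. pscale (lk x p) (F (bas p))):N"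
  if "finite K" "K <= A" for K
  using that
 proof (induction K rule: finite_induct)
  case empty thus ?case using z by simp
 next
  case (insert p K)
  let ?t = "pscale (lk x p) (bas p)" and ?s = "\<Sum>p\<in>K. pscale (lk x p) (bas p)"
  let ?u = "\<Sum>p\<in>K. pscale (lk x p) (F (bas p))"
  have mem: "bas p:sp_in A" "?t:sp_in A" "?s:sp_in A"
   using insert by (auto intro!: sub_scale sub_sum)
  have "F (?t + ?s) - (pscale (lk x p) (F (bas p)) + ?u)
    = (F (?t + ?s) - (F ?t + F ?s)) + (F ?t - pscale (lk x p) (F (bas p))) + (F ?s - ?u)" by simp
  also have "... : N"
   by (intro sub_add[OF N] add[OF mem(2,3)] sc[OF mem(1)] insert(3)) (use insert(4) in auto)
  finally show ?case using insert(1,2) by simp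
 qed
 from this[of "ks x"] x show ?thesis
  by (simp add: sp_in_def lin_ext_def flip: pm_expand)
qed

abbreviation (in quiver) Te :: "(('v, 'e) qpath \<times> ('v, 'e) qpath \<Rightarrow>\<^sub>0 complex) set" where
 "Te \<equiv> sp_in (qpaths Q \<times> qpaths Q)"

text \<open>Instantiated twice, with the quadratic relations of A and with the deformed
  relations.\<close>

locale quiver_quotient = quiver Q for Q :: "('v, 'e) pre_digraph" +
 fixes X :: "('v, 'e) qelem set"
 assumes X_sub: "X <= T"
begin

definition J where "J = quiver_ideal Q X"
definition A where "A = quiver_quot Q X"
abbreviation cl where "cl \<equiv> qcos J"

lemma A_eq: "A = qmod (basis_alg (qpaths Q) pcomp unitT) J"
 by (simp add: A_def quiver_quot_def path_alg_eq J_def)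

lemma J_ideal: "ideal J (path_alg Q)"
 unfolding J_def quiver_ideal_def using X_sub
 by (intro ring.genideal_ideal[OF ring_path_alg]) (simp add: path_alg_eq)

lemma J_sub [simp]: "subsp J" and J_T: "J <= T"
 using additive_subgroup_sub[OF J_ideal] by auto

lemma J_l: "x:T ==> n:J ==> x *. n:J" and J_right: "x:T ==> n:J ==> n *. x:J"
 using ideal.I_l_closed[OF J_ideal, of n x] ideal.I_r_closed[OF J_ideal, of n x] by (simp_all add: path_alg_eq)

lemma X_J: "X <= J"
 unfolding J_def quiver_ideal_def using X_sub
 by (intro ring.genideal_self[OF ring_path_alg]) (simp add: path_alg_eq)

lemma J_span: "J = pm.span (gen_sp X)"
 unfolding J_def by (rule quiver_ideal_span[OF X_sub])

lemma A_ring: "ring A"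
 unfolding A_eq
 by (rule quot_ring[OF J_sub J_l J_right J_T pcomp_in pcomp_as uT_in uT_l uT_r])

lemma A_cr: "cr A = cl ` T"
 unfolding A_eq by (rule quot_cr) simp

lemma A_add: "cl x +[A] cl y = cl (x + y)"
 unfolding A_eq by (rule quot_add) simp

lemma A_mult: "x:T ==> y:T ==> cl x *[A] cl y = cl (x *. y)"
 unfolding A_eq by (rule quot_mult[OF J_sub J_l J_right J_T])

lemma A_one: "1[A] = cl unitT" and A_zero: "0[A] = cl 0"
 unfolding A_eq by (rule quot_one quot_zr; simp)+

lemma A_smult: "c *.[A] cl x = cl (pscale c x)"
 unfolding A_eq by (rule quot_smult) simp

lemma cl_eq: "cl x = cl y <-> x - y:J"
 by (rule qcos_eq_i) simp

lemma qclass_eq: "qclass Q X x = cl x"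
 by (simp add: qclass_def path_alg_eq coset_basis_alg J_def)

lemma rp_cl_J: "rp (cl x) - x:J" by (rule rp_qcos) simp

lemma rp_T: "a:cr A ==> rp a:T"
proof -
 assume "a:cr A"
 then obtain x where x: "a = cl x" "x:T" by (auto simp: A_cr)
 have "rp a - x:T" using rp_qcos[of J x] J_T x by auto
 from sub_add[OF sub_sp_in this x(2)] show ?thesis by simp
qed

lemma cl_rp: "a:cr A ==> cl (rp a) = a"
 by (auto simp: A_cr intro!: cl_eq[THEN iffD2] rp_cl_J)

text \<open>The kernel of the projection from CQ tensor CQ onto A tensor A. Elements of the
  enveloping algebra are from here on represented by elements of \<open>Te\<close>, and equations
  become congruences modulo this subspace.\<close>

definition NN :: "(('v, 'e) qpath \<times> ('v, 'e) qpath \<Rightarrow>\<^sub>0 complex) set" where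
 "NN = pm.span ({ten x y | x y. x:J & y:T} \<union> {ten x y | x y. x:T & y:J})"

lemma NN_sub [simp]: "subsp NN" by (simp add: NN_def)

lemma ten_Te: "x:T ==> y:T ==> ten x y:Te"
 unfolding ten_def by (rule bm_sp) auto

lemma ten_NN1: "x:J ==> y:T ==> ten x y:NN" and ten_NN2: "x:T ==> y:J ==> ten x y:NN"
 unfolding NN_def by (rule pm.span_base; blast)+

lemma NN_induct:
 assumes "z:NN" "subsp S" "!!x y. x:J ==> y:T ==> ten x y:S" "!!x y. x:T ==> y:J ==> ten x y:S"
 shows "z:S"
proof -
 have "NN <= S"
  unfolding NN_def by (rule span_min[OF _ assms(2)]) (auto simp: assms(3,4))
 thus ?thesis using assms(1) by auto
qed

lemma NN_pl:
 assumes "z:NN" "plin f" "subsp S" "!!x y. x:J ==> y:T ==> f (ten x y):S" "!!x y. x:T ==> y:J ==> f (ten x y):S"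
 shows "f z:S"
proof -
 have "z:{z. f z:S}"
  by (rule NN_induct[OF assms(1)])
    (use assms in \<open>auto simp: sub_def pl_add pl_sc pl_zr\<close>)
 thus ?thesis by simp
qed

lemma NN_Te: "NN <= Te"
 using NN_induct[OF _ sub_sp_in ten_Te ten_Te] J_T by blast

lemma Te_mult: "z:Te ==> w:Te ==> z ** w:Te"
 by (rule bm_sp) (auto simp: pc2_def bind_eq_Some_conv dest: pcomp_in)

lemma NN_l: "z:Te ==> n:NN ==> z ** n:NN"
proof (rule NN_pl[of n "%n. z ** n"])
 assume z: "z:Te"
 have b: "bas p ** w = ten (bas (fst p)) (bas (snd p)) ** w" for p :: "('v, 'e) qpath \<times> ('v, 'e) qpath" and w by simp
 show "z ** ten x y:NN" if "x:J" "y:T" for x y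
  by (rule pl_in_sub_sp[OF pl_bm_l NN_sub z])
    (use that in \<open>auto simp: b ten_emul intro!: ten_NN1 J_l T_mult simp del: ten_bas\<close>)
 show "z ** ten x y:NN" if "x:T" "y:J" for x y
  by (rule pl_in_sub_sp[OF pl_bm_l NN_sub z])
    (use that in \<open>auto simp: b ten_emul intro!: ten_NN2 J_right T_mult simp del: ten_bas\<close>)
qed simp_all

lemma NN_swp: "n:NN ==> swp n:NN"
 by (rule NN_pl[of n swp]) (auto simp: swp_ten intro: ten_NN1 ten_NN2)

lemma NN_r: "z:Te ==> n:NN ==> n ** z:NN"
 using NN_swp[OF NN_l[OF swp_sp NN_swp], of z n] by (simp add: swp_emul)

lemma eact_T: "z:Te ==> x:T ==> eact z x:T"
 unfolding eact_def by (rule bm_sp) (auto simp: pact_def bind_eq_Some_conv intro: pcomp_in[OF pcomp_in])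

lemma eact_NN: "z:NN ==> x:T ==> eact z x:J"
 by (rule NN_pl[of z "%z. eact z x"])
   (simp_all add: pl_eact_l eact_ten J_right[OF _ J_right] J_l[OF T_mult])

lemma eact_J: "z:Te ==> x:J ==> eact z x:J"
proof (rule pl_in_sub_sp[OF pl_eact_l J_sub])
 fix p assume "z:Te" "x:J" "p:qpaths Q \<times> qpaths Q"
 hence "bas (fst p):T" "bas (snd p):T" "x:J" by auto
 thus "eact (bas p) x:J"
  using eact_ten[of "bas (fst p)" "bas (snd p)" x] J_right[OF _ J_l] by simp
qed

definition unitE where "unitE = ten unitT unitT"

lemma unitE_Te [simp]: "unitE:Te" by (simp add: unitE_def ten_Te uT_in)

lemma unitE_left: "z:Te ==> unitE ** z = z" and unitE_right: "z:Te ==> z ** unitE = z"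
proof -
 have b: "bas p = ten (bas (fst p)) (bas (snd p))" for p :: "('v, 'e) qpath \<times> ('v, 'e) qpath" by simp
 assume z: "z:Te"
 show "unitE ** z = z"
  by (rule pl_eqI[of "%z. unitE ** z" "%z. z"])
    (use z in \<open>auto simp: b unitE_def ten_emul uT_l uT_r sp_in_def subset_iff simp del: ten_bas\<close>)
 show "z ** unitE = z"
  by (rule pl_eqI[of "%z. z ** unitE" "%z. z"])
    (use z in \<open>auto simp: b unitE_def ten_emul uT_l uT_r sp_in_def subset_iff simp del: ten_bas\<close>)
qed

lemma ten_cong_NN: "x:T ==> x':T ==> y:T ==> y':T ==> x - x':J ==> y - y':J ==> ten x y - ten x' y':NN"
proof -
 assume a: "x:T" "x':T" "y:T" "y':T" "x - x':J" "y - y':J"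
 have "ten x y - ten x' y' = ten (x - x') y + ten x' (y - y')"
  by (simp add: pl_df[OF pl_ten_l] pl_df[OF plin_ten_right])
 also have "... : NN" using a by (intro sub_add[OF NN_sub] ten_NN1 ten_NN2)
 finally show ?thesis .
qed

section \<open>Comparison with the enveloping algebra made of formal pairs of classes\<close>

definition fE where "fE = (%(a, b) (c, d). Some (a *[A] c, d *[A] b))"
abbreviation BE where "BE \<equiv> cr A \<times> cr A"
abbreviation rels where "rels \<equiv> env_rels A"

definition E where "E = env_alg A"

lemma E_eq: "E = qmod (basis_alg BE fE (bas (\<one>\<^bsub>A\<^esub>, 1[A]))) rels"
 by (simp add: E_def env_alg_def fE_def)

lemma rels_sub [simp]: "subsp rels" by (simp add: env_rels_def)

text \<open>\<open>low\<close> replaces a formal pair of classes by the tensor of representatives,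
  \<open>lft\<close> sends a pair of paths to the pair of their classes. They are inverse to each
  other modulo \<open>NN\<close> and the bilinearity relations.\<close>

definition low where "low = lin_ext (%x. ten (rp (fst x)) (rp (snd x)))"
definition lft where "lft = lin_ext (%x. bas (cl (bas (fst x)), cl (bas (snd x))))"

lemma pl_low [simp]: "plin low" and plin_lft [simp]: "plin lft"
 by (simp_all add: low_def lft_def)

lemma low_bas: "low (bas (a, b)) = ten (rp a) (rp b)" and lft_bas: "lft (bas (p, q)) = bas (cl (bas p), cl (bas q))"
 by (simp_all add: low_def lft_def)

lemma clA [simp]: "x:T ==> cl x:cr A" by (simp add: A_cr)

lemma rels_gens:
 "a:cr A ==> a':cr A ==> b:cr A ==> bas (a +[A] a', b) - bas (a, b) - bas (a', b):rels"
 "a:cr A ==> b:cr A ==> b':cr A ==> bas (a, b +[A] b') - bas (a, b) - bas (a, b'):rels"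
 "a:cr A ==> b:cr A ==> bas (c *.[A] a, b) - pscale c (bas (a, b)):rels"
 "a:cr A ==> b:cr A ==> bas (a, c *.[A] b) - pscale c (bas (a, b)):rels"
 unfolding env_rels_def by (rule pm.span_base; blast)+

lemma low_rels: "f:rels ==> low f:NN"
proof -
 have s: "subsp {f. low f:NN}"
  by (auto simp: sub_def pl_add[OF pl_low] pl_sc[OF pl_low] pl_zr[OF pl_low]
    sub_add[OF NN_sub] sub_scale[OF NN_sub] sub_0[OF NN_sub])
 have radd: "rp (a +[A] a') - (rp a + rp a'):J" if "a:cr A" "a':cr A" for a a'
  using that A_add[of "rp a" "rp a'"] rp_cl_J[of "rp a + rp a'"] by (simp add: cl_rp)
 have rsc: "rp (c *.[A] a) - pscale c (rp a):J" if "a:cr A" for a c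
  using that A_smult[of c "rp a"] rp_cl_J[of "pscale c (rp a)"] by (simp add: cl_rp)
 have cA: "a +[A] a':cr A" "c *.[A] a:cr A" if "a:cr A" "a':cr A" for a a' c
  using that by (auto simp: A_cr A_add A_smult sub_add sub_scale)
 have "rels <= {f. low f:NN}"
  unfolding env_rels_def
 proof (rule span_min[OF _ s], safe)
  fix a a' b assume a: "a:cr A" "a':cr A" "b:cr A"
  have "low (bas (a +[A] a', b) - bas (a, b) - bas (a', b)) = ten (rp (a +[A] a') - (rp a + rp a')) (rp b)"
   by (simp add: pl_df[OF pl_low] low_bas pl_df[OF pl_ten_l] pl_add[OF pl_ten_l])
  thus "low (bas (a +[A] a', b) - bas (a, b) - bas (a', b)):NN"
   using ten_NN1[OF radd[OF a(1,2)] rp_T[OF a(3)]] by simp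
 next
  fix a b b' assume a: "a:cr A" "b:cr A" "b':cr A"
  have "low (bas (a, b +[A] b') - bas (a, b) - bas (a, b')) = ten (rp a) (rp (b +[A] b') - (rp b + rp b'))"
   by (simp add: pl_df[OF pl_low] low_bas pl_df[OF plin_ten_right] pl_add[OF plin_ten_right])
  thus "low (bas (a, b +[A] b') - bas (a, b) - bas (a, b')):NN"
   using ten_NN2[OF rp_T[OF a(1)] radd[OF a(2,3)]] by simp
 next
  fix c a b assume a: "a:cr A" "b:cr A"
  have "low (bas (c *.[A] a, b) - pscale c (bas (a, b))) = ten (rp (c *.[A] a) - pscale c (rp a)) (rp b)"
   by (simp add: pl_df[OF pl_low] pl_sc[OF pl_low] low_bas pl_df[OF pl_ten_l] pl_sc[OF pl_ten_l])
  thus "low (bas (c *.[A] a, b) - pscale c (bas (a, b))):NN"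
   using ten_NN1[OF rsc[OF a(1)] rp_T[OF a(2)]] by simp
  have "low (bas (a, c *.[A] b) - pscale c (bas (a, b))) = ten (rp a) (rp (c *.[A] b) - pscale c (rp b))"
   by (simp add: pl_df[OF pl_low] pl_sc[OF pl_low] low_bas pl_df[OF plin_ten_right] pl_sc[OF plin_ten_right])
  thus "low (bas (a, c *.[A] b) - pscale c (bas (a, b))):NN"
   using ten_NN2[OF rp_T[OF a(1)] rsc[OF a(2)]] by simp
 qed
 thus "f:rels ==> low f:NN" by blast
qed

text \<open>The pair of classes is bilinear only modulo \<open>rels\<close>, so the expansion in
  paths is made in one variable at a time by \<open>approx_linear\<close>.\<close>

lemma lft_ten: "x:T ==> y:T ==> bas (cl x, cl y) - lft (ten x y):rels"
proof -
 assume x: "x:T" and y: "y:T"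
 have 1: "bas (cl x, cl y) - lin_ext (%p. bas (cl (bas p), cl y)) x:rels" if "x:T" "y:T" for x y
 proof (rule approx_linear[OF rels_sub that(1), of "%x. bas (cl x, cl y)"])
  show "bas (cl (a + b), cl y) - (bas (cl a, cl y) + bas (cl b, cl y)):rels" if "a:T" "b:T" for a b
   using rels_gens(1)[of "cl a" "cl b" "cl y"] that `y:T` by (simp add: A_add diff_diff_eq)
  show "bas (cl (pscale c a), cl y) - pscale c (bas (cl a, cl y)):rels" if "a:T" for a c
   using rels_gens(3)[of "cl a" "cl y" c] that `y:T` by (simp add: A_smult)
 qed
 have 2: "bas (cl x, cl y) - lin_ext (%p. bas (cl x, cl (bas p))) y:rels" if "x:T" "y:T" for x y
 proof (rule approx_linear[OF rels_sub that(2), of "%y. bas (cl x, cl y)"])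
  show "bas (cl x, cl (a + b)) - (bas (cl x, cl a) + bas (cl x, cl b)):rels" if "a:T" "b:T" for a b
   using rels_gens(2)[of "cl x" "cl a" "cl b"] that `x:T` by (simp add: A_add diff_diff_eq)
  show "bas (cl x, cl (pscale c a)) - pscale c (bas (cl x, cl a)):rels" if "a:T" for a c
   using rels_gens(4)[of "cl x" "cl a" c] that `x:T` by (simp add: A_smult)
 qed
 have eq: "lin_ext (%p. bas (cl (bas p), cl (bas q))) x = lft (ten x (bas q))" for q
  by (rule pl_eqI[OF pl_lin_ext pl_o[OF plin_lft pl_ten_l]]) (simp add: lft_bas)
 have "lin_ext (%q. bas (cl x, cl (bas q))) y - lft (ten x y):rels"
 proof (rule pl_in_sub_sp[OF _ rels_sub y, of "%y. lin_ext (%q. bas (cl x, cl (bas q))) y - lft (ten x y)"])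
  show "plin (%y. lin_ext (%q. bas (cl x, cl (bas q))) y - lft (ten x y))"
   by (intro pl_sub pl_lin_ext pl_o[OF plin_lft] plin_ten_right')
  fix q assume "q:qpaths Q"
  thus "lin_ext (%q. bas (cl x, cl (bas q))) (bas q) - lft (ten x (bas q)):rels"
   using 1[OF x, of "bas q"] by (simp add: eq)
 qed
 from sub_add[OF rels_sub 2[OF x y] this] show ?thesis by simp
qed

lemma lft_NN: "z:NN ==> lft z:rels"
proof (rule NN_pl[of z lft])
 have z: "bas (cl 0, b):rels" "bas (b, cl 0):rels" if "b:cr A" for b
  using rels_gens(3)[of "cl 0" b 0] rels_gens(4)[of b "cl 0" 0] that by (simp_all add: A_smult sub_0 del: qcos_zr)
 fix x y
 show "lft (ten x y):rels" if xy: "x:J" "y:T"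
 proof -
  have "x:T" using xy J_T by auto
  moreover have "cl x = cl 0" using xy by (simp add: cl_eq del: qcos_zr)
  ultimately have "bas (cl 0, cl y) - lft (ten x y):rels" using lft_ten[of x y] xy by metis
  from sub_diff[OF rels_sub z(1)[OF clA[OF xy(2)]] this] show ?thesis by simp
 qed
 show "lft (ten x y):rels" if xy: "x:T" "y:J"
 proof -
  have "y:T" using xy J_T by auto
  moreover have "cl y = cl 0" using xy by (simp add: cl_eq del: qcos_zr)
  ultimately have "bas (cl x, cl 0) - lft (ten x y):rels" using lft_ten[of x y] xy by metis
  from sub_diff[OF rels_sub z(2)[OF clA[OF xy(1)]] this] show ?thesis by simp
 qed
qed simp_all

lemma low_lft: "z:Te ==> low (lft z) - z:NN"
proof (rule pl_in_sub_sp[of "%z. low (lft z) - z"])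
 show "plin (%z. low (lft z) - z)" by (intro pl_sub pl_o[OF pl_low] plin_lft pl_id)
 fix b assume "b:qpaths Q \<times> qpaths Q"
 hence "ten (rp (cl (bas (fst b)))) (rp (cl (bas (snd b)))) - ten (bas (fst b)) (bas (snd b)):NN"
  by (intro ten_cong_NN rp_T rp_cl_J clA) auto
 thus "low (lft (bas b)) - bas b:NN" by (cases b) (simp add: lft_bas low_bas)
qed simp_all

lemma lft_low: "f:sp_in BE ==> f - lft (low f):rels"
proof (rule pl_in_sub_sp[of "%f. f - lft (low f)"])
 show "plin (%z. z - lft (low z))" by (intro pl_sub pl_o[OF plin_lft] pl_low pl_id)
 fix b assume "b:BE"
 thus "bas b - lft (low (bas b)):rels"
  using lft_ten[of "rp (fst b)" "rp (snd b)"] by (cases b) (auto simp: low_bas rp_T cl_rp)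
qed simp_all

lemma lft_sp: "z:Te ==> lft z:sp_in BE"
 unfolding lft_def by (rule lin_ext_sp) auto

lemma low_Te: "f:sp_in BE ==> low f:Te"
 unfolding low_def by (rule lin_ext_sp) (auto intro!: ten_Te rp_T)

lemma rels_sp: "rels <= sp_in BE"
proof -
 have cA: "a +[A] a':cr A" "c *.[A] a:cr A" if "a:cr A" "a':cr A" for a a' c
  using that by (auto simp: A_cr A_add A_smult sub_add sub_scale)
 show ?thesis
  unfolding env_rels_def
  by (rule span_min) (auto intro!: sub_diff sub_scale cA)
qed

text \<open>This replaces membership in a span of formal relations by membership in the kernel
  \<open>NN\<close>; the ideal property of \<open>rels\<close> is then inherited from that of
  \<open>NN\<close>.\<close>

lemma rels_i: "f:sp_in BE ==> f:rels <-> low f:NN"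
 using low_rels lft_NN lft_low sub_add[OF rels_sub, of "f - lft (low f)" "lft (low f)"] by auto

lemma fE_Some: "x:BE ==> y:BE ==> fE x y = Some r ==> r:BE"
 using ring.ring_simprules(5)[OF A_ring] by (auto simp: fE_def)

lemma low_mult: "f:sp_in BE ==> g:sp_in BE ==> low (bmul fE f g) - low f ** low g:NN"
proof (rule pl_in_sub_sp[of "%f. low (bmul fE f g) - low f ** low g"])
 show "plin (%f. low (bmul fE f g) - low f ** low g)"
  by (intro pl_sub pl_o[OF pl_low] pl_bmulL pl_low pl_bm_l)
 fix b assume b: "b:BE" and g: "g:sp_in BE"
 show "low (bmul fE (bas b) g) - low (bas b) ** low g:NN"
 proof (rule pl_in_sub_sp[of "%g. low (bmul fE (bas b) g) - low (bas b) ** low g", OF _ _ g])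
  show "plin (%g. low (bmul fE (bas b) g) - low (bas b) ** low g)"
   by (intro pl_sub pl_o[OF pl_low] pl_bmulR pl_low pl_bm_right')
  fix c assume c: "c:BE"
  obtain b1 b2 c1 c2 where e: "b = (b1, b2)" "c = (c1, c2)" by (cases b; cases c)
  have m: "rp (u *[A] v) - rp u *. rp v:J" if "u:cr A" "v:cr A" for u v
   using A_mult[OF rp_T[OF that(1)] rp_T[OF that(2)]] rp_cl_J[of "rp u *. rp v"] that by (simp add: cl_rp)
  show "low (bmul fE (bas b) (bas c)) - low (bas b) ** low (bas c):NN"
   using b c
   by (auto simp: fE_def low_bas ten_emul intro!: ten_cong_NN m rp_T T_mult ring.ring_simprules(5)[OF A_ring])
 qed simp
qed simp_all

lemma bmulE_sp: "f:sp_in BE ==> g:sp_in BE ==> bmul fE f g:sp_in BE"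
 by (rule bm_sp[OF _ _ fE_Some])

lemma rels_l: "f:sp_in BE ==> n:rels ==> bmul fE f n:rels"
proof -
 assume a: "f:sp_in BE" "n:rels"
 hence n: "n:sp_in BE" using rels_sp by auto
 have "low (bmul fE f n) - low f ** low n + low f ** low n:NN"
  using low_mult[OF a(1) n] NN_l[OF low_Te[OF a(1)] low_rels[OF a(2)]] by (rule sub_add[OF NN_sub])
 thus ?thesis using rels_i[OF bmulE_sp[OF a(1) n]] by simp
qed

lemma rels_r: "f:sp_in BE ==> n:rels ==> bmul fE n f:rels"
proof -
 assume a: "f:sp_in BE" "n:rels"
 hence n: "n:sp_in BE" using rels_sp by auto
 have "low (bmul fE n f) - low n ** low f + low n ** low f:NN"
  using low_mult[OF n a(1)] NN_r[OF low_Te[OF a(1)] low_rels[OF a(2)]] by (rule sub_add[OF NN_sub])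
 thus ?thesis using rels_i[OF bmulE_sp[OF n a(1)]] by simp
qed

lemma oneA: "1[A]:cr A" using ring.ring_simprules(6)[OF A_ring] .

lemma E_ring: "ring E"
 unfolding E_eq
proof (rule quot_ring[OF rels_sub rels_l rels_r rels_sp])
 interpret A: ring A by (rule A_ring)
 show "r:BE" if "p:BE" "q:BE" "fE p q = Some r" for p q r by (rule fE_Some[OF that])
 show "Option.bind (fE p q) (%s. fE s r) = Option.bind (fE q r) (fE p)" if "p:BE" "q:BE" "r:BE" for p q r
  using that A.m_assoc by (cases p; cases q; cases r) (simp add: fE_def)
 show "bmul fE (bas (\<one>\<^bsub>A\<^esub>, 1[A])) x = x" if "x:sp_in BE" for x
  by (rule pl_eqI[of "%x. bmul fE (bas (\<one>\<^bsub>A\<^esub>, 1[A])) x" "%x. x"])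
    (use that in \<open>auto simp: fE_def sp_in_def\<close>)
 show "bmul fE x (bas (\<one>\<^bsub>A\<^esub>, 1[A])) = x" if "x:sp_in BE" for x
  by (rule pl_eqI[of "%x. bmul fE x (bas (\<one>\<^bsub>A\<^esub>, 1[A]))" "%x. x"])
    (use that in \<open>auto simp: fE_def sp_in_def\<close>)
qed (simp_all add: oneA)

text \<open>On representatives, the isomorphism from \<open>Te\<close> modulo \<open>NN\<close> to
  the enveloping algebra in the form of formal pairs of classes.\<close>

definition Psi where "Psi z = qcos rels (lft z)"

lemma Psi_eq: "z:Te ==> w:Te ==> Psi z = Psi w <-> z - w:NN"
proof -
 assume zw: "z:Te" "w:Te"
 hence d: "z - w:Te" by (simp add: sub_diff)
 have "Psi z = Psi w <-> lft (z - w):rels"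
  by (simp add: Psi_def qcos_eq_i pl_df[OF plin_lft])
 also have "... <-> low (lft (z - w)):NN" by (rule rels_i[OF lft_sp[OF d]])
 also have "... <-> z - w:NN"
  using sub_diff[OF NN_sub _ low_lft[OF d], of "low (lft (z - w))"] sub_add[OF NN_sub low_lft[OF d], of "z - w"] by auto
 finally show ?thesis .
qed

lemma Psi_image: "cr E = Psi ` Te"
proof -
 have "qcos rels f:Psi ` Te" if "f:sp_in BE" for f
  using qcos_eqI[OF rels_sub lft_low[OF that]] low_Te[OF that] by (simp add: Psi_def)
 thus ?thesis by (auto simp: E_eq quot_cr Psi_def lft_sp)
qed

lemma Psi_add: "Psi z +[E] Psi w = Psi (z + w)"
 by (simp add: E_eq Psi_def quot_add pl_add[OF plin_lft])

lemma Psi_zr: "0[E] = Psi 0"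
 by (simp add: E_eq Psi_def quot_zr pl_zr[OF plin_lft])

lemma Psi_mult: "z:Te ==> w:Te ==> Psi z *[E] Psi w = Psi (z ** w)"
proof -
 assume zw: "z:Te" "w:Te"
 have "bmul fE (lft z) (lft w) - lft (z ** w):rels"
 proof (rule pl_in_sub_sp[of "%z. bmul fE (lft z) (lft w) - lft (z ** w)", OF _ _ zw(1)])
  show "plin (%z. bmul fE (lft z) (lft w) - lft (z ** w))"
   by (intro pl_sub pl_o[OF plin_lft] pl_bmulL plin_lft pl_bm_l)
  fix b assume b: "b:qpaths Q \<times> qpaths Q"
  show "bmul fE (lft (bas b)) (lft w) - lft (bas b ** w):rels"
  proof (rule pl_in_sub_sp[of "%w. bmul fE (lft (bas b)) (lft w) - lft (bas b ** w)", OF _ _ zw(2)])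
   show "plin (%w. bmul fE (lft (bas b)) (lft w) - lft (bas b ** w))"
    by (intro pl_sub pl_o[OF plin_lft] pl_bmulR plin_lft pl_bm_right')
   fix c assume c: "c:qpaths Q \<times> qpaths Q"
   obtain b1 b2 c1 c2 where e: "b = (b1, b2)" "c = (c1, c2)" by (cases b; cases c)
   have "bas b ** bas c = ten (bas b1 *. bas c1) (bas c2 *. bas b2)"
    unfolding e using ten_emul[of "bas b1" "bas b2" "bas c1" "bas c2"] by (simp only: ten_bas)
   moreover have "bmul fE (lft (bas b)) (lft (bas c)) = bas (cl (bas b1 *. bas c1), cl (bas c2 *. bas b2))"
    using b c by (simp add: e lft_bas A_mult del: bm_bas) (simp add: fE_def A_mult)
   ultimately show "bmul fE (lft (bas b)) (lft (bas c)) - lft (bas b ** bas c):rels"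
    using lft_ten[of "bas b1 *. bas c1" "bas c2 *. bas b2"] b c by (simp add: e T_mult del: bm_bas)
  qed simp
 qed simp
 hence "qcos rels (bmul fE (lft z) (lft w)) = Psi (z ** w)" by (simp add: Psi_def qcos_eqI)
 thus ?thesis
  using quot_mult[OF rels_sub rels_l rels_r rels_sp lft_sp[OF zw(1)] lft_sp[OF zw(2)]]
  by (simp add: E_eq Psi_def)
qed

lemma Psi_one: "1[E] = Psi unitE"
proof -
 have "qcos rels (bas (\<one>\<^bsub>A\<^esub>, 1[A])) = Psi unitE"
  unfolding Psi_def unitE_def A_one by (rule qcos_eqI[OF rels_sub lft_ten[OF uT_in uT_in]])
 thus ?thesis by (simp add: E_eq quot_one)
qed

lemma map_key_swap: "Poly_Mapping.map_key prod.swap f = swp f"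
proof (rule pmI)
 fix k :: "'a \<times> 'a"
 have "inj (prod.swap :: 'a \<times> 'a => 'a \<times> 'a)" by simp
 thus "lk (Poly_Mapping.map_key prod.swap f) k = lk (swp f) k"
  by (cases k) (simp add: map_key.rep_eq lookup_swp)
qed

text \<open>\<open>env_flip\<close> acts on a coset as a set. The flip preserves \<open>NN\<close>,
  hence also the bilinearity relations, and so maps cosets onto cosets.\<close>

lemma env_flip_Psi: "z:Te ==> env_flip (Psi z) = Psi (swp z)"
proof -
 assume z: "z:Te"
 have low_swp: "low (swp f) = swp (low f)" for f
  by (rule pl_eqI[of "%f. low (swp f)" "%f. swp (low f)"])
    (intro pl_o[OF pl_low] pl_o[OF pl_swp] pl_swp pl_low | clarsimp simp: low_bas swp_ten)+
 have lft_swp: "lft (swp f) = swp (lft f)" for f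
  by (rule pl_eqI[of "%f. lft (swp f)" "%f. swp (lft f)"])
    (intro pl_o[OF plin_lft] pl_o[OF pl_swp] pl_swp plin_lft | clarsimp simp: lft_bas)+
 have r: "swp f:rels" if "f:rels" for f
  using that rels_sp rels_i[OF swp_sp, of f] low_rels[OF that] NN_swp by (auto simp: low_swp)
 have "env_flip (Psi z) = swp ` qcos rels (lft z)" by (simp add: env_flip_def map_key_swap Psi_def)
 also have "... = qcos rels (swp (lft z))"
 proof (intro equalityI subsetI)
  fix g assume "g:swp ` qcos rels (lft z)"
  then obtain f where f: "g = swp f" "f - lft z:rels" by (auto simp: qcos_mem)
  thus "g:qcos rels (swp (lft z))" using r[OF f(2)] by (simp add: qcos_mem pl_df[OF pl_swp])
 next
  fix g assume "g:qcos rels (swp (lft z))"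
  hence "swp (g - swp (lft z)):rels" by (intro r) (simp add: qcos_mem)
  hence "swp g:qcos rels (lft z)" by (simp add: qcos_mem pl_df[OF pl_swp])
  thus "g:swp ` qcos rels (lft z)" by (rule rev_image_eqI) simp
 qed
 also have "... = Psi (swp z)" by (simp add: Psi_def lft_swp)
 finally show ?thesis .
qed

lemma env_act_Psi: "z:Te ==> x:T ==> env_act A (Psi z) (cl x) = cl (eact z x)"
proof -
 assume z: "z:Te" and x: "x:T"
 \<comment> \<open>\<open>env_act\<close> evaluates at a representative picked by choice. It differs
   from \<open>lft z\<close> by a relation, and relations act as zero on A.\<close>
 define z' where "z' = rp (Psi z)"
 have d: "z' - lft z:rels" unfolding z'_def Psi_def by (rule rp_qcos) simp
 hence "z' - lft z + lft z:sp_in BE" using rels_sp lft_sp[OF z] by (intro sub_add) auto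
 hence z': "z':sp_in BE" by simp
 have m: "env_act A (Psi z) (cl x) = (\<Oplus>\<^bsub>A\<^esub>ab\<in>ks z'. lk z' ab *.[A] (fst ab *[A] cl x *[A] snd ab))"
  by (simp add: env_act_def z'_def rp_def Let_def)
 have t: "lk z' ab *.[A] (fst ab *[A] cl x *[A] snd ab)
   = cl (pscale (lk z' ab) (eact (low (bas ab)) x))" 
  "pscale (lk z' ab) (eact (low (bas ab)) x):T" if k: "ab:ks z'" for ab
 proof -
  obtain a b where ab: "ab = (a, b)" "a:cr A" "b:cr A" using z' k by (cases ab) (auto simp: sp_in_def)
  hence "a *[A] cl x *[A] b = cl (rp a *. x *. rp b)"
   using A_mult[OF rp_T[OF ab(2)] x] A_mult[OF T_mult[OF rp_T[OF ab(2)] x] rp_T[OF ab(3)]] by (simp add: cl_rp)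
  thus "lk z' ab *.[A] (fst ab *[A] cl x *[A] snd ab)
   = cl (pscale (lk z' ab) (eact (low (bas ab)) x))" by (simp add: ab low_bas eact_ten A_smult)
  show "pscale (lk z' ab) (eact (low (bas ab)) x):T"
   using ab x by (simp add: low_bas eact_ten T_mult rp_T sub_scale)
 qed
 have "env_act A (Psi z) (cl x) = (\<Oplus>\<^bsub>A\<^esub>ab\<in>ks z'. cl (pscale (lk z' ab) (eact (low (bas ab)) x)))"
  unfolding m by (rule abelian_monoid.finsum_cong'[OF abelian_group.axioms(1)[OF ring.is_abelian_group[OF A_ring]]])
    (auto simp: t)
 also have "... = cl (\<Sum>ab\<in>ks z'. pscale (lk z' ab) (eact (low (bas ab)) x))"
  unfolding A_eq by (rule quot_finsum) (auto simp: t(2))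
 also have "(\<Sum>ab\<in>ks z'. pscale (lk z' ab) (eact (low (bas ab)) x)) = eact (low z') x"
  unfolding low_def lin_ext_def[of _ z'] by (simp add: pl_sum[OF pl_eact_l] pl_sc[OF pl_eact_l])
 also have "cl (eact (low z') x) = cl (eact z x)"
 proof -
  have "low z' - z = low (z' - lft z) + (low (lft z) - z)" by (simp add: pl_df[OF pl_low])
  also have "... : NN" using low_rels[OF d] low_lft[OF z] by (rule sub_add[OF NN_sub])
  finally have "eact (low z' - z) x:J" by (rule eact_NN[OF _ x])
  thus ?thesis by (simp add: cl_eq pl_df[OF pl_eact_l])
 qed
 finally show ?thesis .
qed

end

section \<open>Comparison of projective resolutions\<close>

lemma lhD:
 assumes "lmod_hom R M N f"
 shows "x:cr M ==> f x:cr N"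
  and "x:cr M ==> y:cr M ==> f (x +[M] y) = f x +[N] f y"
  and "r:cr R ==> x:cr M ==> f (r *.[M] x) = r *.[N] f x"
 using assms by (auto simp: lmod_hom_def)

lemma lmod_homI:
 assumes "!!x. x:cr M ==> f x:cr N"
  and "!!x y. x:cr M ==> y:cr M ==> f (x +[M] y) = f x +[N] f y"
  and "!!r x. r:cr R ==> x:cr M ==> f (r *.[M] x) = r *.[N] f x"
 shows "lmod_hom R M N f"
 using assms by (auto simp: lmod_hom_def)

lemma lm_ab: "left_module R M ==> abelian_group M"
 by (simp add: left_module_def)

lemma lmod_hom_zr:
 assumes "left_module R M" "left_module R N" "lmod_hom R M N f"
 shows "f 0[M] = 0[N]"
proof -
 interpret M: abelian_group M using assms(1) by (rule lm_ab)
 interpret N: abelian_group N using assms(2) by (rule lm_ab)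
 have z: "f 0[M]:cr N" using lhD(1)[OF assms(3)] by simp
 have "f 0[M] +[N] f 0[M] = f 0[M]"
  using lhD(2)[OF assms(3), of "0[M]" "0[M]"] by simp
 thus ?thesis using z by (metis N.add.l_cancel_one)
qed

lemma lmod_hom_neg:
 assumes "left_module R M" "left_module R N" "lmod_hom R M N f" "x:cr M"
 shows "f (\<ominus>\<^bsub>M\<^esub> x) = -[N] f x"
proof -
 interpret M: abelian_group M using assms(1) by (rule lm_ab)
 interpret N: abelian_group N using assms(2) by (rule lm_ab)
 have "f (\<ominus>\<^bsub>M\<^esub> x) +[N] f x = 0[N]"
  using lhD(2)[OF assms(3), of " -[M] x" x] assms(4) lmod_hom_zr[OF assms(1-3)] by (simp add: M.l_neg)
 thus ?thesis using lhD(1)[OF assms(3)] assms(4) by (metis M.a_inv_closed N.minus_equality)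
qed

lemma lmod_hom_df:
 assumes "left_module R M" "left_module R N" "lmod_hom R M N f" "x:cr M" "y:cr M"
 shows "f (x -[M] y) = f x -[N] f y"
proof -
 interpret M: abelian_group M using assms(1) by (rule lm_ab)
 show ?thesis
  using lhD(2)[OF assms(3,4), of " -[M] y"] lmod_hom_neg[OF assms(1-3,5)] assms(4,5) by (simp add: a_minus_def)
qed

lemma lmod_hom_comp:
 "lmod_hom R M N f ==> lmod_hom R N L g ==> lmod_hom R M L (%x. g (f x))"
 by (auto simp: lmod_hom_def Pi_def)

lemma l_mod_neg_smult:
 assumes "left_module R M" "a:cr R" "x:cr M"
 shows "a *.[M] (\<ominus>\<^bsub>M\<^esub> x) = -[M] (a *.[M] x)"
proof -
 interpret M: abelian_group M using assms(1) by (rule lm_ab)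
 have z: "a *.[M] 0[M] +[M] a *.[M] 0[M] = a *.[M] 0[M]"
  using left_module.smult_r_distr[OF assms(1,2) M.zero_closed M.zero_closed] by simp
 have zc: "a *.[M] 0[M]:cr M" using left_module.smult_closed[OF assms(1,2)] by simp
 have "a *.[M] 0[M] = 0[M]" using z zc by (metis M.add.l_cancel_one)
 hence "a *.[M] (\<ominus>\<^bsub>M\<^esub> x) +[M] a *.[M] x = 0[M]"
  using left_module.smult_r_distr[OF assms(1,2), of " -[M] x" x] assms(3) by (simp add: M.l_neg)
 thus ?thesis using left_module.smult_closed[OF assms(1,2)] assms(3) by (metis M.a_inv_closed M.minus_equality)
qed

lemma lmod_hom_sub:
 assumes "left_module R N" "lmod_hom R M N f" "lmod_hom R M N g"
 shows "lmod_hom R M N (%x. f x -[N] g x)"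
proof (rule lmod_homI)
 interpret N: abelian_group N using assms(1) by (rule lm_ab)
 note [simp] = lhD[OF assms(2)] lhD[OF assms(3)]
 show "f x -[N] g x:cr N" if "x:cr M" for x using that by simp
 show "f (x +[M] y) -[N] g (x +[M] y) = f x -[N] g x +[N] (f y -[N] g y)"
  if "x:cr M" "y:cr M" for x y
  using that by (simp add: a_minus_def N.minus_add N.a_ac)
 show "f (r *.[M] x) -[N] g (r *.[M] x) = r *.[N] (f x -[N] g x)" if "r:cr R" "x:cr M" for r x
  using that by (simp add: a_minus_def left_module.smult_r_distr[OF assms(1)] l_mod_neg_smult[OF assms(1)])
qed

lemma lmod_hom_add:
 assumes "left_module R N" "lmod_hom R M N f" "lmod_hom R M N g"
 shows "lmod_hom R M N (%x. f x +[N] g x)"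
proof (rule lmod_homI)
 interpret N: abelian_group N using assms(1) by (rule lm_ab)
 note [simp] = lhD[OF assms(2)] lhD[OF assms(3)]
 show "f x +[N] g x:cr N" if "x:cr M" for x using that by simp
 show "f (x +[M] y) +[N] g (x +[M] y) = f x +[N] g x +[N] (f y +[N] g y)"
  if "x:cr M" "y:cr M" for x y
  using that by (simp add: N.a_ac)
 show "f (r *.[M] x) +[N] g (r *.[M] x) = r *.[N] (f x +[N] g x)" if "r:cr R" "x:cr M" for r x
  using that by (simp add: left_module.smult_r_distr[OF assms(1)])
qed

lemma l_mod_regular: "ring R ==> left_module R (rgm R)"
proof -
 assume R: "ring R"
 interpret ring R by fact
 have "abelian_group (rgm R)"
  by (rule abelian_groupI) (auto simp: regular_module_def a_ac)
 thus ?thesis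
  by (intro left_module.intro left_module_axioms.intro R) (auto simp: regular_module_def l_distr r_distr m_assoc)
qed

text \<open>A projective module is a summand of a free one: the images of the standard basis are
  lifted, the lift is extended linearly to the free module, and the embedding of P is composed with
  it.\<close>

lemma proj_lift:
 assumes P: "fg_projective R P" and M: "left_module R M" and N: "left_module R N"
  and u: "lmod_hom R P N u" and v: "lmod_hom R M N v"
  and im: "!!x. x:cr P ==> u x:v ` cr M"
 obtains h where "lmod_hom R P M h" "!!x. x:cr P ==> v (h x) = u x"
proof -
 interpret R: ring R using M by (simp add: left_module_def)
 interpret M: abelian_group M using M by (rule lm_ab)
 interpret N: abelian_group N using N by (rule lm_ab)
 obtain k f g where f: "lmod_hom R P (free_module R k) f" and g: "lmod_hom R (free_module R k) P g"
  and gf: "!!x. x:cr P ==> g (f x) = x"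
  using P by (auto simp: fg_projective_def)
 let ?F = "free_module R k"
 define e where "e = (%i. \<lambda>j\<in>{..<k}. if j = i then 1[R] else 0[R])"
 have e: "e i:cr ?F" for i by (auto simp: e_def free_module_def)
 define w where "w = (%x. u (g x))"
 have w: "lmod_hom R ?F N w" unfolding w_def by (rule lmod_hom_comp[OF g u])
 have "EX m. m:cr M & v m = w (e i)" for i
  using im[OF lhD(1)[OF g e[of i]]] by (force simp: w_def)
 then obtain m where m: "!!i. m i:cr M" "!!i. v (m i) = w (e i)" by metis
 define h0 where "h0 = (%x. finsum M (%i. x i *.[M] m i) {..<k})"
 have xc: "x i:cr R" if "x:cr ?F" "i < k" for x i
  using that by (auto simp: free_module_def)
 have sm: "x i *.[M] m i:cr M" if "x:cr ?F" "i < k" for x i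
  by (rule left_module.smult_closed[OF M xc[OF that] m(1)])
 have smult_fin: "finsum M (%i. r *.[M] y i) {..<l} = r *.[M] finsum M y {..<l}"
  if "r:cr R" "!!i. i < l ==> y i:cr M" for r y and l :: nat
  using that(2)
 proof (induction l)
  case 0
  have z: "r *.[M] 0[M] +[M] r *.[M] 0[M] = r *.[M] 0[M]"
   using left_module.smult_r_distr[OF M that(1) M.zero_closed M.zero_closed] by simp
  have zc: "r *.[M] 0[M]:cr M" using left_module.smult_closed[OF M that(1)] by simp
  have "r *.[M] 0[M] = 0[M]" using z zc by (metis M.add.l_cancel_one)
  thus ?case by simp
 next
  case (Suc l)
  have "finsum M (%i. r *.[M] y i) {..<Suc l} = r *.[M] y l +[M] finsum M (%i. r *.[M] y i) {..<l}"
   unfolding lessThan_Suc using Suc left_module.smult_closed[OF M that(1)] by (subst M.finsum_insert) auto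
  moreover have "finsum M y {..<Suc l} = y l +[M] finsum M y {..<l}"
   unfolding lessThan_Suc using Suc by (subst M.finsum_insert) auto
  ultimately show ?case
   using Suc left_module.smult_r_distr[OF M that(1), of "y l" "finsum M y {..<l}"] by simp
 qed
 have h0: "lmod_hom R ?F M h0"
 proof (rule lmod_homI)
  show "h0 x:cr M" if "x:cr ?F" for x
   unfolding h0_def using sm[OF that] by (intro M.finsum_closed) auto
  fix x y assume x: "x:cr ?F" and y: "y:cr ?F"
  have "h0 (x +[?F] y) = finsum M (%i. x i *.[M] m i +[M] y i *.[M] m i) {..<k}"
   unfolding h0_def
  proof (rule M.finsum_cong')
   show "(x +[?F] y) i *.[M] m i = x i *.[M] m i +[M] y i *.[M] m i" if "i:{..<k}" for i
    using that left_module.smult_l_distr[OF M xc[OF x] xc[OF y] m(1), of i i i] by (simp add: free_module_def)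
  qed (use sm[OF x] sm[OF y] in auto)
  also have "... = h0 x +[M] h0 y"
   unfolding h0_def by (rule M.finsum_addf) (use sm[OF x] sm[OF y] in auto)
  finally show "h0 (x +[?F] y) = h0 x +[M] h0 y" .
 next
  fix r x assume r: "r:cr R" and x: "x:cr ?F"
  have "h0 (r *.[?F] x) = finsum M (%i. r *.[M] (x i *.[M] m i)) {..<k}"
   unfolding h0_def
  proof (rule M.finsum_cong')
   show "(r *.[?F] x) i *.[M] m i = r *.[M] (x i *.[M] m i)" if "i:{..<k}" for i
    using that left_module.smult_assoc[OF M r xc[OF x] m(1), of i i] by (simp add: free_module_def)
  qed (use sm[OF x] left_module.smult_closed[OF M r] in auto)
  also have "... = r *.[M] h0 x"
   unfolding h0_def by (rule smult_fin[OF r]) (use sm[OF x] in auto)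
  finally show "h0 (r *.[?F] x) = r *.[M] h0 x" .
 qed
 have vh: "v (h0 x) = w x" if x: "x:cr ?F" for x
 proof -
  \<comment> \<open>Truncation to the first l coordinates; it lets the value of w be computed one
    basis vector at a time.\<close>
  define tr where "tr = (%l. \<lambda>j\<in>{..<k}. if j < l then x j else 0[R])"
  have trc: "tr l:cr ?F" for l using xc[OF x] by (auto simp: tr_def free_module_def)
  have Fz: "w (tr 0) = 0[N]"
  proof -
   have "tr 0 +[?F] tr 0 = tr 0" by (auto simp: tr_def free_module_def)
   hence "w (tr 0) +[N] w (tr 0) = w (tr 0)" using lhD(2)[OF w trc trc, of 0 0] by simp
   thus ?thesis using lhD(1)[OF w trc] by (metis N.add.l_cancel_one)
  qed
  have "l \<le> k ==> v (finsum M (%i. x i *.[M] m i) {..<l}) = w (tr l)" for l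
  proof (induction l)
   case 0 thus ?case using lmod_hom_zr[OF M N v] Fz by simp
  next
   case (Suc l)
   have c: "finsum M (%i. x i *.[M] m i) {..<l}:cr M" using sm[OF x] Suc(2) by (intro M.finsum_closed) auto
   have "finsum M (%i. x i *.[M] m i) {..<Suc l} = x l *.[M] m l +[M] finsum M (%i. x i *.[M] m i) {..<l}"
    unfolding lessThan_Suc using Suc(2) sm[OF x] by (subst M.finsum_insert) auto
   hence "v (finsum M (%i. x i *.[M] m i) {..<Suc l}) = x l *.[N] w (e l) +[N] w (tr l)"
    using Suc lhD(2)[OF v sm[OF x] c, of l] lhD(3)[OF v xc[OF x] m(1), of l l] m(2) by simp
   also have "... = w ((x l *.[?F] e l) +[?F] tr l)"
   proof -
    have "x l *.[?F] e l:cr ?F" using xc[OF x] Suc(2) by (auto simp: free_module_def e_def)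
    thus ?thesis using lhD(2)[OF w _ trc] lhD(3)[OF w xc[OF x] e] Suc(2) by simp
   qed
   also have "(x l *.[?F] e l) +[?F] tr l = tr (Suc l)"
    using xc[OF x] Suc(2) by (auto simp: free_module_def e_def tr_def fun_eq_iff less_Suc_eq)
   finally show ?case .
  qed
  from this[of k] have "v (h0 x) = w (tr k)" by (simp add: h0_def)
  also have "tr k = x" using x by (auto simp: tr_def free_module_def PiE_def extensional_def)
  finally show ?thesis .
 qed
 show ?thesis
 proof (rule that)
  show "lmod_hom R P M (%x. h0 (f x))" by (rule lmod_hom_comp[OF f h0])
  show "v (h0 (f x)) = u x" if "x:cr P" for x
   using vh[OF lhD(1)[OF f that]] gf[OF that] by (simp add: w_def)
 qed
qed

text \<open>A resolution of possibly infinite length: the Koszul complex is recognised as a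
  resolution before its finiteness is known.\<close>

definition fg_res :: "('r, 'm) ring_scheme => ('r, 'x) module
  => (nat => ('r, 'p) module) => (nat => 'p => 'p) => ('p => 'x) => bool" where
 "fg_res R M P d ep <->
   left_module R M & (ALL i. fg_projective R (P i)) &
   (ALL i. lmod_hom R (P (Suc i)) (P i) (d i)) & lmod_hom R (P 0) M ep &
   ep ` cr (P 0) = cr M &
   d 0 ` cr (P 1) = {x:cr (P 0). ep x = 0[M]} &
   (ALL i. d (Suc i) ` cr (P (Suc (Suc i)))
    = {x:cr (P (Suc i)). d i x = 0[P i]})"

lemma fin_fg_res_i:
 "fin_fgproj_resolution R M P d ep <-> fg_res R M P d ep & (EX N. ALL i>N. cr (P i) = {0[P i]})"
 by (auto simp: fin_fgproj_resolution_def fg_res_def)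

lemma fg_resD:
 assumes "fg_res R M P d ep"
 shows "left_module R M" "fg_projective R (P i)" "left_module R (P i)" "lmod_hom R (P (Suc i)) (P i) (d i)"
  "lmod_hom R (P 0) M ep" "y:cr M ==> y:ep ` cr (P 0)"
  "x:cr (P 0) ==> ep x = 0[M] ==> x:d 0 ` cr (P (Suc 0))"
  "z:cr (P (Suc 0)) ==> ep (d 0 z) = 0[M]"
  "x':cr (P (Suc i)) ==> d i x' = 0[P i] ==> x':d (Suc i) ` cr (P (Suc (Suc i)))"
  "z':cr (P (Suc (Suc i))) ==> d i (d (Suc i) z') = 0[P i]"
proof -
 have e0: "d 0 ` cr (P 1) = {x:cr (P 0). ep x = 0[M]}"
  and ei: "d (Suc i) ` cr (P (Suc (Suc i))) = {x:cr (P (Suc i)). d i x = 0[P i]}" for i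
  using assms by (auto simp: fg_res_def)
 show "left_module R M" "fg_projective R (P i)" "left_module R (P i)" "lmod_hom R (P (Suc i)) (P i) (d i)"
  "lmod_hom R (P 0) M ep" "y:cr M ==> y:ep ` cr (P 0)"
  using assms by (auto simp: fg_res_def fg_projective_def)
 show "x:cr (P 0) ==> ep x = 0[M] ==> x:d 0 ` cr (P (Suc 0))"
  "z:cr (P (Suc 0)) ==> ep (d 0 z) = 0[M]" using e0 by auto
 show "x':cr (P (Suc i)) ==> d i x' = 0[P i] ==> x':d (Suc i) ` cr (P (Suc (Suc i)))"
  "z':cr (P (Suc (Suc i))) ==> d i (d (Suc i) z') = 0[P i]" using ei[of i] by auto
qed

text \<open>By dependent choice: the invariant \<open>G\<close> keeps each lift carrying boundaries
  into boundaries, which is the hypothesis of the next lifting step.\<close>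

lemma chain_lift:
 assumes P: "fg_res R M P d ep" and C: "fg_res R M C c et"
 obtains f where "!!i. lmod_hom R (P i) (C i) (f i)" "!!x. x:cr (P 0) ==> et (f 0 x) = ep x"
  "!!i x. x:cr (P (Suc i)) ==> c i (f (Suc i) x) = f i (d i x)"
proof -
 note PD = fg_resD[OF P] and CD = fg_resD[OF C]
 define G where "G = (%n f. lmod_hom R (P n) (C n) f & (n = 0 --> (ALL x:cr (P 0). et (f x) = ep x)) &
   (ALL x:cr (P (Suc n)). f (d n x):c n ` cr (C (Suc n))))"
 have "EX f. G 0 f"
 proof -
  obtain f where f: "lmod_hom R (P 0) (C 0) f" "!!x. x:cr (P 0) ==> et (f x) = ep x"
   by (rule proj_lift[OF PD(2) CD(3) CD(1) PD(5) CD(5)]) (use CD(6) lhD(1)[OF PD(5)] in auto)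
  have "f (d 0 x):c 0 ` cr (C (Suc 0))" if "x:cr (P (Suc 0))" for x
   using that f PD(8) lhD(1)[OF PD(4)] lhD(1)[OF f(1)] by (intro CD(7)) auto
  thus ?thesis using f by (auto simp: G_def)
 qed
 moreover have "EX g. G (Suc n) g & (ALL x:cr (P (Suc n)). c n (g x) = f (d n x))" if "G n f" for f n
 proof -
  have f: "lmod_hom R (P n) (C n) f" "!!x. x:cr (P (Suc n)) ==> f (d n x):c n ` cr (C (Suc n))"
   using that by (auto simp: G_def)
  obtain g where g: "lmod_hom R (P (Suc n)) (C (Suc n)) g" "!!x. x:cr (P (Suc n)) ==> c n (g x) = f (d n x)"
   by (rule proj_lift[OF PD(2) CD(3) CD(3) lmod_hom_comp[OF PD(4) f(1)] CD(4)]) (use f(2) in auto)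
  have "g (d (Suc n) x):c (Suc n) ` cr (C (Suc (Suc n)))" if x: "x:cr (P (Suc (Suc n)))" for x
  proof (rule CD(9))
   show "g (d (Suc n) x):cr (C (Suc n))" using lhD(1)[OF g(1)] lhD(1)[OF PD(4)] x by auto
   have "c n (g (d (Suc n) x)) = f (d n (d (Suc n) x))" using g(2) lhD(1)[OF PD(4) x] by auto
   also have "... = 0[C n]" using PD(10)[OF x] lmod_hom_zr[OF PD(3) CD(3) f(1)] by simp
   finally show "c n (g (d (Suc n) x)) = 0[C n]" .
  qed
  thus ?thesis using g by (auto simp: G_def)
 qed
 ultimately obtain f where "ALL n. G n (f n) & (ALL x:cr (P (Suc n)). c n (f (Suc n) x) = f n (d n x))"
  using dependent_nat_choice[of G "%n f g. ALL x:cr (P (Suc n)). c n (g x) = f (d n x)"] by blast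
 thus ?thesis using that[of f] by (auto simp: G_def)
qed

text \<open>The invariant \<open>G\<close> says that \<open>h (Suc n)\<close> minus the part of the
  homotopy already built takes its values in cycles; by exactness these are boundaries, and
  projectivity provides the next map.\<close>

lemma null_homotopy:
 assumes P: "fg_res R M P d ep" and C: "fg_res R M C c et"
  and h: "!!i. lmod_hom R (P i) (C i) (h i)" "!!x. x:cr (P 0) ==> et (h 0 x) = 0[M]"
  "!!i x. x:cr (P (Suc i)) ==> c i (h (Suc i) x) = h i (d i x)"
 obtains s where "!!i. lmod_hom R (P i) (C (Suc i)) (s i)" "!!x. x:cr (P 0) ==> h 0 x = c 0 (s 0 x)"
  "!!i x. x:cr (P (Suc i)) ==> h (Suc i) x = c (Suc i) (s (Suc i) x) +[C (Suc i)] s i (d i x)"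
proof -
 note PD = fg_resD[OF P] and CD = fg_resD[OF C]
 have ab: "abelian_group (C i)" for i using CD(3) by (rule lm_ab)
 define G where "G = (%n s. lmod_hom R (P n) (C (Suc n)) s & (n = 0 --> (ALL x:cr (P 0). h 0 x = c 0 (s x))) &
   (ALL x:cr (P (Suc n)). c n (s (d n x)) = c n (h (Suc n) x)))"
 have "EX s. G 0 s"
 proof -
  obtain s where s: "lmod_hom R (P 0) (C (Suc 0)) s" "!!x. x:cr (P 0) ==> c 0 (s x) = h 0 x"
   by (rule proj_lift[OF PD(2) CD(3) CD(3) h(1) CD(4)]) (use CD(7) h(2) lhD(1)[OF h(1)] in auto)
  have "c 0 (s (d 0 x)) = c 0 (h (Suc 0) x)" if "x:cr (P (Suc 0))" for x
   using s(2)[OF lhD(1)[OF PD(4) that]] h(3)[OF that] by simp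
  thus ?thesis using s by (auto simp: G_def)
 qed
 moreover have "EX t. G (Suc n) t & (ALL x:cr (P (Suc n)). h (Suc n) x = c (Suc n) (t x) +[C (Suc n)] s (d n x))" if "G n s" for s n
 proof -
  interpret C: abelian_group "C (Suc n)" by (rule ab)
  interpret C': abelian_group "C n" by (rule ab)
  have s: "lmod_hom R (P n) (C (Suc n)) s" "!!x. x:cr (P (Suc n)) ==> c n (s (d n x)) = c n (h (Suc n) x)"
   using that by (auto simp: G_def)
  have sd: "lmod_hom R (P (Suc n)) (C (Suc n)) (%x. s (d n x))" by (rule lmod_hom_comp[OF PD(4) s(1)])
  obtain t where t: "lmod_hom R (P (Suc n)) (C (Suc (Suc n))) t"
   "!!x. x:cr (P (Suc n)) ==> c (Suc n) (t x) = h (Suc n) x -[C (Suc n)] s (d n x)"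
  proof (rule proj_lift[OF PD(2) CD(3) CD(3) lmod_hom_sub[OF CD(3) h(1) sd] CD(4)])
   fix x assume x: "x:cr (P (Suc n))"
   note cl = lhD(1)[OF h(1) x] lhD(1)[OF sd x]
   have "c n (h (Suc n) x -[C (Suc n)] s (d n x)) = 0[C n]"
    using lmod_hom_df[OF CD(3) CD(3) CD(4) cl] s(2)[OF x] lhD(1)[OF CD(4) cl(1)] by (simp add: C'.r_neg a_minus_def)
   thus "h (Suc n) x -[C (Suc n)] s (d n x):c (Suc n) ` cr (C (Suc (Suc n)))"
    using cl by (intro CD(9)) auto
  qed (rule that)
  have eq: "h (Suc n) x = c (Suc n) (t x) +[C (Suc n)] s (d n x)" if "x:cr (P (Suc n))" for x
   using t(2)[OF that] lhD(1)[OF h(1) that] lhD(1)[OF sd that] by (simp add: a_minus_def C.a_assoc C.l_neg)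
  have "c (Suc n) (t (d (Suc n) x)) = c (Suc n) (h (Suc (Suc n)) x)" if x: "x:cr (P (Suc (Suc n)))" for x
  proof -
   have dx: "d (Suc n) x:cr (P (Suc n))" by (rule lhD(1)[OF PD(4) x])
   have "s (d n (d (Suc n) x)) = 0[C (Suc n)]"
    using PD(10)[OF x] lmod_hom_zr[OF PD(3) CD(3) s(1)] by simp
   hence "c (Suc n) (t (d (Suc n) x)) = h (Suc n) (d (Suc n) x)"
    using t(2)[OF dx] lhD(1)[OF h(1) dx] by (simp add: a_minus_def)
   thus ?thesis using h(3)[OF x] by simp
  qed
  thus ?thesis using t eq by (auto simp: G_def)
 qed
 ultimately obtain s where "ALL n. G n (s n) & (ALL x:cr (P (Suc n)). h (Suc n) x = c (Suc n) (s (Suc n) x) +[C (Suc n)] s n (d n x))"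
  using dependent_nat_choice[of G "%n s t. ALL x:cr (P (Suc n)). h (Suc n) x = c (Suc n) (t x) +[C (Suc n)] s (d n x)"] by blast
 thus ?thesis using that[of s] by (auto simp: G_def)
qed

definition homotopic_id :: "('r, 'm) ring_scheme => (nat => ('r, 'p) module) => (nat => 'p => 'p) => (nat => 'p => 'p) => (nat => 'p => 'p) => bool" where
 "homotopic_id R P d k s <-> (ALL i. lmod_hom R (P i) (P (Suc i)) (s i)) &
   (ALL x:cr (P 0). x = k 0 x +[P 0] d 0 (s 0 x)) &
   (ALL i. ALL x:cr (P (Suc i)). x = k (Suc i) x +[P (Suc i)] (d (Suc i) (s (Suc i) x) +[P (Suc i)] s i (d i x)))"

lemma self_homotopic_id:
 assumes P: "fg_res R M P d ep"
  and k: "!!i. lmod_hom R (P i) (P i) (k i)" "!!x. x:cr (P 0) ==> ep (k 0 x) = ep x"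
  "!!i x. x:cr (P (Suc i)) ==> d i (k (Suc i) x) = k i (d i x)"
 obtains s where "homotopic_id R P d k s"
proof -
 note PD = fg_resD[OF P]
 have ab: "abelian_group (P i)" for i using PD(3) by (rule lm_ab)
 have idh: "lmod_hom R (P i) (P i) (%x. x)" for i by (simp add: lmod_hom_def)
 note kc = lhD(1)[OF k(1)]
 obtain s where s: "!!i. lmod_hom R (P i) (P (Suc i)) (s i)" "!!x. x:cr (P 0) ==> x -[P 0] k 0 x = d 0 (s 0 x)"
  "!!i x. x:cr (P (Suc i)) ==> x -[P (Suc i)] k (Suc i) x = d (Suc i) (s (Suc i) x) +[P (Suc i)] s i (d i x)"
 \<comment> \<open>The difference of the identity and k lies over the zero map of M.\<close>
 proof (rule null_homotopy[OF P P, of "%i x. x -[P i] k i x"])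
  show "lmod_hom R (P i) (P i) (%x. x -[P i] k i x)" for i by (rule lmod_hom_sub[OF PD(3) idh k(1)])
  show "ep (x -[P 0] k 0 x) = 0[M]" if "x:cr (P 0)" for x
   using lmod_hom_df[OF PD(3) PD(1) PD(5) that kc[OF that]] k(2)[OF that] lhD(1)[OF PD(5) that]
    abelian_group.r_neg[OF lm_ab[OF PD(1)]] by (simp add: a_minus_def)
  show "d i (x -[P (Suc i)] k (Suc i) x) = d i x -[P i] k i (d i x)" if "x:cr (P (Suc i))" for i x
   using lmod_hom_df[OF PD(3) PD(3) PD(4) that kc[OF that]] k(3)[OF that] by simp
 qed (rule that)
 have rec: "x = y +[P i] (x -[P i] y)" if "x:cr (P i)" "y:cr (P i)" for x y i
 proof -
  interpret abelian_group "P i" by (rule ab)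
  show ?thesis using that by (simp add: a_minus_def a_lcomm[of y x] r_neg)
 qed
 have "homotopic_id R P d k s"
  unfolding homotopic_id_def using s(1) rec[OF _ kc] by (simp add: s(2,3)[symmetric])
 thus ?thesis by (rule that)
qed

section \<open>Dual complexes\<close>

definition cocyc :: "('r, 'm) ring_scheme => (nat => ('r, 'p) module) => (nat => 'p => 'p) => nat => ('p => 'r) => bool" where
 "cocyc R P d i fi <-> lmod_hom R (P i) (rgm R) fi & (ALL x:cr (P (Suc i)). fi (d i x) = 0[R])"

text \<open>In degree zero only the zero map is a coboundary. Values are compared on carriers,
  because homomorphisms here are arbitrary functions outside of them.\<close>

definition cobd :: "('r, 'm) ring_scheme => (nat => ('r, 'p) module) => (nat => 'p => 'p) => nat => ('p => 'r) => bool" where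
 "cobd R P d i fi <-> (case i of 0 => (ALL x:cr (P 0). fi x = 0[R])
   | Suc j => (EX qs. lmod_hom R (P j) (rgm R) qs & (ALL x:cr (P i). fi x = qs (d j x))))"

lemma regular_module_simps [simp]: "cr (rgm R) = cr R" "add (rgm R) = add R"
 "zero (rgm R) = zero R" "smult (rgm R) = mult R"
 by (simp_all add: regular_module_def)

lemma regular_minus [simp]: "a_minus (rgm R) = a_minus R"
 by (auto simp: a_minus_def a_inv_def fun_eq_iff m_inv_def)

text \<open>Asymmetric: the homotopy \<open>s\<close> concerns the composite on the side of
  \<open>C\<close>. The lemma \<open>comparison_exists\<close> provides the locale in both
  directions.\<close>

locale comparison =
 fixes R :: "('r, 'm) ring_scheme" and M :: "('r, 'x) module" and P :: "nat => ('r, 'p) module" and d ep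
  and C :: "nat => ('r, 'q) module" and c et and f g s
 assumes R: "ring R" and P: "fg_res R M P d ep" and C: "fg_res R M C c et"
  and f: "!!i. lmod_hom R (P i) (C i) (f i)" "!!i x. x:cr (P (Suc i)) ==> c i (f (Suc i) x) = f i (d i x)"
  and g: "!!i. lmod_hom R (C i) (P i) (g i)" "!!i x. x:cr (C (Suc i)) ==> d i (g (Suc i) x) = g i (c i x)"
  and s: "homotopic_id R C c (%i x. f i (g i x)) s"
begin

lemmas PD = fg_resD[OF P]
lemmas CD = fg_resD[OF C]

lemma cocyc_pull: "cocyc R C c i fi ==> cocyc R P d i (%x. fi (f i x))"
 unfolding cocyc_def
 using lmod_hom_comp[OF f(1)] f(2)[symmetric] lhD(1)[OF f(1)] by auto

lemma cobd_pull: "cobd R C c i fi ==> cobd R P d i (%x. fi (f i x))"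
proof (cases i)
 case 0
 assume "cobd R C c i fi"
 thus ?thesis using 0 lhD(1)[OF f(1)] by (auto simp: cobd_def)
next
 case (Suc j)
 assume "cobd R C c i fi"
 then obtain qs where "lmod_hom R (C j) (rgm R) qs" "!!x. x:cr (C i) ==> fi x = qs (c j x)"
  using Suc by (auto simp: cobd_def)
 thus ?thesis
  unfolding cobd_def using lhD(1)[OF f(1)] f(2) Suc
  by (auto intro!: lmod_hom_comp[OF f(1)])
qed

text \<open>The homotopy writes x as f g x + c s x + s c x. A cocycle kills c s x, and its value on
  s c x factors through the differential.\<close>

lemma homotopy_cobd:
 assumes "cocyc R C c i fi"
 shows "cobd R C c i (%x. fi x -[R] fi (f i (g i x)))"
proof -
 interpret R: ring R by (rule R)
 have sc: "lmod_hom R (C i) (C (Suc i)) (s i)" for i using s by (auto simp: homotopic_id_def)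
 note cl = lhD(1)[OF f(1) lhD(1)[OF g(1)]] lhD(1)[OF sc] lhD(1)[OF CD(4)]
 interpret Ci: abelian_group "C k" for k by (rule lm_ab[OF CD(3)])
 have aux: "a +[R] b -[R] a = b" if "a:cr R" "b:cr R" for a b
  using that by (simp add: a_minus_def R.a_assoc R.a_lcomm[of a b] R.r_neg)
 show ?thesis
 proof (cases "i = 0")
  case i: True
  have ph: "lmod_hom R (C 0) (rgm R) fi" and pz: "!!x. x:cr (C (Suc 0)) ==> fi (c 0 x) = 0[R]"
   using assms unfolding i cocyc_def by auto
  have "fi x -[R] fi (f 0 (g 0 x)) = 0[R]" if x: "x:cr (C 0)" for x
  proof -
   have "x = f 0 (g 0 x) +[C 0] c 0 (s 0 x)" using s x by (auto simp: homotopic_id_def)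
   hence "fi x = fi (f 0 (g 0 x)) +[R] fi (c 0 (s 0 x))"
    using lhD(2)[OF ph cl(1)[OF x] cl(3)[OF cl(2)[OF x]]] by simp
   thus ?thesis using pz[OF cl(2)[OF x]] lhD(1)[OF ph cl(1)[OF x]] by (simp add: a_minus_def R.r_neg)
  qed
  thus ?thesis unfolding i cobd_def by simp
 next
  case False
  then obtain j where i: "i = Suc j" by (cases i) auto
  have ph: "lmod_hom R (C (Suc j)) (rgm R) fi" and pz: "!!x. x:cr (C (Suc (Suc j))) ==> fi (c (Suc j) x) = 0[R]"
   using assms unfolding i cocyc_def by auto
  note phc = lhD(1)[OF ph, simplified]
  have sj: "lmod_hom R (C j) (rgm R) (%x. fi (s j x))"
   by (rule lmod_hom_comp[OF sc ph])
  have "fi x -[R] fi (f (Suc j) (g (Suc j) x)) = fi (s j (c j x))" if x: "x:cr (C (Suc j))" for x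
  proof -
   have e: "x = f (Suc j) (g (Suc j) x) +[C (Suc j)] (c (Suc j) (s (Suc j) x) +[C (Suc j)] s j (c j x))"
    using s x by (simp add: homotopic_id_def)
   note m = cl(1)[OF x] cl(3)[OF cl(2)[OF x]] cl(2)[OF cl(3)[OF x]]
   have "fi x = fi (f (Suc j) (g (Suc j) x)) +[R] (fi (c (Suc j) (s (Suc j) x)) +[R] fi (s j (c j x)))"
    using lhD(2)[OF ph m(1) Ci.a_closed[OF m(2,3)]] lhD(2)[OF ph m(2,3)] by (simp flip: e)
   thus ?thesis using pz[OF cl(2)[OF x]] phc[OF m(1)] phc[OF m(3)] by (simp add: aux)
  qed
  thus ?thesis using sj unfolding i cobd_def by auto
 qed
qed

lemma cobd_add:
 assumes "cobd R C c i fi" "cobd R C c i qs"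
 shows "cobd R C c i (%x. fi x +[R] qs x)"
proof -
 interpret R: ring R by (rule R)
 show ?thesis
 proof (cases i)
  case 0 thus ?thesis using assms by (simp add: cobd_def)
 next
  case (Suc j)
  obtain a b where a: "lmod_hom R (C j) (rgm R) a" "!!x. x:cr (C i) ==> fi x = a (c j x)"
   and b: "lmod_hom R (C j) (rgm R) b" "!!x. x:cr (C i) ==> qs x = b (c j x)"
   using assms Suc by (auto simp: cobd_def)
  show ?thesis using lmod_hom_add[OF l_mod_regular[OF R] a(1) b(1)] a(2) b(2) Suc by (auto simp: cobd_def)
 qed
qed

text \<open>Pulling back along f loses nothing in cohomology: a cocycle is its pull-back along f g
  plus a coboundary.\<close>

lemma cobd_reflect:
 assumes "cocyc R C c i fi" "cobd R P d i (%x. fi (f i x))"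
 shows "cobd R C c i fi"
proof -
 interpret R: ring R by (rule R)
 have ph: "lmod_hom R (C i) (rgm R) fi" using assms by (auto simp: cocyc_def)
 have "cobd R C c i (%x. fi (f i (g i x)))"
 proof (cases i)
  case 0
  thus ?thesis using assms(2) lhD(1)[OF g(1)] by (auto simp: cobd_def)
 next
  case (Suc j)
  obtain qs where "lmod_hom R (P j) (rgm R) qs" "!!x. x:cr (P i) ==> fi (f i x) = qs (d j x)"
   using assms(2) Suc by (auto simp: cobd_def)
  thus ?thesis
   unfolding cobd_def using lhD(1)[OF g(1)] g(2) Suc
   by (auto intro!: lmod_hom_comp[OF g(1)])
 qed
 from cobd_add[OF homotopy_cobd[OF assms(1)] this]
 have "cobd R C c i (%x. fi x -[R] fi (f i (g i x)) +[R] fi (f i (g i x)))" .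
 moreover have "fi x -[R] fi (f i (g i x)) +[R] fi (f i (g i x)) = fi x" if "x:cr (C i)" for x
  using lhD(1)[OF ph that] lhD(1)[OF ph lhD(1)[OF f(1) lhD(1)[OF g(1) that]]]
  by (simp add: a_minus_def R.a_assoc R.l_neg)
 ultimately show ?thesis by (auto simp: cobd_def split: nat.splits)
qed

end

lemma comparison_exists:
 assumes R: "ring R" and P: "fg_res R M P d ep" and C: "fg_res R M C c et"
 obtains f g s t where "comparison R M P d ep C c et f g s" "comparison R M C c et P d ep g f t"
proof -
 obtain f where f: "!!i. lmod_hom R (P i) (C i) (f i)" "!!x. x:cr (P 0) ==> et (f 0 x) = ep x"
  "!!i x. x:cr (P (Suc i)) ==> c i (f (Suc i) x) = f i (d i x)" by (rule chain_lift[OF P C]) (rule that)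
 obtain g where g: "!!i. lmod_hom R (C i) (P i) (g i)" "!!x. x:cr (C 0) ==> ep (g 0 x) = et x"
  "!!i x. x:cr (C (Suc i)) ==> d i (g (Suc i) x) = g i (c i x)" by (rule chain_lift[OF C P]) (rule that)
 obtain s where s: "homotopic_id R C c (%i x. f i (g i x)) s"
  by (rule self_homotopic_id[OF C, of "%i x. f i (g i x)"])
    (use lmod_hom_comp[OF g(1) f(1)] f(2,3) g(2,3) lhD(1)[OF g(1)] in auto)
 obtain t where t: "homotopic_id R P d (%i x. g i (f i x)) t"
  by (rule self_homotopic_id[OF P, of "%i x. g i (f i x)"])
    (use lmod_hom_comp[OF f(1) g(1)] f(2,3) g(2,3) lhD(1)[OF f(1)] in auto)
 have "comparison R M P d ep C c et f g s" "comparison R M C c et P d ep g f t"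
  by (intro comparison.intro R P C f g s t; assumption)+
 thus ?thesis by (rule that)
qed

section \<open>Filtered lifting\<close>

definition lev :: "('a => nat) => nat => ('a \<Rightarrow>\<^sub>0 complex) => ('a \<Rightarrow>\<^sub>0 complex)" where
 "lev deg k = restr {b. deg b = k}"

text \<open>The bound is strict, so that \<open>below deg 0\<close> is zero and inductions on the
  bound can start there.\<close>

definition below :: "('a => nat) => nat => ('a \<Rightarrow>\<^sub>0 complex) set" where
 "below deg k = sp_in {b. deg b < k}"

lemma pl_lev [simp]: "plin (lev deg k)" by (simp add: lev_def)

lemma lk_lev: "lk (lev deg k x) b = (if deg b = k then lk x b else 0)"
 by (simp add: lev_def lk_restr)

lemma below_sub [simp]: "subsp (below deg k)" by (simp add: below_def)

lemma below_i: "x:below deg k <-> (ALL b. lk x b ~= 0 --> deg b < k)"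
 by (auto simp: below_def sp_in_i)

lemma below_0 [simp]: "x:below deg 0 <-> x = 0"
 by (auto simp: below_i poly_mapping_eq_iff fun_eq_iff)

lemma below_mono: "x:below deg k ==> k \<le> l ==> x:below deg l"
 by (auto simp: below_i)

lemma lev_in_below: "lev deg k x:below deg (Suc k)"
 by (auto simp: below_i lk_lev)

lemma below_step: "x:below deg (Suc k) ==> lev deg k x = 0 ==> x:below deg k"
 unfolding below_i
proof (intro allI impI)
 fix b assume a: "ALL b. lk x b ~= 0 --> deg b < Suc k" "lev deg k x = 0" "lk x b ~= 0"
 have "lk (lev deg k x) b = 0" by (simp add: a(2))
 hence "deg b ~= k" using a(3) by (auto simp: lk_lev)
 thus "deg b < k" using a(1,3) by auto
qed

lemma lev_below: "x:below deg k ==> lev deg k x = 0"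
 by (rule pmI) (auto simp: below_i lk_lev)

lemma lev_lev: "lev deg k (lev deg l x) = (if k = l then lev deg l x else 0)"
 by (rule pmI) (auto simp: lk_lev)

lemma ex_below: "EX k. x:below deg k"
proof -
 have "x:below deg (Suc (Max (deg ` ks x)))"
  by (auto simp: below_i in_keys_iff less_Suc_eq_le)
 thus ?thesis by blast
qed

lemma lev_sp_in: "x:sp_in A ==> lev deg k x:sp_in A"
 by (auto simp: sp_in_i lk_lev)

text \<open>\<open>NI\<close> stands for the relations of the graded algebra, \<open>NJ\<close> for
  those of the deformation; \<open>lead\<close> is the PBW property in the form used for
  lifting.\<close>

locale filtered_pair =
 fixes deg :: "'b => nat" and NI NJ :: "('b \<Rightarrow>\<^sub>0 complex) set"
 assumes NI_sub: "subsp NI" and NJ_sub: "subsp NJ"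
  and NI_graded: "z:NI ==> lev deg k z:NI"
  and lead: "z:NJ ==> z:below deg (Suc k) ==> lev deg k z:NI"

text \<open>
 Vectors are functions on the indices below some bound. An element of the kernel modulo \<open>NJ\<close> has
 its leading form in the kernel modulo \<open>NI\<close>; subtracting a boundary and a lift of an element of
 \<open>NI\<close> lowers the degree.
\<close>

lemma (in filtered_pair) exactness_lift:
 fixes d :: "(nat => ('b \<Rightarrow>\<^sub>0 complex)) => (nat => ('b \<Rightarrow>\<^sub>0 complex))" and d' :: "(nat => ('b \<Rightarrow>\<^sub>0 complex)) => (nat => ('b \<Rightarrow>\<^sub>0 complex))"
 assumes X_diff: "!!x y. x:X ==> y:X ==> (%j. x j - y j):X"
  and X_lev: "!!x k. x:X ==> (%j. lev deg k (x j)):X"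
  and X_lift: "!!x k. x:X ==> (!!j. j < m ==> x j:NI) ==>
    EX x':X. ALL j<m. x' j:NJ & x' j:below deg (Suc k) & lev deg k (x' j) = lev deg k (x j)"
  and Y_lev: "!!y k. y:Y ==> (%j. lev deg k (y j)):Y"
  and Y_add: "!!x y. x:Y ==> y:Y ==> (%j. x j + y j):Y"
  and Y_0: "(%_. 0):Y"
  and d_df: "!!x y j. x:X ==> y:X ==> j < m'' ==> d (%j. x j - y j) j = d x j - d y j"
  and d_lev: "!!x k j. x:X ==> j < m'' ==> lev deg (Suc k) (d x j) = d (%j. lev deg k (x j)) j"
  and d_below: "!!x k j. x:X ==> (!!j. j < m ==> x j:below deg k) ==> j < m'' ==> d x j:below deg (Suc k)"
  and d_NJ: "!!x j. x:X ==> (!!j. j < m ==> x j:NJ) ==> j < m'' ==> d x j:NJ"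
  and d'_X: "!!y. y:Y ==> d' y:X"
  and d'_0: "!!j. j < m ==> d' (%_. 0) j = 0"
  and d'_add: "!!x y j. x:Y ==> y:Y ==> j < m ==> d' (%j. x j + y j) j = d' x j + d' y j"
  and d'_lev: "!!y k j. y:Y ==> j < m ==> lev deg (Suc k) (d' y j) = d' (%j. lev deg k (y j)) j"
  and d'_lev0: "!!y j. y:Y ==> j < m ==> lev deg 0 (d' y j) = 0"
  and dd': "!!y j. y:Y ==> j < m'' ==> d (d' y) j:NJ"
  and exact: "!!x. x:X ==> (!!j. j < m'' ==> d x j:NI) ==> EX y:Y. ALL j<m. x j - d' y j:NI"
  and x: "x:X" and xk: "!!j. j < m'' ==> d x j:NJ"
 shows "EX y:Y. ALL j<m. x j - d' y j:NJ"
proof -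
 have main: "ALL x:X. (ALL j<m''. d x j:NJ) --> (ALL j<m. x j:below deg k) --> (EX y:Y. ALL j<m. x j - d' y j:NJ)" for k
 proof (induction k)
  case 0
  thus ?case using Y_0 d'_0 sub_0[OF NJ_sub] by (intro ballI impI bexI[of _ "%_. 0"]) auto
 next
  case (Suc k)
  show ?case
  proof (intro ballI impI)
   fix x assume xX: "x:X" and dx: "ALL j<m''. d x j:NJ" and xb: "ALL j<m. x j:below deg (Suc k)"
   define xt where "xt = (%j. lev deg k (x j))"
   have xt: "xt:X" unfolding xt_def by (rule X_lev[OF xX])
   have "d xt j:NI" if "j < m''" for j
    using lead[of "d x j" "Suc k"] dx d_below[OF xX, of "Suc k" j] xb d_lev[OF xX that, of k] that by (simp add: xt_def)
   then obtain y where y: "y:Y" "!!j. j < m ==> xt j - d' y j:NI" using exact[OF xt] by blast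
   \<comment> \<open>The differentials raise degrees by one, so only the component of y of degree k
     - 1 reaches degree k; for k = 0 there is none.\<close>
   define y' where "y' = (case k of 0 => (%_. 0) | Suc l => (%j. lev deg l (y j)))"
   have y': "y':Y" using Y_0 Y_lev[OF y(1)] by (auto simp: y'_def split: nat.splits)
   have dy': "d' y' j = lev deg k (d' y j)" if "j < m" for j
    using d'_lev[OF y(1) that] d'_lev0[OF y(1) that] d'_0[OF that] by (auto simp: y'_def split: nat.splits)
   define z where "z = (%j. xt j - d' y' j)"
   have zX: "z:X" unfolding z_def by (rule X_diff[OF xt d'_X[OF y']])
   \<comment> \<open>So z is a homogeneous component of xt - d' y, which lies in the graded subspace
     \<open>NI\<close>.\<close>
   have ze: "z j = lev deg k (xt j - d' y j)" if "j < m" for j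
    using that by (simp add: z_def dy' pl_df[OF pl_lev] xt_def lev_lev)
   have "z j:NI" if "j < m" for j unfolding ze[OF that] by (rule NI_graded[OF y(2)[OF that]])
   then obtain z' where z': "z':X" "!!j. j < m ==> z' j:NJ & z' j:below deg (Suc k) & lev deg k (z' j) = lev deg k (z j)"
    using X_lift[OF zX] by blast
   define w where "w = (%j. (x j - d' y' j) - z' j)"
   have xdy: "(%j. x j - d' y' j):X" by (rule X_diff[OF xX d'_X[OF y']])
   have wX: "w:X" unfolding w_def by (rule X_diff[OF xdy z'(1)])
   have dw: "d w j:NJ" if "j < m''" for j
   proof -
    have "d w j = d x j - d (d' y') j - d z' j"
    unfolding w_def using d_df[OF xdy z'(1) that] d_df[OF xX d'_X[OF y'] that] by simp
    thus ?thesis using dx that dd'[OF y' that] d_NJ[OF z'(1) _ that] z'(2) by (auto intro!: sub_diff[OF NJ_sub])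
   qed
   have "w j:below deg k" if j: "j < m" for j
   proof (rule below_step)
    show "w j:below deg (Suc k)"
    unfolding w_def using xb z'(2) j lev_in_below by (auto intro!: sub_diff[OF below_sub] simp: dy')
    show "lev deg k (w j) = 0"
    using z'(2)[OF j] j by (simp add: w_def pl_df[OF pl_lev] dy' lev_lev ze xt_def)
   qed
   then obtain v where v: "v:Y" "!!j. j < m ==> w j - d' v j:NJ" using Suc.IH wX dw by blast
   show "EX y:Y. ALL j<m. x j - d' y j:NJ"
   proof (intro bexI allI impI)
    show "(%j. y' j + v j):Y" by (rule Y_add[OF y' v(1)])
    fix j assume j: "j < m"
    have "x j - d' (%j. y' j + v j) j = (w j - d' v j) + z' j"
    using d'_add[OF y' v(1) j] by (simp add: w_def)
    thus "x j - d' (%j. y' j + v j) j:NJ" using v(2)[OF j] z'(2)[OF j] sub_add[OF NJ_sub] by auto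
   qed
  qed
 qed
 \<comment> \<open>Finitely many coordinates have a common degree bound, and this is where the
   induction is entered.\<close>
 have "EX k. ALL j<n. x j:below deg k" for n
 proof (induction n)
  case (Suc n)
  then obtain k l where "ALL j<n. x j:below deg k" "x n:below deg l" using ex_below by blast
  hence "ALL j<Suc n. x j:below deg (max k l)" 
   using below_mono[of _ deg k "max k l"] below_mono[of _ deg l "max k l"] by (auto simp: less_Suc_eq)
  thus ?case by blast
 qed simp
 thus ?thesis using main x xk by blast
qed

section \<open>PBW deformations\<close>

lemma Vpow_eq: "Vpow Q m = sp_in {p:qpaths Q. plen p = m}" by (simp add: Vpow_def sp_in_def)
lemma Filt_eq: "Filt Q m = sp_in {p:qpaths Q. plen p \<le> m}" by (simp add: Filt_def sp_in_def)

definition deg2 :: "('v, 'e) qpath \<times> ('v, 'e) qpath => nat" where "deg2 x = plen (fst x) + plen (snd x)"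

lemma tmul_below: "x:below plen (Suc k) ==> y:below plen (Suc l) ==> x *. y:below plen (Suc (k + l))"
 unfolding below_def by (rule bm_sp) (auto simp: plen_pcomp)

lemma lev_ten: "x:below plen (Suc a) ==> y:below plen (Suc b) ==> lev deg2 (a + b) (ten x y) = ten (lev plen a x) (lev plen b y)"
proof (rule pmI)
 fix z assume x: "x:below plen (Suc a)" and y: "y:below plen (Suc b)"
 have "lk x (fst z) = 0 | plen (fst z) < Suc a" "lk y (snd z) = 0 | plen (snd z) < Suc b"
  using x y unfolding below_i by blast+
 thus "lk (lev deg2 (a + b) (ten x y)) z = lk (ten (lev plen a x) (lev plen b y)) z"
  using lk_ten[of _ _ "fst z" "snd z"] by (auto simp: lk_lev deg2_def)
qed

lemma ten_below: "x:below plen (Suc a) ==> y:below plen (Suc b) ==> ten x y:below deg2 (Suc (a + b))"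
 unfolding below_i deg2_def
proof (intro allI impI)
 fix z assume a: "ALL z. lk x z ~= 0 --> plen z < Suc a" "ALL z. lk y z ~= 0 --> plen z < Suc b"
  "lk (ten x y) z ~= 0"
 hence "lk x (fst z) ~= 0" "lk y (snd z) ~= 0"
  using lk_ten[of x y "fst z" "snd z"] by auto
 hence "plen (fst z) < Suc a" "plen (snd z) < Suc b" using a by blast+
 thus "plen (fst z) + plen (snd z) < Suc (a + b)" by simp
qed

text \<open>The assumption \<open>pbw\<close> is injectivity of the map from A to the associated
  graded algebra, in terms of representatives: the leading form of an element of I(P) lies in I(R).
  The map \<open>thy\<close> is the constant part of the deformation; that the linear part is zero
  is built into \<open>P_eq\<close>.\<close>

locale pbw = quiver Q for Q :: "('v, 'e) pre_digraph" +
 fixes R P :: "('v, 'e) qelem set" and thy :: "('v, 'e) qelem => ('v, 'e) qelem"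
 assumes R_bimod: "S_subbimodule Q R" and R_V2: "R <= Vpow Q 2"
  and theta_S: "r:R ==> thy r:Vpow Q 0" and P_eq: "P = (%r. r - thy r) ` R"
  and pbw: "x:Vpow Q m ==> y:below plen m ==> x + y:quiver_ideal Q P ==> x:quiver_ideal Q R"
begin

lemma R_T: "R <= T" using R_V2 by (auto simp: Vpow_eq sp_in_def)

lemma R_sub: "subsp R" using R_bimod by (simp add: S_subbimodule_def)

lemma P_T: "P <= T"
proof
 fix x assume "x:P"
 then obtain r where r: "r:R" "x = r - thy r" by (auto simp: P_eq)
 have "thy r:T" by (rule sp_in_mono[OF theta_S[OF r(1), unfolded Vpow_eq]]) auto
 thus "x:T" using r R_T by (auto intro: sub_diff)
qed

sublocale I: quiver_quotient Q R by unfold_locales (rule R_T)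
sublocale J: quiver_quotient Q P by unfold_locales (rule P_T)

lemma gen_homog: "p:qpaths Q ==> q:qpaths Q ==> r:R ==> bas p *. r *. bas q:sp_in {b. plen b = plen p + 2 + plen q}"
proof (rule bm_sp[where A = "{b. plen b = plen p + 2}" and B = "{q}"])
 assume "r:R"
 thus "bas p *. r:sp_in {b. plen b = plen p + 2}"
  using R_V2 by (intro bm_sp[where A = "{p}" and B = "{b. plen b = 2}"]) (auto simp: Vpow_eq sp_in_def plen_pcomp)
qed (auto simp: plen_pcomp)

lemma lev_homog: "x:sp_in {b. deg b = k} ==> lev deg l x = (if k = l then x else 0)"
 by (rule pmI) (auto simp: lk_lev sp_in_i)

lemma I_graded: "x:I.J ==> lev plen k x:I.J"
proof -
 have "I.J <= {x. lev plen k x:I.J}"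
  unfolding I.J_span
 proof (rule span_min)
  show "subsp {x. lev plen k x:pm.span (gen_sp R)}"
   by (auto simp: sub_def pl_add pl_sc pl_zr pm.span_add pm.span_scale pm.span_zero)
  show "gen_sp R <= {x. lev plen k x:pm.span (gen_sp R)}"
  proof
   fix x assume x: "x:gen_sp R"
   then obtain p r q where "p:qpaths Q" "r:R" "q:qpaths Q" "x = bas p *. r *. bas q" by (auto simp: gen_sp_def)
   hence "lev plen k x = (if plen p + 2 + plen q = k then x else 0)" using lev_homog[OF gen_homog] by simp
   thus "x:{x. lev plen k x:pm.span (gen_sp R)}" using x by (simp add: pm.span_base pm.span_zero)
  qed
 qed
 thus "x:I.J ==> lev plen k x:I.J" by blast
qed

lemma I_low: "x:I.J ==> lk x p ~= 0 ==> plen p \<ge> 2"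
proof -
 have "I.J <= sp_in {p. plen p \<ge> 2}"
  unfolding I.J_span
 proof (rule span_min)
  show "gen_sp R <= sp_in {p. plen p \<ge> 2}"
  proof
   fix x assume "x:gen_sp R"
   then obtain p r q where "p:qpaths Q" "r:R" "q:qpaths Q" "x = bas p *. r *. bas q" by (auto simp: gen_sp_def)
   thus "x:sp_in {p. plen p \<ge> 2}" using gen_homog[of p q r] by (auto simp: sp_in_def)
  qed
 qed simp
 thus "x:I.J ==> lk x p ~= 0 ==> plen p \<ge> 2" by (auto simp: sp_in_i)
qed

text \<open>Only generators p r q of length exactly k contribute to the component of degree k. Each
  of them is replaced by p (r - thy r) q, whose correction is two degrees lower.\<close>

lemma I_lift: "x:I.J ==> EX x':J.J. x':below plen (Suc k) & lev plen k x' = lev plen k x"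
proof -
 let ?S = "{x. EX x':J.J. x':below plen (Suc k) & lev plen k x' = lev plen k x}"
 have "I.J <= ?S"
  unfolding I.J_span
 proof (rule span_min)
  show "subsp ?S"
  proof (rule pm.subspaceI)
   show "0:?S" by (auto intro!: bexI[of _ 0] simp: sub_0)
   fix x y assume "x:?S" "y:?S"
   then obtain x' y' where "x':J.J" "x':below plen (Suc k)" "lev plen k x' = lev plen k x"
    "y':J.J" "y':below plen (Suc k)" "lev plen k y' = lev plen k y" by auto
   hence "x' + y':J.J & x' + y':below plen (Suc k) & lev plen k (x' + y') = lev plen k (x + y)"
    by (simp add: sub_add pl_add[OF pl_lev])
   thus "x + y:?S" by blast
  next
   fix c x assume "x:?S"
   then obtain x' where "x':J.J" "x':below plen (Suc k)" "lev plen k x' = lev plen k x" by auto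
   hence "pscale c x':J.J & pscale c x':below plen (Suc k) & lev plen k (pscale c x') = lev plen k (pscale c x)"
    by (simp add: sub_scale pl_sc[OF pl_lev])
   thus "pscale c x:?S" by blast
  qed
  show "gen_sp R <= ?S"
  proof
   fix x assume "x:gen_sp R"
   then obtain p r q where g: "p:qpaths Q" "r:R" "q:qpaths Q" "x = bas p *. r *. bas q" by (auto simp: gen_sp_def)
   define x' where "x' = bas p *. (r - thy r) *. bas q"
   have lx: "lev plen k x = (if plen p + 2 + plen q = k then x else 0)" using lev_homog[OF gen_homog] g by simp
   show "x:?S"
   proof (cases "plen p + 2 + plen q = k")
    case False
    thus ?thesis using lx by (auto intro!: bexI[of _ 0] simp: sub_0 pl_zr[OF pl_lev])
   next
    case True
    have "r - thy r:J.J" using J.X_J g P_eq by auto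
    hence xJ: "x':J.J" unfolding x'_def using g by (intro J.J_right J.J_l) auto
    have b: "thy r:below plen (Suc 0)" using theta_S[OF g(2)] by (auto simp: Vpow_eq below_def sp_in_def)
    have "bas p *. thy r *. bas q:below plen (Suc (plen p + 0 + plen q))"
    by (intro tmul_below b) (auto simp: below_def)
    hence lo: "bas p *. thy r *. bas q:below plen k" by (rule below_mono) (use True in simp)
    have xx: "x' = x - bas p *. thy r *. bas q" by (simp add: x'_def g(4) bm_df_l bm_df_r)
    have "x:below plen (Suc k)" using gen_homog[OF g(1,3,2)] True by (auto simp: below_def sp_in_def g(4))
    hence "x':below plen (Suc k)" unfolding xx using below_mono[OF lo, of "Suc k"] by (intro sub_diff) auto
    moreover have "lev plen k x' = lev plen k x" unfolding xx by (simp add: pl_df[OF pl_lev] lev_below[OF lo])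
    ultimately show ?thesis using xJ by blast
   qed
  qed
 qed
 thus "x:I.J ==> EX x':J.J. x':below plen (Suc k) & lev plen k x' = lev plen k x" by blast
qed

lemma J_lead: "x:J.J ==> x:below plen (Suc k) ==> lev plen k x:I.J"
proof -
 assume x: "x:J.J" "x:below plen (Suc k)"
 have "x:T" using x J.J_T by auto
 hence v: "lev plen k x:Vpow Q k" by (auto simp: Vpow_eq sp_in_i lk_lev)
 have b: "x - lev plen k x:below plen k"
 proof (rule below_step)
  show "x - lev plen k x:below plen (Suc k)" using x lev_in_below by (intro sub_diff) auto
 qed (simp add: pl_df[OF pl_lev] lev_lev)
 have "lev plen k x + (x - lev plen k x):J.J" using x by simp
 from pbw[OF v b] this show ?thesis by (simp add: J.J_def I.J_def)
qed

text \<open>A normal form for the deformation: a set of paths that is a basis modulo I(R) is by the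
  PBW property also one modulo I(P), and reduction to it never increases lengths. It serves to
  control leading forms of tensors in \<open>NN_lead\<close>.\<close>

lemma filtered_projection:
 obtains pj where "plin pj" "!!x. x:J.J ==> pj x = 0" "!!x. x:T ==> x - pj x:J.J"
  "!!p. p:qpaths Q ==> pj (bas p):below plen (Suc (plen p))" "!!p. p:qpaths Q ==> pj (bas p):T"
proof -
 interpret vp: vector_space_pair pscale pscale ..
 \<comment> \<open>A basis of I(R) is completed by paths to a basis of the path algebra;
   \<open>U\<close> below is the span of the added paths.\<close>
 obtain S where S: "S <= I.J" "pm.independent S" "I.J <= pm.span S"
  using pm.maximal_independent_subset[of I.J] by blast
 obtain B where B: "S <= B" "B <= S \<union> bas ` qpaths Q" "pm.independent B" "S \<union> bas ` qpaths Q <= pm.span B"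
  using pm.maximal_independent_subset_extend[of S "S \<union> bas ` qpaths Q"] S by blast
 obtain g where g: "Vector_Spaces.linear pscale pscale g" "!!b. b:B ==> g b = (if b:S then 0 else b)"
  using vp.linear_independent_extend[OF B(3), of "%b. if b:S then 0 else b"] by blast
 define U where "U = sp_in {p:qpaths Q. bas p:B - S}"
 have glin: "plin g" using g(1) by (auto simp: plin_def vp.linear_add vp.linear_scale)
 have gI: "g x = 0" if "x:I.J" for x
 proof -
  have "subsp {x. g x = 0}"
   by (simp add: sub_def pl_add[OF glin] pl_sc[OF glin] pl_zr[OF glin])
  moreover have "S <= {x. g x = 0}" using B(1) g(2) by fastforce
  ultimately have "pm.span S <= {x. g x = 0}" by (intro span_min)
  thus ?thesis using that S(3) by blast
 qed
 have gU: "g x = x" if "x:U" for x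
 proof (rule pl_eqI[OF glin pl_id])
  fix b assume "b:ks x"
  hence "bas b:B" "bas b ~: S" using that unfolding U_def sp_in_def by blast+
  thus "g (bas b) = bas b" using g(2)[of "bas b"] by simp
 qed
 have dec: "g x:U & x - g x:I.J" if "x:T" for x
 proof -
  have "pm.span B <= {x. g x:U & x - g x:I.J}"
  proof (rule span_min)
   show "subsp {x. g x:U & x - g x:I.J}"
   proof -
    have U: "subsp U" by (simp add: U_def)
    have l: "plin (%x. x - g x)" by (intro pl_sub pl_id glin)
    show ?thesis
    proof (rule pm.subspaceI)
    show "0:{x. g x:U & x - g x:I.J}" using U by (simp add: pl_zr[OF glin] sub_0)
    show "x + y:{x. g x:U & x - g x:I.J}"
    if x: "x:{x. g x:U & x - g x:I.J}" and y: "y:{x. g x:U & x - g x:I.J}" for x y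
    proof (rule CollectI, rule conjI)
    show "g (x + y):U" using sub_add[OF U, of "g x" "g y"] x y by (simp add: pl_add[OF glin])
    show "x + y - g (x + y):I.J"
    using sub_add[OF I.J_sub, of "x - g x" "y - g y"] x y by (simp add: pl_add[OF l])
    qed
    show "pscale c x:{x. g x:U & x - g x:I.J}" if x: "x:{x. g x:U & x - g x:I.J}" for c x
    proof (rule CollectI, rule conjI)
    show "g (pscale c x):U" using sub_scale[OF U, of "g x" c] x by (simp add: pl_sc[OF glin])
    show "pscale c x - g (pscale c x):I.J"
    using sub_scale[OF I.J_sub, of "x - g x" c] x by (simp add: pl_sc[OF l])
    qed
    qed
   qed
   show "B <= {x. g x:U & x - g x:I.J}"
   proof
    fix b assume b: "b:B"
    show "b:{x. g x:U & x - g x:I.J}"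
    proof (cases "b:S")
    case True
    thus ?thesis using S(1) g(2)[OF b] by (auto simp: U_def sub_0)
    next
    case False
    then obtain p where "b = bas p" "p:qpaths Q" using b B(2) by blast
    thus ?thesis using False b g(2)[OF b] by (simp add: U_def sub_0)
    qed
   qed
  qed
  moreover have "x:pm.span B"
  proof -
   have "bas ` qpaths Q <= pm.span B" using B(4) by blast
   from span_min[OF this pm.subspace_span] show ?thesis using sp_in_span[OF that] by (rule subsetD)
  qed
  ultimately show ?thesis by blast
 qed
 have UI: "x = 0" if "x:U" "x:I.J" for x using gU[OF that(1)] gI[OF that(2)] by simp
 have Usub: "subsp U" by (simp add: U_def)
 have Ulev: "lev plen k x:U" if "x:U" for x k using that by (simp add: U_def lev_sp_in)
 \<comment> \<open>The leading form of an element of U in I(P) lies both in U and in I(R), so it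
   vanishes; the degree drops until nothing is left.\<close>
 have UJ: "x:U ==> x:J.J ==> x:below plen k ==> x = 0" for x k
 proof (induction k)
  case (Suc k)
  have "lev plen k x = 0" using J_lead[OF Suc(3,4)] Ulev[OF Suc(2)] by (intro UI)
  thus ?case using Suc below_step by blast
 qed simp
 have UJ0: "x = 0" if "x:U" "x:J.J" for x using UJ[OF that] ex_below by blast
 \<comment> \<open>Division with remainder: the top component is replaced by its normal form modulo
   I(R), and a lift of the difference to I(P) is subtracted.\<close>
 have fil: "x:T ==> x:below plen k ==> EX u:U. u:below plen k & x - u:J.J" for x k
 proof (induction k arbitrary: x)
  case 0
  thus ?case using sub_0[OF Usub] sub_0[OF J.J_sub] by auto
 next
  case (Suc k)
  have d: "g x:U" "x - g x:I.J" using dec[OF Suc(2)] by auto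
  obtain j where j: "j:J.J" "j:below plen (Suc k)" "lev plen k j = lev plen k (x - g x)" using I_lift[OF d(2)] by blast
  define y where "y = x - lev plen k (g x) - j"
  have "U <= T" by (auto simp: U_def sp_in_def)
  hence yT: "y:T" unfolding y_def using Suc(2) Ulev[OF d(1)] j(1) J.J_T by (intro sub_diff) auto
  have "y:below plen k"
  proof (rule below_step)
   show "y:below plen (Suc k)" unfolding y_def using Suc(3) j lev_in_below by (intro sub_diff) auto
   show "lev plen k y = 0" unfolding y_def by (simp add: pl_df[OF pl_lev] lev_lev j(3))
  qed
  from Suc.IH[OF yT this] obtain u where u: "u:U" "u:below plen k" "y - u:J.J" by blast
  show ?case
  proof (intro bexI conjI)
   show "lev plen k (g x) + u:U" using Ulev[OF d(1)] u(1) by (rule sub_add[OF Usub])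
   show "lev plen k (g x) + u:below plen (Suc k)" using lev_in_below below_mono[OF u(2), of "Suc k"] by (intro sub_add) auto
   have e: "x - (lev plen k (g x) + u) = (y - u) + j" by (simp add: y_def)
   show "x - (lev plen k (g x) + u):J.J" unfolding e by (rule sub_add[OF J.J_sub u(3) j(1)])
  qed
 qed
 have "EX u. p:qpaths Q --> u:U & u:below plen (Suc (plen p)) & bas p - u:J.J" for p
  using fil[of "bas p" "Suc (plen p)"] by (cases "p:qpaths Q") (auto simp: below_def)
 then obtain D where D: "!!p. p:qpaths Q ==> D p:U & D p:below plen (Suc (plen p)) & bas p - D p:J.J" by metis
 have diff: "x - lin_ext D x:J.J" if "x:T" for x
  by (rule pl_in_sub_sp[OF pl_sub[OF pl_id pl_lin_ext] J.J_sub that]) (use D in auto)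
 show ?thesis
 proof (rule that[of "lin_ext D"])
  show "lin_ext D x = 0" if "x:J.J" for x
  proof (rule UJ0)
   have xT: "x:T" using that J.J_T by auto
   show "lin_ext D x:U" by (rule pl_in_sub_sp[OF pl_lin_ext Usub xT]) (use D in auto)
   show "lin_ext D x:J.J" using sub_diff[OF J.J_sub that diff[OF xT]] by simp
  qed
 qed (use D diff in \<open>auto simp: U_def sp_in_def\<close>)
qed

lemma NN_graded: "z:I.NN ==> lev deg2 k z:I.NN"
proof (rule I.NN_pl[of z "lev deg2 k"])
 \<comment> \<open>Each summand of a homogeneous component again has a factor in I(R), because
   components of elements of I(R) stay in I(R).\<close>
 have split: "lev deg2 k (ten x y) = (\<Sum>i\<le>k. ten (lev plen i x) (lev plen (k - i) y))" for x y :: "('v, 'e) qelem"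
 proof (rule pmI)
  fix z :: "('v, 'e) qpath \<times> ('v, 'e) qpath"
  obtain p q where z: "z = (p, q)" by (cases z)
  have "(\<Sum>i\<le>k. lk (ten (lev plen i x) (lev plen (k - i) y)) z)
   = (\<Sum>i\<le>k. if i = plen p then (if plen q = k - plen p then lk x p * lk y q else 0) else 0)"
   by (rule sum.cong) (auto simp: z lk_ten lk_lev)
  thus "lk (lev deg2 k (ten x y)) z = lk (\<Sum>i\<le>k. ten (lev plen i x) (lev plen (k - i) y)) z"
   by (auto simp: lookup_sum z lk_lev lk_ten deg2_def)
 qed
 show "lev deg2 k (ten x y):I.NN" if "x:I.J" "y:T" for x y
  unfolding split using that I_graded lev_sp_in by (intro sub_sum I.ten_NN1) auto
 show "lev deg2 k (ten x y):I.NN" if "x:T" "y:I.J" for x y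
  unfolding split using that I_graded lev_sp_in by (intro sub_sum I.ten_NN2) auto
qed auto

lemma NN_low: "z:I.NN ==> z:sp_in {x. deg2 x \<ge> 2}"
proof (rule I.NN_induct[OF _ sub_sp_in])
 fix x y
 show "ten x y:sp_in {x. deg2 x \<ge> 2}" if "x:I.J" "y:T"
  unfolding sp_in_i
 proof (intro allI impI CollectI)
  fix b assume "lk (ten x y) b ~= 0"
  hence "lk x (fst b) ~= 0" using lk_ten[of x y "fst b" "snd b"] by auto
  thus "2 \<le> deg2 b" using I_low[OF that(1)] by (simp add: deg2_def trans_le_add1)
 qed
 show "ten x y:sp_in {x. deg2 x \<ge> 2}" if "x:T" "y:I.J"
  unfolding sp_in_i
 proof (intro allI impI CollectI)
  fix b assume "lk (ten x y) b ~= 0"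
  hence "lk y (snd b) ~= 0" using lk_ten[of x y "fst b" "snd b"] by auto
  thus "2 \<le> deg2 b" using I_low[OF that(2)] by (simp add: deg2_def trans_le_add2)
 qed
qed

text \<open>In a sum of tensors leading terms may cancel, so the claim does not reduce to generators
  of \<open>J.NN\<close>. Instead, pj tensor pj kills \<open>J.NN\<close>, and z is compared with
  its image: for a pair of paths the difference is a sum of two tensors, each with one factor in
  I(P), and \<open>J_lead\<close> applies to that factor.\<close>

lemma NN_lead: "z:J.NN ==> z:below deg2 (Suc k) ==> lev deg2 k z:I.NN"
proof -
 assume z: "z:J.NN" "z:below deg2 (Suc k)"
 obtain pj where pi: "plin pj" "!!x. x:J.J ==> pj x = 0" "!!x. x:T ==> x - pj x:J.J"
  "!!p. p:qpaths Q ==> pj (bas p):below plen (Suc (plen p))" "!!p. p:qpaths Q ==> pj (bas p):T"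
  by (rule filtered_projection) (rule that)
 define PP where "PP = lin_ext (%x. ten (pj (bas (fst x))) (pj (bas (snd x))))"
 have PPl: "plin PP" by (simp add: PP_def)
 have PP: "PP (ten x y) = ten (pj x) (pj y)" for x y
 proof (rule bilin_eqI[of "%x y. PP (ten x y)" "%x y. ten (pj x) (pj y)"])
  show "plin (%x. PP (ten x y))" "plin (%y. PP (ten x y))" for x y
   by (rule pl_o[OF PPl] pl_ten_l plin_ten_right)+
  show "plin (%x. ten (pj x) (pj y))" "plin (%y. ten (pj x) (pj y))" for x y
   by (rule pl_tenL[OF pi(1)], rule plin_tenR[OF pi(1)])
 qed (simp add: PP_def)
 have "PP z:{0}"
  by (rule J.NN_pl[OF z(1) PPl]) (auto simp: PP pi(2) pl_zr[OF pl_ten_l] pl_zr[OF plin_ten_right])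
 hence "z = z - PP z" by simp
 moreover have "lev deg2 k (z - PP z):I.NN"
 proof (rule pl_in_sub_sp[of "%z. lev deg2 k (z - PP z)" I.NN z "(qpaths Q \<times> qpaths Q) \<inter> {b. deg2 b < Suc k}"])
  show "plin (%z. lev deg2 k (z - PP z))" by (intro pl_o[OF pl_lev] pl_sub pl_id PPl)
  show "z:sp_in ((qpaths Q \<times> qpaths Q) \<inter> {b. deg2 b < Suc k})"
   using z subsetD[OF J.NN_Te z(1)] by (simp add: sp_in_def below_def)
  fix b assume b: "b:(qpaths Q \<times> qpaths Q) \<inter> {b. deg2 b < Suc k}"
  define p q where "p = fst b" and "q = snd b"
  have pq: "p:qpaths Q" "q:qpaths Q" "b = (p, q)" "plen p + plen q < Suc k" using b by (auto simp: p_def q_def deg2_def)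
  have bp: "bas p:below plen (Suc (plen p))" "bas q:below plen (Suc (plen q))" by (auto simp: below_def)
  have e: "bas b - PP (bas b) = ten (bas p - pj (bas p)) (bas q) + ten (pj (bas p)) (bas q - pj (bas q))"
   by (simp add: pq(3) PP[of "bas p" "bas q", simplified] pl_df[OF pl_ten_l] pl_df[OF plin_ten_right])
  have b1: "bas p - pj (bas p):below plen (Suc (plen p))" "bas q - pj (bas q):below plen (Suc (plen q))"
   using bp pi(4)[OF pq(1)] pi(4)[OF pq(2)] by (simp_all add: sub_diff)
  show "lev deg2 k (bas b - PP (bas b)):I.NN"
  proof (cases "plen p + plen q = k")
   case True
   have "lev deg2 k (bas b - PP (bas b)) = ten (lev plen (plen p) (bas p - pj (bas p))) (lev plen (plen q) (bas q))
    + ten (lev plen (plen p) (pj (bas p))) (lev plen (plen q) (bas q - pj (bas q)))"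
    unfolding e pl_add[OF pl_lev] True[symmetric] using lev_ten[OF b1(1) bp(2)] lev_ten[OF pi(4)[OF pq(1)] b1(2)] by simp
   also have "... : I.NN"
    using J_lead[OF pi(3) b1(1)] J_lead[OF pi(3) b1(2)] pq(1,2) lev_sp_in[OF pi(5)[OF pq(1)]]
    by (intro sub_add[OF I.NN_sub] I.ten_NN1 I.ten_NN2) (simp_all add: lev_sp_in)
   finally show ?thesis .
  next
   case False
   have "bas b - PP (bas b):below deg2 (Suc (plen p + plen q))"
    unfolding e using ten_below[OF b1(1) bp(2)] ten_below[OF pi(4)[OF pq(1)] b1(2)] by (rule sub_add[OF below_sub])
   hence "bas b - PP (bas b):below deg2 k" by (rule below_mono) (use pq(4) False in simp)
   hence "lev deg2 k (bas b - PP (bas b)) = 0" by (rule lev_below)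
   thus ?thesis by (simp add: sub_0)
  qed
 qed simp
 ultimately show ?thesis by simp
qed

text \<open>One tensor factor is expanded in paths, so that the other one has to be lifted in a
  single degree only, k minus the length of the path.\<close>

lemma NN_lift: "z:I.NN ==> EX z':J.NN. z':below deg2 (Suc k) & lev deg2 k z' = lev deg2 k z"
proof -
 let ?S = "{z. EX z':J.NN. z':below deg2 (Suc k) & lev deg2 k z' = lev deg2 k z}"
 have sub: "subsp ?S"
 proof (rule pm.subspaceI)
  show "0:?S" by (auto intro!: bexI[of _ 0] simp: sub_0)
  fix x y assume "x:?S" "y:?S"
  then obtain x' y' where "x':J.NN" "x':below deg2 (Suc k)" "lev deg2 k x' = lev deg2 k x"
   "y':J.NN" "y':below deg2 (Suc k)" "lev deg2 k y' = lev deg2 k y" by auto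
  hence "x' + y':J.NN & x' + y':below deg2 (Suc k) & lev deg2 k (x' + y') = lev deg2 k (x + y)"
   by (simp add: sub_add pl_add[OF pl_lev])
  thus "x + y:?S" by blast
 next
  fix c x assume "x:?S"
  then obtain x' where "x':J.NN" "x':below deg2 (Suc k)" "lev deg2 k x' = lev deg2 k x" by auto
  hence "pscale c x':J.NN & pscale c x':below deg2 (Suc k) & lev deg2 k (pscale c x') = lev deg2 k (pscale c x)"
   by (simp add: sub_scale pl_sc[OF pl_lev])
  thus "pscale c x:?S" by blast
 qed
 have bq: "ten x y:?S" if "!!p. p:qpaths Q ==> ten x (bas p):?S" "y:T" for x y
  by (rule pl_in_sub_sp[OF plin_ten_right' sub that(2,1)])
 have bq': "ten x y:?S" if "!!p. p:qpaths Q ==> ten (bas p) y:?S" "x:T" for x y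
  by (rule pl_in_sub_sp[OF pl_ten_l sub that(2,1)])
 have triv: "x:?S" if "lev deg2 k x = 0" for x
  using that by (auto intro!: bexI[of _ 0] simp: sub_0 pl_zr[OF pl_lev])
 have lb: "lev plen l (bas p) = (if plen p = l then bas p else 0)" for l and p :: "('v, 'e) qpath"
  by (rule pmI) (auto simp: lk_lev lk_bas)
 show "z:I.NN ==> EX z':J.NN. z':below deg2 (Suc k) & lev deg2 k z' = lev deg2 k z"
 proof -
  assume "z:I.NN"
  hence "z:?S"
  proof (rule I.NN_induct[OF _ sub])
   fix x y assume xy: "x:I.J" "y:T"
   show "ten x y:?S"
   proof (rule bq[OF _ xy(2)])
    fix p assume p: "p:qpaths Q"
    have l: "lev deg2 k (ten x (bas p)) = (if plen p \<le> k then ten (lev plen (k - plen p) x) (bas p) else 0)" for x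
    by (rule pmI) (auto simp: lk_lev lk_ten lk_bas deg2_def)
    show "ten x (bas p):?S"
    proof (cases "plen p \<le> k")
    case True
    obtain x' where x': "x':J.J" "x':below plen (Suc (k - plen p))" "lev plen (k - plen p) x' = lev plen (k - plen p) x"
    using I_lift[OF xy(1)] by blast
    have "ten x' (bas p):J.NN" using x' p by (intro J.ten_NN1) auto
    moreover have "ten x' (bas p):below deg2 (Suc k)"
    using ten_below[OF x'(2), of "bas p" "plen p"] True by (simp add: below_def)
    moreover have "lev deg2 k (ten x' (bas p)) = lev deg2 k (ten x (bas p))" using x' by (simp add: l)
    ultimately show ?thesis by blast
    next
    case False
    thus ?thesis by (intro triv) (simp add: l)
    qed
   qed
  next
   fix x y assume xy: "x:T" "y:I.J"
   show "ten x y:?S"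
   proof (rule bq'[OF _ xy(1)])
    fix p assume p: "p:qpaths Q"
    have l: "lev deg2 k (ten (bas p) x) = (if plen p \<le> k then ten (bas p) (lev plen (k - plen p) x) else 0)" for x
    by (rule pmI) (auto simp: lk_lev lk_ten lk_bas deg2_def)
    show "ten (bas p) y:?S"
    proof (cases "plen p \<le> k")
    case True
    obtain x' where x': "x':J.J" "x':below plen (Suc (k - plen p))" "lev plen (k - plen p) x' = lev plen (k - plen p) y"
    using I_lift[OF xy(2)] by blast
    have "ten (bas p) x':J.NN" using x' p by (intro J.ten_NN2) auto
    moreover have "ten (bas p) x':below deg2 (Suc k)"
    using ten_below[OF _ x'(2), of "bas p" "plen p"] True by (simp add: below_def)
    moreover have "lev deg2 k (ten (bas p) x') = lev deg2 k (ten (bas p) y)" using x' by (simp add: l)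
    ultimately show ?thesis by blast
    next
    case False
    thus ?thesis by (intro triv) (simp add: l)
    qed
   qed
  qed
  thus ?thesis by simp
 qed
qed

text \<open>Leading forms of deformed relations are relations of A, and these start in degree two.
  So below that degree a congruence modulo \<open>J.NN\<close> is an equality.\<close>

lemma NN_J_low: "z:J.NN ==> z:below deg2 2 ==> z = 0"
proof -
 assume z: "z:J.NN" "z:below deg2 2"
 have l: "lev deg2 k y = 0" if "lev deg2 k y:I.NN" "k < 2" for k y
 proof (rule pmI)
  fix b
  have "lk (lev deg2 k y) b = 0 | deg2 b \<ge> 2" using NN_low[OF that(1)] unfolding sp_in_i by blast
  thus "lk (lev deg2 k y) b = lk 0 b" using that(2) by (auto simp: lk_lev)
 qed
 have "z:below deg2 (Suc 0)" using below_step[of z deg2 "Suc 0"] l[OF NN_lead[OF z(1), of 1]] z(2) by (simp add: numeral_2_eq_2)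
 hence "z:below deg2 0" using below_step[of z deg2 0] l[OF NN_lead[OF z(1), of 0]] by simp
 thus ?thesis by simp
qed

sublocale NN: filtered_pair deg2 I.NN J.NN
 by unfold_locales (simp_all add: NN_graded NN_lead)

end

section \<open>The Koszul bimodules\<close>

lemma pcoeff_0 [simp]: "pcoeff 0 p q = 0" by (simp add: pcoeff_def split: option.splits)

lemma lk_ldel: "lk (ldel q x) t = pcoeff x q t"
proof -
 have inner: "(\<Sum>t'\<in>{t'. pcomp q t' = Some p}. lk (Poly_Mapping.single t' c) t) = (if pcomp q t = Some p then c else 0)" for p c
 proof (cases "EX t'. pcomp q t' = Some p")
  case True
  then obtain t' where t': "pcomp q t' = Some p" by blast
  hence "{t'. pcomp q t' = Some p} = {t'}" by (auto intro: pcomp_cancel_l)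
  thus ?thesis by (cases "t = t'") (auto simp: lookup_single)
 qed auto
 have "lk (ldel q x) t = (\<Sum>p\<in>ks x. if pcomp q t = Some p then lk x p else 0)"
  by (simp add: ldel_def lookup_sum inner)
 also have "... = pcoeff x q t"
  by (cases "pcomp q t") (auto simp: pcoeff_def in_keys_iff)
 finally show ?thesis .
qed

lemma lk_rdel: "lk (rdel q x) t = pcoeff x t q"
proof -
 have inner: "(\<Sum>t'\<in>{t'. pcomp t' q = Some p}. lk (Poly_Mapping.single t' c) t) = (if pcomp t q = Some p then c else 0)" for p c
 proof (cases "EX t'. pcomp t' q = Some p")
  case True
  then obtain t' where t': "pcomp t' q = Some p" by blast
  hence "{t'. pcomp t' q = Some p} = {t'}" by (auto intro: pcomp_cancel_r)
  thus ?thesis by (cases "t = t'") (auto simp: lookup_single)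
 qed auto
 have "lk (rdel q x) t = (\<Sum>p\<in>ks x. if pcomp t q = Some p then lk x p else 0)"
  by (simp add: rdel_def lookup_sum inner)
 also have "... = pcoeff x t q"
  by (cases "pcomp t q") (auto simp: pcoeff_def in_keys_iff)
 finally show ?thesis .
qed

lemma pc_add: "pcoeff (x + y) p q = pcoeff x p q + pcoeff y p q"
 and pc_sc: "pcoeff (pscale c x) p q = c * pcoeff x p q"
 by (simp_all add: pcoeff_def Poly_Mapping.lookup_add split: option.split)

lemma pl_ldel [simp]: "plin (ldel q)"
 by (rule plinI; rule pmI; simp add: lk_ldel Poly_Mapping.lookup_add pc_add pc_sc)

lemma pl_rdel [simp]: "plin (rdel q)"
 by (rule plinI; rule pmI; simp add: lk_rdel Poly_Mapping.lookup_add pc_add pc_sc)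

lemma ldel_zero [simp]: "ldel q 0 = 0" and rdel_zero [simp]: "rdel q 0 = 0"
 by (simp_all add: pl_zr)

lemma ldel_rdel: "ldel p (rdel q x) = rdel q (ldel p x)"
proof (rule pmI)
 fix t
 show "lk (ldel p (rdel q x)) t = lk (rdel q (ldel p x)) t"
  using pcomp_as[of p t q]
  by (cases "pcomp p t"; cases "pcomp t q") (simp_all add: lk_ldel lk_rdel pcoeff_def)
qed

lemma ldel_ldel: "pcomp p q = Some r ==> ldel q (ldel p x) = ldel r x"
proof (rule pmI)
 fix t assume "pcomp p q = Some r"
 thus "lk (ldel q (ldel p x)) t = lk (ldel r x) t"
  using pcomp_as[of p q t] by (cases "pcomp q t") (simp_all add: lk_ldel pcoeff_def)
qed

lemma rdel_rdel: "pcomp p q = Some r ==> rdel p (rdel q x) = rdel r x"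
proof (rule pmI)
 fix t assume "pcomp p q = Some r"
 thus "lk (rdel p (rdel q x)) t = lk (rdel r x) t"
  using pcomp_as[of t p q] by (cases "pcomp t p") (simp_all add: lk_rdel pcoeff_def)
qed

lemma lk_neq_pc: "lk (ldel q x) t ~= 0 ==> EX p. pcomp q t = Some p & lk x p ~= 0"
 "lk (rdel q x) t ~= 0 ==> EX p. pcomp t q = Some p & lk x p ~= 0"
 by (cases "pcomp q t"; simp add: lk_ldel pcoeff_def) (cases "pcomp t q"; simp add: lk_rdel pcoeff_def)

lemma ldel_bas: "pcomp q t = Some p ==> ldel q (bas p) = bas t"
proof (rule pmI)
 fix t' assume "pcomp q t = Some p"
 thus "lk (ldel q (bas p)) t' = lk (bas t) t'"
  using pcomp_cancel_l[of q t p t'] by (cases "pcomp q t'") (auto simp: lk_ldel pcoeff_def lk_bas)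
qed

lemma rdel_bas: "pcomp t q = Some p ==> rdel q (bas p) = bas t"
proof (rule pmI)
 fix t' assume "pcomp t q = Some p"
 thus "lk (rdel q (bas p)) t' = lk (bas t) t'"
  using pcomp_cancel_r[of t q p t'] by (cases "pcomp t' q") (auto simp: lk_rdel pcoeff_def lk_bas)
qed

lemma ldel_bas_0: "(!!t. pcomp q t ~= Some p) ==> ldel q (bas p) = 0"
proof (rule pmI)
 fix t' assume "!!t. pcomp q t ~= Some p"
 from this[of t'] show "lk (ldel q (bas p)) t' = lk 0 t'"
  by (cases "pcomp q t'") (auto simp: lk_ldel pcoeff_def lk_bas)
qed

lemma rdel_bas_0: "(!!t. pcomp t q ~= Some p) ==> rdel q (bas p) = 0"
proof (rule pmI)
 fix t' assume "!!t. pcomp t q ~= Some p"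
 from this[of t'] show "lk (rdel q (bas p)) t' = lk 0 t'"
  by (cases "pcomp t' q") (auto simp: lk_rdel pcoeff_def lk_bas)
qed

lemma Vpow_sub [simp]: "subsp (Vpow Q m)" by (simp add: Vpow_eq)

lemma tprod_plin:
 assumes z: "z:tprod Q X Y" and f: "plin f" and S: "subsp S" and m: "!!x y. x:X ==> y:Y ==> f (x *[path_alg Q] y):S"
 shows "f z:S"
proof -
 define U where "U = {z. f z:S}"
 have Ui: "x:U <-> f x:S" for x by (simp add: U_def)
 have U: "subsp U"
  by (rule pm.subspaceI)
    (simp_all add: Ui pl_zr[OF f] pl_add[OF f] pl_sc[OF f] sub_0[OF S] sub_add[OF S] sub_scale[OF S])
 have "w:U" if w0: "w:{x *[path_alg Q] y | x y. x:X & y:Y}" for w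
 proof -
  obtain x y where w: "w = x *[path_alg Q] y" "x:X" "y:Y" using w0 by blast
  show ?thesis unfolding Ui w(1) by (rule m[OF w(2,3)])
 qed
 hence "{x *[path_alg Q] y | x y. x:X & y:Y} <= U" by (rule subsetI)
 from span_min[OF this U] have "z:U" using z unfolding tprod_def by (rule subsetD)
 thus ?thesis by (simp only: Ui)
qed

lemma tprod_sub [simp]: "subsp (tprod Q X Y)" by (simp add: tprod_def)

context quiver
begin

lemma tprod_plin':
 assumes "z:tprod Q X Y" "plin f" "subsp S" "!!x y. x:X ==> y:Y ==> f (x *. y):S"
 shows "f z:S"
 by (rule tprod_plin[OF assms(1-3)]) (simp add: path_alg_eq assms(4))

lemma tprodI: "x:X ==> y:Y ==> x *. y:tprod Q X Y"
 unfolding tprod_def path_alg_eq basis_alg_s by (rule pm.span_base) blast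

lemma tprod3_pl:
 assumes "z:tprod Q (tprod Q X Y) Z" "plin f" "subsp S"
  "!!x y z. x:X ==> y:Y ==> z:Z ==> f (x *. y *. z):S"
 shows "f z:S"
proof (rule tprod_plin'[OF assms(1-3)])
 fix u w assume u: "u:tprod Q X Y" and w: "w:Z"
 show "f (u *. w):S"
  by (rule tprod_plin'[OF u pl_o[OF assms(2) pl_bm_l] assms(3)]) (use assms(4) w in auto)
qed

lemma Vpow_T: "Vpow Q m <= T" by (auto simp: Vpow_eq sp_in_def)

lemma Vpow_mult: "x:Vpow Q i ==> y:Vpow Q j ==> x *. y:Vpow Q (i + j)"
 unfolding Vpow_eq by (rule bm_sp) (auto simp: plen_pcomp intro: pcomp_in)

lemma Vpow_bas [simp]: "bas p:Vpow Q i <-> p:qpaths Q & plen p = i" by (simp add: Vpow_eq)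

lemma Vpow_lk: "x:Vpow Q i ==> lk x p ~= 0 ==> p:qpaths Q & plen p = i"
 by (auto simp: Vpow_eq sp_in_i)

lemma Vpow_i: "x:Vpow Q i <-> (ALL p. lk x p ~= 0 --> p:qpaths Q & plen p = i)"
 by (auto simp: Vpow_eq sp_in_i)

abbreviation ar where "ar \<equiv> arrow Q"
abbreviation ev where "ev v \<equiv> bas (triv v)"
abbreviation av where "av a \<equiv> bas (arrow Q a)"

lemma ldel_Vpow: "q:qpaths Q ==> x:Vpow Q (plen q + i) ==> ldel q x:Vpow Q i"
 unfolding Vpow_i
proof (intro allI impI)
 fix t assume a: "q:qpaths Q" "ALL p. lk x p ~= 0 --> p:qpaths Q & plen p = plen q + i" "lk (ldel q x) t ~= 0"
 then obtain p where "pcomp q t = Some p" "lk x p ~= 0" using lk_neq_pc by blast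
 thus "t:qpaths Q & plen t = i" using a pcomp_factor_r plen_pcomp by (metis add_left_cancel)
qed

lemma rdel_Vpow: "q:qpaths Q ==> x:Vpow Q (plen q + i) ==> rdel q x:Vpow Q i"
 unfolding Vpow_i
proof (intro allI impI)
 fix t assume a: "q:qpaths Q" "ALL p. lk x p ~= 0 --> p:qpaths Q & plen p = plen q + i" "lk (rdel q x) t ~= 0"
 then obtain p where "pcomp t q = Some p" "lk x p ~= 0" using lk_neq_pc by blast
 thus "t:qpaths Q & plen t = i" using a pcomp_factor_l plen_pcomp by (metis add.commute add_left_cancel)
qed

lemma ldel_arrow_Vpow: "a:arcs Q ==> x:Vpow Q (Suc i) ==> ldel (ar a) x:Vpow Q i"
 and rdel_arrow_Vpow: "a:arcs Q ==> x:Vpow Q (Suc i) ==> rdel (ar a) x:Vpow Q i"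
 using ldel_Vpow[of "ar a" x i] rdel_Vpow[of "ar a" x i] by simp_all

lemma ldel_av: "pcomp (ar b) q = Some p ==> ldel (ar a) (bas p) = (if a = b then bas q else 0)"
proof (cases "a = b")
 case False
 assume b: "pcomp (ar b) q = Some p"
 have "ldel (ar a) (bas p) = 0"
  by (rule ldel_bas_0) (use arrow_left_unique[OF _ b] False in blast)
 thus ?thesis using False by simp
qed (simp add: ldel_bas)

lemma rdel_av: "pcomp q (ar b) = Some p ==> rdel (ar a) (bas p) = (if a = b then bas q else 0)"
proof (cases "a = b")
 case False
 assume b: "pcomp q (ar b) = Some p"
 have "rdel (ar a) (bas p) = 0"
  by (rule rdel_bas_0) (use arrow_right_unique[OF _ b] False in blast)
 thus ?thesis using False by simp
qed (simp add: rdel_bas)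

lemma expand_l: "x:Vpow Q (Suc i) ==> x = (\<Sum>a\<in>arcs Q. av a *. ldel (ar a) x)"
proof (rule pl_eqI[OF pl_id])
 show "plin (%x. \<Sum>a\<in>arcs Q. av a *. ldel (ar a) x)"
  by (intro pl_sum_fun pl_bmulR pl_ldel)
 fix p assume "x:Vpow Q (Suc i)" "p:ks x"
 hence "p:qpaths Q" "plen p = Suc i" by (auto simp: Vpow_eq sp_in_def)
 then obtain b q where b: "b:arcs Q" "pcomp (ar b) q = Some p" by (rule split_last)
 have "av a *. ldel (ar a) (bas p) = (if a = b then bas p else 0)" for a
  using b(2) by (simp add: ldel_av[OF b(2)])
 thus "bas p = (\<Sum>a\<in>arcs Q. av a *. ldel (ar a) (bas p))" using b(1) by simp
qed

lemma expand_r: "x:Vpow Q (Suc i) ==> x = (\<Sum>a\<in>arcs Q. rdel (ar a) x *. av a)"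
proof (rule pl_eqI[OF pl_id])
 show "plin (%x. \<Sum>a\<in>arcs Q. rdel (ar a) x *. av a)"
  by (intro pl_sum_fun pl_bmulL pl_rdel)
 fix p assume "x:Vpow Q (Suc i)" "p:ks x"
 hence "p:qpaths Q" "plen p = Suc i" by (auto simp: Vpow_eq sp_in_def)
 then obtain b q where b: "b:arcs Q" "pcomp q (ar b) = Some p" by (rule split_first)
 have "rdel (ar a) (bas p) *. av a = (if a = b then bas p else 0)" for a
  using b(2) by (simp add: rdel_av[OF b(2)])
 thus "bas p = (\<Sum>a\<in>arcs Q. rdel (ar a) (bas p) *. av a)" using b(1) by simp
qed

lemma ldel_mult: "x:Vpow Q (Suc i) ==> ldel (ar a) (x *. y) = ldel (ar a) x *. y"
proof (rule bilin_eqI[of "%x y. ldel (ar a) (x *. y)" "%x y. ldel (ar a) x *. y"])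
 fix p q assume "x:Vpow Q (Suc i)" "p:ks x" "q:ks y"
 hence "p:qpaths Q" "plen p = Suc i" by (auto simp: Vpow_eq sp_in_def)
 then obtain b p' where b: "b:arcs Q" "pcomp (ar b) p' = Some p" by (rule split_last)
 show "ldel (ar a) (bas p *. bas q) = ldel (ar a) (bas p) *. bas q"
 proof (cases "pcomp p q")
  case None
  hence "pcomp p' q = None" using b(2) by (simp add: pcomp_None_i pcomp_ends)
  thus ?thesis using None by (simp add: ldel_av[OF b(2)])
 next
  case (Some r)
  then obtain s where s: "pcomp p' q = Some s" "pcomp (ar b) s = Some r" using pcomp_assoc1[OF b(2)] by blast
  show ?thesis
   using Some s(1) by (simp add: ldel_av[OF b(2)] ldel_av[OF s(2)])
 qed
qed (intro pl_o[OF pl_ldel] pl_bmulL pl_ldel pl_bm_l pl_bm_r)+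

lemma rdel_mult: "y:Vpow Q (Suc i) ==> rdel (ar a) (x *. y) = x *. rdel (ar a) y"
proof (rule bilin_eqI[of "%x y. rdel (ar a) (x *. y)" "%x y. x *. rdel (ar a) y"])
 fix p q assume "y:Vpow Q (Suc i)" "p:ks x" "q:ks y"
 hence "q:qpaths Q" "plen q = Suc i" by (auto simp: Vpow_eq sp_in_def)
 then obtain b q' where b: "b:arcs Q" "pcomp q' (ar b) = Some q" by (rule split_first)
 show "rdel (ar a) (bas p *. bas q) = bas p *. rdel (ar a) (bas q)"
 proof (cases "pcomp p q")
  case None
  hence "pcomp p q' = None" using b(2) by (simp add: pcomp_None_i pcomp_ends)
  thus ?thesis using None by (simp add: rdel_av[OF b(2)])
 next
  case (Some r)
  then obtain s where s: "pcomp p q' = Some s" "pcomp s (ar b) = Some r" using pcomp_assoc2[OF b(2)] by blast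
  show ?thesis
   using Some s(1) by (simp add: rdel_av[OF b(2)] rdel_av[OF s(2)])
 qed
qed (intro pl_o[OF pl_rdel] pl_bmulR pl_rdel pl_bm_l pl_bm_r)+

lemma lk_ev_l: "lk (ev v *. x) p = (if phead p = v then lk x p else 0)"
proof -
 have "ev v *. x = restr {p. phead p = v} x"
  by (rule pl_eqI[of "%x. ev v *. x"]) (auto simp: restr_bas pcomp_tr_l)
 thus ?thesis by (simp add: lk_restr)
qed

lemma lk_ev_r: "lk (x *. ev v) p = (if ptail p = v then lk x p else 0)"
proof -
 have "x *. ev v = restr {p. ptail p = v} x"
  by (rule pl_eqI[of "%x. x *. ev v"]) (auto simp: restr_bas pcomp_tr_r)
 thus ?thesis by (simp add: lk_restr)
qed

lemma ev_ev: "ev v *. ev w = (if v = w then ev v else 0)"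
 by (simp add: pcomp_tr_l)

lemma Vpow_0_expand: "s:Vpow Q 0 ==> s = (\<Sum>v\<in>verts Q. pscale (lk s (triv v)) (ev v))"
proof (rule pmI)
 fix p assume s: "s:Vpow Q 0"
 have sum: "lk (\<Sum>v\<in>verts Q. pscale (lk s (triv v)) (ev v)) p
   = (\<Sum>v\<in>verts Q. if v = phead p then (if p = triv (phead p) then lk s p else 0) else 0)"
  unfolding lookup_sum by (rule sum.cong) (auto simp: lk_bas)
 show "lk s p = lk (\<Sum>v\<in>verts Q. pscale (lk s (triv v)) (ev v)) p"
 proof (cases "lk s p = 0")
  case True thus ?thesis unfolding sum by simp
 next
  case False
  hence "p:qpaths Q" "plen p = 0" using Vpow_lk[OF s] by auto
  hence "p = triv (phead p)" "phead p:verts Q" using plen_0[of p] ends_in[of p] by auto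
  thus ?thesis unfolding sum by simp
 qed
qed

end

section \<open>The spaces K_i: deletions, contractions and bases\<close>

locale quadratic = quiver Q for Q :: "('v, 'e) pre_digraph" +
 fixes R :: "('v, 'e) qelem set"
 assumes R_bimod: "S_subbimodule Q R" and R_V2: "R <= Vpow Q 2"
begin

lemma R_sub: "subsp R" using R_bimod by (simp add: S_subbimodule_def)

lemma R_T: "R <= T" using R_V2 Vpow_T by blast

lemma R_bi: "s:Vpow Q 0 ==> t:Vpow Q 0 ==> r:R ==> s *. r *. t:R"
 using R_bimod by (simp add: S_subbimodule_def path_alg_eq)

lemma unit_V0: "unitT:Vpow Q 0" unfolding unitT_def by (rule sub_sum) simp_all

lemma R_l: "s:Vpow Q 0 ==> r:R ==> s *. r:R"
 using R_bi[of s unitT r] unit_V0 uT_r[of "s *. r"] T_mult[of s r] R_T Vpow_T[of 0] by (auto simp: subset_iff)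

lemma R_r: "s:Vpow Q 0 ==> r:R ==> r *. s:R"
 using R_bi[of unitT s r] unit_V0 uT_l[of r] R_T by auto

abbreviation K where "K \<equiv> Kos Q R"

lemma K_0: "K 0 = Vpow Q 0" and K_1: "K (Suc 0) = Vpow Q (Suc 0)" by (simp_all add: Kos_def)

lemma K_ge2: "i \<ge> 2 ==> k:K i <-> (ALL j l. j + 2 + l = i --> k:tprod Q (tprod Q (Vpow Q j) R) (Vpow Q l))"
 unfolding Kos_def by auto

lemma K_sub [simp]: "subsp (K i)"
proof -
 have "subsp (\<Inter>{tprod Q (tprod Q (Vpow Q j) R) (Vpow Q l) | j l. j + 2 + l = i})"
  by (rule pm.subspace_Inter) auto
 thus ?thesis unfolding Kos_def by simp
qed

lemma K_Vpow: "K i <= Vpow Q i"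
proof
 fix k assume k: "k:K i"
 show "k:Vpow Q i"
 proof (cases "i \<ge> 2")
  case True
  hence k: "k:tprod Q (tprod Q (Vpow Q 0) R) (Vpow Q (i - 2))" using k K_ge2 by simp
  show ?thesis
  proof (rule tprod3_pl[OF k pl_id Vpow_sub])
   fix x y z assume "x:Vpow Q 0" "y:R" "z:Vpow Q (i - 2)"
   hence "x *. y *. z:Vpow Q (0 + 2 + (i - 2))" using R_V2 by (intro Vpow_mult) auto
   moreover have "0 + 2 + (i - 2) = i" using True by simp
   ultimately show "x *. y *. z:Vpow Q i" by (simp only:)
  qed
 next
  case False
  hence "i = 0 | i = Suc 0" by auto
  thus ?thesis using k K_0 K_1 by auto
 qed
qed

lemma K_T: "K i <= T" using K_Vpow Vpow_T by blast

lemma K_2: "K 2 = R"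
proof (intro equalityI subsetI)
 fix k assume "k:K 2"
 hence k: "k:tprod Q (tprod Q (Vpow Q 0) R) (Vpow Q 0)" using K_ge2[of 2 k] by simp
 show "k:R" using tprod3_pl[OF k pl_id R_sub R_bi] by simp
next
 fix k assume k: "k:R"
 have "unitT *. k *. unitT:tprod Q (tprod Q (Vpow Q 0) R) (Vpow Q 0)"
  by (intro tprodI unit_V0 k)
 hence "k:tprod Q (tprod Q (Vpow Q 0) R) (Vpow Q 0)" using k R_T by (auto simp: uT_l uT_r)
 thus "k:K 2" using K_ge2[of 2 k] by auto
qed

lemma K_bi: "s:Vpow Q 0 ==> t:Vpow Q 0 ==> k:K i ==> s *. k *. t:K i"
proof (cases "i \<ge> 2")
 case True
 assume a: "s:Vpow Q 0" "t:Vpow Q 0" "k:K i"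
 show ?thesis unfolding K_ge2[OF True]
 proof (intro allI impI)
  fix j l assume "j + 2 + l = i"
  hence k: "k:tprod Q (tprod Q (Vpow Q j) R) (Vpow Q l)" using a(3) K_ge2[OF True] by blast
  show "s *. k *. t:tprod Q (tprod Q (Vpow Q j) R) (Vpow Q l)"
  proof (rule tprod3_pl[OF k pl_bmulL[OF pl_bm_r] tprod_sub])
   fix x y z assume "x:Vpow Q j" "y:R" "z:Vpow Q l"
   hence "(s *. x) *. y *. (z *. t):tprod Q (tprod Q (Vpow Q j) R) (Vpow Q l)"
    using Vpow_mult[OF a(1)] Vpow_mult[OF _ a(2)] by (intro tprodI) auto
   thus "s *. (x *. y *. z) *. t:tprod Q (tprod Q (Vpow Q j) R) (Vpow Q l)" by (simp only: tmul_as)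
  qed
 qed
next
 case False
 assume a: "s:Vpow Q 0" "t:Vpow Q 0" "k:K i"
 from False have "i = 0 | i = Suc 0" by auto
 thus ?thesis using a K_0 K_1 Vpow_mult[OF Vpow_mult[OF a(1), of k i] a(2)] by auto
qed

text \<open>Deleting the first letter shifts the position of the factor R by one, so every condition
  in the intersection for i comes from one for i + 1.\<close>

lemma ldel_K: "a:arcs Q ==> k:K (Suc i) ==> ldel (ar a) k:K i"
proof (cases "i \<ge> 2")
 case True
 assume a: "a:arcs Q" "k:K (Suc i)"
 show ?thesis unfolding K_ge2[OF True]
 proof (intro allI impI)
  fix j l assume "j + 2 + l = i"
  hence k: "k:tprod Q (tprod Q (Vpow Q (Suc j)) R) (Vpow Q l)" using a(2) K_ge2[of "Suc i" k] by auto
  show "ldel (ar a) k:tprod Q (tprod Q (Vpow Q j) R) (Vpow Q l)"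
  proof (rule tprod3_pl[OF k pl_ldel tprod_sub])
   fix x y z assume x: "x:Vpow Q (Suc j)" "y:R" "z:Vpow Q l"
   have "ldel (ar a) (x *. y *. z) = ldel (ar a) x *. y *. z" unfolding tmul_as by (rule ldel_mult[OF x(1)])
   thus "ldel (ar a) (x *. y *. z):tprod Q (tprod Q (Vpow Q j) R) (Vpow Q l)"
    using x ldel_arrow_Vpow[OF a(1) x(1)] by (auto intro!: tprodI)
  qed
 qed
next
 case False
 assume a: "a:arcs Q" "k:K (Suc i)"
 from False have "i = 0 | i = Suc 0" by auto
 thus ?thesis using ldel_arrow_Vpow[OF a(1), of k i] a(2) K_Vpow[of "Suc i"] K_0 K_1 by auto
qed

lemma rdel_K: "a:arcs Q ==> k:K (Suc i) ==> rdel (ar a) k:K i"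
proof (cases "i \<ge> 2")
 case True
 assume a: "a:arcs Q" "k:K (Suc i)"
 show ?thesis unfolding K_ge2[OF True]
 proof (intro allI impI)
  fix j l assume "j + 2 + l = i"
  hence k: "k:tprod Q (tprod Q (Vpow Q j) R) (Vpow Q (Suc l))" using a(2) K_ge2[of "Suc i" k] by auto
  show "rdel (ar a) k:tprod Q (tprod Q (Vpow Q j) R) (Vpow Q l)"
  proof (rule tprod3_pl[OF k pl_rdel tprod_sub])
   fix x y z assume x: "x:Vpow Q j" "y:R" "z:Vpow Q (Suc l)"
   have "rdel (ar a) (x *. y *. z) = x *. y *. rdel (ar a) z" by (rule rdel_mult[OF x(3)])
   thus "rdel (ar a) (x *. y *. z):tprod Q (tprod Q (Vpow Q j) R) (Vpow Q l)"
    using x rdel_arrow_Vpow[OF a(1) x(3)] by (auto intro!: tprodI)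
  qed
 qed
next
 case False
 assume a: "a:arcs Q" "k:K (Suc i)"
 from False have "i = 0 | i = Suc 0" by auto
 thus ?thesis using rdel_arrow_Vpow[OF a(1), of k i] a(2) K_Vpow[of "Suc i"] K_0 K_1 by auto
qed

text \<open>A factor R away from the left end is seen after deleting the first letter. One at the
  left end is seen after deleting the last letter, and i \<ge> 2 guarantees that there is a letter
  to its right.\<close>

lemma K_SucI:
 assumes "i \<ge> 2" "k:Vpow Q (Suc i)" "!!a. a:arcs Q ==> ldel (ar a) k:K i" "!!a. a:arcs Q ==> rdel (ar a) k:K i"
 shows "k:K (Suc i)"
proof -
 have "k:tprod Q (tprod Q (Vpow Q j) R) (Vpow Q l)" if jl: "j + 2 + l = Suc i" for j l
 proof (cases j)
  case (Suc j')
  have "av a *. ldel (ar a) k:tprod Q (tprod Q (Vpow Q j) R) (Vpow Q l)" if a: "a:arcs Q" for a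
  proof -
   have "ldel (ar a) k:tprod Q (tprod Q (Vpow Q j') R) (Vpow Q l)" using assms(3)[OF a] jl Suc K_ge2[OF assms(1)] by auto
   thus ?thesis
   proof (rule tprod3_pl[OF _ pl_bm_r tprod_sub])
    fix x y z assume x: "x:Vpow Q j'" "y:R" "z:Vpow Q l"
    have "av a:Vpow Q 1" using a by simp
    from Vpow_mult[OF this x(1)] have "av a *. x:Vpow Q j" by (simp add: Suc)
    hence "(av a *. x) *. y *. z:tprod Q (tprod Q (Vpow Q j) R) (Vpow Q l)" using x by (intro tprodI)
    thus "av a *. (x *. y *. z):tprod Q (tprod Q (Vpow Q j) R) (Vpow Q l)" by (simp only: tmul_as)
   qed
  qed
  thus ?thesis by (subst expand_l[OF assms(2)]) (intro sub_sum tprod_sub)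
 next
  case 0
  then obtain l' where l: "l = Suc l'" using jl assms(1) by (cases l) auto
  have "rdel (ar a) k *. av a:tprod Q (tprod Q (Vpow Q j) R) (Vpow Q l)" if a: "a:arcs Q" for a
  proof -
   have "rdel (ar a) k:tprod Q (tprod Q (Vpow Q j) R) (Vpow Q l')" using assms(4)[OF a] jl l K_ge2[OF assms(1)] by auto
   thus ?thesis
   proof (rule tprod3_pl[OF _ pl_bm_l tprod_sub])
    fix x y z assume x: "x:Vpow Q j" "y:R" "z:Vpow Q l'"
    have "av a:Vpow Q 1" using a by simp
    from Vpow_mult[OF x(3) this] have "z *. av a:Vpow Q l" by (simp add: l)
    hence "x *. y *. (z *. av a):tprod Q (tprod Q (Vpow Q j) R) (Vpow Q l)" using x by (intro tprodI)
    thus "x *. y *. z *. av a:tprod Q (tprod Q (Vpow Q j) R) (Vpow Q l)" by (simp only: tmul_as)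
   qed
  qed
  thus ?thesis by (subst expand_r[OF assms(2)]) (intro sub_sum tprod_sub)
 qed
 thus ?thesis using K_ge2[of "Suc i" k] assms(1) by auto
qed

text \<open>The element lies in R tensor a power of V, so contracting all but its first two letters
  with a functional leaves a relation. The functional may fail to respect S; on a product r y the
  result is a combination of the elements r e_v, which still lie in R.\<close>

lemma contract_right:
 assumes k: "k:K (Suc (Suc i))"
 shows "(\<Sum>a\<in>arcs Q. \<Sum>b\<in>arcs Q. pscale (pairing g (ldel (ar b) (ldel (ar a) k))) (av a *. av b)):R"
proof -
 let ?f = "%k. \<Sum>a\<in>arcs Q. \<Sum>b\<in>arcs Q. pscale (pairing g (ldel (ar b) (ldel (ar a) k))) (av a *. av b)"
 have "k:tprod Q (tprod Q (Vpow Q 0) R) (Vpow Q i)" using k K_ge2[of "Suc (Suc i)" k] by auto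
 thus ?thesis
 proof (rule tprod3_pl[of _ _ _ _ ?f])
  show "plin ?f" by (intro pl_sum_fun pl_pr pl_o[OF pl_ldel] pl_ldel)
  fix s r y assume a: "s:Vpow Q 0" "r:R" "y:Vpow Q i"
  define r' where "r' = s *. r"
  have r': "r':R" unfolding r'_def by (rule R_l[OF a(1,2)])
  hence r2: "r':Vpow Q (Suc (Suc 0))" using R_V2 by (auto simp: numeral_2_eq_2)
  define c where "c = (%a b. ldel (ar b) (ldel (ar a) r'))"
  have c0: "c a b:Vpow Q 0" if "a:arcs Q" "b:arcs Q" for a b
   unfolding c_def by (intro ldel_arrow_Vpow that r2)
  have l: "ldel (ar b) (ldel (ar a) (r' *. y)) = c a b *. y" if "a:arcs Q" "b:arcs Q" for a b
   unfolding c_def by (simp add: ldel_mult[OF r2] ldel_mult[OF ldel_arrow_Vpow[OF that(1) r2]])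
  have p: "pairing g (c a b *. y) = (\<Sum>v\<in>verts Q. lk (c a b) (triv v) * pairing g (ev v *. y))"
   if "a:arcs Q" "b:arcs Q" for a b
   by (subst Vpow_0_expand[OF c0[OF that]]) (simp add: bm_sum_l bm_sc_l pr_sum pr_sc)
  have rv: "r' *. ev v = (\<Sum>a\<in>arcs Q. \<Sum>b\<in>arcs Q. pscale (lk (c a b) (triv v)) (av a *. av b))" for v
  proof -
   have "r' = (\<Sum>a\<in>arcs Q. av a *. (\<Sum>b\<in>arcs Q. av b *. c a b))"
    unfolding c_def by (subst expand_l[OF r2], rule sum.cong[OF refl], subst expand_l[OF ldel_arrow_Vpow[OF _ r2]]) auto
   hence "r' *. ev v = (\<Sum>a\<in>arcs Q. \<Sum>b\<in>arcs Q. av a *. av b *. (c a b *. ev v))"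
    by (simp add: bm_sum_l bm_sum_r tmul_as del: bm_bas)
   also have "... = (\<Sum>a\<in>arcs Q. \<Sum>b\<in>arcs Q. pscale (lk (c a b) (triv v)) (av a *. av b))"
   proof (intro sum.cong refl)
    fix a b assume ab: "a:arcs Q" "b:arcs Q"
    have ce: "c a b *. ev v = pscale (lk (c a b) (triv v)) (ev v)"
    proof (rule pmI)
    fix p
    show "lk (c a b *. ev v) p = lk (pscale (lk (c a b) (triv v)) (ev v)) p"
    using Vpow_lk[OF c0[OF ab], of p] plen_0[of p]
    by (cases "lk (c a b) p = 0") (auto simp: lk_ev_r lk_bas)
    qed
    show "av a *. av b *. (c a b *. ev v) = pscale (lk (c a b) (triv v)) (av a *. av b)"
    proof (cases "lk (c a b) (triv v) = 0")
    case False
    then obtain p where "pcomp (ar b) (triv v) = Some p" using lk_neq_pc(1) unfolding c_def by blast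
    hence "tail Q b = v" by (simp add: pcomp_tr_r split: if_splits)
    hence "av b *. ev v = av b" by (simp add: pcomp_tr_r)
    thus ?thesis unfolding ce bm_sc_r tmul_as by simp
    qed (simp add: ce)
   qed
   finally show ?thesis .
  qed
  have "?f (s *. r *. y) = (\<Sum>a\<in>arcs Q. \<Sum>b\<in>arcs Q. \<Sum>v\<in>verts Q.
    pscale (pairing g (ev v *. y)) (pscale (lk (c a b) (triv v)) (av a *. av b)))"
   unfolding r'_def[symmetric] by (intro sum.cong refl) (simp add: l p pm.scale_sum_left mult.commute)
  also have "... = (\<Sum>a\<in>arcs Q. \<Sum>v\<in>verts Q. \<Sum>b\<in>arcs Q.
    pscale (pairing g (ev v *. y)) (pscale (lk (c a b) (triv v)) (av a *. av b)))"
   by (intro sum.cong refl, rule sum.swap)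
  also have "... = (\<Sum>v\<in>verts Q. pscale (pairing g (ev v *. y)) (r' *. ev v))"
   by (subst sum.swap) (simp only: rv sc_sum)
  also have "... : R" using r' by (intro sub_sum R_sub sub_scale R_r) simp_all
  finally show "?f (s *. r *. y):R" .
 qed (rule R_sub)
qed

lemma contract_left:
 assumes k: "k:K (Suc (Suc i))"
 shows "(\<Sum>a\<in>arcs Q. \<Sum>b\<in>arcs Q. pscale (pairing g (rdel (ar b) (rdel (ar a) k))) (av b *. av a)):R"
proof -
 let ?f = "%k. \<Sum>a\<in>arcs Q. \<Sum>b\<in>arcs Q. pscale (pairing g (rdel (ar b) (rdel (ar a) k))) (av b *. av a)"
 have "k:tprod Q (tprod Q (Vpow Q i) R) (Vpow Q 0)" using k K_ge2[of "Suc (Suc i)" k] by auto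
 thus ?thesis
 proof (rule tprod3_pl[of _ _ _ _ ?f])
  show "plin ?f" by (intro pl_sum_fun pl_pr pl_o[OF pl_rdel] pl_rdel)
  fix y r s assume a: "y:Vpow Q i" "r:R" "s:Vpow Q 0"
  define r' where "r' = r *. s"
  have r': "r':R" unfolding r'_def by (rule R_r[OF a(3,2)])
  hence r2: "r':Vpow Q (Suc (Suc 0))" using R_V2 by (auto simp: numeral_2_eq_2)
  define c where "c = (%a b. rdel (ar b) (rdel (ar a) r'))"
  have c0: "c a b:Vpow Q 0" if "a:arcs Q" "b:arcs Q" for a b
   unfolding c_def by (intro rdel_arrow_Vpow that r2)
  have l: "rdel (ar b) (rdel (ar a) (y *. r')) = y *. c a b" if "a:arcs Q" "b:arcs Q" for a b
   unfolding c_def by (simp add: rdel_mult[OF r2] rdel_mult[OF rdel_arrow_Vpow[OF that(1) r2]])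
  have p: "pairing g (y *. c a b) = (\<Sum>v\<in>verts Q. lk (c a b) (triv v) * pairing g (y *. ev v))"
   if "a:arcs Q" "b:arcs Q" for a b
   by (subst Vpow_0_expand[OF c0[OF that]]) (simp add: bm_sum_r bm_sc_r pr_sum pr_sc)
  have rv: "ev v *. r' = (\<Sum>a\<in>arcs Q. \<Sum>b\<in>arcs Q. pscale (lk (c a b) (triv v)) (av b *. av a))" for v
  proof -
   have "r' = (\<Sum>a\<in>arcs Q. (\<Sum>b\<in>arcs Q. c a b *. av b) *. av a)"
    unfolding c_def by (subst expand_r[OF r2], rule sum.cong[OF refl], subst expand_r[OF rdel_arrow_Vpow[OF _ r2]]) auto
   hence "ev v *. r' = (\<Sum>a\<in>arcs Q. \<Sum>b\<in>arcs Q. (ev v *. c a b) *. (av b *. av a))"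
    by (simp add: bm_sum_l bm_sum_r tmul_as)
   also have "... = (\<Sum>a\<in>arcs Q. \<Sum>b\<in>arcs Q. pscale (lk (c a b) (triv v)) (av b *. av a))"
   proof (intro sum.cong refl)
    fix a b assume ab: "a:arcs Q" "b:arcs Q"
    have ce: "ev v *. c a b = pscale (lk (c a b) (triv v)) (ev v)"
    proof (rule pmI)
    fix p
    show "lk (ev v *. c a b) p = lk (pscale (lk (c a b) (triv v)) (ev v)) p"
    using Vpow_lk[OF c0[OF ab], of p] plen_0[of p]
    by (cases "lk (c a b) p = 0") (auto simp: lk_ev_l lk_bas)
    qed
    show "(ev v *. c a b) *. (av b *. av a) = pscale (lk (c a b) (triv v)) (av b *. av a)"
    proof (cases "lk (c a b) (triv v) = 0")
    case False
    then obtain p where "pcomp (triv v) (ar b) = Some p" using lk_neq_pc(2) unfolding c_def by blast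
    hence "head Q b = v" by (simp add: pcomp_tr_l split: if_splits)
    hence "ev v *. av b = av b" by (simp add: pcomp_tr_l)
    thus ?thesis unfolding ce bm_sc_l tmul_as[symmetric] by simp
    qed (simp add: ce)
   qed
   finally show ?thesis .
  qed
  have "?f (y *. r *. s) = (\<Sum>a\<in>arcs Q. \<Sum>b\<in>arcs Q. \<Sum>v\<in>verts Q.
    pscale (pairing g (y *. ev v)) (pscale (lk (c a b) (triv v)) (av b *. av a)))"
   unfolding tmul_as[of y r s] r'_def[symmetric] by (intro sum.cong refl) (simp add: l p pm.scale_sum_left mult.commute)
  also have "... = (\<Sum>a\<in>arcs Q. \<Sum>v\<in>verts Q. \<Sum>b\<in>arcs Q.
    pscale (pairing g (y *. ev v)) (pscale (lk (c a b) (triv v)) (av b *. av a)))"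
   by (intro sum.cong refl, rule sum.swap)
  also have "... = (\<Sum>v\<in>verts Q. pscale (pairing g (y *. ev v)) (ev v *. r'))"
   by (subst sum.swap) (simp only: rv sc_sum)
  also have "... : R" using r' by (intro sub_sum R_sub sub_scale R_l) simp_all
  finally show "?f (y *. r *. s):R" .
 qed (rule R_sub)
qed

text \<open>The elements e_v k e_w span K_i, and an independent set of them is finite since there
  are finitely many paths of each length. Uniform ends make A tensor K_i tensor A a sum of pieces A
  e_h tensor e_t A, hence projective.\<close>

lemma homogeneous_basis:
 obtains m :: nat and kb :: "nat => ('v, 'e) qelem" and kp :: "nat => ('v, 'e) qpath => complex" and hd tl :: "nat => 'v"
 where "!!j. j < m ==> kb j:K i"
  "!!j p. j < m ==> lk (kb j) p ~= 0 ==> phead p = hd j & ptail p = tl j"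
  "!!j. j < m ==> hd j:verts Q & tl j:verts Q"
  "!!j p. j < m ==> kp j p ~= 0 ==> phead p = hd j & ptail p = tl j"
  "!!j j'. j < m ==> j' < m ==> pairing (kp j) (kb j') = (if j = j' then 1 else 0)"
  "!!k. k:K i ==> k = (\<Sum>j<m. pscale (pairing (kp j) k) (kb j))"
proof -
 interpret vf: vector_space_pair "pscale :: complex => ('v, 'e) qelem => _" "(*) :: complex => complex => complex"
  by unfold_locales (simp_all add: algebra_simps)
 define X where "X = {ev v *. k *. ev w | v w k. v:verts Q & w:verts Q & k:K i}"
 have XK: "X <= K i" by (auto simp: X_def intro!: K_bi)
 obtain B where B: "B <= X" "pm.independent B" "X <= pm.span B" using pm.maximal_independent_subset[of X] by blast
 have "B <= pm.span (bas ` {p:qpaths Q. plen p = i})"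
  using B(1) XK K_Vpow[of i] sp_in_span unfolding Vpow_eq by blast
 hence finB: "finite B" using pm.independent_span_bound[OF _ B(2)] finite_paths[of i] by blast
 define m where "m = card B"
 obtain kb where kb: "bij_betw kb {..<m} B" using ex_bij_betw_nat_finite[OF finB] by (auto simp: m_def atLeast0LessThan)
 have kbB: "kb j:B" if "j < m" for j using kb that by (auto simp: bij_betw_def)
 have "EX v w. v:verts Q & w:verts Q & (EX k. kb j = ev v *. k *. ev w)" if "j < m" for j
  using kbB[OF that] B(1) unfolding X_def by blast
 then obtain hd tl where ht: "!!j. j < m ==> hd j:verts Q & tl j:verts Q & (EX k. kb j = ev (hd j) *. k *. ev (tl j))" by metis
 have supp: "phead p = hd j & ptail p = tl j" if "j < m" "lk (kb j) p ~= 0" for j p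
  using ht[OF that(1)] that(2) by (auto simp: lk_ev_r lk_ev_l split: if_splits)
 have "EX fi. Vector_Spaces.linear pscale (*) fi & (ALL x:B. fi x = (if x = b then 1 else 0 :: complex))" for b
  using vf.linear_independent_extend[OF B(2), of "%x. if x = b then 1 else 0"] by blast
 then obtain fi where phi: "!!b. Vector_Spaces.linear pscale (*) (fi b)" "!!b x. x:B ==> fi b x = (if x = b then 1 else 0 :: complex)" by metis
 \<comment> \<open>The dual functional is cut down to the paths with the ends of the j-th basis
   element. All basis elements have uniform ends, so duality is preserved.\<close>
 define kp where "kp = (%j p. if phead p = hd j & ptail p = tl j then fi (kb j) (bas p) else 0)"
 have pk: "pairing (kp j) x = fi (kb j) (ev (hd j) *. x *. ev (tl j))" for j x
 proof -
  have lin: "fi b (x + y) = fi b x + fi b y" "fi b (pscale c x) = c * fi b x" for b x y c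
   using phi(1) by (auto simp: vf.linear_add vf.linear_scale)
  have "fi (kb j) (ev (hd j) *. x *. ev (tl j)) = pairing (%p. fi (kb j) (ev (hd j) *. bas p *. ev (tl j))) x"
   by (rule functional_pr) (simp_all add: bm_add_r bm_add_l bm_sc_r bm_sc_l lin)
  also have "(%p. fi (kb j) (ev (hd j) *. bas p *. ev (tl j))) = kp j"
   using lin(2)[of "kb j" 0 0] by (auto simp: kp_def pcomp_tr_l pcomp_tr_r)
  finally show ?thesis by simp
 qed
 have dual: "pairing (kp j) (kb j') = (if j = j' then 1 else 0)" if j: "j < m" "j' < m" for j j'
 proof -
  have e: "ev (hd j) *. kb j' *. ev (tl j) = (if hd j = hd j' & tl j = tl j' then kb j' else 0)"
  proof (rule pmI)
   fix p
   show "lk (ev (hd j) *. kb j' *. ev (tl j)) p = lk (if hd j = hd j' & tl j = tl j' then kb j' else 0) p"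
    using supp[OF j(2), of p] by (cases "lk (kb j') p = 0") (auto simp: lk_ev_l lk_ev_r)
  qed
  have z: "fi b 0 = 0" for b using phi(1) by (simp add: vf.linear_0)
  have inj: "kb j' = kb j <-> j = j'" using kb j by (auto simp: bij_betw_def inj_on_def)
  show ?thesis unfolding pk e using phi(2)[OF kbB[OF j(2)], of "kb j"] inj z by auto
 qed
 have exp: "k = (\<Sum>j<m. pscale (pairing (kp j) k) (kb j))" if k: "k:K i" for k
 proof -
  have "k = unitT *. k *. unitT" using k K_T[of i] by (simp add: uT_l uT_r subset_iff)
  also have "... = (\<Sum>w\<in>verts Q. \<Sum>v\<in>verts Q. ev v *. k *. ev w)" by (simp add: unitT_def bm_sum_l bm_sum_r)
  also have "... : pm.span X" using k by (intro pm.span_sum pm.span_base) (auto simp: X_def)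
  also have "pm.span X <= pm.span B" by (rule span_min[OF B(3)]) simp
  finally have kB: "k:pm.span B" .
  let ?S = "{k. k = (\<Sum>j<m. pscale (pairing (kp j) k) (kb j))}"
  have "pm.span B <= ?S"
  proof (rule span_min)
   show "B <= ?S"
   proof
    fix b assume "b:B"
    then obtain j' where j': "j' < m" "b = kb j'" using kb by (auto simp: bij_betw_def)
    have "(\<Sum>j<m. pscale (pairing (kp j) (kb j')) (kb j)) = (\<Sum>j<m. if j = j' then kb j' else 0)"
    using dual[OF _ j'(1)] by (intro sum.cong) auto
    thus "b:?S" using j' by simp
   qed
   show "subsp ?S"
   proof -
    define F where "F = (%k. \<Sum>j<m. pscale (pairing (kp j) k) (kb j))"
    have F: "plin F" unfolding F_def by (intro pl_sum_fun pl_pr pl_id)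
    have "subsp {k. k = F k}"
    unfolding sub_def mem_Collect_eq pl_zr[OF F] pl_add[OF F] pl_sc[OF F] by auto
    thus ?thesis by (simp add: F_def)
   qed
  qed
  thus ?thesis using kB by blast
 qed
 show ?thesis
 proof (rule that[of m kb hd tl kp])
  show "kb j:K i" if "j < m" for j using kbB[OF that] B(1) XK by blast
  show "phead p = hd j & ptail p = tl j" if "j < m" "kp j p ~= 0" for j p using that by (auto simp: kp_def split: if_splits)
 qed (use supp ht dual exp in auto)
qed

end

section \<open>The differential of the Koszul complex\<close>

lemma pr_nz: "pairing g x ~= 0 ==> EX p. lk x p ~= 0 & g p ~= 0"
proof (rule ccontr)
 assume a: "pairing g x ~= 0" "\<not> (EX p. lk x p ~= 0 & g p ~= 0)"
 have "pairing g x = (\<Sum>b\<in>ks x. 0)"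
  unfolding pairing_def by (rule sum.cong) (use a(2) in auto)
 thus False using a(1) by simp
qed

locale koszul_data = quadratic Q R for Q :: "('v, 'e) pre_digraph" and R :: "('v, 'e) qelem set" +
 fixes m :: "nat => nat" and kb :: "nat => nat => ('v, 'e) qelem" and kp :: "nat => nat => ('v, 'e) qpath => complex"
  and hd tl :: "nat => nat => 'v"
 assumes kb_K: "j < m i ==> kb i j:K i"
  and kb_ends: "j < m i ==> lk (kb i j) p ~= 0 ==> phead p = hd i j & ptail p = tl i j"
  and ht_verts: "j < m i ==> hd i j:verts Q & tl i j:verts Q"
  and kap_ends: "j < m i ==> kp i j p ~= 0 ==> phead p = hd i j & ptail p = tl i j"
  and dual: "j < m i ==> j' < m i ==> pairing (kp i j) (kb i j') = (if j = j' then 1 else 0)"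
  and expand: "k:K i ==> k = (\<Sum>j<m i. pscale (pairing (kp i j) k) (kb i j))"
begin


text \<open>An idempotent of the enveloping algebra; the left ideal it generates is the summand A
  e_h tensor e_t A that belongs to the j-th basis element of K_i.\<close>

definition EE where "EE i j = (bas (triv (hd i j), triv (tl i j)) :: ('v, 'e) qpath \<times> ('v, 'e) qpath \<Rightarrow>\<^sub>0 complex)"

lemma EE_ten: "EE i j = ten (ev (hd i j)) (ev (tl i j))" by (simp add: EE_def)

lemma EE_Te [simp]: "j < m i ==> EE i j:Te" by (simp add: EE_def ht_verts)

lemma EE_idem [simp]: "EE i j ** EE i j = EE i j" by (simp add: EE_ten ten_emul ev_ev del: bm_bas ten_bas)

text \<open>Coordinates of what is left when a letter is split off on the left or on the right;
  \<open>cR\<close> includes the sign that d_r carries in degree \<open>Suc i\<close>.\<close>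

definition cL where "cL i j a x = pairing (kp i j) (ldel (ar a) x)"
definition cR where "cR i j a x = (- 1) ^ Suc i * pairing (kp i j) (rdel (ar a) x)"

text \<open>The matrix of the Koszul differential from degree \<open>Suc i\<close> to degree
  \<open>i\<close>. Its entries are homogeneous of degree one and live in CQ tensor CQ, where they
  make sense for A and for the deformation.\<close>

definition MM where "MM i j j' = (\<Sum>a\<in>arcs Q. pscale (cL i j' a (kb (Suc i) j)) (ten (av a) (ev (tl (Suc i) j)))
  + pscale (cR i j' a (kb (Suc i) j)) (ten (ev (hd (Suc i) j)) (av a)))"

text \<open>The same entry with units in place of idempotents. This makes it linear in x, so that
  sums over a basis can be evaluated by \<open>nm_expand\<close>; multiplication by
  \<open>EE\<close> restores \<open>MM\<close>.\<close>

definition nm where "nm i j' x = (\<Sum>a\<in>arcs Q. pscale (cL i j' a x) (ten (av a) unitT) + pscale (cR i j' a x) (ten unitT (av a)))"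

lemma pl_nm [simp]: "plin (nm i j)"
proof -
 have "plin (%x. pscale (cR i j a x) v)" for a v
 proof -
  have "plin (%x. pscale ((- 1) ^ Suc i) (pscale (pairing (kp i j) (rdel (ar a) x)) v))"
   by (intro pl_pscale pl_pr pl_rdel)
  thus ?thesis by (simp add: cR_def)
 qed
 hence "plin (%x. \<Sum>a\<in>arcs Q. pscale (cL i j a x) (ten (av a) unitT) + pscale (cR i j a x) (ten unitT (av a)))"
  unfolding cL_def by (intro pl_sum_fun pl_plus pl_pr pl_ldel)
 thus ?thesis unfolding nm_def by simp
qed

lemma cL_nz:
 assumes "j < m (Suc i)" "j' < m i" "cL i j' a (kb (Suc i) j) ~= 0"
 shows "head Q a = hd (Suc i) j" "tail Q a = hd i j'" "tl i j' = tl (Suc i) j"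
proof -
 obtain p where p: "lk (ldel (ar a) (kb (Suc i) j)) p ~= 0" "kp i j' p ~= 0"
  using pr_nz assms(3) unfolding cL_def by blast
 obtain r where r: "pcomp (ar a) p = Some r" "lk (kb (Suc i) j) r ~= 0"
  using lk_neq_pc(1)[OF p(1)] by blast
 show "head Q a = hd (Suc i) j" "tail Q a = hd i j'" "tl i j' = tl (Suc i) j"
  using pcomp_ends[OF r(1)] kb_ends[OF assms(1) r(2)] kap_ends[OF assms(2) p(2)] by auto
qed

lemma cR_nz:
 assumes "j < m (Suc i)" "j' < m i" "cR i j' a (kb (Suc i) j) ~= 0"
 shows "tail Q a = tl (Suc i) j" "head Q a = tl i j'" "hd i j' = hd (Suc i) j"
proof -
 have "pairing (kp i j') (rdel (ar a) (kb (Suc i) j)) ~= 0" using assms(3) by (simp add: cR_def)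
 then obtain p where p: "lk (rdel (ar a) (kb (Suc i) j)) p ~= 0" "kp i j' p ~= 0"
  using pr_nz by blast
 obtain r where r: "pcomp p (ar a) = Some r" "lk (kb (Suc i) j) r ~= 0"
  using lk_neq_pc(2)[OF p(1)] by blast
 show "tail Q a = tl (Suc i) j" "head Q a = tl i j'" "hd i j' = hd (Suc i) j"
  using pcomp_ends[OF r(1)] kb_ends[OF assms(1) r(2)] kap_ends[OF assms(2) p(2)] by auto
qed

lemma ev_av: "ev v *. av a = (if head Q a = v then av a else 0)" "av a *. ev v = (if tail Q a = v then av a else 0)"
 by (simp_all add: pcomp_tr_l pcomp_tr_r)

lemma EE_nm:
 assumes "j < m (Suc i)" "j' < m i"
 shows "EE (Suc i) j ** nm i j' (kb (Suc i) j) = MM i j j'"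
 unfolding nm_def MM_def bm_sum_r
proof (rule sum.cong[OF refl])
 fix a
 have u: "unitT *. ev v = ev v" "ev v *. unitT = ev v" if "v:verts Q" for v
  using that by (simp_all add: uT_l uT_r)
 have "EE (Suc i) j ** (pscale (cL i j' a (kb (Suc i) j)) (ten (av a) unitT)) = pscale (cL i j' a (kb (Suc i) j)) (ten (av a) (ev (tl (Suc i) j)))"
  using cL_nz[OF assms, of a] ht_verts[OF assms(1)]
  by (cases "cL i j' a (kb (Suc i) j) = 0") (simp_all add: bm_sc_r EE_ten ten_emul ev_av u del: bm_bas ten_bas)
 moreover have "EE (Suc i) j ** (pscale (cR i j' a (kb (Suc i) j)) (ten unitT (av a))) = pscale (cR i j' a (kb (Suc i) j)) (ten (ev (hd (Suc i) j)) (av a))"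
  using cR_nz[OF assms, of a] ht_verts[OF assms(1)]
  by (cases "cR i j' a (kb (Suc i) j) = 0") (simp_all add: bm_sc_r EE_ten ten_emul ev_av u del: bm_bas ten_bas)
 ultimately show "EE (Suc i) j ** (pscale (cL i j' a (kb (Suc i) j)) (ten (av a) unitT) + pscale (cR i j' a (kb (Suc i) j)) (ten unitT (av a)))
   = pscale (cL i j' a (kb (Suc i) j)) (ten (av a) (ev (tl (Suc i) j))) + pscale (cR i j' a (kb (Suc i) j)) (ten (ev (hd (Suc i) j)) (av a))"
  by (simp only: bm_add_r)
qed

lemma EE_MM:
 assumes "j < m (Suc i)" "j' < m i"
 shows "EE (Suc i) j ** MM i j j' = MM i j j'"
 by (simp add: EE_nm[OF assms, symmetric] emul_as[symmetric])

lemma MM_EE: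
 assumes "j < m (Suc i)" "j' < m i"
 shows "MM i j j' ** EE i j' = MM i j j'"
 unfolding MM_def bm_sum_l
proof (rule sum.cong[OF refl])
 fix a
 have "pscale (cL i j' a (kb (Suc i) j)) (ten (av a) (ev (tl (Suc i) j))) ** EE i j' = pscale (cL i j' a (kb (Suc i) j)) (ten (av a) (ev (tl (Suc i) j)))"
  using cL_nz[OF assms, of a]
  by (cases "cL i j' a (kb (Suc i) j) = 0") (simp_all add: bm_sc_l EE_ten ten_emul ev_av ev_ev del: bm_bas ten_bas)
 moreover have "pscale (cR i j' a (kb (Suc i) j)) (ten (ev (hd (Suc i) j)) (av a)) ** EE i j' = pscale (cR i j' a (kb (Suc i) j)) (ten (ev (hd (Suc i) j)) (av a))"
  using cR_nz[OF assms, of a]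
  by (cases "cR i j' a (kb (Suc i) j) = 0") (simp_all add: bm_sc_l EE_ten ten_emul ev_av ev_ev del: bm_bas ten_bas)
 ultimately show "(pscale (cL i j' a (kb (Suc i) j)) (ten (av a) (ev (tl (Suc i) j))) + pscale (cR i j' a (kb (Suc i) j)) (ten (ev (hd (Suc i) j)) (av a))) ** EE i j'
   = pscale (cL i j' a (kb (Suc i) j)) (ten (av a) (ev (tl (Suc i) j))) + pscale (cR i j' a (kb (Suc i) j)) (ten (ev (hd (Suc i) j)) (av a))"
  by (simp only: bm_add_l)
qed

lemma MM_Te: "j < m (Suc i) ==> MM i j j':Te"
 unfolding MM_def by (intro sub_sum sub_add sub_scale sub_sp_in) (simp_all add: ht_verts)

lemma MM_deg: "MM i j j':sp_in {x. deg2 x = 1}"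
 unfolding MM_def by (intro sub_sum sub_add sub_scale sub_sp_in) (simp_all add: deg2_def)

lemma lk_MM_l:
 assumes "a:arcs Q"
 shows "lk (MM i j j') (ar a, triv t) = (if tl (Suc i) j = t then cL i j' a (kb (Suc i) j) else 0)"
proof -
 have i1: "triv x = triv y <-> x = y" for x y :: 'v by (simp add: triv_def)
 have i2: "ar x = ar y <-> x = y" for x y by (auto simp: arrow_def)
 have i3: "triv x ~= ar y" for x y by (simp add: triv_def arrow_def)
 have "lk (MM i j j') (ar a, triv t)
   = (\<Sum>b\<in>arcs Q. if b = a then (if tl (Suc i) j = t then cL i j' a (kb (Suc i) j) else 0) else 0)"
  unfolding MM_def lookup_sum by (rule sum.cong) (auto simp: Poly_Mapping.lookup_add lk_bas i1 i2 i3)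
 thus ?thesis using assms by simp
qed

text \<open>An element of positive length is recovered from its left deletions; these lie in K_i and
  are determined by their coordinates.\<close>

lemma K_zeroI:
 assumes "x:K (Suc i)" "!!a j. a:arcs Q ==> j < m i ==> cL i j a x = 0"
 shows "x = 0"
proof -
 have "ldel (ar a) x = 0" if "a:arcs Q" for a
  using expand[OF ldel_K[OF that assms(1)]] assms(2)[OF that] unfolding cL_def by simp
 thus ?thesis using expand_l[of x i] assms(1) K_Vpow[of "Suc i"] by auto
qed

lemma nm_expand:
 assumes "x:K (Suc i)"
 shows "nm i j'' x = (\<Sum>j<m (Suc i). pscale (pairing (kp (Suc i) j) x) (nm i j'' (kb (Suc i) j)))"
 by (subst expand[OF assms]) (simp add: pl_sum[OF pl_nm] pl_sc[OF pl_nm])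

definition DD where "DD i j j'' = (\<Sum>j'<m (Suc i). MM (Suc i) j j' ** MM i j' j'')"

text \<open>The parts of the square of the differential in which both letters are split off on the
  left, respectively on the right; by the contraction lemmas they are relations.\<close>

definition r1 where "r1 i j j'' = (\<Sum>a\<in>arcs Q. \<Sum>b\<in>arcs Q. pscale (pairing (kp i j'') (ldel (ar b) (ldel (ar a) (kb (Suc (Suc i)) j)))) (av a *. av b))"
definition r2 where "r2 i j j'' = (\<Sum>a\<in>arcs Q. \<Sum>b\<in>arcs Q. pscale (pairing (kp i j'') (rdel (ar b) (rdel (ar a) (kb (Suc (Suc i)) j)))) (av b *. av a))"

lemma r1_R: "j < m (Suc (Suc i)) ==> r1 i j j'':R" and r2_R: "j < m (Suc (Suc i)) ==> r2 i j j'':R"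
 unfolding r1_def r2_def by (erule contract_right[OF kb_K], erule contract_left[OF kb_K])

text \<open>Splitting off letters at opposite ends commutes, and the alternating sign makes the two
  mixed terms cancel. What remains is a relation in the left factor minus a relation in the right
  factor.\<close>

lemma DD_eq:
 assumes j: "j < m (Suc (Suc i))" and j'': "j'' < m i"
 shows "DD i j j'' = EE (Suc (Suc i)) j ** (ten (r1 i j j'') unitT - ten unitT (r2 i j j''))"
proof -
 let ?k = "kb (Suc (Suc i)) j" and ?g = "kp i j''" and ?s = "(- 1) ^ Suc (Suc i) :: complex" and ?s' = "(- 1) ^ Suc i :: complex"
 let ?L = "%a. ldel (ar a)" and ?R = "%a. rdel (ar a)"
 have uT: "unitT *. av a = av a" "av a *. unitT = av a" "unitT *. unitT = unitT" if "a:arcs Q" for a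
  using that uT_in by (simp_all add: uT_l uT_r)
 have "DD i j j'' = (\<Sum>j'<m (Suc i). EE (Suc (Suc i)) j ** (nm (Suc i) j' ?k ** nm i j'' (kb (Suc i) j')))"
  unfolding DD_def
 proof (rule sum.cong[OF refl])
  fix j' assume "j':{..<m (Suc i)}"
  hence j': "j' < m (Suc i)" by simp
  have "MM (Suc i) j j' ** MM i j' j'' = MM (Suc i) j j' ** EE (Suc i) j' ** nm i j'' (kb (Suc i) j')"
   by (simp only: EE_nm[OF j' j'', symmetric] emul_as)
  also have "... = MM (Suc i) j j' ** nm i j'' (kb (Suc i) j')"
   by (simp only: MM_EE[OF j j'])
  also have "... = EE (Suc (Suc i)) j ** (nm (Suc i) j' ?k ** nm i j'' (kb (Suc i) j'))"
   by (simp only: EE_nm[OF j j', symmetric] emul_as)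
  finally show "MM (Suc i) j j' ** MM i j' j'' = EE (Suc (Suc i)) j ** (nm (Suc i) j' ?k ** nm i j'' (kb (Suc i) j'))" .
 qed
 also have "... = EE (Suc (Suc i)) j ** (\<Sum>j'<m (Suc i). nm (Suc i) j' ?k ** nm i j'' (kb (Suc i) j'))"
  by (simp only: bm_sum_r)
 also have "(\<Sum>j'<m (Suc i). nm (Suc i) j' ?k ** nm i j'' (kb (Suc i) j'))
   = (\<Sum>a\<in>arcs Q. ten (av a) unitT ** nm i j'' (?L a ?k) + pscale ?s (ten unitT (av a) ** nm i j'' (?R a ?k)))"
 proof -
  have "nm (Suc i) j' ?k ** nm i j'' (kb (Suc i) j')
    = (\<Sum>a\<in>arcs Q. ten (av a) unitT ** pscale (pairing (kp (Suc i) j') (?L a ?k)) (nm i j'' (kb (Suc i) j'))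
    + pscale ?s (ten unitT (av a) ** pscale (pairing (kp (Suc i) j') (?R a ?k)) (nm i j'' (kb (Suc i) j'))))" for j'
   unfolding nm_def[of "Suc i"] cL_def cR_def
   by (simp only: bm_sum_l bm_add_l bm_sc_l bm_sc_r pm.scale_scale)
  hence "(\<Sum>j'<m (Suc i). nm (Suc i) j' ?k ** nm i j'' (kb (Suc i) j'))
    = (\<Sum>a\<in>arcs Q. \<Sum>j'<m (Suc i). ten (av a) unitT ** pscale (pairing (kp (Suc i) j') (?L a ?k)) (nm i j'' (kb (Suc i) j'))
    + pscale ?s (ten unitT (av a) ** pscale (pairing (kp (Suc i) j') (?R a ?k)) (nm i j'' (kb (Suc i) j'))))"
   by (simp only: sum.swap[of _ "arcs Q"])
  also have "... = (\<Sum>a\<in>arcs Q. ten (av a) unitT ** nm i j'' (?L a ?k) + pscale ?s (ten unitT (av a) ** nm i j'' (?R a ?k)))"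
  proof (rule sum.cong[OF refl])
   fix a assume a: "a:arcs Q"
   show "(\<Sum>j'<m (Suc i). ten (av a) unitT ** pscale (pairing (kp (Suc i) j') (?L a ?k)) (nm i j'' (kb (Suc i) j'))
    + pscale ?s (ten unitT (av a) ** pscale (pairing (kp (Suc i) j') (?R a ?k)) (nm i j'' (kb (Suc i) j'))))
    = ten (av a) unitT ** nm i j'' (?L a ?k) + pscale ?s (ten unitT (av a) ** nm i j'' (?R a ?k))"
    unfolding nm_expand[OF ldel_K[OF a kb_K[OF j]]] nm_expand[OF rdel_K[OF a kb_K[OF j]]]
    by (simp only: sum.distrib bm_sum_r sc_sum)
  qed
  finally show ?thesis .
 qed
 also have "... = ten (r1 i j j'') unitT - ten unitT (r2 i j j'')"
 proof -
  have t: "ten (av a) unitT ** nm i j'' x = (\<Sum>b\<in>arcs Q. pscale (pairing ?g (?L b x)) (ten (av a *. av b) unitT) + pscale (?s' * pairing ?g (?R b x)) (ten (av a) (av b)))"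
   "ten unitT (av a) ** nm i j'' x = (\<Sum>b\<in>arcs Q. pscale (pairing ?g (?L b x)) (ten (av b) (av a)) + pscale (?s' * pairing ?g (?R b x)) (ten unitT (av b *. av a)))"
   if a: "a:arcs Q" for a x
   unfolding nm_def cL_def cR_def bm_sum_r
   by (rule sum.cong[OF refl], simp only: bm_add_r bm_sc_r ten_emul uT[OF a] uT(1,2))+
  have "(\<Sum>a\<in>arcs Q. ten (av a) unitT ** nm i j'' (?L a ?k) + pscale ?s (ten unitT (av a) ** nm i j'' (?R a ?k)))
   = (\<Sum>a\<in>arcs Q. \<Sum>b\<in>arcs Q. pscale (pairing ?g (?L b (?L a ?k))) (ten (av a *. av b) unitT))
    + (\<Sum>a\<in>arcs Q. \<Sum>b\<in>arcs Q. pscale (?s' * pairing ?g (?R b (?L a ?k))) (ten (av a) (av b)))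
    + (\<Sum>a\<in>arcs Q. \<Sum>b\<in>arcs Q. pscale (?s * pairing ?g (?L b (?R a ?k))) (ten (av b) (av a)))
    + (\<Sum>a\<in>arcs Q. \<Sum>b\<in>arcs Q. pscale (?s * (?s' * pairing ?g (?R b (?R a ?k)))) (ten unitT (av b *. av a)))"
   by (simp only: t sum.distrib sc_sum sc_distr pm.scale_scale add.assoc cong: sum.cong)
  \<comment> \<open>Exchanging the names of the two arrows brings the second mixed sum into the form
    of the first, with the opposite sign.\<close>
  also have "(\<Sum>a\<in>arcs Q. \<Sum>b\<in>arcs Q. pscale (?s * pairing ?g (?L b (?R a ?k))) (ten (av b) (av a)))
    = (\<Sum>a\<in>arcs Q. \<Sum>b\<in>arcs Q. pscale (?s * pairing ?g (?R b (?L a ?k))) (ten (av a) (av b)))"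
   by (subst sum.swap) (simp only: ldel_rdel)
  also have "... = - (\<Sum>a\<in>arcs Q. \<Sum>b\<in>arcs Q. pscale (?s' * pairing ?g (?R b (?L a ?k))) (ten (av a) (av b)))"
   by (simp flip: sum_negf)
  also have "(\<Sum>a\<in>arcs Q. \<Sum>b\<in>arcs Q. pscale (?s * (?s' * pairing ?g (?R b (?R a ?k)))) (ten unitT (av b *. av a)))
    = - ten unitT (r2 i j j'')"
  proof -
   have "?s * ?s' = -1" by simp
   hence "?s * (?s' * c) = - c" for c by (simp only: mult.assoc[symmetric]) simp
   thus ?thesis
    unfolding r2_def by (simp only: pl_sum[OF plin_ten_right] pl_sc[OF plin_ten_right] pm.scale_minus_left sum_negf)
  qed
  also have "(\<Sum>a\<in>arcs Q. \<Sum>b\<in>arcs Q. pscale (pairing ?g (?L b (?L a ?k))) (ten (av a *. av b) unitT)) = ten (r1 i j j'') unitT"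
   unfolding r1_def by (simp only: pl_sum[OF pl_ten_l] pl_sc[OF pl_ten_l])
  finally show ?thesis by simp
 qed
 finally show ?thesis .
qed

text \<open>Both ways of splitting off the letter of an element of V give the element back, so under
  multiplication the left and right parts of the first differential cancel.\<close>

lemma eact_MM_0:
 assumes j: "j < m (Suc 0)"
 shows "(\<Sum>j'<m 0. eact (MM 0 j j') (kb 0 j')) = 0"
proof -
 let ?k = "kb (Suc 0) j" and ?h = "hd (Suc 0) j" and ?t = "tl (Suc 0) j"
 have "(\<Sum>j'<m 0. eact (MM 0 j j') (kb 0 j'))
  = (\<Sum>j'<m 0. \<Sum>a\<in>arcs Q. av a *. pscale (pairing (kp 0 j') (ldel (ar a) ?k)) (kb 0 j') *. ev ?t
    - ev ?h *. pscale (pairing (kp 0 j') (rdel (ar a) ?k)) (kb 0 j') *. av a)"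
  unfolding MM_def cL_def cR_def
  by (simp only: pl_sum[OF pl_eact_l] pl_add[OF pl_eact_l] pl_sc[OF pl_eact_l] eact_ten
    bm_sc_l bm_sc_r) simp
 also have "... = (\<Sum>a\<in>arcs Q. \<Sum>j'<m 0. av a *. pscale (pairing (kp 0 j') (ldel (ar a) ?k)) (kb 0 j') *. ev ?t
    - ev ?h *. pscale (pairing (kp 0 j') (rdel (ar a) ?k)) (kb 0 j') *. av a)"
  by (rule sum.swap)
 also have "... = (\<Sum>a\<in>arcs Q. av a *. ldel (ar a) ?k *. ev ?t - ev ?h *. rdel (ar a) ?k *. av a)"
 proof (rule sum.cong[OF refl])
  fix a assume a: "a:arcs Q"
  show "(\<Sum>j'<m 0. av a *. pscale (pairing (kp 0 j') (ldel (ar a) ?k)) (kb 0 j') *. ev ?t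
    - ev ?h *. pscale (pairing (kp 0 j') (rdel (ar a) ?k)) (kb 0 j') *. av a)
    = av a *. ldel (ar a) ?k *. ev ?t - ev ?h *. rdel (ar a) ?k *. av a"
   by (simp only: sum_subtractf bm_sum_r[symmetric] bm_sum_l[symmetric]
    expand[OF ldel_K[OF a kb_K[OF j]], symmetric] expand[OF rdel_K[OF a kb_K[OF j]], symmetric])
 qed
 also have "... = ?k *. ev ?t - ev ?h *. ?k"
 proof -
  have k: "?k:Vpow Q (Suc 0)" using kb_K[OF j] K_Vpow by blast
  have "?k *. ev ?t = (\<Sum>a\<in>arcs Q. av a *. ldel (ar a) ?k *. ev ?t)"
   by (subst expand_l[OF k]) (simp only: bm_sum_l)
  moreover have "ev ?h *. ?k = (\<Sum>a\<in>arcs Q. ev ?h *. rdel (ar a) ?k *. av a)"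
   by (subst expand_r[OF k]) (simp only: bm_sum_r tmul_as)
  ultimately show ?thesis by (simp only: sum_subtractf)
 qed
 also have "... = 0"
 proof (rule pmI)
  fix p
  show "lk (?k *. ev ?t - ev ?h *. ?k) p = lk 0 p"
   using kb_ends[OF j, of p] by (cases "lk ?k p = 0") (auto simp: lookup_minus lk_ev_l lk_ev_r)
 qed
 finally show ?thesis .
qed

lemma kb_EE: "j < m i ==> ev (hd i j) *. kb i j *. ev (tl i j) = kb i j"
proof (rule pmI)
 fix p assume "j < m i"
 thus "lk (ev (hd i j) *. kb i j *. ev (tl i j)) p = lk (kb i j) p"
  using kb_ends[of j i p] by (cases "lk (kb i j) p = 0") (auto simp: lk_ev_l lk_ev_r)
qed

lemma eact_EE: "j < m i ==> eact (EE i j) (kb i j) = kb i j"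
 by (simp only: EE_ten eact_ten kb_EE)

text \<open>In degree zero only pairs of trivial paths occur, and the idempotent keeps exactly one
  of them.\<close>

lemma degree_0_EE:
 assumes x: "x:Te" "x:below deg2 (Suc 0)" and e: "EE i j ** x = x"
 shows "x = pscale (lk x (triv (hd i j), triv (tl i j))) (EE i j)"
proof -
 have "plin (%x. EE i j ** x)" "plin (%x. pscale (lk x (triv (hd i j), triv (tl i j))) (EE i j))"
  by simp (simp add: plin_def Poly_Mapping.lookup_add sc_distl)
 hence "EE i j ** x = pscale (lk x (triv (hd i j), triv (tl i j))) (EE i j)"
 proof (rule pl_eqI)
  fix b assume "b:ks x"
  hence b: "fst b:qpaths Q" "snd b:qpaths Q" "deg2 b = 0" using x by (auto simp: sp_in_def below_def)
  then obtain v w where "b = (triv v, triv w)" using plen_0[of "fst b"] plen_0[of "snd b"] by (cases b) (auto simp: deg2_def)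
  moreover have "EE i j ** bas (triv v, triv w) = ten (ev (hd i j) *. ev v) (ev w *. ev (tl i j))" for v w
   using ten_emul[of "ev (hd i j)" "ev (tl i j)" "ev v" "ev w"] by (simp only: EE_ten ten_bas)
  moreover have "triv x = (triv y :: ('v, 'e) qpath) <-> x = y" for x y :: 'v by (simp add: triv_def)
  ultimately show "EE i j ** bas b = pscale (lk (bas b) (triv (hd i j), triv (tl i j))) (EE i j)"
   by (auto simp: ev_ev lk_bas EE_def pl_zr[OF pl_ten_l] pl_zr[OF plin_ten_right] simp del: bm_bas)
 qed
 thus ?thesis using e by simp
qed

end

locale koszul_pbw = pbw Q R P thy + koszul_data Q R m kb kp hd tl
 for Q :: "('v, 'e) pre_digraph" and R P thy m kb kp hd tl
begin

lemma DD_I: "j < m (Suc (Suc i)) ==> j'' < m i ==> DD i j j'':I.NN"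
proof -
 assume a: "j < m (Suc (Suc i))" "j'' < m i"
 have "r1 i j j'':I.J" "r2 i j j'':I.J" using r1_R[OF a(1)] r2_R[OF a(1)] I.X_J by auto
 hence "ten (r1 i j j'') unitT - ten unitT (r2 i j j''):I.NN"
  by (intro sub_diff[OF I.NN_sub] I.ten_NN1 I.ten_NN2 uT_in)
 thus ?thesis unfolding DD_eq[OF a] using I.NN_l EE_Te[OF a(1)] by blast
qed

text \<open>The formula of \<open>DD_eq\<close> with the two relations replaced by their constant
  parts, to which they are congruent in the deformation: the square of the differential modulo
  \<open>J.NN\<close>.\<close>

definition CC where "CC i j j'' = EE (Suc (Suc i)) j ** (ten (thy (r1 i j j'')) unitT - ten unitT (thy (r2 i j j'')))"

lemma DD_CC:
 assumes a: "j < m (Suc (Suc i))" "j'' < m i"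
 shows "DD i j j'' - CC i j j'':J.NN"
proof -
 have P: "r - thy r:J.J" if "r:R" for r using J.X_J that unfolding P_eq by blast
 have "DD i j j'' - CC i j j'' = EE (Suc (Suc i)) j ** (ten (r1 i j j'' - thy (r1 i j j'')) unitT - ten unitT (r2 i j j'' - thy (r2 i j j'')))"
  unfolding DD_eq[OF a] CC_def by (simp add: bm_df_r pl_df[OF pl_ten_l] pl_df[OF plin_ten_right])
 also have "... : J.NN"
  using P[OF r1_R[OF a(1)]] P[OF r2_R[OF a(1)]]
  by (intro J.NN_l EE_Te a sub_diff[OF J.NN_sub] J.ten_NN1 J.ten_NN2 uT_in)
 finally show ?thesis .
qed

lemma emul_below: "x:below deg2 (Suc k) ==> y:below deg2 (Suc l) ==> x ** y:below deg2 (Suc (k + l))"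
 unfolding below_def
proof (rule bm_sp, assumption+)
 fix p q r
 assume a: "p:{b. deg2 b < Suc k}" "q:{b. deg2 b < Suc l}" "pc2 p q = Some r"
 then obtain a b where "pcomp (fst p) (fst q) = Some a" "pcomp (snd q) (snd p) = Some b" "r = (a, b)"
  by (auto simp: pc2_def bind_eq_Some_conv)
 hence "deg2 r = deg2 p + deg2 q" by (simp add: deg2_def plen_pcomp)
 thus "r:{b. deg2 b < Suc (k + l)}" using a by simp
qed

lemma CC_props:
 assumes a: "j < m (Suc (Suc i))" "j'' < m i"
 shows "CC i j j'':Te" "CC i j j'':below deg2 (Suc 0)" "EE (Suc (Suc i)) j ** CC i j j'' = CC i j j''"
  "CC i j j'' ** EE i j'' = CC i j j''"
proof -
 have th: "thy r:T" "thy r:below plen (Suc 0)" if "r:R" for r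
  using theta_S[OF that] unfolding Vpow_eq below_def by (auto simp: sp_in_def)
 have un: "unitT:below plen (Suc 0)" using unit_V0 unfolding Vpow_eq below_def by (auto simp: sp_in_def)
 have E0: "EE (Suc (Suc i)) j:below deg2 (Suc 0)" by (simp add: EE_def below_def deg2_def)
 show te: "CC i j j'':Te"
  unfolding CC_def using th r1_R[OF a(1)] r2_R[OF a(1)]
  by (intro I.Te_mult EE_Te a sub_diff[OF sub_sp_in] I.ten_Te uT_in) auto
 have z: "ten (thy (r1 i j j'')) unitT - ten unitT (thy (r2 i j j'')):below deg2 (Suc (0 + 0))"
  using th(2)[OF r1_R[OF a(1)]] th(2)[OF r2_R[OF a(1)]] un by (intro sub_diff[OF below_sub] ten_below)
 have "EE (Suc (Suc i)) j ** (ten (thy (r1 i j j'')) unitT - ten unitT (thy (r2 i j j''))):below deg2 (Suc (0 + (0 + 0)))"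
  by (rule emul_below[OF E0 z])
 thus b: "CC i j j'':below deg2 (Suc 0)" unfolding CC_def by simp
 show "EE (Suc (Suc i)) j ** CC i j j'' = CC i j j''" unfolding CC_def by (simp add: emul_as[symmetric])
 \<comment> \<open>On the right, the idempotent is inherited from \<open>DD\<close> modulo
   \<open>J.NN\<close>; in degree zero this congruence is an equality.\<close>
 have DE: "DD i j j'' ** EE i j'' = DD i j j''"
  unfolding DD_def bm_sum_l emul_as by (rule sum.cong) (simp_all add: MM_EE a)
 have "(DD i j j'' - CC i j j'') - (DD i j j'' - CC i j j'') ** EE i j'':J.NN"
  using DD_CC[OF a] J.NN_r[OF EE_Te[OF a(2)] DD_CC[OF a]] by (rule sub_diff[OF J.NN_sub])
 hence n: "CC i j j'' ** EE i j'' - CC i j j'':J.NN" by (simp add: bm_df_l DE)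
 have E1: "EE i j'':below deg2 (Suc 0)" by (simp add: EE_def below_def deg2_def)
 have "CC i j j'' ** EE i j'':below deg2 (Suc (0 + 0))" by (rule emul_below[OF b E1])
 hence "CC i j j'' ** EE i j'' - CC i j j'':below deg2 (Suc 0)" using b by (intro sub_diff[OF below_sub]) auto
 hence "CC i j j'' ** EE i j'' - CC i j j'':below deg2 2" by (rule below_mono) simp
 hence "CC i j j'' ** EE i j'' - CC i j j'' = 0" by (rule NN_J_low[OF n])
 thus "CC i j j'' ** EE i j'' = CC i j j''" by simp
qed

definition cc where "cc i j j'' = lk (CC i j j'') (triv (hd (Suc (Suc i)) j), triv (tl (Suc (Suc i)) j))"

lemma CC_scalar:
 assumes a: "j < m (Suc (Suc i))" "j'' < m i"
 shows "CC i j j'' = pscale (cc i j j'') (EE (Suc (Suc i)) j)"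
  "cc i j j'' ~= 0 ==> hd i j'' = hd (Suc (Suc i)) j & tl i j'' = tl (Suc (Suc i)) j"
proof -
 show c: "CC i j j'' = pscale (cc i j j'') (EE (Suc (Suc i)) j)"
  unfolding cc_def by (rule degree_0_EE[OF CC_props(1,2,3)[OF a]])
 assume nz: "cc i j j'' ~= 0"
 have t: "triv x = (triv y :: ('v, 'e) qpath) <-> x = y" for x y :: 'v by (simp add: triv_def)
 have "EE (Suc (Suc i)) j ** EE i j'' = EE (Suc (Suc i)) j"
 proof -
  have "pscale (cc i j j'') (EE (Suc (Suc i)) j ** EE i j'') = pscale (cc i j j'') (EE (Suc (Suc i)) j)"
   using CC_props(4)[OF a] unfolding c bm_sc_l .
  thus ?thesis using nz by (simp only: pm.scale_cancel_left) simp
 qed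
 hence "ten (ev (hd (Suc (Suc i)) j) *. ev (hd i j'')) (ev (tl i j'') *. ev (tl (Suc (Suc i)) j)) = EE (Suc (Suc i)) j"
  by (simp only: EE_ten ten_emul)
 moreover have "EE (Suc (Suc i)) j ~= 0" by (metis EE_def lk_bas_self lookup_zero zero_neq_one)
 ultimately show "hd i j'' = hd (Suc (Suc i)) j & tl i j'' = tl (Suc (Suc i)) j"
  by (auto simp: ev_ev pl_zr[OF pl_ten_l] pl_zr[OF plin_ten_right] simp del: bm_bas split: if_splits)
qed

lemma combination_zr:
 assumes "(\<Sum>j<m i. pscale (c j) (kb i j)) = 0" "j < m i"
 shows "c j = 0"
proof -
 have "pairing (kp i j) (\<Sum>j'<m i. pscale (c j') (kb i j')) = (\<Sum>j'<m i. if j' = j then c j else 0)"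
  unfolding pr_sum pr_sc by (rule sum.cong) (use assms(2) dual in auto)
 thus ?thesis using assms by simp
qed

text \<open>Grouping three consecutive differentials in two ways shows that, modulo
  \<open>J.NN\<close>, CC in degree i + 1 followed by a differential equals a differential followed
  by CC in degree i, which is zero by induction. In degree one the congruence is an equality, so the
  combination of basis elements with coefficients \<open>cc\<close> has no left deletions and
  vanishes. For i = 0 the augmentation takes the place of the next differential.\<close>

lemma CC_0: "j < m (Suc (Suc i)) ==> j'' < m i ==> CC i j j'' = 0"
proof (induction i arbitrary: j j'')
 case 0
 note j = 0(1)
 have e: "eact (CC 0 j j') (kb 0 j') = pscale (cc 0 j j') (kb 0 j')" if j': "j' < m 0" for j'
 proof (cases "cc 0 j j' = 0")
  case False
  hence "EE (Suc (Suc 0)) j = EE 0 j'" using CC_scalar(2)[OF j j'] by (simp add: EE_def)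
  thus ?thesis using CC_scalar(1)[OF j j'] eact_EE[OF j'] by (simp add: pl_sc[OF pl_eact_l])
 qed (use CC_scalar(1)[OF j j'] in \<open>simp add: pl_zr[OF pl_eact_l]\<close>)
 have d: "(\<Sum>j'<m 0. eact (DD 0 j j') (kb 0 j')) = 0"
 proof -
  have "(\<Sum>j'<m 0. eact (DD 0 j j') (kb 0 j')) = (\<Sum>j'<m 0. \<Sum>l<m (Suc 0). eact (MM (Suc 0) j l) (eact (MM 0 l j') (kb 0 j')))"
   unfolding DD_def by (simp only: pl_sum[OF pl_eact_l] eact_emul)
  also have "... = (\<Sum>l<m (Suc 0). eact (MM (Suc 0) j l) (\<Sum>j'<m 0. eact (MM 0 l j') (kb 0 j')))"
   by (subst sum.swap) (simp only: pl_sum[OF plin_eact_right])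
  also have "... = 0" by (rule sum.neutral) (simp add: eact_MM_0 pl_zr[OF plin_eact_right])
  finally show ?thesis .
 qed
 \<comment> \<open>The augmentation sends \<open>J.NN\<close> into I(P) and kills \<open>DD\<close>
   exactly, so a combination of elements of S lies in I(P). Leading forms of I(P) have length at
   least two, so the combination is zero.\<close>
 have "(\<Sum>j'<m 0. eact (DD 0 j j' - CC 0 j j') (kb 0 j')):J.J"
  using DD_CC[OF j] subsetD[OF K_T kb_K] by (intro sub_sum J.J_sub J.eact_NN) auto
 hence "- (\<Sum>j'<m 0. pscale (cc 0 j j') (kb 0 j')):J.J"
  by (simp add: pl_df[OF pl_eact_l] sum_subtractf d e)
 hence x: "(\<Sum>j'<m 0. pscale (cc 0 j j') (kb 0 j')):J.J" using sub_neg[OF J.J_sub, of "- (\<Sum>j'<m 0. pscale (cc 0 j j') (kb 0 j'))"] by simp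
 have "(\<Sum>j'<m 0. pscale (cc 0 j j') (kb 0 j')):Vpow Q 0"
  using kb_K K_0 by (intro sub_sum sub_scale Vpow_sub) auto
 hence b: "(\<Sum>j'<m 0. pscale (cc 0 j j') (kb 0 j')):below plen (Suc 0)" by (auto simp: Vpow_eq below_def sp_in_def)
 have "(\<Sum>j'<m 0. pscale (cc 0 j j') (kb 0 j')):below plen 0"
 proof (rule below_step[OF b])
  have "lev plen 0 (\<Sum>j'<m 0. pscale (cc 0 j j') (kb 0 j')):I.J" by (rule J_lead[OF x b])
  thus "lev plen 0 (\<Sum>j'<m 0. pscale (cc 0 j j') (kb 0 j')) = 0"
  proof (intro pmI)
   fix p
   assume l: "lev plen 0 (\<Sum>j'<m 0. pscale (cc 0 j j') (kb 0 j')):I.J"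
   show "lk (lev plen 0 (\<Sum>j'<m 0. pscale (cc 0 j j') (kb 0 j'))) p = lk 0 p"
    using I_low[OF l, of p] unfolding lk_lev by (cases "plen p = 0") auto
  qed
 qed
 hence "(\<Sum>j'<m 0. pscale (cc 0 j j') (kb 0 j')) = 0" by simp
 from combination_zr[OF this 0(2)] show ?case using CC_scalar(1)[OF 0] by simp
next
 case (Suc i)
 note j = Suc.prems(1)
 let ?l = "j"
 have zero: "(\<Sum>j'<m (Suc i). CC (Suc i) j j' ** MM i j' q) = 0" if q: "q < m i" for q
 proof -
  have assoc: "(\<Sum>j'<m (Suc (Suc i)). MM (Suc (Suc i)) j j' ** DD i j' q) = (\<Sum>j'<m (Suc i). DD (Suc i) j j' ** MM i j' q)"
   unfolding DD_def bm_sum_l bm_sum_r emul_as by (rule sum.swap)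
  have "(\<Sum>j'<m (Suc (Suc i)). MM (Suc (Suc i)) j j' ** (DD i j' q - CC i j' q)):J.NN"
   using q MM_Te[OF j] by (intro sub_sum J.NN_sub J.NN_l DD_CC) auto
  moreover have "CC i j' q = 0" if "j' < m (Suc (Suc i))" for j' using Suc.IH[OF that q] .
  ultimately have 1: "(\<Sum>j'<m (Suc (Suc i)). MM (Suc (Suc i)) j j' ** DD i j' q):J.NN" by simp
  have "(\<Sum>j'<m (Suc i). (DD (Suc i) j j' - CC (Suc i) j j') ** MM i j' q):J.NN"
   using j MM_Te by (intro sub_sum J.NN_sub J.NN_r DD_CC) auto
  hence "(\<Sum>j'<m (Suc i). DD (Suc i) j j' ** MM i j' q) - (\<Sum>j'<m (Suc i). CC (Suc i) j j' ** MM i j' q):J.NN"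
   by (simp add: bm_df_l sum_subtractf)
  from sub_diff[OF J.NN_sub 1[unfolded assoc] this]
  have n: "(\<Sum>j'<m (Suc i). CC (Suc i) j j' ** MM i j' q):J.NN" by simp
  have Mb: "MM i j' q:below deg2 (Suc 1)" for j' using MM_deg[of i j' q] by (auto simp: below_def sp_in_def)
  have "CC (Suc i) j j' ** MM i j' q:below deg2 (Suc (0 + 1))" if "j' < m (Suc i)" for j'
   by (rule emul_below[OF CC_props(2)[OF j that] Mb])
  hence "(\<Sum>j'<m (Suc i). CC (Suc i) j j' ** MM i j' q):below deg2 2"
   by (intro sub_sum below_sub) (auto simp: numeral_2_eq_2)
  thus ?thesis by (rule NN_J_low[OF n])
 qed
 have s: "CC (Suc i) j j' ** MM i j' q = pscale (cc (Suc i) j j') (MM i j' q)" if j': "j' < m (Suc i)" and q: "q < m i" for j' q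
 proof (cases "cc (Suc i) j j' = 0")
  case False
  hence "EE (Suc (Suc (Suc i))) j = EE (Suc i) j'" using CC_scalar(2)[OF j j'] by (simp add: EE_def)
  thus ?thesis using CC_scalar(1)[OF j j'] EE_MM[OF j' q] by (simp add: bm_sc_l)
 qed (use CC_scalar(1)[OF j j'] in simp)
 \<comment> \<open>The coefficients at pairs of an arrow and a trivial path read off the left
   deletions of this combination from the matrix equation.\<close>
 define x where "x = (\<Sum>j'<m (Suc i). pscale (cc (Suc i) j j') (kb (Suc i) j'))"
 have "x = 0"
 proof (rule K_zeroI)
  show "x:K (Suc i)" unfolding x_def using kb_K by (intro sub_sum sub_scale K_sub) auto
  fix a q assume a: "a:arcs Q" and q: "q < m i"
  let ?t = "tl (Suc (Suc (Suc i))) j"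
  have "(\<Sum>j'<m (Suc i). pscale (cc (Suc i) j j') (MM i j' q)) = 0" using zero[OF q] s[OF _ q] by simp
  hence "lk (\<Sum>j'<m (Suc i). pscale (cc (Suc i) j j') (MM i j' q)) (ar a, triv ?t) = 0" by simp
  hence "(\<Sum>j'<m (Suc i). cc (Suc i) j j' * (if tl (Suc i) j' = ?t then cL i q a (kb (Suc i) j') else 0)) = 0"
   by (simp add: lookup_sum lk_MM_l[OF a])
  moreover have "cL i q a x = (\<Sum>j'<m (Suc i). cc (Suc i) j j' * (if tl (Suc i) j' = ?t then cL i q a (kb (Suc i) j') else 0))"
   unfolding x_def cL_def pl_sum[OF pl_ldel] pl_sc[OF pl_ldel] pr_sum pr_sc
  proof (rule sum.cong[OF refl])
   fix j' assume "j':{..<m (Suc i)}"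
   thus "cc (Suc i) j j' * pairing (kp i q) (ldel (ar a) (kb (Suc i) j'))
    = cc (Suc i) j j' * (if tl (Suc i) j' = ?t then pairing (kp i q) (ldel (ar a) (kb (Suc i) j')) else 0)"
    using CC_scalar(2)[OF j, of j'] by (cases "cc (Suc i) j j' = 0") auto
  qed
  ultimately show "cL i q a x = 0" by simp
 qed
 hence "(\<Sum>j'<m (Suc i). pscale (cc (Suc i) j j') (kb (Suc i) j')) = 0" unfolding x_def .
 from combination_zr[OF this Suc.prems(2)] show ?case using CC_scalar(1)[OF Suc.prems] by simp
qed

lemma DD_J: "j < m (Suc (Suc i)) ==> j'' < m i ==> DD i j j'':J.NN"
 using DD_CC[of j i j''] CC_0[of j i j''] by simp

end

section \<open>Exactness of the Koszul complex in coordinates\<close>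

context koszul_data
begin

lemma nm_EE:
 assumes "j < m (Suc i)" "j' < m i"
 shows "nm i j' (kb (Suc i) j) ** EE i j' = MM i j j'"
 unfolding nm_def MM_def bm_sum_l
proof (rule sum.cong[OF refl])
 fix a
 have u: "unitT *. ev v = ev v" "ev v *. unitT = ev v" if "v:verts Q" for v
  using that by (simp_all add: uT_l uT_r)
 have "pscale (cL i j' a (kb (Suc i) j)) (ten (av a) unitT) ** EE i j' = pscale (cL i j' a (kb (Suc i) j)) (ten (av a) (ev (tl (Suc i) j)))"
  using cL_nz[OF assms, of a] ht_verts[OF assms(1)]
  by (cases "cL i j' a (kb (Suc i) j) = 0") (simp_all add: bm_sc_l EE_ten ten_emul ev_av u del: bm_bas ten_bas)
 moreover have "pscale (cR i j' a (kb (Suc i) j)) (ten unitT (av a)) ** EE i j' = pscale (cR i j' a (kb (Suc i) j)) (ten (ev (hd (Suc i) j)) (av a))"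
  using cR_nz[OF assms, of a] ht_verts[OF assms(1)]
  by (cases "cR i j' a (kb (Suc i) j) = 0") (simp_all add: bm_sc_l EE_ten ten_emul ev_av u del: bm_bas ten_bas)
 ultimately show "(pscale (cL i j' a (kb (Suc i) j)) (ten (av a) unitT) + pscale (cR i j' a (kb (Suc i) j)) (ten unitT (av a))) ** EE i j'
   = pscale (cL i j' a (kb (Suc i) j)) (ten (av a) (ev (tl (Suc i) j))) + pscale (cR i j' a (kb (Suc i) j)) (ten (ev (hd (Suc i) j)) (av a))"
  by (simp only: bm_add_l)
qed

text \<open>A row represents the element of A tensor K_i tensor A with these coefficients at the
  basis of K_i; a column represents the homomorphism into the enveloping algebra with these values
  at the generators. \<open>drow\<close> and \<open>dcol\<close> are the differential and its
  dual.\<close>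

definition row where "row i x <-> (ALL j<m i. x j:Te & x j ** EE i j = x j)"
definition col where "col i c <-> (ALL j<m i. c j:Te & EE i j ** c j = c j)"
definition drow where "drow i x = (%j'. \<Sum>j<m (Suc i). x j ** MM i j j')"
definition dcol where "dcol i c = (%j. \<Sum>j'<m i. MM i j j' ** c j')"

lemma Vpow_0_ev: "s:Vpow Q 0 ==> s *. ev v = pscale (lk s (triv v)) (ev v)"
 "s:Vpow Q 0 ==> ev v *. s = pscale (lk s (triv v)) (ev v)"
proof -
 assume s: "s:Vpow Q 0"
 show "s *. ev v = pscale (lk s (triv v)) (ev v)"
 proof (rule pmI)
  fix p show "lk (s *. ev v) p = lk (pscale (lk s (triv v)) (ev v)) p"
   using Vpow_lk[OF s, of p] plen_0[of p] by (cases "lk s p = 0") (auto simp: lk_ev_r lk_bas)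
 qed
 show "ev v *. s = pscale (lk s (triv v)) (ev v)"
 proof (rule pmI)
  fix p show "lk (ev v *. s) p = lk (pscale (lk s (triv v)) (ev v)) p"
   using Vpow_lk[OF s, of p] plen_0[of p] by (cases "lk s p = 0") (auto simp: lk_ev_l lk_bas)
 qed
qed

lemma pairing_ev:
 assumes j: "j < m i"
 shows "pairing (kp i j) (ev v *. x) = (if v = hd i j then pairing (kp i j) x else 0)"
  and "pairing (kp i j) (x *. ev v) = (if v = tl i j then pairing (kp i j) x else 0)"
proof -
 have "pairing (kp i j) (ev v *. x) = pairing (%p. pairing (kp i j) (ev v *. bas p)) x"
  by (rule functional_pr) (simp_all add: bm_add_r bm_sc_r pr_add pr_sc)
 also have "(%p. pairing (kp i j) (ev v *. bas p)) = (%p. if v = hd i j then kp i j p else 0)"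
  using kap_ends[OF j] by (auto simp: pcomp_tr_l fun_eq_iff)
 finally show "pairing (kp i j) (ev v *. x) = (if v = hd i j then pairing (kp i j) x else 0)"
  by (auto simp: pairing_def)
 have "pairing (kp i j) (x *. ev v) = pairing (%p. pairing (kp i j) (bas p *. ev v)) x"
  by (rule functional_pr) (simp_all add: bm_add_l bm_sc_l pr_add pr_sc)
 also have "(%p. pairing (kp i j) (bas p *. ev v)) = (%p. if v = tl i j then kp i j p else 0)"
  using kap_ends[OF j] by (auto simp: pcomp_tr_r fun_eq_iff)
 finally show "pairing (kp i j) (x *. ev v) = (if v = tl i j then pairing (kp i j) x else 0)"
  by (auto simp: pairing_def)
qed

lemma pr_V0:
 assumes j: "j < m i" and s: "s:Vpow Q 0"
 shows "pairing (kp i j) (s *. x) = lk s (triv (hd i j)) * pairing (kp i j) x"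
  and "pairing (kp i j) (x *. s) = lk s (triv (tl i j)) * pairing (kp i j) x"
 using ht_verts[OF j]
 by (subst Vpow_0_expand[OF s], simp add: bm_sum_l bm_sum_r bm_sc_l bm_sc_r pr_sum pr_sc pairing_ev[OF j] if_distrib[of "(*) _"] cong: if_cong)+

end

context koszul_pbw
begin

abbreviation cA where "cA \<equiv> cr I.A"
abbreviation relsK where "relsK i \<equiv> tens_rels Q R (K i)"
abbreviation freeK where "freeK i \<equiv> sp_in (cA \<times> K i \<times> cA)"

lemma relsK_sub [simp]: "subsp (relsK i)" by (simp add: tens_rels_def Let_def)

lemma relsK_gens:
 "a:cA ==> a':cA ==> k:K i ==> b:cA ==> bas (a +[I.A] a', k, b) - bas (a, k, b) - bas (a', k, b):relsK i"
 "a:cA ==> k:K i ==> k':K i ==> b:cA ==> bas (a, k + k', b) - bas (a, k, b) - bas (a, k', b):relsK i"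
 "a:cA ==> k:K i ==> b:cA ==> b':cA ==> bas (a, k, b +[I.A] b') - bas (a, k, b) - bas (a, k, b'):relsK i"
 "a:cA ==> k:K i ==> b:cA ==> bas (c *.[I.A] a, k, b) - pscale c (bas (a, k, b)):relsK i"
 "a:cA ==> k:K i ==> b:cA ==> bas (a, pscale c k, b) - pscale c (bas (a, k, b)):relsK i"
 "a:cA ==> k:K i ==> b:cA ==> bas (a, k, c *.[I.A] b) - pscale c (bas (a, k, b)):relsK i"
 "a:cA ==> s:Vpow Q 0 ==> k:K i ==> b:cA ==> bas (a *[I.A] I.cl s, k, b) - bas (a, s *. k, b):relsK i"
 "a:cA ==> s:Vpow Q 0 ==> k:K i ==> b:cA ==> bas (a, k *. s, b) - bas (a, k, I.cl s *[I.A] b):relsK i"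
 unfolding tens_rels_def Let_def I.A_def[symmetric] path_alg_eq basis_alg_s I.qclass_eq
 subgoal by (rule pm.span_base, rule UnI1, rule UnI1, rule UnI1, rule UnI1, rule UnI1, rule UnI1, rule UnI1, rule CollectI, intro exI conjI, rule refl, assumption+)
 subgoal by (rule pm.span_base, rule UnI1, rule UnI1, rule UnI1, rule UnI1, rule UnI1, rule UnI1, rule UnI2, rule CollectI, intro exI conjI, rule refl, assumption+)
 subgoal by (rule pm.span_base, rule UnI1, rule UnI1, rule UnI1, rule UnI1, rule UnI1, rule UnI2, rule CollectI, intro exI conjI, rule refl, assumption+)
 subgoal by (rule pm.span_base, rule UnI1, rule UnI1, rule UnI1, rule UnI1, rule UnI2, rule CollectI, intro exI conjI, rule refl, assumption+)
 subgoal by (rule pm.span_base, rule UnI1, rule UnI1, rule UnI1, rule UnI2, rule CollectI, intro exI conjI, rule refl, assumption+)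
 subgoal by (rule pm.span_base, rule UnI1, rule UnI1, rule UnI2, rule CollectI, intro exI conjI, rule refl, assumption+)
 subgoal by (rule pm.span_base, rule UnI1, rule UnI2, rule CollectI, intro exI conjI, rule refl, assumption+)
 subgoal by (rule pm.span_base, rule UnI2, rule CollectI, intro exI conjI, rule refl, assumption+)
 done

lemma relsK_induct:
 assumes S: "subsp S"
  and "!!a a' k b. a:cA ==> a':cA ==> k:K i ==> b:cA ==> bas (a +[I.A] a', k, b) - bas (a, k, b) - bas (a', k, b):S"
  and "!!a k k' b. a:cA ==> k:K i ==> k':K i ==> b:cA ==> bas (a, k + k', b) - bas (a, k, b) - bas (a, k', b):S"
  and "!!a k b b'. a:cA ==> k:K i ==> b:cA ==> b':cA ==> bas (a, k, b +[I.A] b') - bas (a, k, b) - bas (a, k, b'):S"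
  and "!!a k b c. a:cA ==> k:K i ==> b:cA ==> bas (c *.[I.A] a, k, b) - pscale c (bas (a, k, b)):S"
  and "!!a k b c. a:cA ==> k:K i ==> b:cA ==> bas (a, pscale c k, b) - pscale c (bas (a, k, b)):S"
  and "!!a k b c. a:cA ==> k:K i ==> b:cA ==> bas (a, k, c *.[I.A] b) - pscale c (bas (a, k, b)):S"
  and "!!a k b s. a:cA ==> s:Vpow Q 0 ==> k:K i ==> b:cA ==> bas (a *[I.A] I.cl s, k, b) - bas (a, s *. k, b):S"
  and "!!a k b s. a:cA ==> s:Vpow Q 0 ==> k:K i ==> b:cA ==> bas (a, k *. s, b) - bas (a, k, I.cl s *[I.A] b):S"
 shows "relsK i <= S"
 unfolding tens_rels_def Let_def I.A_def[symmetric] path_alg_eq basis_alg_s I.qclass_eq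
 by (rule span_min[OF _ S]) (intro Un_least subsetI; elim CollectE exE conjE; simp only: assms(2-))

lemma A_cl: "a:cA ==> a':cA ==> a +[I.A] a':cA" "a:cA ==> c *.[I.A] a:cA" "a:cA ==> a':cA ==> a *[I.A] a':cA"
proof -
 show "a:cA ==> a':cA ==> a +[I.A] a':cA" using ring.ring_simprules(1)[OF I.A_ring] .
 show "a:cA ==> a':cA ==> a *[I.A] a':cA" using ring.ring_simprules(5)[OF I.A_ring] .
 show "a:cA ==> c *.[I.A] a:cA" by (auto simp: I.A_cr I.A_smult sub_scale)
qed

lemma rp_add: "a:cA ==> a':cA ==> rp (a +[I.A] a') - (rp a + rp a'):I.J"
 and rp_sc: "a:cA ==> rp (c *.[I.A] a) - pscale c (rp a):I.J"
 and rp_mult: "a:cA ==> a':cA ==> rp (a *[I.A] a') - rp a *. rp a':I.J"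
 using I.A_add[of "rp a" "rp a'"] I.rp_cl_J[of "rp a + rp a'"] I.A_smult[of c "rp a"] I.rp_cl_J[of "pscale c (rp a)"]
  I.A_mult[of "rp a" "rp a'"] I.rp_cl_J[of "rp a *. rp a'"] I.rp_T[of a] I.rp_T[of a']
 by (simp_all add: I.cl_rp)

lemma V0_cA: "s:Vpow Q i ==> I.cl s:cA" by (rule I.clA) (use Vpow_T in blast)

lemma relsK_free: "relsK i <= freeK i"
proof (rule relsK_induct)
 fix s k assume "s:Vpow Q 0" "k:K i"
 hence "s *. k *. unitT:K i" "unitT *. k *. s:K i" "k:T" "s:T"
  using K_bi[OF _ unit_V0] K_bi[OF unit_V0] subsetD[OF K_T] subsetD[OF Vpow_T] by blast+
 hence sk: "s *. k:K i" "k *. s:K i" using T_mult by (simp_all add: uT_l uT_r)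
 fix a b assume "a:cA" "b:cA"
 thus "bas (a *[I.A] I.cl s, k, b) - bas (a, s *. k, b):freeK i" "bas (a, k *. s, b) - bas (a, k, I.cl s *[I.A] b):freeK i"
  using sk `k:K i` V0_cA[OF `s:Vpow Q 0`] by (simp_all add: sub_diff A_cl)
qed (simp_all add: sub_diff sub_scale sub_add A_cl)

text \<open>The j-th coordinate of a formal triple: the middle entry is expanded in the basis
  \<open>kb\<close>, and the outer entries are replaced by representatives.\<close>

definition sg where "sg i j = lin_ext (%g. pscale (pairing (kp i j) (fst (snd g))) (ten (rp (fst g)) (rp (snd (snd g))) ** EE i j))"

lemma sg_bas: "sg i j (bas (a, k, b)) = pscale (pairing (kp i j) k) (ten (rp a) (rp b) ** EE i j)" by (simp add: sg_def)

lemma pl_sg [simp]: "plin (sg i j)" by (simp add: sg_def)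

lemma sg_Te: "j < m i ==> f:freeK i ==> sg i j f:Te"
proof (rule pl_in_sub_sp[OF pl_sg sub_sp_in], assumption)
 fix g assume "j < m i" "g:cA \<times> K i \<times> cA"
 thus "sg i j (bas g):Te"
  by (cases g) (simp add: sg_bas sub_scale I.Te_mult I.ten_Te I.rp_T)
qed

lemma sg_EE: "sg i j f ** EE i j = sg i j f"
 by (rule pl_eqI[of "%f. sg i j f ** EE i j"])
   (simp_all add: pl_bmulL sg_def bm_sc_l emul_as)

text \<open>Linearity relations are respected since representatives are linear modulo I(R).
  Balancing relations are respected since, next to the idempotent \<open>EE i j\<close>, an element
  of S acts as the same scalar on either side.\<close>

lemma sg_rels: "j < m i ==> f:relsK i ==> sg i j f:I.NN"
proof -
 assume j: "j < m i"
 have nE: "n ** EE i j:I.NN" if "n:I.NN" for n by (rule I.NN_r[OF EE_Te[OF j] that])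
 have sc: "pscale c n:I.NN" if "n:I.NN" for c n using that by (simp add: sub_scale)
 have "relsK i <= {f. sg i j f:I.NN}"
 proof (rule relsK_induct; (unfold mem_Collect_eq)?)
  show "subsp {f. sg i j f:I.NN}"
   by (rule pm.subspaceI)
    (simp_all add: pl_zr[OF pl_sg] pl_add[OF pl_sg] pl_sc[OF pl_sg] sub_0 sub_add sub_scale)
 next
  fix a a' k b assume a: "a:cA" "a':cA" "k:K i" "b:cA"
  have "sg i j (bas (a +[I.A] a', k, b) - bas (a, k, b) - bas (a', k, b))
   = pscale (pairing (kp i j) k) (ten (rp (a +[I.A] a') - (rp a + rp a')) (rp b) ** EE i j)"
   by (simp add: pl_df[OF pl_sg] sg_bas pl_df[OF pl_ten_l] pl_add[OF pl_ten_l] bm_df_l bm_add_l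
    sc_diff sc_distr)
  thus "sg i j (bas (a +[I.A] a', k, b) - bas (a, k, b) - bas (a', k, b)):I.NN"
   using I.ten_NN1[OF rp_add[OF a(1,2)] I.rp_T[OF a(4)]] by (simp only: sc nE)
 next
  fix a k k' b assume a: "a:cA" "k:K i" "k':K i" "b:cA"
  have "sg i j (bas (a, k + k', b) - bas (a, k, b) - bas (a, k', b)) = 0"
   by (simp add: pl_df[OF pl_sg] sg_bas pr_add sc_distl)
  thus "sg i j (bas (a, k + k', b) - bas (a, k, b) - bas (a, k', b)):I.NN" by (simp add: sub_0)
 next
  fix a k b b' assume a: "a:cA" "k:K i" "b:cA" "b':cA"
  have "sg i j (bas (a, k, b +[I.A] b') - bas (a, k, b) - bas (a, k, b'))
   = pscale (pairing (kp i j) k) (ten (rp a) (rp (b +[I.A] b') - (rp b + rp b')) ** EE i j)"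
   by (simp add: pl_df[OF pl_sg] sg_bas pl_df[OF plin_ten_right] pl_add[OF plin_ten_right] bm_df_l bm_add_l
    sc_diff sc_distr)
  thus "sg i j (bas (a, k, b +[I.A] b') - bas (a, k, b) - bas (a, k, b')):I.NN"
   using I.ten_NN2[OF I.rp_T[OF a(1)] rp_add[OF a(3,4)]] by (simp only: sc nE)
 next
  fix a k b c assume a: "a:cA" "k:K i" "b:cA"
  have "sg i j (bas (c *.[I.A] a, k, b) - pscale c (bas (a, k, b)))
   = pscale (pairing (kp i j) k) (ten (rp (c *.[I.A] a) - pscale c (rp a)) (rp b) ** EE i j)"
   by (simp add: pl_df[OF pl_sg] pl_sc[OF pl_sg] sg_bas pl_df[OF pl_ten_l] pl_sc[OF pl_ten_l] bm_df_l bm_sc_l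
    sc_diff mult.commute)
  thus "sg i j (bas (c *.[I.A] a, k, b) - pscale c (bas (a, k, b))):I.NN"
   using I.ten_NN1[OF rp_sc[OF a(1)] I.rp_T[OF a(3)]] by (simp only: sc nE)
  have "sg i j (bas (a, pscale c k, b) - pscale c (bas (a, k, b))) = 0"
   by (simp add: pl_df[OF pl_sg] pl_sc[OF pl_sg] sg_bas pr_sc)
  thus "sg i j (bas (a, pscale c k, b) - pscale c (bas (a, k, b))):I.NN" by (simp add: sub_0)
  have "sg i j (bas (a, k, c *.[I.A] b) - pscale c (bas (a, k, b)))
   = pscale (pairing (kp i j) k) (ten (rp a) (rp (c *.[I.A] b) - pscale c (rp b)) ** EE i j)"
   by (simp add: pl_df[OF pl_sg] pl_sc[OF pl_sg] sg_bas pl_df[OF plin_ten_right] pl_sc[OF plin_ten_right] bm_df_l bm_sc_l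
    sc_diff mult.commute)
  thus "sg i j (bas (a, k, c *.[I.A] b) - pscale c (bas (a, k, b))):I.NN"
   using I.ten_NN2[OF I.rp_T[OF a(1)] rp_sc[OF a(3)]] by (simp only: sc nE)
 next
  fix a k b s assume a: "a:cA" "s:Vpow Q 0" "k:K i" "b:cA"
  have sT: "s:T" using a(2) Vpow_T by auto
  have m1: "rp (a *[I.A] I.cl s) - rp a *. s:I.J"
   using I.A_mult[OF I.rp_T[OF a(1)] sT] I.rp_cl_J[of "rp a *. s"] by (simp add: I.cl_rp[OF a(1)])
  have m2: "rp (I.cl s *[I.A] b) - s *. rp b:I.J"
   using I.A_mult[OF sT I.rp_T[OF a(4)]] I.rp_cl_J[of "s *. rp b"] by (simp add: I.cl_rp[OF a(4)])
  have e1: "ten (rp a *. s) (rp b) ** EE i j = pscale (lk s (triv (hd i j))) (ten (rp a) (rp b) ** EE i j)"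
   by (simp only: EE_ten ten_emul tmul_as Vpow_0_ev[OF a(2)] bm_sc_r pl_sc[OF pl_ten_l])
  have e2: "ten (rp a) (s *. rp b) ** EE i j = pscale (lk s (triv (tl i j))) (ten (rp a) (rp b) ** EE i j)"
   by (simp only: EE_ten ten_emul tmul_as[symmetric] Vpow_0_ev[OF a(2)] bm_sc_l pl_sc[OF plin_ten_right])
  have "sg i j (bas (a *[I.A] I.cl s, k, b) - bas (a, s *. k, b))
   = pscale (pairing (kp i j) k) (ten (rp (a *[I.A] I.cl s) - rp a *. s) (rp b) ** EE i j)"
   by (simp add: pl_df[OF pl_sg] sg_bas pl_df[OF pl_ten_l] bm_df_l e1 pr_V0[OF j a(2)]
    sc_diff mult.commute)
  thus "sg i j (bas (a *[I.A] I.cl s, k, b) - bas (a, s *. k, b)):I.NN"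
   using I.ten_NN1[OF m1 I.rp_T[OF a(4)]] by (simp only: sc nE)
  have "sg i j (bas (a, k *. s, b) - bas (a, k, I.cl s *[I.A] b))
   = pscale (- pairing (kp i j) k) (ten (rp a) (rp (I.cl s *[I.A] b) - s *. rp b) ** EE i j)"
   by (simp add: pl_df[OF pl_sg] sg_bas pl_df[OF plin_ten_right] bm_df_l e2 pr_V0[OF j a(2)]
    sc_diff mult.commute)
  thus "sg i j (bas (a, k *. s, b) - bas (a, k, I.cl s *[I.A] b)):I.NN"
   using I.ten_NN2[OF I.rp_T[OF a(1)] m2] by (simp only: sc nE)
 qed
 thus "f:relsK i ==> sg i j f:I.NN" by blast
qed

text \<open>The way back for a fixed middle entry: pairs of paths become triples of classes. Summed
  over the basis this gives \<open>tau\<close>, the inverse of the coordinates \<open>sg\<close>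
  modulo relations.\<close>

definition LL where "LL k = lin_ext (%x. bas (I.cl (bas (fst x)), k, I.cl (bas (snd x))))"

lemma pl_LL [simp]: "plin (LL k)" by (simp add: LL_def)

lemma LL_bas: "LL k (bas (p, q)) = bas (I.cl (bas p), k, I.cl (bas q))" by (simp add: LL_def)

lemma LL_ten: "k:K i ==> x:T ==> y:T ==> bas (I.cl x, k, I.cl y) - LL k (ten x y):relsK i"
proof -
 assume k: "k:K i" and x: "x:T" and y: "y:T"
 have 1: "bas (I.cl x, k, I.cl y) - lin_ext (%p. bas (I.cl (bas p), k, I.cl y)) x:relsK i" if "x:T" "y:T" for x y
 proof (rule approx_linear[OF relsK_sub that(1), of "%x. bas (I.cl x, k, I.cl y)"])
  show "bas (I.cl (a + b), k, I.cl y) - (bas (I.cl a, k, I.cl y) + bas (I.cl b, k, I.cl y)):relsK i" if "a:T" "b:T" for a b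
   using relsK_gens(1)[of "I.cl a" "I.cl b" k i "I.cl y"] that `y:T` k by (simp add: I.A_add diff_diff_eq)
  show "bas (I.cl (pscale c a), k, I.cl y) - pscale c (bas (I.cl a, k, I.cl y)):relsK i" if "a:T" for a c
   using relsK_gens(4)[of "I.cl a" k i "I.cl y" c] that `y:T` k by (simp add: I.A_smult)
 qed
 have 2: "bas (I.cl x, k, I.cl y) - lin_ext (%p. bas (I.cl x, k, I.cl (bas p))) y:relsK i" if "x:T" "y:T" for x y
 proof (rule approx_linear[OF relsK_sub that(2), of "%y. bas (I.cl x, k, I.cl y)"])
  show "bas (I.cl x, k, I.cl (a + b)) - (bas (I.cl x, k, I.cl a) + bas (I.cl x, k, I.cl b)):relsK i" if "a:T" "b:T" for a b
   using relsK_gens(3)[of "I.cl x" k i "I.cl a" "I.cl b"] that `x:T` k by (simp add: I.A_add diff_diff_eq)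
  show "bas (I.cl x, k, I.cl (pscale c a)) - pscale c (bas (I.cl x, k, I.cl a)):relsK i" if "a:T" for a c
   using relsK_gens(6)[of "I.cl x" k i "I.cl a" c] that `x:T` k by (simp add: I.A_smult)
 qed
 have eq: "lin_ext (%p. bas (I.cl (bas p), k, I.cl (bas q))) x = LL k (ten x (bas q))" for q
  by (rule pl_eqI[OF pl_lin_ext pl_o[OF pl_LL pl_ten_l]]) (simp add: LL_bas)
 have "lin_ext (%q. bas (I.cl x, k, I.cl (bas q))) y - LL k (ten x y):relsK i"
 proof (rule pl_in_sub_sp[OF _ relsK_sub y, of "%y. lin_ext (%q. bas (I.cl x, k, I.cl (bas q))) y - LL k (ten x y)"])
  show "plin (%y. lin_ext (%q. bas (I.cl x, k, I.cl (bas q))) y - LL k (ten x y))"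
   by (rule pl_sub[OF pl_lin_ext pl_o[OF pl_LL plin_ten_right']])
  fix q assume "q:qpaths Q"
  thus "lin_ext (%q. bas (I.cl x, k, I.cl (bas q))) (bas q) - LL k (ten x (bas q)):relsK i"
   using 1[OF x, of "bas q"] by (simp add: eq)
 qed
 from sub_add[OF relsK_sub 2[OF x y] this] show ?thesis by simp
qed

lemma LL_NN: "k:K i ==> z:I.NN ==> LL k z:relsK i"
proof (rule I.NN_pl[of z "LL k"])
 assume k: "k:K i"
 have z: "bas (I.cl 0, k, b):relsK i" "bas (b, k, I.cl 0):relsK i" if "b:cA" for b
  using relsK_gens(4)[of "I.cl 0" k i b 0] relsK_gens(6)[of b k i "I.cl 0" 0] that k
  by (simp_all add: I.A_smult sub_0 del: qcos_zr)
 fix x y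
 show "LL k (ten x y):relsK i" if xy: "x:I.J" "y:T"
 proof -
  have "x:T" using xy I.J_T by auto
  moreover have "I.cl x = I.cl 0" using xy by (simp add: I.cl_eq del: qcos_zr)
  ultimately have "bas (I.cl 0, k, I.cl y) - LL k (ten x y):relsK i" using LL_ten[OF k, of x y] xy by metis
  from sub_diff[OF relsK_sub z(1)[OF I.clA[OF xy(2)]] this] show ?thesis by simp
 qed
 show "LL k (ten x y):relsK i" if xy: "x:T" "y:I.J"
 proof -
  have "y:T" using xy I.J_T by auto
  moreover have "I.cl y = I.cl 0" using xy by (simp add: I.cl_eq del: qcos_zr)
  ultimately have "bas (I.cl x, k, I.cl 0) - LL k (ten x y):relsK i" using LL_ten[OF k, of x y] xy by metis
  from sub_diff[OF relsK_sub z(2)[OF I.clA[OF xy(1)]] this] show ?thesis by simp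
 qed
qed simp_all

lemma relsK_combination:
 fixes n :: nat
 assumes "a:cA" "b:cA" "!!j. j < n ==> y j:K i"
 shows "bas (a, \<Sum>j<n. pscale (c j) (y j), b) - (\<Sum>j<n. pscale (c j) (bas (a, y j, b))):relsK i"
 using assms(3)
proof (induction n)
 case 0
 have "bas (a, pscale 0 0, b) - pscale 0 (bas (a, 0, b)):relsK i"
  by (rule relsK_gens(5)[OF assms(1) _ assms(2)]) (simp add: sub_0)
 thus ?case by simp
next
 case (Suc n)
 let ?s = "\<Sum>j<n. pscale (c j) (y j)"
 have sK: "?s:K i" "pscale (c n) (y n):K i" using Suc(2) by (auto intro!: sub_sum sub_scale)
 have "bas (a, \<Sum>j<Suc n. pscale (c j) (y j), b) - (\<Sum>j<Suc n. pscale (c j) (bas (a, y j, b)))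
  = (bas (a, ?s + pscale (c n) (y n), b) - bas (a, ?s, b) - bas (a, pscale (c n) (y n), b))
   + (bas (a, ?s, b) - (\<Sum>j<n. pscale (c j) (bas (a, y j, b))))
   + (bas (a, pscale (c n) (y n), b) - pscale (c n) (bas (a, y n, b)))" by simp
 also have "... : relsK i"
  by (intro sub_add[OF relsK_sub] relsK_gens(2)[OF assms(1) sK assms(2)] Suc.IH relsK_gens(5) assms(1,2)) (use Suc(2) in auto)
 finally show ?case .
qed

definition tau where "tau i x = (\<Sum>j<m i. LL (kb i j) (x j))"

text \<open>Reassembling the coordinates inserts the trivial paths e_h and e_t into the outer
  entries; balancing over S moves them onto the basis element, which they fix.\<close>

lemma tau_sg: "f:freeK i ==> f - tau i (%j. sg i j f):relsK i"
proof (rule pl_in_sub_sp[of "%f. f - tau i (%j. sg i j f)"])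
 show "plin (%f. f - tau i (%j. sg i j f))"
  unfolding tau_def by (intro pl_sub pl_id pl_sum_fun pl_o[OF pl_LL pl_sg])
 fix g assume "g:cA \<times> K i \<times> cA"
 then obtain a k b where g: "g = (a, k, b)" "a:cA" "k:K i" "b:cA" by (cases g) auto
 let ?c = "%j. pairing (kp i j) k"
 let ?F = "%j. LL (kb i j) (ten (rp a) (rp b) ** EE i j)"
 have t: "tau i (%j. sg i j (bas g)) = (\<Sum>j<m i. pscale (?c j) (?F j))"
  unfolding tau_def g(1) sg_bas by (simp only: pl_sc[OF pl_LL])
 have "bas (a, kb i j, b) - ?F j:relsK i" if j: "j < m i" for j
 proof -
  let ?h = "ev (hd i j)" and ?t = "ev (tl i j)"
  have V: "?h:Vpow Q 0" "?t:Vpow Q 0" using ht_verts[OF j] by simp_all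
  have hT: "?h:T" "?t:T" using ht_verts[OF j] by simp_all
  have F: "?F j = LL (kb i j) (ten (rp a *. ?h) (?t *. rp b))" by (simp only: EE_ten ten_emul)
  have e: "I.cl (rp a *. ?h) = a *[I.A] I.cl ?h" "I.cl (?t *. rp b) = I.cl ?t *[I.A] b"
   using I.A_mult[OF I.rp_T[OF g(2)] hT(1)] I.A_mult[OF hT(2) I.rp_T[OF g(4)]] by (simp_all only: I.cl_rp[OF g(2)] I.cl_rp[OF g(4)])
  have tb: "I.cl ?t *[I.A] b:cA" using V0_cA[OF V(2)] g(4) by (rule A_cl(3))
  have hk: "?h *. kb i j:K i"
  proof -
   have "?h *. kb i j *. unitT:K i" by (rule K_bi[OF V(1) unit_V0 kb_K[OF j]])
   moreover have "?h *. kb i j:T" using T_mult[OF hT(1)] kb_K[OF j] K_T by blast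
   ultimately show ?thesis by (simp add: uT_r)
  qed
  have "bas (I.cl (rp a *. ?h), kb i j, I.cl (?t *. rp b)) - ?F j:relsK i"
   unfolding F using I.rp_T g hT by (intro LL_ten kb_K j T_mult) auto
  moreover have "bas (a *[I.A] I.cl ?h, kb i j, I.cl ?t *[I.A] b) - bas (a, ?h *. kb i j, I.cl ?t *[I.A] b):relsK i"
   by (rule relsK_gens(7)[OF g(2) V(1) kb_K[OF j] tb])
  moreover have "bas (a, ?h *. kb i j *. ?t, b) - bas (a, ?h *. kb i j, I.cl ?t *[I.A] b):relsK i"
   by (rule relsK_gens(8)[OF g(2) V(2) hk g(4)])
  ultimately have "(bas (I.cl (rp a *. ?h), kb i j, I.cl (?t *. rp b)) - ?F j)
    - (bas (a *[I.A] I.cl ?h, kb i j, I.cl ?t *[I.A] b) - bas (a, ?h *. kb i j, I.cl ?t *[I.A] b))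
    + (bas (a, ?h *. kb i j *. ?t, b) - bas (a, ?h *. kb i j, I.cl ?t *[I.A] b)):relsK i"
   by (rule sub_add[OF relsK_sub sub_diff[OF relsK_sub]])
  thus ?thesis unfolding e kb_EE[OF j] by simp
 qed
 hence "(\<Sum>j<m i. pscale (?c j) (bas (a, kb i j, b) - ?F j)):relsK i"
  by (intro sub_sum sub_scale relsK_sub) auto
 moreover have "bas g - (\<Sum>j<m i. pscale (?c j) (bas (a, kb i j, b))):relsK i"
  using relsK_combination[OF g(2,4), of "m i" "kb i" i ?c] kb_K expand[OF g(3)] unfolding g(1) by simp
 ultimately have "(bas g - (\<Sum>j<m i. pscale (?c j) (bas (a, kb i j, b)))) + (\<Sum>j<m i. pscale (?c j) (bas (a, kb i j, b) - ?F j)):relsK i"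
  by (intro sub_add[OF relsK_sub])
 thus "bas g - tau i (%j. sg i j (bas g)):relsK i"
  unfolding t by (simp add: sc_diff sum_subtractf)
qed simp_all

lemma relsK_i: "f:freeK i ==> (!!j. j < m i ==> sg i j f:I.NN) ==> f:relsK i"
proof -
 assume f: "f:freeK i" "!!j. j < m i ==> sg i j f:I.NN"
 have "tau i (%j. sg i j f):relsK i"
  unfolding tau_def using f(2) by (intro sub_sum relsK_sub LL_NN kb_K) auto
 from sub_add[OF relsK_sub tau_sg[OF f(1)] this] show ?thesis by simp
qed

lemma tau_free: "row i x ==> tau i x:freeK i"
 unfolding tau_def
proof (intro sub_sum sub_sp_in)
 fix j assume x: "row i x" and j: "j:{..<m i}"
 hence "x j:Te" by (simp add: row_def)
 thus "LL (kb i j) (x j):freeK i"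
  unfolding LL_def by (rule lin_ext_sp) (use j kb_K in auto)
qed

lemma sg_tau: "row i x ==> j < m i ==> sg i j (tau i x) - x j:I.NN"
proof -
 assume x: "row i x" and j: "j < m i"
 have "sg i j (LL (kb i j') z) - (if j = j' then z ** EE i j else 0):I.NN" if j': "j' < m i" and z: "z:Te" for j' z
 proof (rule pl_in_sub_sp[OF _ I.NN_sub z, of "%z. sg i j (LL (kb i j') z) - (if j = j' then z ** EE i j else 0)"])
  show "plin (%z. sg i j (LL (kb i j') z) - (if j = j' then z ** EE i j else 0))"
   by (rule pl_sub[OF pl_o[OF pl_sg pl_LL]]) (cases "j = j'", simp_all add: plin_def)
  fix b assume b: "b:qpaths Q \<times> qpaths Q"
  obtain p q where pq: "b = (p, q)" by (cases b)
  have "ten (rp (I.cl (bas p))) (rp (I.cl (bas q))) - ten (bas p) (bas q):I.NN"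
   using b pq by (intro I.ten_cong_NN I.rp_T I.clA I.rp_cl_J) auto
  hence "(ten (rp (I.cl (bas p))) (rp (I.cl (bas q))) - ten (bas p) (bas q)) ** EE i j:I.NN"
   by (rule I.NN_r[OF EE_Te[OF j]])
  hence n: "ten (rp (I.cl (bas p))) (rp (I.cl (bas q))) ** EE i j - bas b ** EE i j:I.NN"
   by (simp only: bm_df_l pq ten_bas)
  show "sg i j (LL (kb i j') (bas b)) - (if j = j' then bas b ** EE i j else 0):I.NN"
   using n dual[OF j j'] by (cases "j = j'") (simp_all add: pq LL_bas sg_bas sub_0 del: bm_bas)
 qed
 hence "(\<Sum>j'<m i. sg i j (LL (kb i j') (x j')) - (if j = j' then x j' ** EE i j else 0)):I.NN"
  using x by (intro sub_sum I.NN_sub) (auto simp: row_def)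
 moreover have "(\<Sum>j'<m i. if j = j' then x j' ** EE i j else 0) = x j ** EE i j" using j by simp
 ultimately show ?thesis
  using x j by (simp add: tau_def pl_sum[OF pl_sg] sum_subtractf row_def)
qed

section \<open>The Koszul differential in coordinates\<close>

definition KD where "KD i = lin_ext (%g. dl_gen Q R g + pscale ((- 1) ^ Suc i) (dr_gen Q R g))"

lemma pl_KD [simp]: "plin (KD i)" by (simp add: KD_def)

lemma KD_bas: "KD i (bas (a, k, b)) = (\<Sum>x\<in>arcs Q. bas (a *[I.A] I.cl (av x), ldel (ar x) k, b))
  + pscale ((- 1) ^ Suc i) (\<Sum>x\<in>arcs Q. bas (a, rdel (ar x) k, I.cl (av x) *[I.A] b))"
 unfolding KD_def dl_gen_def dr_gen_def I.A_def[symmetric] I.qclass_eq by simp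

lemma KD_free: "f:freeK (Suc i) ==> KD i f:freeK i"
proof (rule pl_in_sub_sp[OF pl_KD sub_sp_in], assumption)
 fix g assume "g:cA \<times> K (Suc i) \<times> cA"
 then obtain a k b where g: "g = (a, k, b)" "a:cA" "k:K (Suc i)" "b:cA" by (cases g) auto
 have "I.cl (av x):cA" if "x:arcs Q" for x using that by simp
 thus "KD i (bas g):freeK i"
  unfolding g(1) KD_bas using g ldel_K rdel_K
  by (intro sub_add sub_scale sub_sum sub_sp_in) (simp_all add: A_cl)
qed

text \<open>On a triple both sides expand over the arrows; they differ only in the representatives
  chosen for the products of the outer entries with an arrow, hence by elements of
  \<open>I.NN\<close>.\<close>

lemma sg_KD:
 assumes f: "f:freeK (Suc i)" and j': "j' < m i"
 shows "sg i j' (KD i f) - drow i (%j. sg (Suc i) j f) j':I.NN"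
proof (rule pl_in_sub_sp[OF _ I.NN_sub f, of "%f. sg i j' (KD i f) - drow i (%j. sg (Suc i) j f) j'"])
 show "plin (%f. sg i j' (KD i f) - drow i (%j. sg (Suc i) j f) j')"
  unfolding drow_def
  by (intro pl_sub pl_o[OF pl_sg pl_KD] pl_sum_fun pl_o[OF pl_bm_l pl_sg])
 fix g assume "g:cA \<times> K (Suc i) \<times> cA"
 then obtain a k b where g: "g = (a, k, b)" "a:cA" "k:K (Suc i)" "b:cA" by (cases g) auto
 let ?t = "ten (rp a) (rp b)"
 have "drow i (%j. sg (Suc i) j (bas g)) j' = (\<Sum>j<m (Suc i). pscale (pairing (kp (Suc i) j) k) (?t ** MM i j j'))"
  unfolding drow_def g(1) sg_bas
  by (rule sum.cong[OF refl]) (simp add: bm_sc_l emul_as EE_MM[OF _ j'])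
 also have "... = (\<Sum>j<m (Suc i). pscale (pairing (kp (Suc i) j) k) (?t ** (nm i j' (kb (Suc i) j) ** EE i j')))"
  by (rule sum.cong[OF refl]) (simp add: nm_EE[OF _ j'])
 also have "... = ?t ** (nm i j' k ** EE i j')"
  unfolding nm_expand[OF g(3)] by (simp only: bm_sum_l bm_sum_r bm_sc_l bm_sc_r)
 finally have dr: "drow i (%j. sg (Suc i) j (bas g)) j' = ?t ** (nm i j' k ** EE i j')" .
 have uT: "unitT *. rp b = rp b" "rp a *. unitT = rp a" using I.rp_T g by (simp_all add: uT_l uT_r)
 have t: "?t ** (nm i j' k ** EE i j') = (\<Sum>x\<in>arcs Q. pscale (cL i j' x k) (ten (rp a *. av x) (rp b) ** EE i j') + pscale (cR i j' x k) (ten (rp a) (av x *. rp b) ** EE i j'))"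
  unfolding emul_as[symmetric] nm_def by (simp only: bm_sum_r bm_sum_l bm_add_r bm_add_l bm_sc_r bm_sc_l ten_emul uT)
 have s: "sg i j' (KD i (bas g)) = (\<Sum>x\<in>arcs Q. pscale (cL i j' x k) (ten (rp (a *[I.A] I.cl (av x))) (rp b) ** EE i j')
   + pscale (cR i j' x k) (ten (rp a) (rp (I.cl (av x) *[I.A] b)) ** EE i j'))"
  unfolding g(1) KD_bas cL_def cR_def
  by (simp only: pl_add[OF pl_sg] pl_sc[OF pl_sg] pl_sum[OF pl_sg] sg_bas sum.distrib sc_sum pm.scale_scale)
 have m: "rp (a *[I.A] I.cl (av x)) - rp a *. av x:I.J" "rp (I.cl (av x) *[I.A] b) - av x *. rp b:I.J" if "x:arcs Q" for x
  using I.A_mult[OF I.rp_T[OF g(2)], of "av x"] I.A_mult[OF _ I.rp_T[OF g(4)], of "av x"] I.rp_cl_J[of "rp a *. av x"] I.rp_cl_J[of "av x *. rp b"] that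
  by (simp_all add: I.cl_rp g)
 have "sg i j' (KD i (bas g)) - drow i (%j. sg (Suc i) j (bas g)) j'
  = (\<Sum>x\<in>arcs Q. pscale (cL i j' x k) (ten (rp (a *[I.A] I.cl (av x)) - rp a *. av x) (rp b) ** EE i j')
   + pscale (cR i j' x k) (ten (rp a) (rp (I.cl (av x) *[I.A] b) - av x *. rp b) ** EE i j'))"
  unfolding dr t s sum_subtractf[symmetric]
  by (rule sum.cong[OF refl])
    (simp only: pl_df[OF pl_ten_l] pl_df[OF plin_ten_right] bm_df_l sc_diff add_diff_add)
 also have "... : I.NN"
  using m g I.rp_T
  by (intro sub_sum sub_add sub_scale I.NN_sub I.NN_r[OF EE_Te[OF j']] I.ten_NN1 I.ten_NN2) auto
 finally show "sg i j' (KD i (bas g)) - drow i (%j. sg (Suc i) j (bas g)) j':I.NN" .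
qed

lemma drow_NN: "j' < m i ==> (!!j. j < m (Suc i) ==> n j:I.NN) ==> drow i n j':I.NN"
 unfolding drow_def by (intro sub_sum I.NN_sub I.NN_r MM_Te) auto

lemma drow_diff: "drow i (%j. x j - y j) j' = drow i x j' - drow i y j'"
 by (simp add: drow_def bm_df_l sum_subtractf)

lemma KD_rels: "n:relsK (Suc i) ==> KD i n:relsK i"
proof (rule relsK_i)
 assume n: "n:relsK (Suc i)"
 hence nf: "n:freeK (Suc i)" using relsK_free by blast
 thus "KD i n:freeK i" by (rule KD_free)
 fix j' assume j': "j' < m i"
 have "drow i (%j. sg (Suc i) j n) j':I.NN" using sg_rels n by (intro drow_NN[OF j']) auto
 from sub_add[OF I.NN_sub sg_KD[OF nf j'] this] show "sg i j' (KD i n):I.NN" by simp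
qed

lemma kos_df_qcos: "kos_diff Q R i (qcos (relsK (Suc i)) f) = qcos (relsK i) (KD i f)"
proof -
 have "qcos (relsK i) (KD i x) = qcos (relsK i) (KD i f)" if "x:qcos (relsK (Suc i)) f" for x
  using KD_rels[of "x - f" i] that by (intro qcos_eqI) (simp_all add: qcos_mem pl_df[OF pl_KD])
 hence "(\<Union>x\<in>qcos (relsK (Suc i)) f. qcos (relsK i) (KD i x)) = qcos (relsK i) (KD i f)"
  by (rule UN_coset[OF relsK_sub])
 thus ?thesis
  by (simp add: kos_diff_def free_tens_def basis_vs_def coset_basis_alg KD_def)
qed

lemma kos_tens_cr: "cr (kos_tens Q R i) = qcos (relsK i) ` freeK i"
 and kos_tens_zero: "zero (kos_tens Q R i) = qcos (relsK i) 0"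
 unfolding kos_tens_def free_tens_def basis_vs_def I.A_def[symmetric]
 by (rule quot_cr[OF relsK_sub], rule quot_zr[OF relsK_sub])

text \<open>The Koszul hypothesis is carried over by \<open>tau\<close> and \<open>sg\<close>: a row
  is reassembled to a cycle, a preimage of the cycle exists, and its coordinates are the required
  row.\<close>

lemma row_exact_I:
 assumes kos: "two_koszul Q R" and x: "row (Suc i) x" and dx: "!!j'. j' < m i ==> drow i x j':I.NN"
 shows "EX y. row (Suc (Suc i)) y & (ALL j<m (Suc i). x j - drow (Suc i) y j:I.NN)"
proof -
 define f where "f = tau (Suc i) x"
 have f: "f:freeK (Suc i)" unfolding f_def by (rule tau_free[OF x])
 have sf: "sg (Suc i) j f - x j:I.NN" if "j < m (Suc i)" for j unfolding f_def by (rule sg_tau[OF x that])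
 have "KD i f:relsK i"
 proof (rule relsK_i[OF KD_free[OF f]])
  fix j' assume j': "j' < m i"
  have "drow i (%j. sg (Suc i) j f - x j) j':I.NN" using sf by (intro drow_NN[OF j']) auto
  hence "drow i (%j. sg (Suc i) j f) j' - drow i x j':I.NN" by (simp only: drow_diff)
  from sub_add[OF I.NN_sub sub_add[OF I.NN_sub sg_KD[OF f j'] this] dx[OF j']]
  show "sg i j' (KD i f):I.NN" by simp
 qed
 hence "kos_diff Q R i (qcos (relsK (Suc i)) f) = zero (kos_tens Q R i)"
  unfolding kos_df_qcos kos_tens_zero by (intro qcos_eqI) simp_all
 moreover have "qcos (relsK (Suc i)) f:cr (kos_tens Q R (Suc i))" using f by (simp add: kos_tens_cr)
 ultimately have "qcos (relsK (Suc i)) f:kos_diff Q R (Suc i) ` cr (kos_tens Q R (Suc (Suc i)))"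
  using kos unfolding two_koszul_def by auto
 then obtain g where g: "g:freeK (Suc (Suc i))" "qcos (relsK (Suc i)) f = qcos (relsK (Suc i)) (KD (Suc i) g)"
  unfolding kos_tens_cr by (auto simp: kos_df_qcos)
 hence fg: "f - KD (Suc i) g:relsK (Suc i)" by (simp add: qcos_eq_i)
 define y where "y = (%j. sg (Suc (Suc i)) j g)"
 have "row (Suc (Suc i)) y" unfolding row_def y_def by (auto intro: sg_Te g simp: sg_EE)
 moreover have "x j - drow (Suc i) y j:I.NN" if j: "j < m (Suc i)" for j
 proof -
  have "sg (Suc i) j f - sg (Suc i) j (KD (Suc i) g):I.NN" using sg_rels[OF j fg] by (simp only: pl_df[OF pl_sg])
  from sub_diff[OF I.NN_sub sub_add[OF I.NN_sub this sg_KD[OF g(1) j]] sf[OF j]]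
  show ?thesis by (simp add: y_def)
 qed
 ultimately show ?thesis by blast
qed

end

section \<open>Direct summands of free modules cut out by idempotents\<close>

definition comb :: "('r, 'x, 'n) module_scheme => nat => (nat => 'x) => (nat => 'r) => 'x" where
 "comb M k v x = (\<Oplus>\<^bsub>M\<^esub>j\<in>{..<k}. x j *.[M] v j)"

text \<open>The direct sum of the left ideals generated by the idempotents e_j. With the classes of
  \<open>EE i j\<close> it becomes the Koszul bimodule in degree i.\<close>

definition idem_mod :: "('r, 'm) ring_scheme => nat => (nat => 'r) => ('r, nat => 'r) module" where
 "idem_mod R k e = (free_module R k)\<lparr>carrier := {x:{..<k} \<rightarrow>\<^sub>E cr R. ALL j<k. x j *[R] e j = x j}\<rparr>"

lemma idem_mod_s [simp]:
 "cr (idem_mod R k e) = {x:{..<k} \<rightarrow>\<^sub>E cr R. ALL j<k. x j *[R] e j = x j}"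
 "x +[idem_mod R k e] y = (\<lambda>i\<in>{..<k}. x i +[R] y i)"
 "zero (idem_mod R k e) = (\<lambda>i\<in>{..<k}. 0[R])"
 "a *.[idem_mod R k e] x = (\<lambda>i\<in>{..<k}. a *[R] x i)"
 by (simp_all add: idem_mod_def free_module_def)

context left_module
begin

lemma comb_cl: "(!!j. j < k ==> v j:cr M) ==> (!!j. j < k ==> x j:cr R) ==> comb M k v x:cr M"
 unfolding comb_def by (intro M.finsum_closed) (simp add: smult_closed)

lemma comb_add:
 assumes "!!j. j < k ==> v j:cr M" "!!j. j < k ==> x j:cr R" "!!j. j < k ==> y j:cr R"
 shows "comb M k v (\<lambda>i\<in>{..<k}. x i \<oplus> y i) = comb M k v x +[M] comb M k v y"
proof -
 have "comb M k v (\<lambda>i\<in>{..<k}. x i \<oplus> y i) = (\<Oplus>\<^bsub>M\<^esub>j\<in>{..<k}. x j *.[M] v j +[M] y j *.[M] v j)"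
  unfolding comb_def using assms by (intro M.finsum_cong') (auto simp: smult_l_distr smult_closed)
 also have "... = comb M k v x +[M] comb M k v y"
  unfolding comb_def using assms by (intro M.finsum_addf) (auto simp: smult_closed)
 finally show ?thesis .
qed

lemma smult_zr: "a:cr R ==> a *.[M] 0[M] = 0[M]"
 using smult_r_distr[of a "0[M]" "0[M]"] smult_closed[of a "0[M]"] by simp

lemma comb_smult:
 assumes "!!j. j < k ==> v j:cr M" "!!j. j < k ==> x j:cr R" "a:cr R"
 shows "comb M k v (\<lambda>i\<in>{..<k}. a \<otimes> x i) = a *.[M] comb M k v x"
 using assms(1,2)
proof (induction k)
 case 0
 thus ?case by (simp add: comb_def smult_zr[OF assms(3)])
next
 case (Suc k)
 have s: "comb M (Suc k) v y = y k *.[M] v k +[M] comb M k v y" if "!!j. j < Suc k ==> y j:cr R" for y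
  unfolding comb_def lessThan_Suc using that Suc(2) by (intro M.finsum_insert) (auto simp: smult_closed)
 have "comb M (Suc k) v (\<lambda>i\<in>{..<Suc k}. a \<otimes> x i) = (a \<otimes> x k) *.[M] v k +[M] comb M k v (\<lambda>i\<in>{..<Suc k}. a \<otimes> x i)"
  by (subst s) (use Suc assms(3) in auto)
 also have "comb M k v (\<lambda>i\<in>{..<Suc k}. a \<otimes> x i) = comb M k v (\<lambda>i\<in>{..<k}. a \<otimes> x i)"
  unfolding comb_def using Suc assms(3) by (intro M.finsum_cong') (auto intro: smult_closed)
 also have "... = a *.[M] comb M k v x" by (rule Suc.IH) (use Suc.prems in auto)
 also have "(a \<otimes> x k) *.[M] v k +[M] ... = a *.[M] comb M (Suc k) v x"
  using Suc(2,3) assms(3) comb_cl[of k v x] by (simp add: s smult_assoc smult_r_distr smult_closed)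
 finally show ?case .
qed

end

lemma comb_hom:
 fixes M :: "('r, 'x) module"
 assumes "left_module R M"
 shows "(!!j. j < k ==> v j:cr M) ==> lmod_hom R (idem_mod R k e) M (comb M k v)"
proof (rule lmod_homI)
 interpret left_module R M by fact
 assume v: "!!j. j < k ==> v j:cr M"
 fix x y a
 assume x: "x:cr (idem_mod R k e)"
 thus "comb M k v x:cr M" by (intro comb_cl v) auto
 show "comb M k v (x +[idem_mod R k e] y) = comb M k v x +[M] comb M k v y" if "y:cr (idem_mod R k e)"
  unfolding idem_mod_s using x that by (intro comb_add v) auto
 show "comb M k v (a *.[idem_mod R k e] x) = a *.[M] comb M k v x" if "a:cr R"
  unfolding idem_mod_s using x that by (intro comb_smult v) auto
qed

locale idempotents = ring R for R (structure) +
 fixes e :: "nat => 'a" and k :: nat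
 assumes e: "j < k ==> e j:cr R" and ee: "j < k ==> e j \<otimes> e j = e j"
begin

abbreviation PE where "PE \<equiv> idem_mod R k e"

lemma idem_carrier: "x:cr PE <-> x:extensional {..<k} & (ALL j<k. x j:cr R & x j \<otimes> e j = x j)"
 by (auto simp: PiE_iff)

lemma idem_l_mod: "left_module R PE"
proof -
 have c: "x j:cr R" "x j \<otimes> e j = x j" if "x:cr PE" "j < k" for x j using that unfolding idem_carrier by blast+
 have eq: "(!!j. j < k ==> x j = y j) ==> restrict x {..<k} = restrict y {..<k}" for x y :: "nat => 'a" by (rule restrict_ext) simp
 have eq': "(!!j. j < k ==> x j = y j) ==> y:cr PE ==> restrict x {..<k} = y" for x y :: "nat => 'a"
 by (auto simp: fun_eq_iff)
 have ab: "abelian_group PE"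
 proof (rule abelian_groupI)
  fix x y z assume x: "x:cr PE" and y: "y:cr PE" and z: "z:cr PE"
  show "x +[PE] y:cr PE" using c[OF x] c[OF y] by (simp add: l_distr e)
  show "x +[PE] y +[PE] z = x +[PE] (y +[PE] z)"
   unfolding idem_mod_s(2) by (rule eq) (simp add: c[OF x] c[OF y] c[OF z] a_assoc)
  show "x +[PE] y = y +[PE] x"
   unfolding idem_mod_s(2) by (rule eq) (simp add: c[OF x] c[OF y] a_comm)
  show "0[PE] +[PE] x = x"
   unfolding idem_mod_s(2,3) by (rule eq'[OF _ x]) (simp add: c[OF x])
  show "EX y:cr PE. y +[PE] x = 0[PE]"
  proof (rule bexI[of _ "\<lambda>j\<in>{..<k}. \<ominus> x j"])
   show "(\<lambda>j\<in>{..<k}. \<ominus> x j):cr PE" using c[OF x] by (simp add: l_minus e)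
   show "(\<lambda>j\<in>{..<k}. \<ominus> x j) +[PE] x = 0[PE]"
    unfolding idem_mod_s(2,3) by (rule eq) (simp add: c[OF x] l_neg)
  qed
 next
  show "0[PE]:cr PE" by (simp add: e)
 qed
 show ?thesis
 proof (rule left_module.intro[OF ring_axioms ab left_module_axioms.intro])
  fix x y a b assume x: "x:cr PE" and y: "y:cr PE" and a: "a:cr R" and b: "b:cr R"
  show "a *.[PE] x:cr PE" using c[OF x] a by (simp add: m_assoc e)
  show "(a \<oplus> b) *.[PE] x = a *.[PE] x +[PE] b *.[PE] x"
   unfolding idem_mod_s(2,4) by (rule eq) (simp add: c[OF x] a b l_distr)
  show "a *.[PE] (x +[PE] y) = a *.[PE] x +[PE] a *.[PE] y"
   unfolding idem_mod_s(2,4) by (rule eq) (simp add: c[OF x] c[OF y] a r_distr)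
  show "(a \<otimes> b) *.[PE] x = a *.[PE] (b *.[PE] x)"
   unfolding idem_mod_s(4) by (rule eq) (simp add: c[OF x] a b m_assoc)
 next
  fix x assume x: "x:cr PE"
  show "\<one> *.[PE] x = x"
   unfolding idem_mod_s(4) by (rule eq'[OF _ x]) (simp add: c[OF x])
 qed
qed

lemma idem_fg_projective: "fg_projective R PE"
 unfolding fg_projective_def
proof (intro conjI exI ballI idem_l_mod)
 show "lmod_hom R PE (free_module R k) (%x. x)"
  by (rule lmod_homI) (auto simp: free_module_def)
 have c: "x j:cr R" if "x:cr (free_module R k)" "j < k" for x j
  using that by (auto simp: free_module_def)
 show "lmod_hom R (free_module R k) PE (%x. \<lambda>j\<in>{..<k}. x j \<otimes> e j)"
 proof (rule lmod_homI)
  fix x y a assume x: "x:cr (free_module R k)"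
  show "(\<lambda>j\<in>{..<k}. x j \<otimes> e j):cr PE" using c[OF x] by (simp add: m_assoc e ee)
  show "(\<lambda>j\<in>{..<k}. (x +[free_module R k] y) j \<otimes> e j) = (\<lambda>j\<in>{..<k}. x j \<otimes> e j) +[PE] (\<lambda>j\<in>{..<k}. y j \<otimes> e j)"
   if y: "y:cr (free_module R k)"
   unfolding idem_mod_s(2) by (rule restrict_ext) (simp add: free_module_def c[OF x] c[OF y] e l_distr)
  show "(\<lambda>j\<in>{..<k}. (a *.[free_module R k] x) j \<otimes> e j) = a *.[PE] (\<lambda>j\<in>{..<k}. x j \<otimes> e j)" if "a:cr R"
   unfolding idem_mod_s(4) by (rule restrict_ext) (simp add: free_module_def c[OF x] that e m_assoc)
 qed
 show "(\<lambda>j\<in>{..<k}. x j \<otimes> e j) = x" if "x:cr PE" for x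
  using that by (auto simp: fun_eq_iff)
qed

definition unitv where "unitv j = (\<lambda>i\<in>{..<k}. if i = j then e j else \<zero>)"

lemma unitv: "j < k ==> unitv j:cr PE"
 by (auto simp: unitv_def e ee)

lemma hom_comb:
 assumes N: "left_module R N" and h: "lmod_hom R PE N fi" and x: "x:cr PE"
 shows "fi x = comb N k (%j. fi (unitv j)) x"
proof -
 interpret N: left_module R N by (rule N)
 \<comment> \<open>Truncations of x, so that one generator is added at a time.\<close>
 let ?t = "%n. \<lambda>i\<in>{..<k}. if i < n then x i else \<zero>"
 have xc: "x i:cr R" "x i \<otimes> e i = x i" if "i < k" for i using x that by auto
 have tc: "?t n:cr PE" for n using xc e by auto
 have "fi (?t n) = comb N n (%j. fi (unitv j)) x" if "n \<le> k" for n
  using that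
 proof (induction n)
  case 0
  have z: "?t 0 = 0[PE]" by auto
  show ?case unfolding z lmod_hom_zr[OF idem_l_mod N h] by (simp add: comb_def)
 next
  case (Suc n)
  have xu: "x n *.[PE] unitv n:cr PE"
   using left_module.smult_closed[OF idem_l_mod] xc unitv Suc(2) by simp
  have "?t (Suc n) = x n *.[PE] unitv n +[PE] ?t n"
   using xc Suc(2) by (auto simp: unitv_def less_Suc_eq)
  hence "fi (?t (Suc n)) = x n *.[N] fi (unitv n) +[N] fi (?t n)"
   using lhD(2)[OF h xu tc] lhD(3)[OF h xc(1) unitv] Suc(2) by simp
  also have "fi (?t n) = comb N n (%j. fi (unitv j)) x" by (rule Suc.IH) (use Suc.prems in simp)
  also have "x n *.[N] fi (unitv n) +[N] ... = comb N (Suc n) (%j. fi (unitv j)) x"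
   unfolding comb_def lessThan_Suc using Suc(2) xc lhD(1)[OF h unitv]
   by (subst N.finsum_insert) (auto simp: N.smult_closed)
  finally show ?case .
 qed
 from this[of k] have "fi (?t k) = comb N k (%j. fi (unitv j)) x" by simp
 moreover have "?t k = x" using x by (auto simp: PiE_def extensional_def)
 ultimately show ?thesis by simp
qed

end

lemma finsum_regular: "finsum (rgm R) = finsum R"
 by (simp add: finsum_def finprod_def fun_eq_iff)

lemma matrix_hom:
 fixes R (structure)
 assumes "ring R" and M: "!!j j'. j < k ==> j' < k' ==> M j j':cr R & M j j' \<otimes> e' j' = M j j'"
  and e': "!!j'. j' < k' ==> e' j':cr R"
 shows "lmod_hom R (idem_mod R k e) (idem_mod R k' e') (%x. \<lambda>j'\<in>{..<k'}. comb (rgm R) k (%j. M j j') x)"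
proof -
 interpret ring R by fact
 interpret L: left_module R "rgm R" by (rule l_mod_regular) fact
 have h: "lmod_hom R (idem_mod R k e) (rgm R) (comb (rgm R) k (%j. M j j'))" if "j' < k'" for j'
  by (rule comb_hom[OF L.left_module_axioms]) (use M[OF _ that] in simp)
 have r: "x \<otimes> e' j' = x" if "j' < k'" and "x = comb (rgm R) k (%j. M j j') y" "y:cr (idem_mod R k e)" for x y j'
  unfolding that(2) comb_def regular_module_simps
 proof -
  have y: "y j:cr R" if "j < k" for j using `y:carrier (idem_mod R k e)` that by auto
  show "(\<Oplus>\<^bsub>rgm R\<^esub>j\<in>{..<k}. y j \<otimes> M j j') \<otimes> e' j' = (\<Oplus>\<^bsub>rgm R\<^esub>j\<in>{..<k}. y j \<otimes> M j j')"
   unfolding finsum_regular using M[OF _ that(1)] y e'[OF that(1)]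
   by (subst finsum_ldistr) (auto simp: m_assoc intro!: finsum_cong')
 qed
 show ?thesis
 proof (rule lmod_homI)
  fix x y a
  assume x: "x:cr (idem_mod R k e)"
  show "(\<lambda>j'\<in>{..<k'}. comb (rgm R) k (%j. M j j') x):cr (idem_mod R k' e')"
   using lhD(1)[OF h x] r[OF _ refl x] by simp
  show "(\<lambda>j'\<in>{..<k'}. comb (rgm R) k (%j. M j j') (x +[idem_mod R k e] y)) =
    (\<lambda>j'\<in>{..<k'}. comb (rgm R) k (%j. M j j') x) +[idem_mod R k' e'] (\<lambda>j'\<in>{..<k'}. comb (rgm R) k (%j. M j j') y)"
   if y: "y:cr (idem_mod R k e)"
   using lhD(2)[OF h x y] by auto
  show "(\<lambda>j'\<in>{..<k'}. comb (rgm R) k (%j. M j j') (a *.[idem_mod R k e] x)) =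
    a *.[idem_mod R k' e'] (\<lambda>j'\<in>{..<k'}. comb (rgm R) k (%j. M j j') x)"
   if a: "a:cr R"
   using lhD(3)[OF h a x] by auto
 qed
qed

section \<open>The Koszul complex of a filtered deformation\<close>

text \<open>Homogeneous of degree one; the first clause adds that nothing is mapped into degree
  zero.\<close>

definition raises :: "('b => nat) => (('b \<Rightarrow>\<^sub>0 complex) => ('b \<Rightarrow>\<^sub>0 complex)) => bool" where
 "raises deg f <-> plin f & (ALL z. lev deg 0 (f z) = 0) & (ALL z k. lev deg (Suc k) (f z) = f (lev deg k z))"

lemma raises_below: "raises deg f ==> z:below deg k ==> f z:below deg (Suc k)"
proof -
 assume f: "raises deg f" and z: "z:below deg k"
 have "lev deg l (f z) = 0" if "l \<ge> Suc k" for l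
 proof -
  obtain l' where l': "l = Suc l'" "l' \<ge> k" using `l \<ge> Suc k` by (cases l) auto
  have "lev deg l' z = 0" by (rule lev_below[OF below_mono[OF z l'(2)]])
  thus ?thesis using f l' pl_zr[of f] by (simp add: raises_def)
 qed
 thus ?thesis unfolding below_i
  by (metis lk_lev lookup_zero not_le)
qed

context filtered_pair
begin

text \<open>Vectors are cut out by the projections \<open>pr\<close>, later left or right
  multiplication by idempotents, and the differentials are matrices of maps of degree one. In this
  form the lifting serves rows and columns alike.\<close>

lemma matrix_exactness_lift:
 fixes F G :: "nat => nat => ('b \<Rightarrow>\<^sub>0 complex) => ('b \<Rightarrow>\<^sub>0 complex)" and pr pr' :: "nat => ('b \<Rightarrow>\<^sub>0 complex) => ('b \<Rightarrow>\<^sub>0 complex)"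
  and B and l m n :: nat
 defines "X \<equiv> {x. ALL j<m. x j:sp_in B & pr j (x j) = x j}" and "Y \<equiv> {y. ALL j<l. y j:sp_in B & pr' j (y j) = y j}"
 defines "d \<equiv> %x j'. \<Sum>j<m. F j j' (x j)" and "d' \<equiv> %y j'. \<Sum>j<l. G j j' (y j)"
 assumes pr: "!!j. j < m ==> plin (pr j)" "!!j k z. j < m ==> lev deg k (pr j z) = pr j (lev deg k z)"
   "!!j z. j < m ==> pr j (pr j z) = pr j z" "!!j z. j < m ==> z:NJ ==> pr j z:NJ"
  and pr': "!!j. j < l ==> plin (pr' j)" "!!j k z. j < l ==> lev deg k (pr' j z) = pr' j (lev deg k z)"
  and F: "!!j j'. j < m ==> j' < n ==> raises deg (F j j')" "!!j j' z. j < m ==> j' < n ==> z:NJ ==> F j j' z:NJ"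
  and G: "!!j j'. j < l ==> j' < m ==> raises deg (G j j')" "!!j j' z. j < l ==> j' < m ==> z:sp_in B ==> G j j' z:sp_in B"
   "!!j j' z. j < l ==> j' < m ==> pr j' (G j j' z) = G j j' z"
  and FG: "!!y j. y:Y ==> j < n ==> d (d' y) j:NJ"
  and NJB: "NJ <= sp_in B"
  and lift: "!!z k. z:NI ==> EX z':NJ. z':below deg (Suc k) & lev deg k z' = lev deg k z"
  and exact: "!!x. x:X ==> (!!j. j < n ==> d x j:NI) ==> EX y:Y. ALL j<m. x j - d' y j:NI"
  and x: "x:X" and dx: "!!j. j < n ==> d x j:NJ"
 shows "EX y:Y. ALL j<m. x j - d' y j:NJ"
proof (rule exactness_lift[where X = X and Y = Y and d = d and d' = d' and m = m and m'' = n, OF _ _ _ _ _ _ _ _ _ _ _ _ _ _ _ FG exact x dx])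
 have Fl: "plin (F j j')" if "j < m" "j' < n" for j j' using F(1)[OF that] by (simp add: raises_def)
 have Gl: "plin (G j j')" if "j < l" "j' < m" for j j' using G(1)[OF that] by (simp add: raises_def)
 fix x y :: "nat => ('b \<Rightarrow>\<^sub>0 complex)" and k j :: nat
 show "(%j. x j - y j):X" if "x:X" "y:X"
  using that by (auto simp: X_def pl_df[OF pr(1)] sub_diff)
 show "(%j. lev deg k (x j)):X" if "x:X" using that by (auto simp: X_def pr(2)[symmetric] lev_sp_in)
 show "(%j. lev deg k (y j)):Y" if "y:Y" using that by (auto simp: Y_def pr'(2)[symmetric] lev_sp_in)
 show "(%j. x j + y j):Y" if "x:Y" "y:Y"
  using that by (auto simp: Y_def pl_add[OF pr'(1)] sub_add)
 show "(%_. 0):Y" by (auto simp: Y_def pl_zr[OF pr'(1)] sub_0)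
 show "EX x':X. ALL j<m. x' j:NJ & x' j:below deg (Suc k) & lev deg k (x' j) = lev deg k (x j)"
  if xX: "x:X" and xN: "!!j. j < m ==> x j:NI"
 proof -
  have "EX z'. j < m --> z':NJ & z':below deg (Suc k) & lev deg k z' = lev deg k (x j)" for j
   using lift[OF xN, of j k] by blast
  then obtain z where z: "!!j. j < m ==> z j:NJ & z j:below deg (Suc k) & lev deg k (z j) = lev deg k (x j)" by metis
  have b: "pr j z:below deg (Suc k)" if j: "j < m" and "z:below deg (Suc k)" for j z
  proof -
   have "lev deg i (pr j z) = 0" if "i \<ge> Suc k" for i
    unfolding pr(2)[OF j] using lev_below[OF below_mono[OF `z:below deg (Suc k)` that]] by (simp add: pl_zr[OF pr(1)[OF j]])
   thus ?thesis unfolding below_i by (metis lk_lev lookup_zero not_le)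
  qed
  show ?thesis
  \<comment> \<open>The lifts of the single coordinates may leave X. Projecting them keeps their
    components of degree k, because the projection is homogeneous and fixes
    \<open>x j\<close>.\<close>
  proof (rule bexI[of _ "%j. pr j (z j)"], intro allI impI conjI)
   show "(%j. pr j (z j)):X" using z NJB by (auto simp: X_def pr)
   fix j assume j: "j < m"
   show "pr j (z j):NJ" "pr j (z j):below deg (Suc k)" using z[OF j] pr(4)[OF j] b[OF j] by blast+
   have "lev deg k (pr j (z j)) = pr j (lev deg k (x j))" using z[OF j] by (simp add: pr(2)[OF j])
   also have "... = lev deg k (pr j (x j))" by (simp add: pr(2)[OF j])
   finally show "lev deg k (pr j (z j)) = lev deg k (x j)" using xX j by (simp add: X_def)
  qed
 qed
 show "d (%j. x j - y j) j = d x j - d y j" if "j < n"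
  using that by (simp add: d_def pl_df[OF Fl] sum_subtractf)
 show "lev deg (Suc k) (d x j) = d (%j. lev deg k (x j)) j" if "j < n"
  using that F(1) by (simp add: d_def pl_sum[OF pl_lev] raises_def)
 show "d x j:below deg (Suc k)" if "!!j. j < m ==> x j:below deg k" "j < n"
  unfolding d_def using that raises_below[OF F(1)] by (intro sub_sum below_sub) auto
 show "d x j:NJ" if "!!j. j < m ==> x j:NJ" "j < n"
  unfolding d_def using that F(2) by (intro sub_sum NJ_sub) auto
 show "d' y:X" if "y:Y"
  unfolding X_def
 proof (intro CollectI allI impI conjI)
  fix j' assume j': "j' < m"
  show "d' y j':sp_in B" unfolding d'_def using that G(2) j' by (intro sub_sum sub_sp_in) (auto simp: Y_def)
  show "pr j' (d' y j') = d' y j'" unfolding d'_def using G(3) j' by (simp add: pl_sum[OF pr(1)])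
 qed
 show "d' (%_. 0) j = 0" if "j < m" using that by (simp add: d'_def pl_zr[OF Gl])
 show "d' (%j. x j + y j) j = d' x j + d' y j" if "j < m" using that by (simp add: d'_def pl_add[OF Gl] sum.distrib)
 show "lev deg (Suc k) (d' y j) = d' (%j. lev deg k (y j)) j" if "j < m"
  using that G(1) by (simp add: d'_def pl_sum[OF pl_lev] raises_def)
 show "lev deg 0 (d' y j) = 0" if "j < m"
  using that G(1) by (simp add: d'_def pl_sum[OF pl_lev] raises_def)
qed

end

lemma pc2_deg: "pc2 b c = Some r ==> deg2 r = deg2 b + deg2 c"
 by (cases b; cases c) (auto simp: pc2_def deg2_def bind_eq_Some_conv dest!: plen_pcomp)

lemma lev_bas: "lev deg k (bas b) = (if deg b = k then bas b else 0)"
 by (rule pmI) (auto simp: lk_lev lk_bas)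

lemma lev_emul:
 assumes "M:sp_in {x. deg2 x = l}"
 shows "lev deg2 k (z ** M) = (if l \<le> k then lev deg2 (k - l) z ** M else 0)"
  and "lev deg2 k (M ** z) = (if l \<le> k then M ** lev deg2 (k - l) z else 0)"
proof -
 have b: "lev deg2 k (obas (pc2 b c)) = (if deg2 b + deg2 c = k then obas (pc2 b c) else 0)" for b c :: "('v, 'e) qpath \<times> ('v, 'e) qpath" and k
  by (cases "pc2 b c") (auto simp: lev_bas pc2_deg pl_zr[OF pl_lev])
 have d: "deg2 c = l" if "c:ks M" for c using assms that by (auto simp: sp_in_def)
 have "lev deg2 k (z ** M) - (if l \<le> k then lev deg2 (k - l) z ** M else 0) = 0"
 proof (rule bilin_eqI[of "%z M. lev deg2 k (z ** M) - (if l \<le> k then lev deg2 (k - l) z ** M else 0)" "%_ _. 0"])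
  fix b c assume "b:ks z" "c:ks M"
  thus "lev deg2 k (bas b ** bas c) - (if l \<le> k then lev deg2 (k - l) (bas b) ** bas c else 0) = 0"
   using d[of c] by (auto simp: b lev_bas)
 qed (auto simp: plin_def pl_add[OF pl_lev] pl_sc[OF pl_lev] bm_add_l bm_add_r bm_sc_l bm_sc_r sc_diff)
 thus "lev deg2 k (z ** M) = (if l \<le> k then lev deg2 (k - l) z ** M else 0)" by simp
 have "lev deg2 k (M ** z) - (if l \<le> k then M ** lev deg2 (k - l) z else 0) = 0"
 proof (rule bilin_eqI[of "%M z. lev deg2 k (M ** z) - (if l \<le> k then M ** lev deg2 (k - l) z else 0)" "%_ _. 0"])
  fix b c assume "b:ks z" "c:ks M"
  thus "lev deg2 k (bas c ** bas b) - (if l \<le> k then bas c ** lev deg2 (k - l) (bas b) else 0) = 0"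
   using d[of c] by (auto simp: b lev_bas)
 qed (auto simp: plin_def pl_add[OF pl_lev] pl_sc[OF pl_lev] bm_add_l bm_add_r bm_sc_l bm_sc_r sc_diff)
 thus "lev deg2 k (M ** z) = (if l \<le> k then M ** lev deg2 (k - l) z else 0)" by simp
qed

context koszul_data
begin

lemma EE_deg: "EE i j:sp_in {x. deg2 x = 0}" by (simp add: EE_def deg2_def)

lemma raises_MM: "raises deg2 (%z. z ** MM i j j')" "raises deg2 (%z. MM i j j' ** z)"
 by (simp_all add: raises_def lev_emul[OF MM_deg])

lemma drow_drow: "drow i (drow (Suc i) y) j'' = (\<Sum>j<m (Suc (Suc i)). y j ** DD i j j'')"
 unfolding drow_def DD_def bm_sum_l bm_sum_r emul_as by (rule sum.swap)

lemma dcol_dcol: "dcol (Suc i) (dcol i c) j = (\<Sum>j''<m i. DD i j j'' ** c j'')"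
 unfolding dcol_def DD_def bm_sum_l bm_sum_r emul_as by (rule sum.swap)

end

context koszul_pbw
begin

lemma row_exact_lift:
 assumes exact: "!!x. row (Suc i) x ==> (!!j. j < m i ==> drow i x j:I.NN) ==>
   EX y. row (Suc (Suc i)) y & (ALL j<m (Suc i). x j - drow (Suc i) y j:I.NN)"
  and x: "row (Suc i) x" and dx: "!!j. j < m i ==> drow i x j:J.NN"
 shows "EX y. row (Suc (Suc i)) y & (ALL j<m (Suc i). x j - drow (Suc i) y j:J.NN)"
proof -
 have "EX y:{y. ALL j<m (Suc (Suc i)). y j:Te & y j ** EE (Suc (Suc i)) j = y j}. ALL j<m (Suc i). x j - drow (Suc i) y j:J.NN"
  unfolding drow_def
 proof (rule NN.matrix_exactness_lift[where n = "m i" and F = "%j j' z. z ** MM i j j'" and pr = "%j z. z ** EE (Suc i) j"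
    and G = "%j j' z. z ** MM (Suc i) j j'" and pr' = "%j z. z ** EE (Suc (Suc i)) j"])
  show "EX y:{y. ALL j<m (Suc (Suc i)). y j:Te & y j ** EE (Suc (Suc i)) j = y j}. ALL j<m (Suc i). x j - (\<Sum>j'<m (Suc (Suc i)). y j' ** MM (Suc i) j' j):I.NN"
   if "x:{x. ALL j<m (Suc i). x j:Te & x j ** EE (Suc i) j = x j}" "!!j. j < m i ==> (\<Sum>j'<m (Suc i). x j' ** MM i j' j):I.NN" for x
   using exact[of x] that unfolding row_def drow_def by blast
  show "x:{x. ALL j<m (Suc i). x j:Te & x j ** EE (Suc i) j = x j}" using x by (simp add: row_def)
  show "(\<Sum>j'<m (Suc i). x j' ** MM i j' j):J.NN" if "j < m i" for j using dx[OF that] by (simp add: drow_def)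
  show "(\<Sum>j<m (Suc i). (\<Sum>ja<m (Suc (Suc i)). y ja ** MM (Suc i) ja j) ** MM i j j'):J.NN"
   if "y:{y. ALL j<m (Suc (Suc i)). y j:Te & y j ** EE (Suc (Suc i)) j = y j}" "j' < m i" for y j'
   using drow_drow[of i y j'] that unfolding drow_def
   by (auto intro!: sub_sum J.NN_l DD_J)
 qed (auto simp: raises_MM emul_as MM_EE lev_emul[OF EE_deg] intro: J.NN_r I.Te_mult MM_Te NN_lift subsetD[OF J.NN_Te])
 thus ?thesis unfolding row_def by blast
qed

lemma col_exact_lift:
 assumes exact: "!!x. col (Suc i) x ==> (!!j. j < m (Suc (Suc i)) ==> dcol (Suc i) x j:I.NN) ==>
   EX y. col i y & (ALL j<m (Suc i). x j - dcol i y j:I.NN)"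
  and x: "col (Suc i) x" and dx: "!!j. j < m (Suc (Suc i)) ==> dcol (Suc i) x j:J.NN"
 shows "EX y. col i y & (ALL j<m (Suc i). x j - dcol i y j:J.NN)"
proof -
 have "EX y:{y. ALL j<m i. y j:Te & EE i j ** y j = y j}. ALL j<m (Suc i). x j - dcol i y j:J.NN"
  unfolding dcol_def
 proof (rule NN.matrix_exactness_lift[where n = "m (Suc (Suc i))" and F = "%j' j z. MM (Suc i) j j' ** z" and pr = "%j z. EE (Suc i) j ** z"
    and G = "%j' j z. MM i j j' ** z" and pr' = "%j z. EE i j ** z"])
  show "EX y:{y. ALL j<m i. y j:Te & EE i j ** y j = y j}. ALL j<m (Suc i). x j - (\<Sum>j'<m i. MM i j j' ** y j'):I.NN"
   if "x:{x. ALL j<m (Suc i). x j:Te & EE (Suc i) j ** x j = x j}" "!!j. j < m (Suc (Suc i)) ==> (\<Sum>j'<m (Suc i). MM (Suc i) j j' ** x j'):I.NN" for x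
   using exact[of x] that unfolding col_def dcol_def by blast
  show "x:{x. ALL j<m (Suc i). x j:Te & EE (Suc i) j ** x j = x j}" using x by (simp add: col_def)
  show "(\<Sum>j'<m (Suc i). MM (Suc i) j j' ** x j'):J.NN" if "j < m (Suc (Suc i))" for j using dx[OF that] by (simp add: dcol_def)
  show "(\<Sum>j<m (Suc i). MM (Suc i) j' j ** (\<Sum>ja<m i. MM i j ja ** y ja)):J.NN"
   if "y:{y. ALL j<m i. y j:Te & EE i j ** y j = y j}" "j' < m (Suc (Suc i))" for y j'
   using dcol_dcol[of i y j'] that unfolding dcol_def
   by (auto intro!: sub_sum J.NN_r DD_J)
 qed (auto simp: raises_MM emul_as[symmetric] EE_MM lev_emul[OF EE_deg] intro: J.NN_l I.Te_mult MM_Te NN_lift subsetD[OF J.NN_Te])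
 thus ?thesis unfolding col_def by blast
qed

lemma col_exact_lift_0:
 assumes exact: "!!x j. col 0 x ==> (!!j. j < m (Suc 0) ==> dcol 0 x j:I.NN) ==> j < m 0 ==> x j:I.NN"
  and x: "col 0 x" and dx: "!!j. j < m (Suc 0) ==> dcol 0 x j:J.NN" and j: "j < m 0"
 shows "x j:J.NN"
proof -
 \<comment> \<open>With no coordinates in the source, exactness says that the kernel vanishes modulo
   the relations.\<close>
 have "EX y:{y :: nat => _. ALL j<0. y j:Te & y j = y j}. ALL j<m 0. x j - (\<Sum>j'<0. y j'):J.NN"
 proof (rule NN.matrix_exactness_lift[where n = "m (Suc 0)" and F = "%j' j z. MM 0 j j' ** z" and pr = "%j z. EE 0 j ** z" and G = "%_ _ z. z" and pr' = "%_ z. z"])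
  show "EX y:{y :: nat => _. ALL j<0. y j:Te & y j = y j}. ALL j<m 0. x j - (\<Sum>j'<0. y j'):I.NN"
   if "x:{x. ALL j<m 0. x j:Te & EE 0 j ** x j = x j}" "!!j. j < m (Suc 0) ==> (\<Sum>j'<m 0. MM 0 j j' ** x j'):I.NN" for x
   using exact[of x] that unfolding col_def dcol_def by auto
  show "x:{x. ALL j<m 0. x j:Te & EE 0 j ** x j = x j}" using x by (simp add: col_def)
  show "(\<Sum>j'<m 0. MM 0 j j' ** x j'):J.NN" if "j < m (Suc 0)" for j using dx[OF that] by (simp add: dcol_def)
 qed (auto simp: raises_MM emul_as[symmetric] EE_MM lev_emul[OF EE_deg] intro: J.NN_l I.Te_mult MM_Te NN_lift subsetD[OF J.NN_Te] sub_0)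
 thus ?thesis using j by simp
qed

end

section \<open>The Koszul resolution\<close>

context koszul_data
begin

text \<open>The basis elements of K_0 = S are scalar multiples of trivial paths: \<open>lam\<close>
  is the scalar and \<open>mu\<close> the coordinate of the unit. \<open>uu z\<close> are then the
  coordinates of z as an element of A tensor S tensor A over S.\<close>

definition lam where "lam j = lk (kb 0 j) (triv (hd 0 j))"
definition mu where "mu j = kp 0 j (triv (hd 0 j))"
definition uu where "uu z j = pscale (mu j) (z ** EE 0 j)"

lemma kb_0:
 assumes j: "j < m 0"
 shows "tl 0 j = hd 0 j" "kb 0 j = pscale (lam j) (ev (hd 0 j))"
proof -
 have V: "kb 0 j:Vpow Q 0" using kb_K[OF j] by (simp add: K_0)
 have "kb 0 j ~= 0" using dual[OF j j] by auto
 then obtain p where p: "lk (kb 0 j) p ~= 0" by (metis lookup_zero pmI)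
 have "ptail p = phead p" using Vpow_lk[OF V p] plen_0 by blast
 thus t: "tl 0 j = hd 0 j" using kb_ends[OF j p] by simp
 have "ev (hd 0 j) *. kb 0 j *. ev (hd 0 j) = kb 0 j" using kb_EE[OF j] t by simp
 thus "kb 0 j = pscale (lam j) (ev (hd 0 j))"
  by (simp add: Vpow_0_ev(2)[OF V] bm_sc_l ev_ev lam_def del: bm_bas)
qed

lemma lam_kap: "j < m 0 ==> j' < m 0 ==> lam j' * kp 0 j (triv (hd 0 j')) = (if j = j' then 1 else 0)"
 using dual[of j 0 j'] kb_0(2)[of j'] by (metis pr_sc pairing_bas)

lemma EE_EE_0: "j < m 0 ==> j' < m 0 ==> EE 0 j' ** EE 0 j = (if hd 0 j' = hd 0 j then EE 0 j else 0)"
 by (simp add: EE_ten ten_emul kb_0(1) ev_ev pl_zr[OF pl_ten_l] del: bm_bas ten_bas)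

lemma pl_uu: "plin (%z. uu z j)"
 unfolding uu_def by (intro pl_pscale pl_bm_l)

lemma uu_row: "z:Te ==> row 0 (uu z)"
 unfolding row_def uu_def by (auto simp: bm_sc_l emul_as intro!: sub_scale bm_sp[OF _ EE_Te]
  split: option.splits simp: pc2_def bind_eq_Some_conv intro: pcomp_in)

lemma row_uu:
 assumes x: "row 0 x" and j: "j < m 0"
 shows "uu (\<Sum>j'<m 0. pscale (lam j') (x j')) j = x j"
proof -
 have "uu (\<Sum>j'<m 0. pscale (lam j') (x j')) j = (\<Sum>j'<m 0. pscale (mu j * lam j') (x j' ** EE 0 j))"
  by (simp add: uu_def bm_sum_l bm_sc_l sc_sum)
 also have "... = (\<Sum>j'<m 0. if j' = j then x j else 0)"
 proof (rule sum.cong[OF refl])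
  fix j' assume "j':{..<m 0}"
  hence j': "j' < m 0" by simp
  have "x j' ** EE 0 j = x j' ** (EE 0 j' ** EE 0 j)" using x j' by (simp add: row_def emul_as[symmetric])
  also have "... = (if hd 0 j' = hd 0 j then x j' ** EE 0 j else 0)" by (simp add: EE_EE_0[OF j j'])
  finally have 1: "x j' ** EE 0 j = (if hd 0 j' = hd 0 j then x j' ** EE 0 j else 0)" .
  show "pscale (mu j * lam j') (x j' ** EE 0 j) = (if j' = j then x j else 0)"
  proof (cases "hd 0 j' = hd 0 j")
   case True
   hence "mu j * lam j' = (if j = j' then 1 else 0)" using lam_kap[OF j j'] by (simp add: mu_def mult.commute)
   thus ?thesis using x j by (auto simp: row_def)
  next
   case False
   hence "x j' ** EE 0 j = 0" using 1 by simp
   thus ?thesis using False by auto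
  qed
 qed
 finally show ?thesis using j by simp
qed

lemma mu_unit: "j < m 0 ==> pairing (kp 0 j) unitT = mu j"
proof -
 assume j: "j < m 0"
 have "pairing (kp 0 j) unitT = (\<Sum>v\<in>verts Q. if v = hd 0 j then mu j else 0)"
  unfolding unitT_def pr_sum
  by (rule sum.cong) (use kap_ends[OF j, of "triv _"] in \<open>auto simp: mu_def\<close>)
 thus ?thesis using ht_verts[OF j] by simp
qed

lemma nm_arrow: "a:arcs Q ==> nm 0 j (av a) = pscale (kp 0 j (triv (tail Q a))) (ten (av a) unitT) - pscale (kp 0 j (triv (head Q a))) (ten unitT (av a))"
proof -
 assume a: "a:arcs Q"
 have l: "ldel (ar b) (av a) = (if b = a then ev (tail Q a) else 0)" for b by (rule ldel_av) (simp add: pcomp_tr_r)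
 have r: "rdel (ar b) (av a) = (if b = a then ev (head Q a) else 0)" for b by (rule rdel_av) (simp add: pcomp_tr_l)
 have "nm 0 j (av a) = (\<Sum>b\<in>arcs Q. if b = a then pscale (kp 0 j (triv (tail Q a))) (ten (av a) unitT) - pscale (kp 0 j (triv (head Q a))) (ten unitT (av a)) else 0)"
  unfolding nm_def cL_def cR_def l r by (rule sum.cong) auto
 thus ?thesis using a by simp
qed

lemma drow_add: "drow i (%j. x j + y j) j' = drow i x j' + drow i y j'"
 and drow_sc: "drow i (%j. pscale c (x j)) j' = pscale c (drow i x j')"
 and drow_zr: "drow i (%_. 0) j' = 0"
 by (simp_all add: drow_def bm_add_l bm_sc_l sum.distrib sc_sum)

lemma row_add: "row i x ==> row i y ==> row i (%j. x j + y j)"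
 and row_sc: "row i x ==> row i (%j. pscale c (x j))"
 and row_zr: "row i (%_. 0)"
 by (simp_all add: row_def bm_add_l bm_sc_l sub_add sub_scale sub_0)

text \<open>The difference is the Koszul boundary of x tensor a tensor y; w is that element in
  coordinates.\<close>

lemma arrow_boundary:
 assumes a: "a:arcs Q" and x: "x:T" and y: "y:T"
 shows "EX w. row (Suc 0) w & (ALL j<m 0. uu (ten (x *. av a) y) j - uu (ten x (av a *. y)) j = drow 0 w j)"
proof -
 define w where "w = (%l. pscale (pairing (kp (Suc 0) l) (av a)) (ten x y ** EE (Suc 0) l))"
 have xy: "ten x y:Te" using x y lk_ten[of x y] by (auto simp: sp_in_i)
 have aK: "av a:K (Suc 0)" using a by (simp add: K_1)
 have "row (Suc 0) w"
  unfolding row_def w_def by (auto simp: bm_sc_l emul_as intro!: sub_scale bm_sp[OF xy EE_Te]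
   split: option.splits simp: pc2_def bind_eq_Some_conv intro: pcomp_in)
 moreover have "uu (ten (x *. av a) y) j - uu (ten x (av a *. y)) j = drow 0 w j" if j: "j < m 0" for j
 proof -
  have "drow 0 w j = (\<Sum>l<m (Suc 0). pscale (pairing (kp (Suc 0) l) (av a)) (ten x y ** (nm 0 j (kb (Suc 0) l) ** EE 0 j)))"
   unfolding drow_def w_def
   by (rule sum.cong[OF refl]) (simp add: bm_sc_l emul_as EE_MM[OF _ j] nm_EE[OF _ j])
  also have "... = ten x y ** (nm 0 j (av a) ** EE 0 j)"
   unfolding nm_expand[OF aK] by (simp only: bm_sum_l bm_sum_r bm_sc_l bm_sc_r)
  also have "... = pscale (kp 0 j (triv (tail Q a))) (ten (x *. av a) y ** EE 0 j) - pscale (kp 0 j (triv (head Q a))) (ten x (av a *. y) ** EE 0 j)"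
   using uT_l[OF y] uT_r[OF x] unfolding nm_arrow[OF a] emul_as[symmetric]
   by (simp only: bm_df_l bm_df_r bm_sc_l bm_sc_r ten_emul)
  also have "pscale (kp 0 j (triv (tail Q a))) (ten (x *. av a) y ** EE 0 j) = uu (ten (x *. av a) y) j"
   by (cases "tail Q a = hd 0 j") (simp_all add: uu_def mu_def EE_ten ten_emul tmul_as ev_av pl_zr[OF pl_ten_l] del: bm_bas ten_bas)
  also have "pscale (kp 0 j (triv (head Q a))) (ten x (av a *. y) ** EE 0 j) = uu (ten x (av a *. y)) j"
   by (cases "head Q a = hd 0 j") (simp_all add: uu_def mu_def EE_ten ten_emul kb_0(1)[OF j] tmul_as[symmetric] ev_av pl_zr[OF plin_ten_right] del: bm_bas ten_bas)
  finally show ?thesis by simp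
 qed
 ultimately show ?thesis by blast
qed

lemma eact_unit_ten: "x:T ==> eact (ten x y) unitT = x *. y"
 by (simp add: eact_ten uT_r)

text \<open>Arrows are moved one at a time from the right factor to the left one, each move changing
  z by a boundary. So exactness at the augmentation is proved directly for every quotient of CQ
  instead of being lifted from A.\<close>

lemma uu_reduce:
 assumes z: "z:Te"
 shows "EX w. row (Suc 0) w & (ALL j<m 0. uu z j - uu (ten (eact z unitT) unitT) j = drow 0 w j)"
proof -
 let ?f = "%z j. uu z j - uu (ten (eact z unitT) unitT) j"
 let ?S = "{z. EX w. row (Suc 0) w & (ALL j<m 0. ?f z j = drow 0 w j)}"
 have f: "plin (%z. ?f z j)" for j
  by (intro pl_sub pl_uu pl_o[OF pl_uu] pl_o[OF pl_ten_l pl_eact_l])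
 have S: "subsp ?S"
 proof (rule pm.subspaceI)
  show "0:?S" using row_zr[of "Suc 0"] drow_zr[of 0] pl_zr[OF f] by force
  show "x + y:?S" if xy: "x:?S" "y:?S" for x y
  proof -
   obtain v w where "row (Suc 0) v" "ALL j<m 0. ?f x j = drow 0 v j" "row (Suc 0) w" "ALL j<m 0. ?f y j = drow 0 w j" using xy by blast
   hence "row (Suc 0) (%j. v j + w j) & (ALL j<m 0. ?f (x + y) j = drow 0 (%j. v j + w j) j)"
    unfolding drow_add pl_add[OF f] by (simp add: row_add)
   thus ?thesis by blast
  qed
  show "pscale c x:?S" if xy: "x:?S" for c x
  proof -
   obtain v where "row (Suc 0) v" "ALL j<m 0. ?f x j = drow 0 v j" using xy by blast
   hence "row (Suc 0) (%j. pscale c (v j)) & (ALL j<m 0. ?f (pscale c x) j = drow 0 (%j. pscale c (v j)) j)"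
    unfolding drow_sc pl_sc[OF f] by (simp add: row_sc)
   thus ?thesis by blast
  qed
 qed
 have "ten x (bas q):?S" if "x:T" "q:qpaths Q" for x q
  using that
 proof (induction "plen q" arbitrary: x q)
  case 0
  then obtain v where q: "q = triv v" "v:verts Q" using plen_0[of q] ends_in[of q] by auto
  have "?f (ten x (bas q)) j = drow 0 (%_. 0) j" if j: "j < m 0" for j
   using kb_0(1)[OF j] uT_r[of "ev (hd 0 j)"] 0(2) q
   by (cases "v = hd 0 j")
    (simp_all add: drow_zr eact_unit_ten uu_def EE_ten ten_emul tmul_as pl_zr[OF pl_ten_l] pl_zr[OF plin_ten_right] ev_ev del: bm_bas ten_bas)
  thus ?case using row_zr[of "Suc 0"] by blast
 next
  case (Suc n)
  obtain a q' where a: "a:arcs Q" "q':qpaths Q" "plen q' = n" "pcomp (ar a) q' = Some q"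
   using split_last[OF Suc(4) Suc(2)[symmetric]] by blast
  have q: "bas q = av a *. bas q'" by (simp add: a(4))
  have xa: "x *. av a:T" using Suc(3) a(1) by (intro T_mult) simp_all
  obtain v where v: "row (Suc 0) v" "ALL j<m 0. ?f (ten (x *. av a) (bas q')) j = drow 0 v j"
   using Suc(1)[OF a(3)[symmetric] xa a(2)] by blast
  obtain w where w: "row (Suc 0) w" "ALL j<m 0. uu (ten (x *. av a) (bas q')) j - uu (ten x (av a *. bas q')) j = drow 0 w j"
   using arrow_boundary[OF a(1) Suc(3), of "bas q'"] a(2) by auto
  have "?f (ten x (bas q)) j = drow 0 (%j. v j + pscale (- 1) (w j)) j" if j: "j < m 0" for j
  proof -
   have "?f (ten x (bas q)) j = ?f (ten (x *. av a) (bas q')) j - drow 0 w j"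
    unfolding eact_unit_ten[OF xa] eact_unit_ten[OF Suc(3)] q w(2)[rule_format, OF j, symmetric] by (simp add: tmul_as)
   moreover have "drow 0 (%j. v j + pscale (- 1) (w j)) j = drow 0 v j - drow 0 w j" by (simp only: drow_add drow_sc) simp
   ultimately show ?thesis using v(2) j by simp
  qed
  thus ?case using row_add[OF v(1) row_sc[OF w(1), of "- 1"]] by blast
 qed
 hence "z:?S"
  using pl_in_sub_sp[OF pl_id S z] by (metis (no_types, lifting) SigmaE sp_in_bas ten_bas)
 thus ?thesis by blast
qed

definition eps where "eps x = (\<Sum>j<m 0. eact (x j) (kb 0 j))"

lemma eps_row: "row 0 x ==> eact (\<Sum>j<m 0. pscale (lam j) (x j)) unitT = eps x"
proof -
 assume x: "row 0 x"
 have "eact (x j) (kb 0 j) = pscale (lam j) (eact (x j) unitT)" if j: "j < m 0" for j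
 proof -
  have "eact (x j) unitT = eact (x j ** EE 0 j) unitT" using x j by (simp add: row_def)
  also have "... = eact (x j) (ev (hd 0 j))"
   using kb_0(1)[OF j] ht_verts[OF j] uT_r[of "ev (hd 0 j)"] by (simp add: eact_emul EE_ten eact_ten ev_ev del: bm_bas ten_bas)
  finally show ?thesis using kb_0(2)[OF j] by (simp add: pl_sc[OF plin_eact_right])
 qed
 thus ?thesis by (simp add: eps_def pl_sum[OF pl_eact_l] pl_sc[OF pl_eact_l])
qed

lemma eps_uu: "t:T ==> eps (uu (ten t unitT)) = t"
proof -
 assume t: "t:T"
 have "eact (uu (ten t unitT) j) (kb 0 j) = t *. pscale (mu j) (kb 0 j)" if j: "j < m 0" for j
  using eact_EE[OF j] kb_K[OF j] subsetD[OF K_T] by (simp add: uu_def pl_sc[OF pl_eact_l] eact_emul eact_ten bm_sc_r uT_r T_mult t)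
 hence "eps (uu (ten t unitT)) = t *. (\<Sum>j<m 0. pscale (mu j) (kb 0 j))" by (simp add: eps_def bm_sum_r)
 also have "(\<Sum>j<m 0. pscale (mu j) (kb 0 j)) = unitT"
  using expand[of unitT 0] unit_V0 by (simp add: mu_unit K_0)
 finally show ?thesis by (simp add: uT_r t)
qed

end

text \<open>The same matrices over two quotients: X = R gives A, X = P the deformation. The locale
  separates the formal part from the two facts that have to be lifted.\<close>

locale koszul_complex = quiver_quotient Q X + koszul_data Q R m kb kp hd tl
 for Q :: "('v, 'e) pre_digraph" and X R m kb kp hd tl +
 assumes DD_NN: "j < m (Suc (Suc i)) ==> j'' < m i ==> DD i j j'':NN"
  and rows_exact: "row (Suc i) x ==> (!!j. j < m i ==> drow i x j:NN) ==>
   EX y. row (Suc (Suc i)) y & (ALL j<m (Suc i). x j - drow (Suc i) y j:NN)"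
begin

text \<open>Modulo boundaries x is the tensor of its augmentation with the unit, and this lies in
  \<open>NN\<close> as soon as the augmentation lies in the ideal.\<close>

lemma rows_exact_0:
 assumes x: "row 0 x" and e: "eps x:J"
 shows "EX w. row (Suc 0) w & (ALL j<m 0. x j - drow 0 w j:NN)"
proof -
 let ?z = "\<Sum>j<m 0. pscale (lam j) (x j)"
 have z: "?z:Te" using x by (intro sub_sum sub_scale sub_sp_in) (simp add: row_def)
 obtain w where w: "row (Suc 0) w" "ALL j<m 0. uu ?z j - uu (ten (eps x) unitT) j = drow 0 w j"
  using uu_reduce[OF z] unfolding eps_row[OF x] by blast
 have "x j - drow 0 w j:NN" if j: "j < m 0" for j
 proof -
  have "x j - drow 0 w j = uu (ten (eps x) unitT) j" using w(2) j row_uu[OF x j] by (auto simp: algebra_simps)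
  also have "... : NN" unfolding uu_def using e j by (intro sub_scale NN_sub NN_r EE_Te ten_NN1) (simp_all add: uT_in)
  finally show ?thesis .
 qed
 thus ?thesis using w(1) by blast
qed

section \<open>The Koszul complex as left modules over the enveloping algebra, and its dual\<close>

definition eE where "eE i j = Psi (EE i j)"
definition PC where "PC i = idem_mod E (m i) (eE i)"
definition dC where "dC i x = (\<lambda>j'\<in>{..<m i}. comb (rgm E) (m (Suc i)) (%j. Psi (MM i j j')) x)"
definition eC where "eC = comb (diag_module A) (m 0) (%j. cl (kb 0 j))"
definition phi where "phi i c = comb (rgm E) (m i) (%j. Psi (c j))"
definition rowP where "rowP i z = (\<lambda>j\<in>{..<m i}. Psi (z j))"

lemma Psi_E [simp]: "z:Te ==> Psi z:cr E" by (simp add: Psi_image)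

lemma finsum_Psi: "finite S ==> (!!i. i:S ==> g i:Te) ==> finsum E (%i. Psi (g i)) S = Psi (sum g S)"
 unfolding Psi_def pl_sum[OF plin_lft] E_eq by (rule quot_finsum) (simp_all add: lft_sp)

lemma EE_eE: "idempotents E (eE i) (m i)"
 by (intro idempotents.intro idempotents_axioms.intro E_ring) (simp_all add: eE_def Psi_mult)

lemma PC_cr: "cr (PC i) = rowP i ` {z. row i z}"
proof (intro equalityI subsetI)
 fix x assume x: "x:cr (PC i)"
 hence xj: "x j:cr E" "x j *[E] eE i j = x j" if "j < m i" for j using that by (auto simp: PC_def)
 have "EX z. j < m i --> z:Te & x j = Psi z" for j using xj(1)[of j] by (auto simp: Psi_image)
 then obtain z where z: "!!j. j < m i ==> z j:Te & x j = Psi (z j)" by metis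
 have "x j = Psi (z j ** EE i j)" if "j < m i" for j
  using xj(2)[OF that] z[OF that] that by (simp add: eE_def Psi_mult)
 hence "x = rowP i (%j. z j ** EE i j)" using x by (auto simp: rowP_def PC_def fun_eq_iff)
 moreover have "row i (%j. z j ** EE i j)" using z by (auto simp: row_def emul_as Te_mult)
 ultimately show "x:rowP i ` {z. row i z}" by blast
next
 fix x assume "x:rowP i ` {z. row i z}"
 then obtain z where z: "row i z" "x = rowP i z" by blast
 thus "x:cr (PC i)" by (auto simp: PC_def rowP_def row_def eE_def Psi_mult)
qed

lemma rowP_eq: "row i z ==> row i w ==> rowP i z = rowP i w <-> (ALL j<m i. z j - w j:NN)"
proof -
 assume "row i z" "row i w"
 hence "Psi (z j) = Psi (w j) <-> z j - w j:NN" if "j < m i" for j using that by (simp add: row_def Psi_eq)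
 thus ?thesis by (auto simp: rowP_def fun_eq_iff)
qed

lemma PC_zr: "0[PC i] = rowP i (%_. 0)" by (simp add: PC_def rowP_def Psi_zr)

lemma comb_rowP: "row i z ==> (!!j. j < m i ==> c j:Te) ==>
  comb (rgm E) (m i) (%j. Psi (c j)) (rowP i z) = Psi (\<Sum>j<m i. z j ** c j)"
proof -
 assume z: "row i z" and c: "!!j. j < m i ==> c j:Te"
 interpret ring E by (rule E_ring)
 have "comb (rgm E) (m i) (%j. Psi (c j)) (rowP i z) = (\<Oplus>\<^bsub>E\<^esub>j\<in>{..<m i}. Psi (z j ** c j))"
  unfolding comb_def finsum_regular using z c
  by (intro finsum_cong') (auto simp: rowP_def row_def Psi_mult Te_mult)
 also have "... = Psi (\<Sum>j<m i. z j ** c j)" using z c by (intro finsum_Psi) (auto simp: row_def Te_mult)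
 finally show ?thesis .
qed

lemma dC_rowP: "row (Suc i) z ==> dC i (rowP (Suc i) z) = rowP i (drow i z)"
 by (auto simp: dC_def rowP_def[of i] drow_def comb_rowP MM_Te)

lemma drow_row: "row (Suc i) z ==> row i (drow i z)"
 unfolding row_def drow_def
 by (auto simp: bm_sum_l emul_as MM_EE intro!: sub_sum Te_mult MM_Te)

lemma E_diag: "left_module E (diag_module A)"
proof -
 interpret A: ring A by (rule A_ring)
 have s: "EX z:Te. a = Psi z" if "a:cr E" for a using that by (auto simp: Psi_image)
 have t: "EX x:T. a = cl x" if "a:cr A" for a using that by (auto simp: A_cr)
 have n: "EX y:cr A. y +[A] x = 0[A]" if "x:cr A" for x using A.l_neg[OF that] A.a_inv_closed[OF that] by blast
 have ab: "abelian_group (diag_module A)"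
  by (rule abelian_groupI) (simp_all add: diag_module_def A.a_ac)
 show ?thesis
 proof (rule left_module.intro[OF E_ring ab left_module_axioms.intro]; (unfold diag_module_def)?; simp)
  fix a b x y
  assume "a:cr E"
  then obtain z where z: "z:Te" "a = Psi z" using s by blast
  assume "x:cr A"
  then obtain t where t1: "t:T" "x = cl t" using t by blast
  show "env_act A a x:cr A" using z t1 by (simp add: env_act_Psi eact_T)
  show "env_act A a (x +[A] y) = env_act A a x +[A] env_act A a y" if "y:cr A"
   using t[OF that] z t1 by (auto simp: env_act_Psi A_add pl_add[OF plin_eact_right] sub_add)
  assume "b:cr E"
  then obtain w where w: "w:Te" "b = Psi w" using s by blast
  show "env_act A (a +[E] b) x = env_act A a x +[A] env_act A b x"
   using w z t1 by (auto simp: Psi_add env_act_Psi A_add pl_add[OF pl_eact_l] sub_add)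
  show "env_act A (a *[E] b) x = env_act A a (env_act A b x)"
   using w z t1 by (auto simp: Psi_mult env_act_Psi eact_emul eact_T Te_mult)
 next
  fix x assume "x:cr A"
  then obtain t where t1: "t:T" "x = cl t" using t by blast
  thus "env_act A 1[E] x = x"
   by (simp add: Psi_one env_act_Psi) (simp add: unitE_def eact_ten uT_l uT_r T_mult)
 qed
qed

lemma eC_rowP: "row 0 z ==> eC (rowP 0 z) = cl (eps z)"
proof -
 assume z: "row 0 z"
 have kT: "kb 0 j:T" if "j < m 0" for j using kb_K[OF that] K_T by blast
 interpret ring A by (rule A_ring)
 have fs: "finsum (diag_module A) = finsum A" by (simp add: finsum_def finprod_def diag_module_def fun_eq_iff)
 have "eC (rowP 0 z) = (\<Oplus>\<^bsub>A\<^esub>j\<in>{..<m 0}. cl (eact (z j) (kb 0 j)))"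
  unfolding eC_def comb_def fs using z kT
  by (intro finsum_cong') (auto simp: rowP_def row_def diag_module_def env_act_Psi eact_T)
 also have "... = cl (eps z)"
  unfolding eps_def A_eq using z kT by (intro quot_finsum) (auto simp: row_def eact_T)
 finally show ?thesis .
qed

lemma eps_drow: "row (Suc 0) z ==> eps (drow 0 z) = 0"
proof -
 have "eps (drow 0 z) = (\<Sum>j<m (Suc 0). eact (z j) (\<Sum>j'<m 0. eact (MM 0 j j') (kb 0 j')))"
  unfolding eps_def drow_def pl_sum[OF pl_eact_l] pl_sum[OF plin_eact_right] eact_emul by (rule sum.swap)
 thus ?thesis by (simp add: eact_MM_0 pl_zr[OF plin_eact_right])
qed

lemma kz_res: "fg_res E (diag_module A) PC dC eC"
 unfolding fg_res_def
proof (intro conjI allI E_diag)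
 interpret ring E by (rule E_ring)
 have kT: "kb 0 j:T" if "j < m 0" for j using kb_K[OF that] K_T by blast
 have cA: "cr (diag_module A) = cr A" "zero (diag_module A) = zero A" by (simp_all add: diag_module_def)
 show "fg_projective E (PC i)" for i unfolding PC_def by (rule idempotents.idem_fg_projective[OF EE_eE])
 show "lmod_hom E (PC (Suc i)) (PC i) (dC i)" for i
  unfolding PC_def dC_def by (rule matrix_hom[OF E_ring]) (auto simp: eE_def Psi_mult MM_Te MM_EE)
 show "lmod_hom E (PC 0) (diag_module A) eC"
  unfolding PC_def eC_def by (rule comb_hom[OF E_diag]) (simp add: cA kT)
 show "eC ` cr (PC 0) = cr (diag_module A)"
 proof (intro equalityI subsetI)
  fix x assume "x:eC ` cr (PC 0)"
  thus "x:cr (diag_module A)" using kT by (auto simp: PC_cr eC_rowP cA eps_def row_def intro!: clA sub_sum eact_T)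
 next
  fix x assume "x:cr (diag_module A)"
  then obtain t where t: "t:T" "x = cl t" by (auto simp: cA A_cr)
  have "row 0 (uu (ten t unitT))" by (rule uu_row) (simp add: ten_Te t uT_in)
  moreover have "eC (rowP 0 (uu (ten t unitT))) = x" using t by (simp add: eC_rowP calculation eps_uu)
  ultimately show "x:eC ` cr (PC 0)" unfolding PC_cr by blast
 qed
 show "dC 0 ` cr (PC 1) = {x:cr (PC 0). eC x = 0[diag_module A]}"
 proof (intro equalityI subsetI)
  fix x assume "x:dC 0 ` cr (PC 1)"
  then obtain z where z: "row (Suc 0) z" "x = rowP 0 (drow 0 z)" by (auto simp: PC_cr dC_rowP)
  thus "x:{x:cr (PC 0). eC x = 0[diag_module A]}"
   using drow_row[OF z(1)] by (auto simp: PC_cr eC_rowP eps_drow cA A_zero)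
 next
  fix x assume "x:{x:cr (PC 0). eC x = 0[diag_module A]}"
  then obtain z where z: "row 0 z" "x = rowP 0 z" "cl (eps z) = cl 0" by (auto simp: PC_cr eC_rowP cA A_zero)
  hence "eps z:J" by (simp add: cl_eq del: qcos_zr)
  from rows_exact_0[OF z(1) this] obtain w where w: "row (Suc 0) w" "ALL j<m 0. z j - drow 0 w j:NN" by blast
  hence "x = dC 0 (rowP (Suc 0) w)" using z by (simp add: dC_rowP rowP_eq drow_row)
  thus "x:dC 0 ` cr (PC 1)" using w(1) by (auto simp: PC_cr)
 qed
 show "dC (Suc i) ` cr (PC (Suc (Suc i))) = {x:cr (PC (Suc i)). dC i x = 0[PC i]}" for i
 proof (intro equalityI subsetI)
  fix x assume "x:dC (Suc i) ` cr (PC (Suc (Suc i)))"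
  then obtain z where z: "row (Suc (Suc i)) z" "x = rowP (Suc i) (drow (Suc i) z)" by (auto simp: PC_cr dC_rowP)
  have "drow i (drow (Suc i) z) j:NN" if "j < m i" for j
   unfolding drow_drow using z that by (intro sub_sum NN_sub NN_l DD_NN) (auto simp: row_def)
  thus "x:{x:cr (PC (Suc i)). dC i x = 0[PC i]}"
   using drow_row[OF z(1)] drow_row[OF drow_row[OF z(1)]] by (auto simp: z(2) PC_cr dC_rowP PC_zr rowP_eq row_zr)
 next
  fix x assume "x:{x:cr (PC (Suc i)). dC i x = 0[PC i]}"
  then obtain z where z: "row (Suc i) z" "x = rowP (Suc i) z" "rowP i (drow i z) = rowP i (%_. 0)"
   by (auto simp: PC_cr dC_rowP PC_zr)
  hence "drow i z j:NN" if "j < m i" for j using that by (simp add: rowP_eq row_zr drow_row)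
  from rows_exact[OF z(1) this] obtain w where w: "row (Suc (Suc i)) w" "ALL j<m (Suc i). z j - drow (Suc i) w j:NN" by blast
  hence "x = dC (Suc i) (rowP (Suc (Suc i)) w)" using z by (simp add: dC_rowP rowP_eq drow_row)
  thus "x:dC (Suc i) ` cr (PC (Suc (Suc i)))" using w(1) by (auto simp: PC_cr)
 qed
qed

lemma phi_hom: "col i c ==> lmod_hom E (PC i) (rgm E) (phi i c)"
 unfolding PC_def phi_def by (rule comb_hom[OF l_mod_regular[OF E_ring]]) (simp add: col_def)

lemma phi_rowP: "row i z ==> col i c ==> phi i c (rowP i z) = Psi (\<Sum>j<m i. z j ** c j)"
 unfolding phi_def by (rule comb_rowP) (simp_all add: col_def)

lemma dcol_col: "col i c ==> col (Suc i) (dcol i c)"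
 unfolding col_def dcol_def
 by (auto simp: bm_sum_r emul_as[symmetric] EE_MM intro!: sub_sum Te_mult MM_Te)

lemma phi_dC: "col i c ==> x:cr (PC (Suc i)) ==> phi i c (dC i x) = phi (Suc i) (dcol i c) x"
proof -
 assume c: "col i c" and "x:cr (PC (Suc i))"
 then obtain z where z: "row (Suc i) z" "x = rowP (Suc i) z" by (auto simp: PC_cr)
 have "(\<Sum>j'<m i. drow i z j' ** c j') = (\<Sum>j<m (Suc i). z j ** dcol i c j)"
  unfolding drow_def dcol_def bm_sum_l bm_sum_r emul_as by (rule sum.swap)
 thus ?thesis using z c by (simp add: dC_rowP phi_rowP drow_row dcol_col)
qed

lemma unit_row: "j < m i ==> row i (%j'. if j' = j then EE i j else 0)"
 by (simp add: row_def sub_0)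

lemma phi_unit: "col i c ==> j < m i ==> phi i c (rowP i (%j'. if j' = j then EE i j else 0)) = Psi (c j)"
proof -
 assume c: "col i c" and j: "j < m i"
 have "(\<Sum>j'<m i. (if j' = j then EE i j else 0) ** c j') = (\<Sum>j'<m i. if j' = j then c j else 0)"
  by (rule sum.cong) (use c j in \<open>auto simp: col_def\<close>)
 thus ?thesis using c j by (simp add: phi_rowP unit_row)
qed

lemma col_df: "col i b ==> col i c ==> col i (%j. b j - c j)"
 by (simp add: col_def bm_df_r sub_diff)

lemma phi_eq_i: "col i b ==> col i c ==> (ALL x:cr (PC i). phi i b x = phi i c x) <-> (ALL j<m i. b j - c j:NN)"
proof (intro iffI allI ballI impI)
 fix j assume b: "col i b" "col i c" and e: "ALL x:cr (PC i). phi i b x = phi i c x" and j: "j < m i"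
 have "Psi (b j) = Psi (c j)" using e phi_unit[OF b(1) j] phi_unit[OF b(2) j] unit_row[OF j] by (auto simp: PC_cr)
 thus "b j - c j:NN" using b j by (simp add: Psi_eq col_def)
next
 fix x assume b: "col i b" "col i c" and n: "ALL j<m i. b j - c j:NN" and x: "x:cr (PC i)"
 obtain z where z: "row i z" "x = rowP i z" using x by (auto simp: PC_cr)
 have "(\<Sum>j<m i. z j ** b j) - (\<Sum>j<m i. z j ** c j) = (\<Sum>j<m i. z j ** (b j - c j))" by (simp add: bm_df_r sum_subtractf)
 also have "... : NN" using n z by (intro sub_sum NN_sub NN_l) (auto simp: row_def)
 finally have n': "(\<Sum>j<m i. z j ** b j) - (\<Sum>j<m i. z j ** c j):NN" .
 have "(\<Sum>j<m i. z j ** a j):Te" if "col i a" for a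
  using that z(1) by (intro sub_sum sub_sp_in Te_mult) (auto simp: row_def col_def)
 thus "phi i b x = phi i c x" using n' b by (simp add: z(2) phi_rowP[OF z(1)] Psi_eq)
qed

text \<open>The images of the generators determine the homomorphism. Their representatives are
  multiplied by the idempotents, which fix the generators, to obtain a genuine column.\<close>

lemma hom_phi:
 assumes h: "lmod_hom E (PC i) (rgm E) fi"
 obtains c where "col i c" "!!x. x:cr (PC i) ==> fi x = phi i c x"
proof -
 interpret idempotents E "eE i" "m i" by (rule EE_eE)
 have u: "unitv j:cr (PC i)" if "j < m i" for j unfolding PC_def using that by (rule unitv)
 have "EX z. j < m i --> z:Te & fi (unitv j) = Psi z" for j
  using lhD(1)[OF h u] by (auto simp: Psi_image)
 then obtain z where z: "!!j. j < m i ==> z j:Te & fi (unitv j) = Psi (z j)" by metis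
 have e: "Psi (z j) = Psi (EE i j ** z j)" if j: "j < m i" for j
 proof -
  have "eE i j *.[PC i] unitv j = unitv j" unfolding PC_def using e[OF j] ee[OF j] by (auto simp: unitv_def fun_eq_iff)
  hence "fi (unitv j) = eE i j *[E] fi (unitv j)" using lhD(3)[OF h e[OF j] u[OF j]] by simp
  thus ?thesis using z[OF j] j by (simp add: eE_def Psi_mult)
 qed
 define c where "c = (%j. EE i j ** z j)"
 have c: "col i c" using z by (auto simp: col_def c_def emul_as[symmetric] Te_mult)
 moreover have "fi x = phi i c x" if "x:cr (PC i)" for x
 proof -
  have "fi x = comb (rgm E) (m i) (%j. fi (unitv j)) x"
   using hom_comb[OF l_mod_regular[OF E_ring] h[unfolded PC_def]] that by (simp add: PC_def)
  also have "... = phi i c x"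
   unfolding phi_def comb_def finsum_regular
   by (rule finsum_cong') (use z e that in \<open>auto simp: c_def Te_mult PC_def\<close>)
  finally show ?thesis .
 qed
 ultimately show ?thesis by (rule that)
qed

lemma cocyc_phi: "col i c ==> cocyc E PC dC i (phi i c) <-> (ALL j<m (Suc i). dcol i c j:NN)"
proof -
 assume c: "col i c"
 have z: "col (Suc i) (%_. 0)" by (simp add: col_def sub_0)
 have "phi (Suc i) (%_. 0) x = 0[E]" if "x:cr (PC (Suc i))" for x
  using that phi_rowP[OF _ z] by (auto simp: PC_cr Psi_zr)
 thus ?thesis
  using phi_eq_i[OF dcol_col[OF c] z] phi_dC[OF c] phi_hom[OF c] by (simp add: cocyc_def)
qed

lemma cobd_phi: "col (Suc i) c ==> cobd E PC dC (Suc i) (phi (Suc i) c) <-> (EX b. col i b & (ALL j<m (Suc i). c j - dcol i b j:NN))"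
proof
 assume c: "col (Suc i) c" and "cobd E PC dC (Suc i) (phi (Suc i) c)"
 then obtain qs where p: "lmod_hom E (PC i) (rgm E) qs" "!!x. x:cr (PC (Suc i)) ==> phi (Suc i) c x = qs (dC i x)"
  by (auto simp: cobd_def)
 obtain b where b: "col i b" "!!x. x:cr (PC i) ==> qs x = phi i b x" by (rule hom_phi[OF p(1)]) blast
 have d: "dC i x:cr (PC i)" if "x:cr (PC (Suc i))" for x
  using fg_resD(4)[OF kz_res, THEN lhD(1)] that by blast
 have "ALL x:cr (PC (Suc i)). phi (Suc i) c x = phi (Suc i) (dcol i b) x"
  using p(2) b(2)[OF d] phi_dC[OF b(1)] by simp
 thus "EX b. col i b & (ALL j<m (Suc i). c j - dcol i b j:NN)" using phi_eq_i[OF c dcol_col[OF b(1)]] b(1) by blast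
next
 assume c: "col (Suc i) c" and "EX b. col i b & (ALL j<m (Suc i). c j - dcol i b j:NN)"
 then obtain b where b: "col i b" "ALL j<m (Suc i). c j - dcol i b j:NN" by blast
 thus "cobd E PC dC (Suc i) (phi (Suc i) c)"
  using phi_eq_i[OF c dcol_col[OF b(1)]] phi_dC[OF b(1)] phi_hom[OF b(1)] by (auto simp: cobd_def)
qed

end

section \<open>Cohomology of the dual complex\<close>

lemma image_additive_subgroup:
 assumes "abelian_group M" "abelian_group N" and f: "!!x. x:cr M ==> f x:cr N"
  "!!x y. x:cr M ==> y:cr M ==> f (x +[M] y) = f x +[N] f y"
 shows "additive_subgroup (f ` cr M) N"
proof -
 interpret M: abelian_group M by fact
 interpret N: abelian_group N by fact
 interpret group_hom "add_monoid M" "add_monoid N" f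
  by (intro group_hom.intro group_hom_axioms.intro M.a_group N.a_group homI) (simp_all add: f)
 show ?thesis using img_is_subgroup by (intro additive_subgroupI) simp
qed

context
 fixes R :: "('r, 'm) ring_scheme" and C :: "('r, 'x) cochain"
 assumes C: "cochain_complex R C"
begin

lemma cob_mod: "left_module R (cob C i)" and cdiff_hom: "lmod_hom R (cob C i) (cob C (i + 1)) (cdiff C i)"
 using C unfolding cochain_complex_def by blast+

lemma cob_subgroup: "additive_subgroup (cobound C i) (cob C i)"
 unfolding cobound_def using lhD[OF cdiff_hom[of "i - 1"]]
 by (intro image_additive_subgroup lm_ab[OF cob_mod]) simp_all

lemma cob_coset:
 assumes x: "x:cr (cob C i)" and y: "y:cr (cob C i)"
 shows "y:cobound C i +>\<^bsub>cob C i\<^esub> x <-> y -[cob C i] x:cobound C i"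
  and "cobound C i +>\<^bsub>cob C i\<^esub> x = cobound C i +>\<^bsub>cob C i\<^esub> y <-> y -[cob C i] x:cobound C i"
  and "cobound C i +>\<^bsub>cob C i\<^esub> x <= cr (cob C i)"
proof -
 interpret abelian_group "cob C i" by (rule lm_ab[OF cob_mod])
 interpret abelian_subgroup "cobound C i" "cob C i" by (rule abelian_subgroupI3[OF cob_subgroup]) unfold_locales
 show 1: "y:cobound C i +>\<^bsub>cob C i\<^esub> x <-> y -[cob C i] x:cobound C i" unfolding minus_eq by (rule a_rcos_module[OF x y])
 show "cobound C i +>\<^bsub>cob C i\<^esub> x = cobound C i +>\<^bsub>cob C i\<^esub> y <-> y -[cob C i] x:cobound C i"
  using 1 a_rcos_self[OF y] a_repr_independence[OF _ x a_subgroup, of y] by auto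
 show "cobound C i +>\<^bsub>cob C i\<^esub> x <= cr (cob C i)" using a_r_coset_subset_G[OF a_subset x] .
qed

definition cocycles where "cocycles i = {x:cr (cob C i). cdiff C i x = 0[cob C (i + 1)]}"

lemma coh_cr: "cr (cohomology C i) = (%x. cobound C i +>\<^bsub>cob C i\<^esub> x) ` cocycles i"
proof -
 have e: "N +>\<^bsub>M\<lparr>carrier := X\<rparr>\<^esub> x = N +>\<^bsub>M\<^esub> x" for M :: "('r, 'x) module" and X N x
  by (simp add: a_r_coset_def r_coset_def)
 show ?thesis
  by (auto simp: cohomology_def quotient_module_def ring.defs FactRing_def A_RCOSETS_def' e cocycles_def)
qed

end

text \<open>The induced map on cohomology is additive, so injectivity can be tested at zero. This
  turns bijectivity into two conditions on elements, in which no cosets occur.\<close>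

lemma quasi_iso_bij:
 assumes C: "cochain_complex R C" and D: "cochain_complex R D" and f: "!!i. lmod_hom R (cob C i) (cob D i) (f i)"
  and fd: "!!i x. x:cr (cob C i) ==> f (i + 1) (cdiff C i x) = cdiff D i (f i x)"
 shows "bij_betw (%X. \<Union>x\<in>X. cobound D i +>\<^bsub>cob D i\<^esub> f i x) (cr (cohomology C i)) (cr (cohomology D i)) <->
  (ALL z:cocycles C i. f i z:cobound D i --> z:cobound C i) &
  (ALL w:cocycles D i. EX z:cocycles C i. f i z -[cob D i] w:cobound D i)"
proof -
 let ?F = "%X. \<Union>x\<in>X. cobound D i +>\<^bsub>cob D i\<^esub> f i x"
 let ?c = "%x. cobound C i +>\<^bsub>cob C i\<^esub> x" and ?d = "%x. cobound D i +>\<^bsub>cob D i\<^esub> x"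
 interpret MC: left_module R "cob C i" by (rule cob_mod[OF C])
 note fh = lhD[OF f] and fdiff = lmod_hom_df[OF cob_mod[OF C] cob_mod[OF D] f]
 have fb: "f i x:cobound D i" if x: "x:cobound C i" for x
 proof -
  obtain y where y: "y:cr (cob C (i - 1))" "x = cdiff C (i - 1) y" using x by (auto simp: cobound_def)
  thus ?thesis using fd[OF y(1)] fh(1)[OF y(1)] by (auto simp: cobound_def)
 qed
 have fz: "f i z:cocycles D i" if "z:cocycles C i" for z
  using that fd[of z i] fh(1)[of z i] lmod_hom_zr[OF cob_mod[OF C] cob_mod[OF D] f] by (auto simp: cocycles_def[OF C] cocycles_def[OF D])
 have zc: "z:cr (cob C i)" if "z:cocycles C i" for z using that by (simp add: cocycles_def[OF C])
 have zd: "z:cr (cob D i)" if "z:cocycles D i" for z using that by (simp add: cocycles_def[OF D])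
 have F: "?F (?c z) = ?d (f i z)" if z: "z:cocycles C i" for z
 proof -
  have "?d (f i x) = ?d (f i z)" if x: "x:?c z" for x
  proof -
   have xc: "x:cr (cob C i)" using cob_coset(3)[OF C zc[OF z] zc[OF z]] x by blast
   have "x -[cob C i] z:cobound C i" using x cob_coset(1)[OF C zc[OF z] xc] by simp
   hence "f i x -[cob D i] f i z:cobound D i" using fb fdiff[OF xc zc[OF z]] by metis
   thus ?thesis using cob_coset(2)[OF D fh(1)[OF zc[OF z]] fh(1)[OF xc]] by simp
  qed
  moreover have "z:?c z"
   using cob_coset(1)[OF C zc[OF z] zc[OF z]] additive_subgroup.zero_closed[OF cob_subgroup[OF C]] MC.M.r_neg[OF zc[OF z]] by (simp add: MC.M.minus_eq)
  ultimately show ?thesis by blast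
 qed
 have sub: "z -[cob C i] z':cocycles C i" if z: "z:cocycles C i" "z':cocycles C i" for z z'
 proof -
  interpret MD: left_module R "cob C (i + 1)" by (rule cob_mod[OF C])
  show ?thesis
   using z lmod_hom_df[OF cob_mod[OF C] cob_mod[OF C] cdiff_hom[OF C] zc[OF z(1)] zc[OF z(2)]]
   by (simp add: cocycles_def[OF C] MD.M.minus_eq)
 qed
 show ?thesis
 proof (intro iffI conjI ballI impI)
  assume b: "bij_betw ?F (cr (cohomology C i)) (cr (cohomology D i))"
  have z0: "0[cob C i]:cocycles C i"
   using lmod_hom_zr[OF cob_mod[OF C] cob_mod[OF C] cdiff_hom[OF C]] by (simp add: cocycles_def[OF C])
  show "z:cobound C i" if z: "z:cocycles C i" "f i z:cobound D i" for z
  proof -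
   have dz: "z -[cob C i] 0[cob C i] = z" using zc[OF z(1)] by (simp add: MC.M.minus_eq)
   hence "f i z -[cob D i] f i 0[cob C i]:cobound D i" using fdiff[OF zc[OF z(1)] zc[OF z0]] z(2) by simp
   hence e: "?F (?c 0[cob C i]) = ?F (?c z)"
    unfolding F[OF z(1)] F[OF z0] using cob_coset(2)[OF D zd[OF fz[OF z0]] zd[OF fz[OF z(1)]]] by simp
   have "?c 0[cob C i] = ?c z"
    by (rule inj_onD[OF bij_betw_imp_inj_on[OF b] e]; unfold coh_cr[OF C]) (use z(1) z0 in blast)+
   thus ?thesis using cob_coset(2)[OF C zc[OF z0] zc[OF z(1)]] dz by simp
  qed
  show "EX z:cocycles C i. f i z -[cob D i] w:cobound D i" if w: "w:cocycles D i" for w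
  proof -
   have "?d w:?F ` ?c ` cocycles C i"
    using bij_betw_imp_surj_on[OF b] w unfolding coh_cr[OF C] coh_cr[OF D] by (metis imageI)
   then obtain z where z: "z:cocycles C i" "?d w = ?F (?c z)" by (elim imageE) simp
   hence "?d w = ?d (f i z)" using F by simp
   thus ?thesis using z(1) cob_coset(2)[OF D zd[OF w] zd[OF fz[OF z(1)]]] by blast
  qed
 next
  assume a: "(ALL z:cocycles C i. f i z:cobound D i --> z:cobound C i) & (ALL w:cocycles D i. EX z:cocycles C i. f i z -[cob D i] w:cobound D i)"
  show "bij_betw ?F (cr (cohomology C i)) (cr (cohomology D i))"
   unfolding bij_betw_def coh_cr[OF C] coh_cr[OF D]
  proof (rule conjI, rule inj_onI)
   fix X Y assume "X:?c ` cocycles C i" "Y:?c ` cocycles C i" and e: "?F X = ?F Y"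
   then obtain z z' where z: "z:cocycles C i" "z':cocycles C i" "X = ?c z" "Y = ?c z'" by blast
   hence "?d (f i z) = ?d (f i z')" using e F by simp
   hence "f i z' -[cob D i] f i z:cobound D i" using cob_coset(2)[OF D zd[OF fz[OF z(1)]] zd[OF fz[OF z(2)]]] by simp
   hence "z' -[cob C i] z:cobound C i" using a sub[OF z(2,1)] fdiff[OF zc[OF z(2)] zc[OF z(1)]] by metis
   thus "X = Y" unfolding z(3,4) using cob_coset(2)[OF C zc[OF z(1)] zc[OF z(2)]] by simp
  next
   show "?F ` ?c ` cocycles C i = ?d ` cocycles D i"
   proof (intro equalityI subsetI)
   fix X assume "X:?F ` ?c ` cocycles C i"
   thus "X:?d ` cocycles D i" using F fz by auto
  next
   fix X assume "X:?d ` cocycles D i"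
   then obtain w where w: "w:cocycles D i" "X = ?d w" by blast
   then obtain z where z: "z:cocycles C i" "f i z -[cob D i] w:cobound D i" using a by blast
   hence "X = ?F (?c z)" unfolding F[OF z(1)] w(2) using cob_coset(2)[OF D zd[OF w(1)] zd[OF fz[OF z(1)]]] by simp
   thus "X:?F ` ?c ` cocycles C i" using z(1) by blast
   qed
  qed
 qed
qed

lemma du_s [simp]:
 "cr (env_dual A M) = {f:extensional (cr M). lmod_hom (env_alg A) M (rgm (env_alg A)) f}"
 "0[env_dual A M] = (\<lambda>m\<in>cr M. 0[env_alg A])"
 "f +[env_dual A M] g = (\<lambda>m\<in>cr M. f m +[env_alg A] g m)"
 "z *.[env_dual A M] f = (\<lambda>m\<in>cr M. f m *[env_alg A] env_flip z)"
 by (simp_all add: env_dual_def)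

lemma env_du_neg:
 assumes "ring (env_alg A)" "left_module (env_alg A) M" "abelian_group (env_dual A M)" and f: "f:cr (env_dual A M)"
 shows " -[env_dual A M] f = (\<lambda>m\<in>cr M. -[env_alg A] f m)"
proof -
 interpret ring "env_alg A" by fact
 interpret D: abelian_group "env_dual A M" by fact
 interpret M: left_module "env_alg A" M by fact
 have fm: "f m:cr (env_alg A)" if "m:cr M" for m using f that lhD(1)[of "env_alg A" M "rgm (env_alg A)" f m] by simp
 have "lmod_hom (env_alg A) M (rgm (env_alg A)) (\<lambda>m\<in>cr M. -[env_alg A] f m)"
  using f lhD[of "env_alg A" M "rgm (env_alg A)" f]
  by (intro lmod_homI) (auto simp: minus_add r_minus M.smult_closed)
 hence "(\<lambda>m\<in>cr M. -[env_alg A] f m):cr (env_dual A M)" by simp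
 moreover have "(\<lambda>m\<in>cr M. -[env_alg A] f m) +[env_dual A M] f = 0[env_dual A M]"
  using fm by (auto simp: l_neg fun_eq_iff)
 ultimately show ?thesis using D.minus_equality[OF _ f] by simp
qed

abbreviation "dual_shift n A P d \<equiv> shift_complex (int n) (env_dual_complex A P d)"

lemma du_shift_cob:
 "cob (dual_shift n A P d) (int i - int n) = env_dual A (P i)"
 "k + int n < 0 ==> cob (dual_shift n A P d) k = zero_submodule (env_dual A (P 0))"
 by (simp_all add: shift_complex_def env_dual_complex_def)

context
 fixes A :: "(complex, 'a) module" and P d and n :: nat
 assumes E: "ring (env_alg A)" and P: "!!i. left_module (env_alg A) (P i)" and d: "!!i. lmod_hom (env_alg A) (P (Suc i)) (P i) (d i)"
  and ab: "!!i. abelian_group (env_dual A (P i))"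
begin

lemma du_pull: "qs:cr (env_dual A (P i)) ==> (\<lambda>p\<in>cr (P (Suc i)). qs (d i p)):cr (env_dual A (P (Suc i)))"
proof -
 assume "qs:cr (env_dual A (P i))"
 hence h: "lmod_hom (env_alg A) (P (Suc i)) (rgm (env_alg A)) (%p. qs (d i p))" using lmod_hom_comp[OF d] by auto
 interpret left_module "env_alg A" "P (Suc i)" by (rule P)
 have "lmod_hom (env_alg A) (P (Suc i)) (rgm (env_alg A)) (\<lambda>p\<in>cr (P (Suc i)). qs (d i p))"
  using lhD[OF h] by (intro lmod_homI) (simp_all add: smult_closed)
 thus ?thesis by simp
qed

lemma du_shift_cdiff:
 "qs:cr (env_dual A (P i)) ==> cdiff (dual_shift n A P d) (int i - int n) qs =
  (if even n then (\<lambda>p\<in>cr (P (Suc i)). qs (d i p)) else (\<lambda>p\<in>cr (P (Suc i)). -[env_alg A] qs (d i p)))"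
 using env_du_neg[OF E P ab du_pull[of qs i]]
 by (auto simp: shift_complex_def env_dual_complex_def nat_add_distrib fun_eq_iff)

lemma du_cyc:
 "qs:cr (env_dual A (P i)) ==>
  cdiff (dual_shift n A P d) (int i - int n) qs = 0[cob (dual_shift n A P d) (int i - int n + 1)] <-> cocyc (env_alg A) P d i qs"
proof -
 assume p: "qs:cr (env_dual A (P i))"
 interpret ring "env_alg A" by (rule E)
 have c: "qs (d i x):cr (env_alg A)" if "x:cr (P (Suc i))" for x
  using p lhD(1)[of "env_alg A" "P i" "rgm (env_alg A)" qs] lhD(1)[OF d that] by simp
 have z: "cob (dual_shift n A P d) (int i - int n + 1) = env_dual A (P (Suc i))"
  using du_shift_cob(1)[of n A P d "Suc i"] by (simp add: algebra_simps)
 have " -[env_alg A] qs (d i x) = 0[env_alg A] <-> qs (d i x) = 0[env_alg A]" if "x:cr (P (Suc i))" for x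
  using c[OF that] by (metis minus_minus minus_zero)
 thus ?thesis unfolding du_shift_cdiff[OF p] z using p by (auto simp: cocyc_def fun_eq_iff)
qed

text \<open>The sign that an odd shift puts on the differential is absorbed by negating the
  preimage.\<close>

lemma du_cob:
 assumes p: "qs:cr (env_dual A (P i))"
 shows "qs:cobound (dual_shift n A P d) (int i - int n) <-> cobd (env_alg A) P d i qs"
proof (cases i)
 case 0
 have ex: "qs:extensional (cr (P 0))" using p 0 by simp
 interpret D: abelian_group "env_dual A (P 0)" by (rule ab)
 \<comment> \<open>The dual complex is zero below its first term, so there only the zero map is a
   coboundary.\<close>
 have z: "cdiff (dual_shift n A P d) (- int n - 1) x = 0[env_dual A (P 0)]" for x
  using D.minus_equality[OF D.l_zero[OF D.zero_closed] D.zero_closed D.zero_closed] by (auto simp: shift_complex_def env_dual_complex_def)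
 have "cobound (dual_shift n A P d) (int i - int n) = {0[env_dual A (P 0)]}"
  unfolding cobound_def 0 using z by (auto simp: du_shift_cob(2) zero_submodule_def)
 thus ?thesis using ex by (auto simp: cobd_def 0 fun_eq_iff extensional_def)
next
 case (Suc j)
 interpret ring "env_alg A" by (rule E)
 have i: "int i - int n - 1 = int j - int n" using Suc by simp
 have L: "left_module (env_alg A) (rgm (env_alg A))" by (rule l_mod_regular[OF E])
 have cob: "cobound (dual_shift n A P d) (int i - int n) = cdiff (dual_shift n A P d) (int j - int n) ` cr (env_dual A (P j))"
  unfolding cobound_def i du_shift_cob(1) by simp
 have dc: "d j x:cr (P j)" if "x:cr (P (Suc j))" for x by (rule lhD(1)[OF d that])
 show ?thesis
 proof
  assume "qs:cobound (dual_shift n A P d) (int i - int n)"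
  then obtain chy where c: "chy:cr (env_dual A (P j))" "qs = cdiff (dual_shift n A P d) (int j - int n) chy" unfolding cob by blast
  hence h: "lmod_hom (env_alg A) (P j) (rgm (env_alg A)) chy" by simp
  interpret Pj: left_module "env_alg A" "P j" by (rule P)
  have "lmod_hom (env_alg A) (P j) (rgm (env_alg A)) (%x. -[env_alg A] chy x)"
   using lhD[OF h] by (intro lmod_homI) (auto simp: minus_add r_minus)
  thus "cobd (env_alg A) P d i qs"
   using h c(2) unfolding du_shift_cdiff[OF c(1)] cobd_def Suc by (cases "even n") auto
 next
  assume "cobd (env_alg A) P d i qs"
  then obtain chy where h: "lmod_hom (env_alg A) (P j) (rgm (env_alg A)) chy" and e: "!!x. x:cr (P i) ==> qs x = chy (d j x)"
   by (auto simp: cobd_def Suc)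
  interpret Pj: left_module "env_alg A" "P j" by (rule P)
  define chy' where "chy' = (\<lambda>x\<in>cr (P j). if even n then chy x else -[env_alg A] chy x)"
  have "lmod_hom (env_alg A) (P j) (rgm (env_alg A)) chy'"
   using lhD[OF h] by (intro lmod_homI) (auto simp: chy'_def minus_add r_minus Pj.smult_closed)
  hence c: "chy':cr (env_dual A (P j))" by (simp add: chy'_def)
  moreover have "qs = cdiff (dual_shift n A P d) (int j - int n) chy'"
   unfolding du_shift_cdiff[OF c] using p e dc lhD(1)[OF h dc]
   by (auto simp: Suc chy'_def fun_eq_iff extensional_def restrict_def)
  ultimately show "qs:cobound (dual_shift n A P d) (int i - int n)" unfolding cob by blast
 qed
qed

end

section \<open>Column form of the Calabi-Yau condition\<close>

text \<open>The roof is turned into a function \<open>thy\<close> on cocycles of degree n: go back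
  along f to the apex, then along g to A. Modulo coboundaries it is an isomorphism of bimodules; in
  the other degrees cohomology vanishes with the stalk complex.\<close>

lemma calabi_yau_cohomology:
 fixes A :: "(complex, 'a) module"
 defines "E \<equiv> env_alg A"
 assumes E: "ring E" and cy: "calabi_yau n A"
 obtains P :: "nat => (('a \<times> 'a \<Rightarrow>\<^sub>0 complex) set, nat => ('a \<times> 'a \<Rightarrow>\<^sub>0 complex) set) module" and d ep N thy
 where "fg_res E (diag_module A) P d ep" "!!i. i > N ==> cr (P i) = {0[P i]}"
  "!!i fi. i ~= n ==> cocyc E P d i fi ==> cobd E P d i fi"
  "!!fi qs. ALL x:cr (P n). fi x = qs x ==> thy fi = thy qs"
  "!!fi. cocyc E P d n fi ==> thy fi:cr A"
  "!!fi qs. cocyc E P d n fi ==> cocyc E P d n qs ==> thy (%x. fi x +[E] qs x) = thy fi +[A] thy qs"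
  "!!z fi. z:cr E ==> cocyc E P d n fi ==> thy (%x. fi x *[E] env_flip z) = env_act A z (thy fi)"
  "!!a. a:cr A ==> EX fi. cocyc E P d n fi & thy fi = a"
  "!!fi. cocyc E P d n fi ==> thy fi = 0[A] <-> cobd E P d n fi"
proof -
 let ?S = "stalk_complex (diag_module A)"
 obtain P :: "nat => (('a \<times> 'a \<Rightarrow>\<^sub>0 complex) set, nat => ('a \<times> 'a \<Rightarrow>\<^sub>0 complex) set) module" and d ep
   and Z :: "(('a \<times> 'a \<Rightarrow>\<^sub>0 complex) set, (nat => ('a \<times> 'a \<Rightarrow>\<^sub>0 complex) set) => ('a \<times> 'a \<Rightarrow>\<^sub>0 complex) set) cochain" and f g
  where P: "fg_res E (diag_module A) P d ep" and fin: "EX N. ALL i>N. cr (P i) = {0[P i]}"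
   and qf: "quasi_iso E Z (dual_shift n A P d) f" and qg: "quasi_iso E Z ?S g"
  using cy[unfolded calabi_yau_def derived_iso_def fin_fg_res_i, folded E_def] by (elim exE conjE) (rule that, assumption, rule exI, assumption+)
 let ?C = "dual_shift n A P d"
 have Z: "cochain_complex E Z" and C: "cochain_complex E ?C" and S: "cochain_complex E ?S"
  and f: "!!i. lmod_hom E (cob Z i) (cob ?C i) (f i)" and g: "!!i. lmod_hom E (cob Z i) (cob ?S i) (g i)"
  and fd: "!!i x. x:cr (cob Z i) ==> f (i + 1) (cdiff Z i x) = cdiff ?C i (f i x)"
  and gd: "!!i x. x:cr (cob Z i) ==> g (i + 1) (cdiff Z i x) = cdiff ?S i (g i x)"
  using qf qg unfolding quasi_iso_def by blast+
 have bf: "(ALL z:cocycles Z i. f i z:cobound ?C i --> z:cobound Z i) & (ALL w:cocycles ?C i. EX z:cocycles Z i. f i z -[cob ?C i] w:cobound ?C i)" for i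
  by (rule iffD1[OF quasi_iso_bij[where f = f and C = Z and D = "?C" and R = E]]) (rule Z | rule C | rule f | erule fd | rule qf[unfolded quasi_iso_def, THEN conjunct2, THEN conjunct2, THEN conjunct2, THEN conjunct2, THEN spec])+
 have bg: "(ALL z:cocycles Z i. g i z:cobound ?S i --> z:cobound Z i) & (ALL w:cocycles ?S i. EX z:cocycles Z i. g i z -[cob ?S i] w:cobound ?S i)" for i
  by (rule iffD1[OF quasi_iso_bij[where f = g and C = Z and D = "?S" and R = E]]) (rule Z | rule S | rule g | erule gd | rule qg[unfolded quasi_iso_def, THEN conjunct2, THEN conjunct2, THEN conjunct2, THEN conjunct2, THEN spec])+
 have fb: "f i x:cobound ?C i" and gb: "g i x:cobound ?S i" if x: "x:cobound Z i" for i x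
 proof -
  obtain y where y: "y:cr (cob Z (i - 1))" "x = cdiff Z (i - 1) y" using x by (auto simp: cobound_def)
  thus "f i x:cobound ?C i" "g i x:cobound ?S i"
   using fd[OF y(1)] gd[OF y(1)] lhD(1)[OF f y(1)] lhD(1)[OF g y(1)] by (auto simp: cobound_def)
 qed
 note PD = fg_resD[OF P]
 have dual: "left_module E (env_dual A (P i))" for i using cob_mod[OF C, of "int i - int n"] by (simp add: du_shift_cob)
 note ab = lm_ab[OF dual]
 let ?r = "%i fi. restrict fi (cr (P i))"
 have rc: "cocyc E P d i (?r i fi) <-> cocyc E P d i fi" "cobd E P d i (?r i fi) <-> cobd E P d i fi" for i fi
 proof -
  interpret left_module E "P i" by (rule PD(3))
  have "lmod_hom E (P i) (rgm E) (?r i fi) <-> lmod_hom E (P i) (rgm E) fi"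
   by (auto simp: lmod_hom_def Pi_def smult_closed)
  thus "cocyc E P d i (?r i fi) <-> cocyc E P d i fi" using lhD(1)[OF PD(4)] by (auto simp: cocyc_def)
  show "cobd E P d i (?r i fi) <-> cobd E P d i fi" by (auto simp: cobd_def split: nat.splits)
 qed
 have rd: "?r i fi:cr (env_dual A (P i))" if "cocyc E P d i fi" for i fi
  using that rc(1)[of i fi] by (simp add: cocyc_def E_def)
 note dl = du_cyc[where A = A and P = P and d = d and n = n, folded E_def, OF E PD(3,4) ab]
  du_cob[where A = A and P = P and d = d and n = n, folded E_def, OF E PD(3,4) ab]
 have rz: "?r i fi:cocycles ?C (int i - int n)" if "cocyc E P d i fi" for i fi
  using rd[OF that] that dl(1)[OF rd[OF that]] rc by (simp add: cocycles_def[OF C] du_shift_cob del: du_s)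
 have rb: "?r i fi:cobound ?C (int i - int n) <-> cobd E P d i fi" if "cocyc E P d i fi" for i fi
  using dl(2)[OF rd[OF that]] rc by simp
 have bS: "cobound ?S i = {0[A]}" for i
  using lm_ab[OF PD(1)[unfolded diag_module_def]] abelian_group.axioms(1) abelian_monoid.zero_closed
  by (fastforce simp: cobound_def stalk_complex_def zero_submodule_def diag_module_def)
 have zZ: "z:cr (cob Z i)" if "z:cocycles Z i" for z i using that by (simp add: cocycles_def[OF Z])
 \<comment> \<open>In a degree where the stalk complex is zero, g shows every cocycle of the apex to
   be a coboundary, and f carries this over to the dual complex.\<close>
 have main: "cobd E P d i fi" if "i ~= n" and c: "cocyc E P d i fi" for i fi
 proof -
  let ?k = "int i - int n"
  interpret D: abelian_group "cob ?C ?k" by (rule lm_ab[OF cob_mod[OF C]])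
  interpret B: additive_subgroup "cobound ?C ?k" "cob ?C ?k" by (rule cob_subgroup[OF C])
  obtain z where z: "z:cocycles Z ?k" "f ?k z -[cob ?C ?k] ?r i fi:cobound ?C ?k" using bf rz[OF c] by blast
  have "g ?k z:cobound ?S ?k"
   using lhD(1)[OF g zZ[OF z(1)]] `i ~= n` unfolding bS by (simp add: stalk_complex_def zero_submodule_def diag_module_def)
  hence b: "f ?k z:cobound ?C ?k" using bg z(1) fb by blast
  have rC: "?r i fi:cr (cob ?C ?k)" using rd[OF c] by (simp add: du_shift_cob)
  have fz: "f ?k z:cr (cob ?C ?k)" by (rule lhD(1)[OF f zZ[OF z(1)]])
  have "f ?k z -[cob ?C ?k] (f ?k z -[cob ?C ?k] ?r i fi) = ?r i fi"
   using fz rC by (simp add: D.minus_eq D.minus_add D.a_assoc[symmetric] D.r_neg)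
  moreover have "f ?k z -[cob ?C ?k] (f ?k z -[cob ?C ?k] ?r i fi):cobound ?C ?k"
   unfolding D.minus_eq[of "f ?k z" "_ -[cob ?C ?k] _"] by (intro B.a_closed B.a_inv_closed b z(2))
  ultimately show ?thesis using rb[OF c] by simp
 qed
 let ?D = "env_dual A (P n)"
 have C0: "cob ?C 0 = ?D" using du_shift_cob(1)[of n A P d n] by simp
 interpret D: left_module E ?D by (rule dual)
 interpret Z: left_module E "cob Z 0" by (rule cob_mod[OF Z])
 interpret A: left_module E "diag_module A" by (rule PD(1))
 interpret B: additive_subgroup "cobound ?C 0" ?D using cob_subgroup[OF C, of 0] by (simp only: C0)
 have S0: "cob ?S 0 = diag_module A" by (simp add: stalk_complex_def)
 have f0: "lmod_hom E (cob Z 0) ?D (f 0)" and g0: "lmod_hom E (cob Z 0) (diag_module A) (g 0)"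
  using f[of 0] g[of 0] by (simp_all add: C0 S0)
 note rn = rd[of n] and rz0 = rz[of n, simplified] and rb0 = rb[of n, simplified]
 have Zop: "z +[cob Z 0] w:cocycles Z 0" "z -[cob Z 0] w:cocycles Z 0" "a *.[cob Z 0] z:cocycles Z 0"
  if z: "z:cocycles Z 0" "w:cocycles Z 0" "a:cr E" for z w a
 proof -
  interpret Z1: left_module E "cob Z 1" by (rule cob_mod[OF Z])
  note h = cdiff_hom[OF Z, of 0, simplified]
  show "z +[cob Z 0] w:cocycles Z 0" "z -[cob Z 0] w:cocycles Z 0" "a *.[cob Z 0] z:cocycles Z 0"
   using z lhD(2,3)[OF h] lmod_hom_df[OF cob_mod[OF Z] cob_mod[OF Z] h] Z1.smult_zr[OF z(3)]
   by (simp_all add: cocycles_def[OF Z] Z.smult_closed Z1.M.minus_eq)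
 qed
 \<comment> \<open>Both conditions say that z is a coboundary of the apex; this makes
   \<open>thy\<close> independent of the chosen preimage.\<close>
 have key: "f 0 z:cobound ?C 0 <-> g 0 z = 0[A]" if "z:cocycles Z 0" for z
  using bf bg fb gb that unfolding bS by blast
 define zt where "zt fi = (SOME z. z:cocycles Z 0 & f 0 z -[?D] ?r n fi:cobound ?C 0)" for fi
 define thy where "thy fi = g 0 (zt fi)" for fi
 have zeta: "zt fi:cocycles Z 0" "f 0 (zt fi) -[?D] ?r n fi:cobound ?C 0" if "cocyc E P d n fi" for fi
 proof -
  have "EX z. z:cocycles Z 0 & f 0 z -[?D] ?r n fi:cobound ?C 0" using bf[of 0] rz0[OF that] by (auto simp only: C0)
  from someI_ex[OF this] show "zt fi:cocycles Z 0" "f 0 (zt fi) -[?D] ?r n fi:cobound ?C 0" unfolding zt_def by blast+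
 qed
 have fc: "f 0 z:cr ?D" if "z:cocycles Z 0" for z using lhD(1)[OF f0 zZ[OF that]] .
 have theta: "thy fi = g 0 z" if c: "cocyc E P d n fi" and z: "z:cocycles Z 0" "f 0 z -[?D] ?r n fi:cobound ?C 0" for fi z
 proof -
  have "f 0 (zt fi -[cob Z 0] z) = f 0 (zt fi) -[?D] f 0 z"
   by (rule lmod_hom_df[OF cob_mod[OF Z] dual f0 zZ[OF zeta(1)[OF c]] zZ[OF z(1)]])
  also have "... = (f 0 (zt fi) -[?D] ?r n fi) -[?D] (f 0 z -[?D] ?r n fi)"
  proof -
   have "p -[?D] q = (p -[?D] s) -[?D] (q -[?D] s)" if "p:cr ?D" "q:cr ?D" "s:cr ?D" for p q s
   proof -
    have "(p -[?D] s) -[?D] (q -[?D] s) = p +[?D] (\<ominus>\<^bsub>?D\<^esub> q +[?D] (s +[?D] -[?D] s))"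
    using that by (simp add: D.M.minus_eq D.M.minus_add D.M.a_ac del: du_s)
    thus ?thesis using that by (simp add: D.M.r_neg D.M.minus_eq del: du_s)
   qed
   thus ?thesis using fc[OF zeta(1)[OF c]] fc[OF z(1)] rn[OF c] by blast
  qed
  also have "... : cobound ?C 0" unfolding D.M.minus_eq[of "_ -[?D] _"] by (intro B.a_closed B.a_inv_closed zeta(2) c z(2))
  finally have "g 0 (zt fi -[cob Z 0] z) = 0[A]" using key Zop(2)[OF zeta(1)[OF c] z(1) D.R.zero_closed] by blast
  hence "thy fi -[diag_module A] g 0 z = 0[diag_module A]"
   using lmod_hom_df[OF cob_mod[OF Z] PD(1) g0 zZ[OF zeta(1)[OF c]] zZ[OF z(1)]] by (simp add: thy_def diag_module_def)
  thus ?thesis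
   using lhD(1)[OF g0 zZ[OF zeta(1)[OF c]]] lhD(1)[OF g0 zZ[OF z(1)]] unfolding thy_def
   by (simp add: A.M.minus_eq A.M.add.inv_solve_right')
 qed
 obtain N where N: "!!i. i > N ==> cr (P i) = {0[P i]}" using fin by blast
 note reg = l_mod_regular[OF E]
 show ?thesis
 proof (rule that[OF P N main, of _ thy])
  fix fi qs z
  show "ALL x:cr (P n). fi x = qs x ==> thy fi = thy qs"
   unfolding thy_def zt_def by (simp cong: restrict_cong)
  assume c: "cocyc E P d n fi"
  note z1 = zeta(1)[OF c] zeta(2)[OF c]
  show "thy fi:cr A" using lhD(1)[OF g0 zZ[OF z1(1)]] by (simp add: thy_def diag_module_def)
  show "thy (%x. fi x +[E] qs x) = thy fi +[A] thy qs" if c': "cocyc E P d n qs"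
  proof -
   note z2 = zeta(1)[OF c'] zeta(2)[OF c']
   have h: "cocyc E P d n (%x. fi x +[E] qs x)"
    using c c' lmod_hom_add[OF reg] by (auto simp: cocyc_def)
   have r: "?r n (%x. fi x +[E] qs x) = ?r n fi +[?D] ?r n qs" by (auto simp: E_def fun_eq_iff)
   have "f 0 (zt fi +[cob Z 0] zt qs) -[?D] ?r n (%x. fi x +[E] qs x) = (f 0 (zt fi) -[?D] ?r n fi) +[?D] (f 0 (zt qs) -[?D] ?r n qs)"
    unfolding r lhD(2)[OF f0 zZ[OF z1(1)] zZ[OF z2(1)]]
    using fc[OF z1(1)] fc[OF z2(1)] rn[OF c] rn[OF c'] by (simp add: D.M.minus_eq D.M.minus_add D.M.a_ac del: du_s)
   also have "... : cobound ?C 0" by (intro B.a_closed z1 z2)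
   finally have "thy (%x. fi x +[E] qs x) = g 0 (zt fi +[cob Z 0] zt qs)" by (rule theta[OF h Zop(1)[OF z1(1) z2(1) D.R.zero_closed]])
   thus ?thesis using lhD(2)[OF g0 zZ[OF z1(1)] zZ[OF z2(1)]] by (simp add: thy_def diag_module_def)
  qed
  show "thy (%x. fi x *[E] env_flip z) = env_act A z (thy fi)" if z: "z:cr E"
  proof -
   have r: "?r n (%x. fi x *[E] env_flip z) = z *.[?D] ?r n fi" by (auto simp: E_def fun_eq_iff)
   have zr: "z *.[?D] ?r n fi:cocycles ?C 0"
   proof -
    interpret C1: left_module E "cob ?C (0 + 1)" by (rule cob_mod[OF C])
    show ?thesis
    using rz0[OF c] lhD(3)[OF cdiff_hom[OF C, of 0] z, of "?r n fi"] C1.smult_zr[OF z] D.smult_closed[OF z]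
    by (simp add: cocycles_def[OF C] C0 del: du_s)
   qed
   have h: "cocyc E P d n (%x. fi x *[E] env_flip z)"
   proof -
    have "z *.[?D] ?r n fi:cr ?D" using zr by (simp add: cocycles_def[OF C] C0)
    hence "cocyc E P d n (z *.[?D] ?r n fi)" using dl(1)[of "z *.[?D] ?r n fi" n] zr by (simp add: cocycles_def[OF C])
    thus ?thesis unfolding r[symmetric] rc .
   qed
   have "f 0 (z *.[cob Z 0] zt fi) -[?D] (z *.[?D] ?r n fi) = z *.[?D] (f 0 (zt fi) -[?D] ?r n fi)"
    unfolding lhD(3)[OF f0 z zZ[OF z1(1)]]
    using fc[OF z1(1)] rn[OF c] z l_mod_neg_smult[OF dual z rn[OF c]]
    by (simp add: D.M.minus_eq D.smult_r_distr del: du_s)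
   also have "... : cobound ?C 0"
   proof -
    obtain y where y: "y:cr (cob ?C (0 - 1))" "f 0 (zt fi) -[?D] ?r n fi = cdiff ?C (0 - 1) y"
    using z1(2) unfolding cobound_def by blast
    have "z *.[cob ?C (0 - 1)] y:cr (cob ?C (0 - 1))" using left_module.smult_closed[OF cob_mod[OF C] z y(1)] .
    moreover have "z *.[?D] (f 0 (zt fi) -[?D] ?r n fi) = cdiff ?C (0 - 1) (z *.[cob ?C (0 - 1)] y)"
    unfolding y(2) using lhD(3)[OF cdiff_hom[OF C, of "0 - 1"] z y(1)] by (simp add: C0)
    ultimately show ?thesis unfolding cobound_def by blast
   qed
   finally have "thy (%x. fi x *[E] env_flip z) = g 0 (z *.[cob Z 0] zt fi)" unfolding r[symmetric] by (rule theta[OF h Zop(3)[OF z1(1) z1(1) z]])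
   thus ?thesis using lhD(3)[OF g0 z zZ[OF z1(1)]] by (simp add: thy_def diag_module_def)
  qed
  have "thy fi = 0[A] <-> f 0 (zt fi):cobound ?C 0" using key[OF z1(1)] by (simp add: thy_def)
  also have "... <-> ?r n fi:cobound ?C 0"
  proof
   assume "f 0 (zt fi):cobound ?C 0"
   hence "f 0 (zt fi) +[?D] -[?D] (f 0 (zt fi) -[?D] ?r n fi):cobound ?C 0" by (intro B.a_closed B.a_inv_closed z1)
   thus "?r n fi:cobound ?C 0"
    using fc[OF z1(1)] rn[OF c] by (simp add: D.M.minus_eq D.M.minus_add D.M.a_assoc[symmetric] D.M.r_neg del: du_s)
  next
   assume "?r n fi:cobound ?C 0"
   hence "(f 0 (zt fi) -[?D] ?r n fi) +[?D] ?r n fi:cobound ?C 0" by (intro B.a_closed z1)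
   thus "f 0 (zt fi):cobound ?C 0"
    using fc[OF z1(1)] rn[OF c] by (simp add: D.M.minus_eq D.M.a_assoc D.M.l_neg del: du_s)
  qed
  finally show "thy fi = 0[A] <-> cobd E P d n fi" unfolding rb0[OF c] .
 next
  fix a assume a: "a:cr A"
  hence "a:cocycles ?S 0" by (simp add: cocycles_def[OF S]) (simp add: diag_module_def stalk_complex_def zero_submodule_def)
  then obtain z where z: "z:cocycles Z 0" "g 0 z -[diag_module A] a = 0[A]" using bg[of 0] unfolding bS S0 by blast
  have ga: "g 0 z = a"
   using z(2) lhD(1)[OF g0 zZ[OF z(1)]] a A.M.add.inv_solve_right'[of "0[diag_module A]" "g 0 z" a] A.M.l_zero[of a]
   unfolding A.M.minus_eq using A.M.zero_closed by (simp add: diag_module_def)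
  have fz: "f 0 z:cr ?D" by (rule fc[OF z(1)])
  have "cdiff ?C 0 (f 0 z) = 0[cob ?C (0 + 1)]"
   using z(1) fd[OF zZ[OF z(1)]] lmod_hom_zr[OF cob_mod[OF Z] cob_mod[OF C] f] by (simp add: cocycles_def[OF Z])
  hence c: "cocyc E P d n (f 0 z)" using dl(1)[OF fz] by simp
  have "?r n (f 0 z) = f 0 z" using fz by (auto simp: extensional_def fun_eq_iff)
  hence "f 0 z -[?D] ?r n (f 0 z) = 0[?D]" using fz by (simp add: D.M.minus_eq D.M.r_neg del: du_s)
  hence "thy (f 0 z) = g 0 z" using B.zero_closed by (intro theta[OF c z(1)]) simp
  thus "EX fi. cocyc E P d n fi & thy fi = a" using c ga by blast
 qed
qed

context koszul_complex
begin

text \<open>Closed and exact columns: cocycles and coboundaries of the dual Koszul complex, read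
  modulo \<open>NN\<close>. The index of \<open>excol\<close> is the degree of the bounding column,
  one less than that of the column itself.\<close>

definition clcol where "clcol i c <-> col i c & (ALL j<m (Suc i). dcol i c j:NN)"
definition excol where "excol i c <-> (EX b. col i b & (ALL j<m (Suc i). c j - dcol i b j:NN))"

lemma clcol_cocyc: "clcol i c ==> cocyc E PC dC i (phi i c)" by (simp add: clcol_def cocyc_phi)

lemma cocyc_clcol:
 assumes "cocyc E PC dC i fi"
 obtains c where "clcol i c" "!!x. x:cr (PC i) ==> fi x = phi i c x"
proof -
 obtain c where c: "col i c" "!!x. x:cr (PC i) ==> fi x = phi i c x"
  using hom_phi[of i fi] assms by (auto simp: cocyc_def)
 have "cocyc E PC dC i (phi i c)"
  using assms c(2) lhD(1)[OF fg_resD(4)[OF kz_res]] phi_hom[OF c(1)] unfolding cocyc_def by metis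
 thus ?thesis using c by (intro that[of c]) (simp_all add: clcol_def cocyc_phi)
qed

lemma phi_add: "col i b ==> col i c ==> x:cr (PC i) ==> phi i (%j. b j + c j) x = phi i b x +[E] phi i c x"
 and phi_flip: "col i c ==> z:Te ==> x:cr (PC i) ==> phi i (%j. c j ** swp z) x = phi i c x *[E] env_flip (Psi z)"
proof -
 show "phi i (%j. b j + c j) x = phi i b x +[E] phi i c x" if b: "col i b" "col i c" "x:cr (PC i)"
 proof -
  have "col i (%j. b j + c j)" using b by (simp add: col_def bm_add_r sub_add)
  thus ?thesis using b by (auto simp: PC_cr phi_rowP Psi_add bm_add_r sum.distrib)
 qed
 show "phi i (%j. c j ** swp z) x = phi i c x *[E] env_flip (Psi z)" if c: "col i c" "z:Te" "x:cr (PC i)"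
 proof -
  have sz: "swp z:Te" by (rule swp_sp[OF c(2)])
  hence "col i (%j. c j ** swp z)" using c by (simp add: col_def emul_as[symmetric] Te_mult)
  moreover obtain r where r: "row i r" "x = rowP i r" using c(3) by (auto simp: PC_cr)
  moreover have "(\<Sum>j<m i. r j ** c j):Te"
   using r c by (intro sub_sum sub_sp_in Te_mult) (auto simp: row_def col_def)
  ultimately show ?thesis using c sz by (simp add: phi_rowP env_flip_Psi Psi_mult emul_as bm_sum_l)
 qed
qed

text \<open>The Calabi-Yau property is transported from the unknown resolution to the Koszul
  resolution by comparison maps. The first clause records the finite length of the unknown one:
  beyond it the composite through that resolution is zero, so the homotopy contracts the Koszul
  complex.\<close>

lemma cy_columns:
 assumes cy: "calabi_yau (Suc n) A"
 obtains N TT where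
  "!!i j. Suc i > N ==> j < m (Suc i) ==> EX y b. row (Suc (Suc i)) y & col i b &
    EE (Suc i) j - ((\<Sum>l<m (Suc (Suc i)). y l ** MM (Suc i) l j) + dcol i b j):NN"
  "!!i c. i ~= n ==> clcol (Suc i) c ==> excol i c"
  "!!c j. clcol 0 c ==> j < m 0 ==> c j:NN"
  "!!c. clcol (Suc n) c ==> TT c:cr A"
  "!!b c. clcol (Suc n) b ==> clcol (Suc n) c ==> TT (%j. b j + c j) = TT b +[A] TT c"
  "!!z c. z:Te ==> clcol (Suc n) c ==> TT (%j. c j ** swp z) = env_act A (Psi z) (TT c)"
  "!!a. a:cr A ==> EX c. clcol (Suc n) c & TT c = a"
  "!!c. clcol (Suc n) c ==> TT c = 0[A] <-> excol n c"
proof -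
 obtain P :: "nat => (_, nat => (('v, 'e) qelem set \<times> ('v, 'e) qelem set \<Rightarrow>\<^sub>0 complex) set) module" and d ep N thy
  where P: "fg_res E (diag_module A) P d ep" and N: "!!i. i > N ==> cr (P i) = {0[P i]}"
  and ex: "!!i fi. i ~= Suc n ==> cocyc E P d i fi ==> cobd E P d i fi"
  and cong: "!!fi qs. ALL x:cr (P (Suc n)). fi x = qs x ==> thy fi = thy qs"
  and th: "!!fi. cocyc E P d (Suc n) fi ==> thy fi:cr A"
  "!!fi qs. cocyc E P d (Suc n) fi ==> cocyc E P d (Suc n) qs ==> thy (%x. fi x +[E] qs x) = thy fi +[A] thy qs"
  "!!z fi. z:cr E ==> cocyc E P d (Suc n) fi ==> thy (%x. fi x *[E] env_flip z) = env_act A z (thy fi)"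
  "!!a. a:cr A ==> EX fi. cocyc E P d (Suc n) fi & thy fi = a"
  "!!fi. cocyc E P d (Suc n) fi ==> thy fi = 0[A] <-> cobd E P d (Suc n) fi"
  by (rule calabi_yau_cohomology[OF E_ring[unfolded E_def] cy, folded E_def]) (rule that)
 obtain f g s t where "comparison E (diag_module A) P d ep PC dC eC f g s" "comparison E (diag_module A) PC dC eC P d ep g f t"
  by (rule comparison_exists[OF E_ring P kz_res])
 then interpret F: comparison E "diag_module A" P d ep PC dC eC f g s + G: comparison E "diag_module A" PC dC eC P d ep g f t .
 interpret ring E by (rule E_ring)
 let ?F = "%i c x. phi i c (f i x)"
 have pull: "cocyc E P d i (?F i c)" if "clcol i c" for i c by (rule F.cocyc_pull[OF clcol_cocyc[OF that]])
 have bd: "excol i c <-> cobd E P d (Suc i) (?F (Suc i) c)" if c: "clcol (Suc i) c" for i c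
  using F.cobd_reflect[OF clcol_cocyc[OF c]] F.cobd_pull[of "Suc i" "phi (Suc i) c"] cobd_phi[of i c] c by (auto simp: clcol_def excol_def)
 show ?thesis
 proof (rule that[of N "%c. thy (?F (Suc n) c)"])
  fix b c z
  assume c: "clcol (Suc n) c"
  show "thy (?F (Suc n) c):cr A" by (rule th(1)[OF pull[OF c]])
  show "thy (?F (Suc n) (%j. b j + c j)) = thy (?F (Suc n) b) +[A] thy (?F (Suc n) c)" if b: "clcol (Suc n) b"
   unfolding th(2)[OF pull[OF b] pull[OF c], symmetric]
   by (rule cong) (use b c lhD(1)[OF F.f(1)] in \<open>simp add: phi_add clcol_def\<close>)
  show "thy (?F (Suc n) (%j. c j ** swp z)) = env_act A (Psi z) (thy (?F (Suc n) c))" if z: "z:Te"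
   unfolding th(3)[OF Psi_E[OF z] pull[OF c], symmetric]
   by (rule cong) (use z c lhD(1)[OF F.f(1)] in \<open>simp add: phi_flip clcol_def\<close>)
  show "thy (?F (Suc n) c) = 0[A] <-> excol n c" using th(5)[OF pull[OF c]] bd[OF c] by simp
 next
  show "excol i c" if "i ~= n" "clcol (Suc i) c" for i c using ex[OF _ pull[OF that(2)]] bd[OF that(2)] that(1) by simp
  show "c j:NN" if c: "clcol 0 c" and j: "j < m 0" for c j
  proof -
   have "cobd E PC dC 0 (phi 0 c)" using F.cobd_reflect[OF clcol_cocyc[OF c]] ex[OF _ pull[OF c]] by simp
   hence "Psi (c j) = 0[E]" using phi_unit[of 0 c j] unit_row[OF j] c j by (auto simp: cobd_def PC_cr clcol_def)
   thus ?thesis using c j by (simp add: Psi_zr Psi_eq clcol_def col_def sub_0)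
  qed
 next
  fix a assume a: "a:cr A"
  obtain fi where p: "cocyc E P d (Suc n) fi" "thy fi = a" using th(4)[OF a] by blast
  obtain c where c: "clcol (Suc n) c" "!!x. x:cr (PC (Suc n)) ==> fi (g (Suc n) x) = phi (Suc n) c x"
   by (rule cocyc_clcol[OF G.cocyc_pull[OF p(1)]]) (rule that)
  \<comment> \<open>The cocycle fi and its pull-back along g f differ by a coboundary, on which
    \<open>thy\<close> vanishes. So the pull-back, which comes from a column, has the same
    value.\<close>
  let ?h = "%x. fi x -[E] fi (g (Suc n) (f (Suc n) x))"
  have cg: "cocyc E P d (Suc n) (%x. fi (g (Suc n) (f (Suc n) x)))" by (rule F.cocyc_pull[OF G.cocyc_pull[OF p(1)]])
  have ch: "cocyc E P d (Suc n) ?h"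
   unfolding cocyc_def
  proof (intro conjI ballI)
   show "lmod_hom E (P (Suc n)) (rgm E) ?h"
    by (rule lmod_hom_sub[OF l_mod_regular[OF E_ring], simplified]) (use p(1) cg in \<open>simp_all add: cocyc_def\<close>)
   show "?h (d (Suc n) x) = 0[E]" if "x:cr (P (Suc (Suc n)))" for x
    using p(1) cg that by (simp add: cocyc_def minus_eq)
  qed
  have "thy ?h = 0[A]" using th(5)[OF ch] G.homotopy_cobd[OF p(1)] by simp
  moreover have "thy fi = thy (%x. ?h x +[E] fi (g (Suc n) (f (Suc n) x)))"
  proof (rule cong, rule ballI)
   fix x assume x: "x:cr (P (Suc n))"
   have "fi x:cr E" "fi (g (Suc n) (f (Suc n) x)):cr E"
    using p(1) cg x by (auto simp: cocyc_def dest: lhD(1))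
   thus "fi x = ?h x +[E] fi (g (Suc n) (f (Suc n) x))" by (simp add: minus_eq a_assoc l_neg)
  qed
  moreover have "thy (%x. fi (g (Suc n) (f (Suc n) x))) = thy (?F (Suc n) c)"
   by (rule cong) (use c(2) lhD(1)[OF F.f(1)] in simp)
  ultimately have e': "a = 0[A] +[A] thy (?F (Suc n) c)" using th(2)[OF ch cg] p(2) by simp
  interpret A: ring A by (rule A_ring)
  from e' have "thy (?F (Suc n) c) = a" using th(1)[OF pull[OF c(1)]] by simp
  thus "EX c. clcol (Suc n) c & thy (?F (Suc n) c) = a" using c(1) by blast
 next
  fix i j assume i: "Suc i > N" and j: "j < m (Suc i)"
  \<comment> \<open>The homotopy is evaluated at the j-th generator u, and the homomorphism with
    column \<open>dt\<close> reads off the j-th coordinate of the result.\<close>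
  define u where "u = rowP (Suc i) (%j'. if j' = j then EE (Suc i) j else 0)"
  define dt where "dt = (%j'. if j' = j then EE (Suc i) j else 0)"
  have dt: "col (Suc i) dt" by (simp add: col_def dt_def sub_0)
  have u: "u:cr (PC (Suc i))" unfolding u_def PC_cr using unit_row[OF j] by blast
  note res = fg_resD[OF kz_res]
  interpret PM: left_module E "PC (Suc i)" by (rule res(3))
  have sh: "lmod_hom E (PC i) (PC (Suc i)) (s i)" for i using F.s by (simp add: homotopic_id_def)
  have "g (Suc i) u = 0[P (Suc i)]" using lhD(1)[OF F.g(1) u] N[OF i] by simp
  hence "f (Suc i) (g (Suc i) u) = 0[PC (Suc i)]"
   using lmod_hom_zr[OF fg_resD(3)[OF P] res(3) F.f(1)] by simp
  hence e: "u = 0[PC (Suc i)] +[PC (Suc i)] (dC (Suc i) (s (Suc i) u) +[PC (Suc i)] s i (dC i u))"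
   using F.s u unfolding homotopic_id_def by metis
  have c1: "dC (Suc i) (s (Suc i) u):cr (PC (Suc i))" by (rule lhD(1)[OF res(4) lhD(1)[OF sh u]])
  have c2: "s i (dC i u):cr (PC (Suc i))" by (rule lhD(1)[OF sh lhD(1)[OF res(4) u]])
  note ph = phi_hom[OF dt]
  have "phi (Suc i) dt u = phi (Suc i) dt (dC (Suc i) (s (Suc i) u)) +[E] phi (Suc i) dt (s i (dC i u))"
   by (subst e) (use lhD(2)[OF ph c1 c2] PM.M.l_zero c1 c2 in simp)
  moreover have "phi (Suc i) dt u = Psi (EE (Suc i) j)" unfolding u_def using phi_unit[OF dt j] by (simp add: dt_def)
  moreover obtain y where y: "row (Suc (Suc i)) y" "s (Suc i) u = rowP (Suc (Suc i)) y"
   using lhD(1)[OF sh u] by (auto simp: PC_cr)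
  have "dcol (Suc i) dt l = MM (Suc i) l j" if "l < m (Suc (Suc i))" for l
  proof -
   have "dcol (Suc i) dt l = (\<Sum>j'<m (Suc i). if j' = j then MM (Suc i) l j else 0)"
    unfolding dcol_def dt_def by (rule sum.cong) (use MM_EE[OF that j] in auto)
   thus ?thesis using j by simp
  qed
  hence "phi (Suc i) dt (dC (Suc i) (s (Suc i) u)) = Psi (\<Sum>l<m (Suc (Suc i)). y l ** MM (Suc i) l j)"
   using phi_dC[OF dt lhD(1)[OF sh u]] phi_rowP[OF y(1) dcol_col[OF dt]] by (simp add: y(2))
  moreover obtain b where b: "col i b" "!!x. x:cr (PC i) ==> phi (Suc i) dt (s i x) = phi i b x"
   by (rule hom_phi[OF lmod_hom_comp[OF sh ph]]) (rule that)
  have "phi (Suc i) dt (s i (dC i u)) = Psi (dcol i b j)"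
   using b(2)[OF lhD(1)[OF res(4) u]] phi_dC[OF b(1) u] phi_unit[OF dcol_col[OF b(1)] j] by (simp add: u_def)
  ultimately have "Psi (EE (Suc i) j) = Psi ((\<Sum>l<m (Suc (Suc i)). y l ** MM (Suc i) l j) + dcol i b j)" by (simp add: Psi_add)
  moreover have "(\<Sum>l<m (Suc (Suc i)). y l ** MM (Suc i) l j):Te" "dcol i b j:Te"
   using y(1) dcol_col[OF b(1)] j by (auto intro!: sub_sum Te_mult MM_Te simp: row_def col_def)
  ultimately have "EE (Suc i) j - ((\<Sum>l<m (Suc (Suc i)). y l ** MM (Suc i) l j) + dcol i b j):NN"
   using j by (simp add: Psi_eq sub_add)
  thus "EX y b. row (Suc (Suc i)) y & col i b &
    EE (Suc i) j - ((\<Sum>l<m (Suc (Suc i)). y l ** MM (Suc i) l j) + dcol i b j):NN" using y(1) b(1) by blast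
 qed
qed

end

section \<open>The top degree of the Koszul complex\<close>

lemma lev_eact: "lev plen 0 (eact z x) = eact (lev deg2 0 z) (lev plen 0 x)"
proof (rule bilin_eqI[of "%z x. lev plen 0 (eact z x)" "%z x. eact (lev deg2 0 z) (lev plen 0 x)"])
 fix b :: "('v, 'e) qpath \<times> ('v, 'e) qpath" and c :: "('v, 'e) qpath"
 obtain p q where b: "b = (p, q)" by (cases b)
 have e: "eact (bas (p, q)) (bas c) = bas p *. bas c *. bas q" using eact_ten[of "bas p" "bas q" "bas c"] by simp
 have "plen r = plen p + plen c + plen q" if "pcomp p c = Some s" "pcomp s q = Some r" for r s
  using plen_pcomp[OF that(1)] plen_pcomp[OF that(2)] by simp
 hence "lev plen 0 (bas p *. bas c *. bas q) = (if plen p + plen c + plen q = 0 then bas p *. bas c *. bas q else 0)"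
  by (cases "pcomp p c"; cases "pcomp (the (pcomp p c)) q") (auto simp: lev_bas pl_zr[OF pl_lev])
 thus "lev plen 0 (eact (bas b) (bas c)) = eact (lev deg2 0 (bas b)) (lev plen 0 (bas c))"
  unfolding b by (auto simp: lev_bas deg2_def e pl_zr[OF pl_eact_l] pl_zr[OF plin_eact_right])
qed (intro pl_o[OF pl_lev] pl_eact_l plin_eact_right pl_o[OF pl_eact_l pl_lev] pl_o[OF plin_eact_right pl_lev])+

locale koszul_deformation = koszul_pbw Q R P thy m kb kp hd tl
 for Q :: "('v, 'e) pre_digraph" and R P thy m kb kp hd tl +
 assumes kos: "two_koszul Q R"
begin

sublocale CI: koszul_complex Q R R m kb kp hd tl
 by unfold_locales (rule DD_I, assumption+, rule row_exact_I[OF kos])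

sublocale CJ: koszul_complex Q P R m kb kp hd tl
 by unfold_locales (rule DD_J, assumption+, rule row_exact_lift[OF row_exact_I[OF kos]])

lemma lev_NN: "n:I.NN ==> k < 2 ==> lev deg2 k n = 0"
proof (rule pmI)
 fix b assume "n:I.NN" "k < 2"
 thus "lk (lev deg2 k n) b = lk 0 b" using NN_low[of n] by (auto simp: lk_lev sp_in_i)
qed

lemma lev_dcol: "lev deg2 0 (dcol i b j) = 0" "lev deg2 (Suc k) (dcol i b j) = dcol i (%j'. lev deg2 k (b j')) j"
 using raises_MM(2) by (simp_all add: dcol_def pl_sum[OF pl_lev] raises_def)

lemma lev_EE: "lev deg2 k (EE i j) = (if k = 0 then EE i j else 0)"
 by (simp add: EE_def lev_bas deg2_def)

lemma EE_nz: "EE i j ~= 0" by (metis EE_def lk_bas_self lookup_zero zero_neq_one)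

definition dt where "dt i j = (%j'. if j' = j then EE i j else 0)"

lemma col_dt: "j < m i ==> col i (dt i j)" by (simp add: col_def dt_def sub_0)

end

text \<open>The dimension of the Calabi-Yau property is \<open>Suc n\<close> here. The assumptions
  are the output of \<open>cy_columns\<close> for A; the congruences among them are modulo
  \<open>I.NN\<close>, which is graded and starts in degree two, so they are equalities in degrees
  zero and one.\<close>

locale top_class = koszul_deformation Q R P thy m kb kp hd tl
 for Q :: "('v, 'e) pre_digraph" and R P thy m kb kp hd tl +
 fixes n N :: nat and TT :: "(nat => (('v, 'e) qpath \<times> ('v, 'e) qpath \<Rightarrow>\<^sub>0 complex)) => ('v, 'e) qelem set"
 assumes contract: "Suc i > N ==> j < m (Suc i) ==> EX y b. row (Suc (Suc i)) y & col i b &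
    EE (Suc i) j - ((\<Sum>l<m (Suc (Suc i)). y l ** MM (Suc i) l j) + dcol i b j):I.NN"
  and exact: "i ~= n ==> CI.clcol (Suc i) c ==> CI.excol i c"
  and exact_0: "CI.clcol 0 c ==> j < m 0 ==> c j:I.NN"
  and Th_A: "CI.clcol (Suc n) c ==> TT c:cr I.A"
  and Th_add: "CI.clcol (Suc n) b ==> CI.clcol (Suc n) c ==> TT (%j. b j + c j) = TT b +[I.A] TT c"
  and Th_act: "z:Te ==> CI.clcol (Suc n) c ==> TT (%j. c j ** swp z) = env_act I.A (I.Psi z) (TT c)"
  and Th_onto: "a:cr I.A ==> EX c. CI.clcol (Suc n) c & TT c = a"
  and Th_ker: "CI.clcol (Suc n) c ==> TT c = 0[I.A] <-> CI.excol n c"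
begin

text \<open>Entries of the differential have degree one and relations start in degree two, so no
  generator is congruent to a boundary. If a term above the top were nonzero, exactness would make
  the next one nonzero, and so on, against the contraction beyond \<open>N\<close>.\<close>

lemma m_zr: "i > n ==> m (Suc i) = 0"
proof (rule ccontr)
 assume i: "i > n" and "m (Suc i) ~= 0"
 hence pos: "m (Suc i + k) ~= 0" for k
 proof (induction k)
  case (Suc k)
  show ?case
  proof
   assume z: "m (Suc i + Suc k) = 0"
   have j: "0 < m (Suc i + k)" using Suc by simp
   \<comment> \<open>Without generators in the next degree every column is closed, in particular
     that of a single dual generator.\<close>
   hence "CI.clcol (Suc (i + k)) (dt (Suc (i + k)) 0)" using z col_dt[of 0 "Suc (i + k)"] by (simp add: CI.clcol_def)
   then obtain b where "EE (Suc (i + k)) 0 - dcol (i + k) b 0:I.NN" using exact[of "i + k"] i j unfolding CI.excol_def dt_def by force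
   from lev_NN[OF this, of 0] show False by (simp add: pl_df[OF pl_lev] lev_dcol lev_EE EE_nz)
  qed
 qed simp
 have "Suc (i + N) > N" "0 < m (Suc (i + N))" using pos[of N] by simp_all
 from contract[OF this] obtain y b where "EE (Suc (i + N)) 0 - ((\<Sum>l<m (Suc (Suc (i + N))). y l ** MM (Suc (i + N)) l 0) + dcol (i + N) b 0):I.NN" by blast
 from lev_NN[OF this, of 0] show False
  using raises_MM(1) by (simp add: pl_df[OF pl_lev] pl_add[OF pl_lev] pl_sum[OF pl_lev] lev_dcol lev_EE EE_nz raises_def)
qed

lemma clcol_top: "CI.clcol (Suc n) c <-> col (Suc n) c" by (simp add: CI.clcol_def m_zr)

lemma Th_smult: "col (Suc n) c ==> x:T ==> TT c = I.cl x ==> z:Te ==> TT (%j. c j ** swp z) = I.cl (eact z x)"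
 using Th_act[of z c] by (simp add: clcol_top I.env_act_Psi)

lemma Th_rep: "col (Suc n) c ==> EX x:T. TT c = I.cl x"
 using Th_A[of c] by (auto simp: clcol_top I.A_cr)

lemma Th_plus: "col (Suc n) b ==> col (Suc n) c ==> TT b = I.cl x ==> TT c = I.cl y ==> TT (%j. b j + c j) = I.cl (x + y)"
 using Th_add[of b c] by (simp add: clcol_top I.A_add)

lemma col_smult: "col i c ==> z:Te ==> col i (%j. c j ** z)" and col_add: "col i b ==> col i c ==> col i (%j. b j + c j)"
 and col_sc: "col i c ==> col i (%j. pscale r (c j))"
 by (simp_all add: col_def emul_as[symmetric] I.Te_mult bm_add_r bm_sc_r sub_add sub_scale)

lemma Th_cong:
 assumes b: "col (Suc n) b" and c: "col (Suc n) c" and e: "CI.excol n (%j. b j - c j)"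
 shows "TT b = TT c"
proof -
 have d: "col (Suc n) (%j. b j - c j)" by (rule CI.col_df[OF b c])
 obtain x where x: "x:T" "TT c = I.cl x" using Th_rep[OF c] by blast
 have "TT (%j. b j - c j) = I.cl 0" using Th_ker[of "%j. b j - c j"] d e by (simp add: clcol_top I.A_zero)
 from Th_plus[OF d c this x(2)] show ?thesis by (simp add: x(2))
qed

lemma Th_cong0: "col (Suc n) b ==> col (Suc n) c ==> (!!j. j < m (Suc n) ==> b j = c j) ==> TT b = TT c"
 by (rule Th_cong) (auto simp: CI.excol_def col_def dcol_def sub_0 intro!: exI[of _ "%_. 0"])

lemma Th_sum:
 fixes k :: nat
 assumes "!!j. j < k ==> col (Suc n) (C j)" "!!j. j < k ==> TT (C j) = I.cl (x j)"
 shows "col (Suc n) (%i. \<Sum>j<k. C j i) & TT (%i. \<Sum>j<k. C j i) = I.cl (\<Sum>j<k. x j)"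
 using assms
proof (induction k)
 case 0
 have z: "col (Suc n) (%_. 0)" by (simp add: col_def sub_0)
 hence "CI.excol n (%_. 0)" by (auto simp: CI.excol_def col_def dcol_def sub_0 intro!: exI[of _ "%_. 0"])
 hence "TT (%_. 0) = I.cl 0" using Th_ker[of "%_. 0"] z by (simp add: clcol_top I.A_zero)
 thus ?case using z by simp
next
 case (Suc k)
 hence "col (Suc n) (%i. \<Sum>j<k. C j i)" "TT (%i. \<Sum>j<k. C j i) = I.cl (\<Sum>j<k. x j)" "col (Suc n) (C k)" "TT (C k) = I.cl (x k)" by simp_all
 thus ?case using Th_plus col_add by simp
qed

lemma Th_df: "col (Suc n) c ==> col (Suc n) c' ==> TT c = TT c' ==> CI.excol n (%j. c j - c' j)"
proof -
 assume c: "col (Suc n) c" "col (Suc n) c'" "TT c = TT c'"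
 have d: "col (Suc n) (%j. c j - c' j)" by (rule CI.col_df[OF c(1,2)])
 obtain x where x: "x:T" "TT c' = I.cl x" using Th_rep[OF c(2)] by blast
 obtain y where y: "y:T" "TT (%j. c j - c' j) = I.cl y" using Th_rep[OF d] by blast
 have "I.cl (y + x) = I.cl x" using Th_plus[OF d c(2) y(2) x(2)] c(3) x(2) by simp
 hence "I.cl y = I.cl 0" by (simp add: I.cl_eq del: qcos_zr)
 thus ?thesis using Th_ker[of "%j. c j - c' j"] d y(2) by (simp add: clcol_top I.A_zero)
qed

text \<open>\<open>xd j\<close> represents the value of the isomorphism at the j-th dual generator.
  Its part of length zero, \<open>g j\<close>, and the scalar \<open>al j\<close> in it carry the
  degree-zero information of the Calabi-Yau property; \<open>co c j\<close> is the constant term of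
  a column entry.\<close>

definition xd where "xd j = rp (TT (dt (Suc n) j))"
definition g where "g j = lev plen 0 (xd j)"
definition al where "al j = lk (g j) (triv (hd (Suc n) j))"
definition co where "co c j = lk (c j) (triv (hd (Suc n) j), triv (tl (Suc n) j))"

lemma xd: "j < m (Suc n) ==> xd j:T" "j < m (Suc n) ==> TT (dt (Suc n) j) = I.cl (xd j)"
 using Th_A[of "dt (Suc n) j"] col_dt[of j "Suc n"] by (simp_all add: xd_def clcol_top I.rp_T I.cl_rp)

lemma Th_eq: "col (Suc n) c ==> TT c = I.cl (\<Sum>j<m (Suc n). eact (swp (c j)) (xd j))"
proof -
 assume c: "col (Suc n) c"
 have cT: "c j:Te" if "j < m (Suc n)" for j using c that by (simp add: col_def)
 have t: "col (Suc n) (%i. dt (Suc n) j i ** c j)" "TT (%i. dt (Suc n) j i ** c j) = I.cl (eact (swp (c j)) (xd j))" if j: "j < m (Suc n)" for j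
  using col_smult[OF col_dt[OF j] cT[OF j]] Th_smult[OF col_dt[OF j] xd[OF j] swp_sp[OF cT[OF j]]] by simp_all
 note s = Th_sum[of "m (Suc n)" "%j i. dt (Suc n) j i ** c j", OF t]
 have "(\<Sum>j<m (Suc n). dt (Suc n) j i ** c j) = c i" if "i < m (Suc n)" for i
 proof -
  have "(\<Sum>j<m (Suc n). dt (Suc n) j i ** c j) = (\<Sum>j<m (Suc n). if j = i then c i else 0)"
   by (rule sum.cong) (use c in \<open>auto simp: dt_def col_def\<close>)
  thus ?thesis using that by simp
 qed
 hence "TT c = TT (%i. \<Sum>j<m (Suc n). dt (Suc n) j i ** c j)" using s by (intro Th_cong0[OF c]) auto
 thus ?thesis using s by simp
qed

lemma lev_I: "x:I.J ==> k < 2 ==> lev plen k x = 0"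
proof (rule pmI)
 fix p assume "x:I.J" "k < 2"
 thus "lk (lev plen k x) p = lk 0 p" using I_low[of x p] by (cases "lk x p = 0") (auto simp: lk_lev)
qed

lemma lev_cl: "I.cl x = I.cl y ==> k < 2 ==> lev plen k x = lev plen k y"
 using lev_I[of "x - y" k] by (simp add: I.cl_eq pl_df[OF pl_lev])

lemma lev_swp:
 fixes z :: "('v, 'e) qpath \<times> ('v, 'e) qpath \<Rightarrow>\<^sub>0 complex"
 shows "lev deg2 k (swp z) = swp (lev deg2 k z)"
proof (rule pl_eqI[of "%z. lev deg2 k (swp z)" "%z. swp (lev deg2 k z)"])
 fix b :: "('v, 'e) qpath \<times> ('v, 'e) qpath"
 obtain p q where "b = (p, q)" by (cases b)
 thus "lev deg2 k (swp (bas b)) = swp (lev deg2 k (bas b))" by (simp add: lev_bas deg2_def pl_zr[OF pl_swp])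
qed (intro pl_o[OF pl_lev] pl_o[OF pl_swp] pl_lev pl_swp)+

lemma lev_col: "col i c ==> j < m i ==> lev deg2 0 (c j) = pscale (lk (c j) (triv (hd i j), triv (tl i j))) (EE i j)"
proof -
 assume c: "col i c" and j: "j < m i"
 have "EE i j ** lev deg2 0 (c j) = lev deg2 0 (EE i j ** c j)" by (simp add: lev_emul[OF EE_deg])
 hence "EE i j ** lev deg2 0 (c j) = lev deg2 0 (c j)" "lev deg2 0 (c j):Te" using c j by (simp_all add: col_def lev_sp_in)
 thus ?thesis using degree_0_EE[of "lev deg2 0 (c j)" i j] lev_in_below[of deg2 0 "c j"] by (simp add: lk_lev deg2_def)
qed

lemma g_EE: "j < m (Suc n) ==> eact (swp (EE (Suc n) j)) (g j) = g j"
proof -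
 assume j: "j < m (Suc n)"
 have "TT (%i. dt (Suc n) j i ** swp (swp (EE (Suc n) j))) = I.cl (eact (swp (EE (Suc n) j)) (xd j))"
  using j by (intro Th_smult col_dt xd swp_sp EE_Te)
 moreover have "(%i. dt (Suc n) j i ** swp (swp (EE (Suc n) j))) = dt (Suc n) j" by (auto simp: dt_def)
 ultimately have "I.cl (eact (swp (EE (Suc n) j)) (xd j)) = I.cl (xd j)" using xd(2)[OF j] by simp
 from lev_cl[OF this, of 0] show ?thesis by (simp add: lev_eact lev_swp lev_EE g_def)
qed

lemma g_eq: "j < m (Suc n) ==> g j = (if tl (Suc n) j = hd (Suc n) j then pscale (al j) (ev (hd (Suc n) j)) else 0)"
proof -
 assume j: "j < m (Suc n)"
 have V: "g j:Vpow Q 0" using xd(1)[OF j] unfolding g_def lev_def Vpow_eq by (rule sp_in_mono[OF restr_supp2]) auto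
 have "g j = ev (tl (Suc n) j) *. g j *. ev (hd (Suc n) j)" using g_EE[OF j] by (simp only: EE_ten swp_ten eact_ten)
 also have "... = pscale (al j) (ev (tl (Suc n) j) *. ev (hd (Suc n) j))" by (simp only: tmul_as Vpow_0_ev(1)[OF V] bm_sc_r al_def)
 finally show ?thesis by (simp add: ev_ev del: bm_bas)
qed

text \<open>As I(R) has nothing of length below two, the part of length zero is well defined on
  classes, and only the constant terms of the column reach it.\<close>

lemma lev_Th: "col (Suc n) c ==> TT c = I.cl x ==> lev plen 0 x = (\<Sum>j<m (Suc n). pscale (co c j) (g j))"
proof -
 assume c: "col (Suc n) c" and x: "TT c = I.cl x"
 have "lev plen 0 x = lev plen 0 (\<Sum>j<m (Suc n). eact (swp (c j)) (xd j))" using Th_eq[OF c] x by (intro lev_cl) simp_all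
 also have "... = (\<Sum>j<m (Suc n). pscale (co c j) (g j))"
  unfolding pl_sum[OF pl_lev]
  by (rule sum.cong) (simp_all add: lev_eact lev_swp lev_col[OF c] co_def pl_sc[OF pl_swp] pl_sc[OF pl_eact_l] g_EE[unfolded g_def] g_def)
 finally show ?thesis .
qed

text \<open>A preimage of a path arises from a preimage of the trivial path at its tail by
  multiplication with the path, which raises all degrees by its length.\<close>

lemma Th_high:
 assumes x: "x:sp_in {p:qpaths Q. plen p \<ge> k}"
 shows "EX c. col (Suc n) c & (ALL j<m (Suc n). ALL l<k. lev deg2 l (c j) = 0) & TT c = I.cl x"
proof -
 let ?S = "{x:T. EX c. col (Suc n) c & (ALL j<m (Suc n). ALL l<k. lev deg2 l (c j) = 0) & TT c = I.cl x}"
 have "subsp ?S"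
 proof (rule pm.subspaceI)
  have "col (Suc n) (%_. 0) & TT (%_. 0) = I.cl 0" using Th_sum[of 0 "%_ _. 0" "%_. 0"] by simp
  thus "0:?S" by (auto simp: sub_0 pl_zr[OF pl_lev])
  show "x + y:?S" if xy: "x:?S" "y:?S" for x y
  proof -
   obtain b c where b: "col (Suc n) b" "ALL j<m (Suc n). ALL l<k. lev deg2 l (b j) = 0" "TT b = I.cl x"
    and c: "col (Suc n) c" "ALL j<m (Suc n). ALL l<k. lev deg2 l (c j) = 0" "TT c = I.cl y" using xy by blast
   thus ?thesis using xy col_add[OF b(1) c(1)] Th_plus[OF b(1) c(1) b(3) c(3)]
    by (auto simp: sub_add pl_add[OF pl_lev] intro!: exI[of _ "%j. b j + c j"])
  qed
  show "pscale r x:?S" if xy: "x:?S" for r x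
  proof -
   obtain c where c: "col (Suc n) c" "ALL j<m (Suc n). ALL l<k. lev deg2 l (c j) = 0" "TT c = I.cl x" using xy by blast
   have z: "pscale r I.unitE:Te" "swp (pscale r I.unitE) = pscale r I.unitE"
    by (simp_all add: sub_scale pl_sc[OF pl_swp] swp_ten I.unitE_def I.ten_Te uT_in)
   have e: "c j ** pscale r I.unitE = pscale r (c j)" if "j < m (Suc n)" for j
    using c(1) that by (simp add: col_def bm_sc_r I.unitE_right)
   have "TT (%j. c j ** pscale r I.unitE) = I.cl (pscale r x)"
    using Th_smult[OF c(1) _ c(3) z(1)] xy unfolding z(2)
    by (simp add: pl_sc[OF pl_eact_l] I.unitE_def eact_ten uT_l uT_r T_mult)
   thus ?thesis using xy c(2) e col_smult[OF c(1) z(1)]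
    by (auto simp: sub_scale pl_sc[OF pl_lev] intro!: exI[of _ "%j. c j ** pscale r I.unitE"])
  qed
 qed
 moreover have "bas p:?S" if p: "p:{p:qpaths Q. plen p \<ge> k}" for p
 proof -
  have v: "ptail p:verts Q" "bas p:T" "bas p *. ev (ptail p) = bas p" using p ends_in[of p] by (auto simp: pcomp_tr_r)
  obtain c where c: "col (Suc n) c" "TT c = I.cl (ev (ptail p))" using Th_onto[of "I.cl (ev (ptail p))"] v by (auto simp: clcol_top)
  have z: "ten (bas p) unitT:Te" using v(2) by (rule I.ten_Te[OF _ uT_in])
  have "TT (%j. c j ** ten unitT (bas p)) = I.cl (bas p)"
   using Th_smult[OF c(1) _ c(2) z] v by (simp add: swp_ten eact_ten uT_r del: bm_bas ten_bas)
  moreover have "ten unitT (bas p):sp_in {x. deg2 x = plen p}"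
   unfolding unitT_def pl_sum[OF pl_ten_l] by (intro sub_sum sub_sp_in) (simp add: deg2_def)
  moreover have "col (Suc n) (%j. c j ** ten unitT (bas p))" by (rule col_smult[OF c(1) I.ten_Te[OF uT_in v(2)]])
  ultimately show ?thesis using p by (auto simp: lev_emul)
 qed
 ultimately have "x:?S" using pl_in_sub_sp[OF pl_id _ x] by blast
 thus ?thesis by blast
qed

lemma lev_zr_sp: "x:T ==> (!!l. l < k ==> lev plen l x = 0) ==> x:sp_in {p:qpaths Q. plen p \<ge> k}"
 unfolding sp_in_i
proof (intro allI impI CollectI conjI)
 fix p assume x: "ALL b. lk x b ~= 0 --> b:qpaths Q" "!!l. l < k ==> lev plen l x = 0" "lk x p ~= 0"
 thus "p:qpaths Q" by blast
 show "k \<le> plen p" using lk_lev[of plen "plen p" x p] x(2)[of "plen p"] x(3) by (cases "plen p < k") auto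
qed

text \<open>If the combination vanishes, the column of constants r has an image of length at least
  one, which by \<open>Th_high\<close> is also the image of a column without constant terms. The
  difference of the two columns is exact, and exact columns have no constant terms.\<close>

lemma g_independent:
 assumes "(\<Sum>j<m (Suc n). pscale (r j) (g j)) = 0" "j < m (Suc n)"
 shows "r j = 0"
proof -
 define c where "c = (%j. pscale (r j) (EE (Suc n) j))"
 have c: "col (Suc n) c" by (simp add: col_def c_def bm_sc_r sub_scale)
 have co: "co c j = r j" for j by (simp add: co_def c_def EE_def)
 obtain x where x: "x:T" "TT c = I.cl x" using Th_rep[OF c] by blast
 have "lev plen 0 x = 0" unfolding lev_Th[OF c x(2)] co by (rule assms(1))
 hence "x:sp_in {p:qpaths Q. plen p \<ge> 1}" by (intro lev_zr_sp[OF x(1)]) simp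
 from Th_high[OF this] obtain c' where c': "col (Suc n) c'" "ALL j<m (Suc n). lev deg2 0 (c' j) = 0" "TT c' = I.cl x" by auto
 have "CI.excol n (%j. c j - c' j)" using Th_df[OF c c'(1)] x(2) c'(3) by simp
 then obtain b where "c j - c' j - dcol n b j:I.NN" using assms(2) by (auto simp: CI.excol_def)
 from lev_NN[OF this, of 0] have "pscale (r j) (EE (Suc n) j) = 0"
  using c'(2) assms(2) by (simp add: pl_df[OF pl_lev] lev_dcol c_def pl_sc[OF pl_lev] lev_EE)
 thus ?thesis by (simp add: EE_nz)
qed

text \<open>The part of length zero is nonzero by independence, and it lies in e_t S e_h, which is
  zero unless the ends agree.\<close>

lemma top_ends:
 assumes j: "j < m (Suc n)"
 shows "tl (Suc n) j = hd (Suc n) j" "al j ~= 0"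
proof -
 have "g j ~= 0"
 proof
  assume "g j = 0"
  hence "(\<Sum>j'<m (Suc n). pscale (if j' = j then 1 else 0) (g j')) = 0" by (intro sum.neutral) auto
  from g_independent[OF this j] show False by simp
 qed
 thus "tl (Suc n) j = hd (Suc n) j" "al j ~= 0" using g_eq[OF j] by (auto split: if_splits)
qed

text \<open>Two generators at the same vertex would have proportional parts of length zero.\<close>

lemma top_inj:
 assumes j: "j < m (Suc n)" "j' < m (Suc n)" "hd (Suc n) j = hd (Suc n) j'"
 shows "j = j'"
proof (rule ccontr)
 assume ne: "j ~= j'"
 let ?r = "%i. if i = j then al j' else if i = j' then - al j else 0"
 have "(\<Sum>i<m (Suc n). pscale (?r i) (g i)) = (\<Sum>i\<in>{j, j'}. pscale (?r i) (g i))"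
  using j by (intro sum.mono_neutral_right) auto
 also have "... = 0" using ne j(3) by (simp add: g_eq[OF j(1)] g_eq[OF j(2)] top_ends[OF j(1)] top_ends[OF j(2)] mult.commute)
 finally show False using g_independent[OF _ j(1), of ?r] top_ends(2)[OF j(2)] by simp
qed

text \<open>The trivial path at v is in the image, and only generators at v contribute to it in
  length zero. Together with \<open>top_inj\<close>, the top generators correspond to the
  vertices.\<close>

lemma top_cover: "v:verts Q ==> EX j<m (Suc n). hd (Suc n) j = v"
proof (rule ccontr)
 assume v: "v:verts Q" and h: "\<not> (EX j<m (Suc n). hd (Suc n) j = v)"
 obtain c where c: "col (Suc n) c" "TT c = I.cl (ev v)" using Th_onto[of "I.cl (ev v)"] v by (auto simp: clcol_top)
 have "ev v = (\<Sum>j<m (Suc n). pscale (co c j) (g j))" using lev_Th[OF c] by (simp add: lev_bas)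
 from arg_cong[OF this, of "%x. lk x (triv v)"]
 have "1 = (\<Sum>j<m (Suc n). co c j * lk (g j) (triv v))" by (simp add: lookup_sum)
 also have "... = 0" using h by (intro sum.neutral) (auto simp: g_eq lk_bas triv_def)
 finally show False by simp
qed

text \<open>The functional lives on the Koszul term below the top and detects b as the first letter
  of exactly one top basis element. The elements b xd_w and xd_u b, suitably scaled, have opposite
  parts of length one. So the column c of degree one with their sum as image is exact up to higher
  degree, and \<open>et\<close> consists of the constant terms of a column that bounds it.\<close>

lemma top_functional:
 assumes b: "b:arcs Q"
 shows "EX j0 et s. j0 < m (Suc n) & s ~= 0 &
  (ALL a:arcs Q. ALL j<m (Suc n). (\<Sum>l<m n. et l * cL n l a (kb (Suc n) j)) = (if a = b & j = j0 then s else 0))"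
proof -
 let ?D = "Suc n"
 have bT: "av b:T" "head Q b:verts Q" "tail Q b:verts Q" using b by auto
 obtain u w where u: "u < m ?D" "hd ?D u = head Q b" and w: "w < m ?D" "hd ?D w = tail Q b" using top_cover bT by metis
 \<comment> \<open>Chosen so that the parts of length one of the two summands of x below
   cancel.\<close>
 define be where "be = - al w"
 define c where "c = (%j. pscale (al u) (dt ?D w j ** ten unitT (av b)) + pscale be (dt ?D u j ** ten (av b) unitT))"
 define x where "x = pscale (al u) (av b *. xd w) + pscale be (xd u *. av b)"
 have z: "ten (av b) unitT:Te" "ten unitT (av b):Te" by (intro I.ten_Te bT uT_in)+
 have c12: "col ?D (%j. dt ?D w j ** ten unitT (av b))" "col ?D (%j. dt ?D u j ** ten (av b) unitT)"
  using col_smult[OF col_dt[OF w(1)] z(2)] col_smult[OF col_dt[OF u(1)] z(1)] .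
 have c: "col ?D c" unfolding c_def by (intro col_add col_sc c12)
 have xT: "x:T" unfolding x_def using xd(1)[OF u(1)] xd(1)[OF w(1)] bT by (intro sub_add sub_scale sub_sp_in T_mult)
 have Thc: "TT c = I.cl x"
 proof -
  have "I.cl (\<Sum>j<m ?D. eact (swp (c j)) (xd j)) = I.cl x"
  proof -
   have "eact (swp (c j)) (xd j) = (if j = w then pscale (al u) (eact (swp (EE ?D w ** ten unitT (av b))) (xd w)) else 0)
    + (if j = u then pscale be (eact (swp (EE ?D u ** ten (av b) unitT)) (xd u)) else 0)" for j
    by (simp add: c_def dt_def pl_add[OF pl_swp] pl_sc[OF pl_swp] pl_add[OF pl_eact_l] pl_sc[OF pl_eact_l] pl_zr[OF pl_swp] pl_zr[OF pl_eact_l])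
   hence "(\<Sum>j<m ?D. eact (swp (c j)) (xd j)) = pscale (al u) (eact (swp (EE ?D w ** ten unitT (av b))) (xd w)) + pscale be (eact (swp (EE ?D u ** ten (av b) unitT)) (xd u))"
    using u(1) w(1) by (simp add: sum.distrib)
   moreover have e: "I.cl (eact (swp (EE ?D j)) (xd j)) = I.cl (xd j)" if j: "j < m ?D" for j
   proof -
    have "(%i. dt ?D j i ** swp (swp (EE ?D j))) = dt ?D j" by (auto simp: dt_def)
    thus ?thesis using Th_smult[OF col_dt[OF j] xd[OF j] swp_sp[OF EE_Te[OF j]]] xd(2)[OF j] by simp
   qed
   have "eact (ten (av b) unitT) (eact (swp (EE ?D w)) (xd w)) - av b *. xd w:I.J" "eact (ten unitT (av b)) (eact (swp (EE ?D u)) (xd u)) - xd u *. av b:I.J"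
   proof -
    have "eact (ten (av b) unitT) (eact (swp (EE ?D w)) (xd w) - xd w):I.J" "eact (ten unitT (av b)) (eact (swp (EE ?D u)) (xd u) - xd u):I.J"
    using e[OF w(1)] e[OF u(1)] z by (simp_all add: I.cl_eq I.eact_J)
    thus "eact (ten (av b) unitT) (eact (swp (EE ?D w)) (xd w)) - av b *. xd w:I.J" "eact (ten unitT (av b)) (eact (swp (EE ?D u)) (xd u)) - xd u *. av b:I.J"
    using xd(1)[OF w(1)] xd(1)[OF u(1)] bT(1) by (simp_all add: pl_df[OF plin_eact_right] eact_ten[of unitT "av b" "xd u"] eact_ten[of "av b" unitT "xd w"] uT_l uT_r T_mult del: ten_bas bm_bas)
   qed
   ultimately show ?thesis
    unfolding x_def I.cl_eq swp_emul swp_ten eact_emul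
    by (simp only: add_diff_add sc_diff[symmetric]) (intro sub_add sub_scale I.J_sub)
  qed
  thus ?thesis using Th_eq[OF c] by simp
 qed
 have "lev plen 0 x = 0 & lev plen 1 x = 0"
 proof -
  have l: "lev plen 0 (av b *. y) = 0" "lev plen 0 (y *. av b) = 0" "lev plen 1 (av b *. y) = av b *. lev plen 0 y" "lev plen 1 (y *. av b) = lev plen 0 y *. av b" for y
  proof -
   have p: "lev plen k (obas (pcomp p q)) = (if plen p + plen q = k then obas (pcomp p q) else 0)" for k and p q :: "('v, 'e) qpath"
    by (cases "pcomp p q") (auto simp: lev_bas plen_pcomp pl_zr[OF pl_lev])
   show "lev plen 0 (av b *. y) = 0"
    by (rule pl_eqI[of "%y. lev plen 0 (av b *. y)" "%y. 0"])
    (simp_all add: plin_def pl_add[OF pl_lev] pl_sc[OF pl_lev] bm_add_r bm_sc_r p)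
   show "lev plen 0 (y *. av b) = 0"
    by (rule pl_eqI[of "%y. lev plen 0 (y *. av b)" "%y. 0"])
    (simp_all add: plin_def pl_add[OF pl_lev] pl_sc[OF pl_lev] bm_add_l bm_sc_l p)
   show "lev plen 1 (av b *. y) = av b *. lev plen 0 y"
    by (rule pl_eqI[of "%y. lev plen 1 (av b *. y)" "%y. av b *. lev plen 0 y"])
    (simp_all add: plin_def pl_add[OF pl_lev] pl_sc[OF pl_lev] bm_add_r bm_sc_r lev_bas p)
   show "lev plen 1 (y *. av b) = lev plen 0 y *. av b"
    by (rule pl_eqI[of "%y. lev plen 1 (y *. av b)" "%y. lev plen 0 y *. av b"])
    (simp_all add: plin_def pl_add[OF pl_lev] pl_sc[OF pl_lev] bm_add_l bm_sc_l lev_bas p)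
  qed
  have bz: "pscale (al u * al w) y + pscale (be * al u) y = 0" for y :: "('v, 'e) qelem"
   by (simp add: be_def)
  show ?thesis
   using g_eq[OF u(1)] g_eq[OF w(1)] top_ends(1)[OF u(1)] top_ends(1)[OF w(1)] u(2) w(2)
   by (simp add: x_def pl_add[OF pl_lev] pl_sc[OF pl_lev] l[unfolded One_nat_def] g_def[symmetric] bz bm_sc_l bm_sc_r ev_av mult.commute del: bm_bas)
 qed
 hence "x:sp_in {p:qpaths Q. plen p \<ge> 2}" by (intro lev_zr_sp[OF xT]) (elim conjE less_2_cases[THEN disjE]; simp)
 from Th_high[OF this] obtain c' where c': "col ?D c'" "ALL j<m ?D. ALL l<2. lev deg2 l (c' j) = 0" "TT c' = I.cl x" by blast
 have "CI.excol n (%j. c j - c' j)" using Th_df[OF c c'(1)] Thc c'(3) by simp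
 then obtain h where "col n h & (ALL j<m ?D. c j - c' j - dcol n h j:I.NN)" unfolding CI.excol_def ..
 hence h: "col n h" "!!j. j < m ?D ==> c j - c' j - dcol n h j:I.NN" by simp_all
 define et where "et l = lk (h l) (triv (hd n l), triv (tl n l))" for l
 have hl: "lev deg2 0 (h l) = pscale (et l) (EE n l)" if "l < m n" for l using lev_col[OF h(1) that] by (simp add: et_def)
 \<comment> \<open>In degree one neither relations nor c' contribute, and the coboundary of h sees
   only the constant terms of h.\<close>
 have key: "(\<Sum>l<m n. pscale (et l) (MM n j l)) = c j" if j: "j < m ?D" for j
 proof -
  have t: "ten unitT (av b):sp_in {x. deg2 x = 1}" "ten (av b) unitT:sp_in {x. deg2 x = 1}"
   unfolding unitT_def pl_sum[OF pl_ten_l] pl_sum[OF plin_ten_right] by (intro sub_sum sub_sp_in; simp add: deg2_def)+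
  have "lev deg2 1 (c j) = c j"
   by (simp add: c_def dt_def pl_add[OF pl_lev] pl_sc[OF pl_lev] lev_emul[OF t(1)] lev_emul[OF t(2)] lev_EE pl_zr[OF pl_lev])
  hence "c j = lev deg2 1 (dcol n h j)"
   using lev_NN[OF h(2)[OF j], of 1] c'(2) j by (simp add: pl_df[OF pl_lev])
  also have "... = (\<Sum>l<m n. pscale (et l) (MM n j l))"
   unfolding One_nat_def lev_dcol(2) by (unfold dcol_def, rule sum.cong) (simp_all add: hl bm_sc_r MM_EE[OF j])
  finally show ?thesis by simp
 qed
 have i1: "triv v ~= ar a" "ar a ~= triv v" for v a by (simp_all add: triv_def arrow_def)
 have i2: "ar a = ar a' <-> a = a'" for a a' by (auto simp: arrow_def)
 have "(\<Sum>l<m n. et l * cL n l a (kb ?D j)) = (if a = b & j = u then be else 0)" if a: "a:arcs Q" and j: "j < m ?D" for a j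
 proof -
  let ?p = "(ar a, triv (tl ?D j))"
  have "(\<Sum>l<m n. et l * cL n l a (kb ?D j)) = lk (c j) ?p"
   unfolding key[OF j, symmetric] lookup_sum by (simp add: lk_MM_l[OF a])
  also have "... = (if a = b & j = u then be else 0)"
  proof -
   have w': "EE ?D w ** ten unitT (av b) = ten (ev (hd ?D w)) (av b)"
    using ht_verts[OF w(1)] top_ends(1)[OF w(1)] w(2) uT_r[of "ev (hd ?D w)"] by (simp add: EE_ten ten_emul ev_av del: bm_bas ten_bas)
   have u': "EE ?D u ** ten (av b) unitT = ten (av b) (ev (hd ?D u))"
    using ht_verts[OF u(1)] top_ends(1)[OF u(1)] u(2) uT_l[of "ev (hd ?D u)"] by (simp add: EE_ten ten_emul ev_av del: bm_bas ten_bas)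
   show ?thesis
    unfolding c_def dt_def using w' u' top_ends(1)[OF u(1)]
    by (auto simp: Poly_Mapping.lookup_add lk_ten lk_bas i1 i2 simp del: ten_bas)
  qed
  finally show ?thesis .
 qed
 thus ?thesis using u(1) top_ends(2)[OF w(1)] be_def by (intro exI[of _ u] exI[of _ et] exI[of _ be]) simp
qed

end

section \<open>Superpotentials\<close>

lemma pc_nz: "pcoeff x p q ~= 0 ==> EX r. pcomp p q = Some r & lk x r ~= 0"
 by (cases "pcomp p q") (auto simp: pcoeff_def)

locale superpotential_class = top_class Q R P thy m kb kp hd tl n N TT
 for Q :: "('v, 'e) pre_digraph" and R P thy m kb kp hd tl n N TT +
 fixes \<Phi> :: "('v, 'e) qelem"
 assumes n: "n \<ge> 1" and sp: "superpotential Q (Suc n) \<Phi>" and R_eq: "R = superpot_rels Q \<Phi> (Suc n - 2)"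
begin

abbreviation sg' where "sg' \<equiv> (- 1 :: complex) ^ n"

lemma sg': "sg' * sg' = 1" by simp

lemma Phi_V: "\<Phi> : Vpow Q (Suc n)" using sp by (simp add: superpotential_def)

lemma rot: "a:arcs Q ==> ldel (ar a) \<Phi> = pscale sg' (rdel (ar a) \<Phi>)"
proof (rule pmI)
 fix t assume a: "a:arcs Q"
 have "pcoeff \<Phi> (ar a) t = sg' * pcoeff \<Phi> t (ar a)"
 proof (cases "t:qpaths Q")
  case True
  thus ?thesis using sp a by (simp add: superpotential_def)
 next
  case False
  \<comment> \<open>The symmetry is given for paths of Q only; for other t both coefficients vanish,
    because \<Phi> is supported on paths of Q and factors of paths are paths.\<close>
  have "pcoeff \<Phi> (ar a) t = 0"
   using False pc_nz[of \<Phi> "ar a" t] pcomp_factor_r[of "ar a" t] Vpow_lk[OF Phi_V] arrow_in[OF a] by blast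
  moreover have "pcoeff \<Phi> t (ar a) = 0"
   using False pc_nz[of \<Phi> t "ar a"] pcomp_factor_l[of t "ar a"] Vpow_lk[OF Phi_V] arrow_in[OF a] by blast
  ultimately show ?thesis by simp
 qed
 thus "lk (ldel (ar a) \<Phi>) t = lk (pscale sg' (rdel (ar a) \<Phi>)) t"
  by (simp add: lk_ldel lk_rdel)
qed

text \<open>The coefficient of a zero product is zero by convention, so by cyclic symmetry a path
  that cannot be rotated does not occur in \<Phi>.\<close>

lemma Phi_closed: "lk \<Phi> r ~= 0 ==> phead r = ptail r"
proof -
 assume r: "lk \<Phi> r ~= 0"
 obtain a t where a: "a:arcs Q" "t:qpaths Q" "pcomp (ar a) t = Some r"
  using split_last[of r n] Vpow_lk[OF Phi_V r] by metis
 have "pcoeff \<Phi> (ar a) t ~= 0" using r by (simp add: pcoeff_def a(3))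
 hence "pcoeff \<Phi> t (ar a) ~= 0" using sp a by (simp add: superpotential_def)
 hence "pcomp t (ar a) ~= None" using pc_nz by blast
 thus ?thesis using pcomp_ends[OF a(3)] by (simp add: pcomp_None_i)
qed

text \<open>The path is rotated from the left end to the right end one arrow at a time; the case of
  a trivial path uses that \<Phi> consists of closed paths.\<close>

lemma ldel_rot: "p:qpaths Q ==> EX s. ldel p \<Phi> = pscale s (rdel p \<Phi>)"
proof (induction "plen p" arbitrary: p)
 case 0
 then obtain v where p: "p = triv v" using plen_0[of p] by auto
 have "ldel p \<Phi> = rdel p \<Phi>"
 proof (rule pmI)
  fix t show "lk (ldel p \<Phi>) t = lk (rdel p \<Phi>) t"
   using Phi_closed[of t] by (cases "lk \<Phi> t = 0") (simp_all add: lk_ldel lk_rdel pcoeff_def p pcomp_tr_l pcomp_tr_r)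
 qed
 thus ?case by (intro exI[of _ 1]) simp
next
 case (Suc k)
 obtain a q where a: "a:arcs Q" "q:qpaths Q" "plen q = k" "pcomp (ar a) q = Some p" using split_last[OF Suc(3) Suc(2)[symmetric]] by blast
 obtain s where s: "ldel q \<Phi> = pscale s (rdel q \<Phi>)" using Suc(1)[of q] a by auto
 have "ldel p \<Phi> = pscale sg' (ldel q (rdel (ar a) \<Phi>))" by (simp add: ldel_ldel[OF a(4), symmetric] rot[OF a(1)] pl_sc[OF pl_ldel])
 also have "... = pscale (sg' * s) (rdel p \<Phi>)" by (simp add: ldel_rdel s pl_sc[OF pl_rdel] rdel_rdel[OF a(4)])
 finally show ?case by blast
qed

lemma ldel_triv: "ldel (triv v) x = ev v *. x"
 by (rule pmI) (simp add: lk_ldel lk_ev_l pcoeff_def pcomp_tr_l)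

lemma ldel_ldel_None: "pcomp p q = None ==> ldel q (ldel p x) = 0"
proof (rule pmI, rule ccontr)
 fix t assume pq: "pcomp p q = None" and "lk (ldel q (ldel p x)) t ~= lk 0 t"
 hence "pcoeff (ldel p x) q t ~= 0" by (simp add: lk_ldel)
 then obtain r where r: "pcomp q t = Some r" "pcoeff x p r ~= 0" using pc_nz[of "ldel p x"] unfolding lk_ldel by blast
 then obtain r' where "pcomp p r = Some r'" using pc_nz by blast
 thus False using pcomp_ends[OF r(1)] pcomp_ends[of p r r'] pq by (simp add: pcomp_None_i)
qed

lemma X_R: "p:qpaths Q ==> plen p = n - 1 ==> ldel p \<Phi> : R"
 unfolding R_eq superpot_rels_def S_generated_def by auto

text \<open>Cyclic symmetry turns a deletion at the right end into one at the left end, so both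
  deletions asked for by \<open>K_SucI\<close> are left deletions of \<Phi> by longer paths. Those
  by paths of length n - 1 are the defining relations.\<close>

lemma ldel_Phi_K: "i \<ge> 2 ==> p:qpaths Q ==> plen p + i = Suc n ==> ldel p \<Phi> : K i"
proof (induction i arbitrary: p rule: dec_induct)
 case base
 hence "plen p = n - 1" by simp
 thus ?case using X_R[OF base(1)] K_2 by simp
next
 case (step i)
 have V: "ldel p \<Phi> : Vpow Q (Suc i)" using ldel_Vpow[OF step(4), of \<Phi> "Suc i"] Phi_V step(5) by simp
 have h: "ldel (ar a) (ldel p \<Phi>):K i" if a: "a:arcs Q" for a
 proof (cases "pcomp p (ar a)")
  case None
  thus ?thesis by (simp add: ldel_ldel_None sub_0)
 next
  case (Some r)
  thus ?thesis using step(3)[of r] pcomp_in[OF step(4) arrow_in[OF a] Some] plen_pcomp[OF Some] step(5) by (simp add: ldel_ldel)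
 qed
 moreover have "rdel (ar a) (ldel p \<Phi>):K i" if a: "a:arcs Q" for a
 proof -
  have "rdel (ar a) (ldel p \<Phi>) = pscale sg' (ldel p (ldel (ar a) \<Phi>))"
   by (simp add: ldel_rdel[symmetric] rot[OF a] pl_sc[OF pl_ldel])
  moreover have "ldel p (ldel (ar a) \<Phi>):K i"
  proof (cases "pcomp (ar a) p")
   case None
   thus ?thesis by (simp add: ldel_ldel_None sub_0)
  next
   case (Some r)
   thus ?thesis using step(3)[of r] pcomp_in[OF arrow_in[OF a] step(4) Some] plen_pcomp[OF Some] step(5) by (simp add: ldel_ldel)
  qed
  ultimately show ?thesis by (simp add: sub_scale)
 qed
 ultimately show ?case using K_SucI[OF step(1) V] by blast
qed

lemma Phi_K: "\<Phi> : K (Suc n)"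
proof -
 have "ev v *. \<Phi> : K (Suc n)" if "v:verts Q" for v
  using ldel_Phi_K[of "Suc n" "triv v"] that n by (simp add: ldel_triv)
 hence "(\<Sum>v\<in>verts Q. ev v *. \<Phi>):K (Suc n)" by (intro sub_sum K_sub) auto
 hence "unitT *. \<Phi> : K (Suc n)" by (simp add: unitT_def bm_sum_l)
 moreover have "\<Phi> : T" using Phi_V Vpow_T by blast
 ultimately show ?thesis by (simp add: uT_l)
qed

section \<open>Contraction with the superpotential\<close>

definition ka where "ka j = pairing (kp (Suc n) j) \<Phi>"

lemma Phi_expand: "\<Phi> = (\<Sum>j<m (Suc n). pscale (ka j) (kb (Suc n) j))"
 using expand[OF Phi_K] by (simp add: ka_def)

text \<open>Otherwise e_v \<Phi> = 0 for the vertex v of the j-th generator, which is the only one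
  at v. By cyclic symmetry e_v then kills all relations, hence also the j-th basis element, since
  this lies in R tensor a power of V and is fixed by e_v.\<close>

lemma ka_nz: "j < m (Suc n) ==> ka j ~= 0"
proof
 assume j: "j < m (Suc n)" and z: "ka j = 0"
 let ?v = "hd (Suc n) j"
 have v: "ev ?v:Vpow Q 0" using ht_verts[OF j] by simp
 have "ev ?v *. pscale (ka i) (kb (Suc n) i) = 0" if i: "i:{..<m (Suc n)}" for i
 proof (cases "i = j")
  case False
  hence "?v ~= hd (Suc n) i" using top_inj[OF j, of i] i by auto
  have "ev ?v *. kb (Suc n) i = 0"
  proof (rule pmI)
   fix p show "lk (ev ?v *. kb (Suc n) i) p = lk 0 p"
    using kb_ends[of i "Suc n" p] i `?v ~= hd (Suc n) i`
    by (cases "lk (kb (Suc n) i) p = 0") (simp_all add: lk_ev_l)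
  qed
  thus ?thesis by (simp add: bm_sc_r)
 qed (simp add: z)
 hence vP: "ev ?v *. \<Phi> = 0" by (subst Phi_expand) (simp add: bm_sum_r)
 \<comment> \<open>A left deletion is a multiple of a right deletion, and deleting on the right
   keeps the heads of the paths.\<close>
 have vd: "ev ?v *. ldel p \<Phi> = 0" if p: "p:qpaths Q" for p
 proof -
  obtain s where s: "ldel p \<Phi> = pscale s (rdel p \<Phi>)" using ldel_rot[OF p] by blast
  have "lk (ev ?v *. rdel p \<Phi>) t = 0" for t
  proof -
   have "lk \<Phi> r = 0" if "phead r = ?v" for r
    using arg_cong[OF vP, of "%x. lk x r"] that by (simp add: lk_ev_l)
   thus ?thesis using pcomp_ends[of t p] by (auto simp: lk_ev_l lk_rdel pcoeff_def split: option.splits)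
  qed
  hence "ev ?v *. rdel p \<Phi> = 0" by (intro pmI) simp
  thus ?thesis by (simp add: s bm_sc_r)
 qed
 \<comment> \<open>The elements killed by e_v form an S-subbimodule, so only the generators of R
   have to be inspected.\<close>
 let ?Y = "{x:T. ev ?v *. x = 0}"
 have "S_subbimodule Q ?Y"
  unfolding S_subbimodule_def path_alg_eq basis_alg_s
 proof (intro conjI ballI)
  show "subsp ?Y" by (rule pm.subspaceI) (simp_all add: sub_0 sub_add sub_scale bm_add_r bm_sc_r)
  fix s t x assume s: "s:Vpow Q 0" "t:Vpow Q 0" "x:?Y"
  hence "s:T" "t:T" using Vpow_T by blast+
  moreover have "ev ?v *. (s *. x *. t) = pscale (lk s (triv ?v)) (ev ?v *. x *. t)"
   by (simp only: tmul_as[symmetric] Vpow_0_ev(2)[OF s(1)] bm_sc_l)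
  ultimately show "s *. x *. t:?Y" using s(3) by (simp add: T_mult)
 qed auto
 moreover have "{ldel p \<Phi> |p. p:qpaths Q & plen p = Suc n - 2} <= ?Y"
 proof
  fix x assume "x:{ldel p \<Phi> |p. p:qpaths Q & plen p = Suc n - 2}"
  then obtain p where p: "x = ldel p \<Phi>" "p:qpaths Q" "plen p = n - 1" by auto
  thus "x:?Y" using vd[OF p(2)] X_R[OF p(2,3)] R_T by auto
 qed
 ultimately have RY: "R <= ?Y" unfolding R_eq superpot_rels_def S_generated_def by blast
 have "kb (Suc n) j:tprod Q (tprod Q (Vpow Q 0) R) (Vpow Q (n - 1))"
  using K_ge2[of "Suc n" "kb (Suc n) j"] kb_K[OF j] n by auto
 hence "ev ?v *. kb (Suc n) j:{0}"
 proof (rule tprod3_pl)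
  fix x y z assume "x:Vpow Q 0" "y:R"
  thus "ev ?v *. (x *. y *. z):{0}"
   using RY by (auto simp: tmul_as[symmetric] Vpow_0_ev(2) bm_sc_l)
 qed simp_all
 hence "kb (Suc n) j = 0" using kb_EE[OF j] by simp
 thus False using dual[OF j j] by simp
qed

lemma cL_Phi: "(\<Sum>j<m (Suc n). ka j * cL n l a (kb (Suc n) j)) = cL n l a \<Phi>"
 and cR_Phi: "(\<Sum>j<m (Suc n). ka j * cR n l a (kb (Suc n) j)) = cR n l a \<Phi>"
 by (subst Phi_expand, simp add: cL_def cR_def pl_sum[OF pl_ldel] pl_sc[OF pl_ldel] pl_sum[OF pl_rdel] pl_sc[OF pl_rdel]
   pr_sum pr_sc sum_distrib_left mult.left_commute)+

text \<open>The sign of d_r in the top degree is opposite to the sign of the cyclic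
  symmetry.\<close>

lemma cR_cL: "a:arcs Q ==> cR n l a \<Phi> = - cL n l a \<Phi>"
 by (simp add: cR_def cL_def rot pr_sc)

text \<open>On tensors, \<open>fm\<close> sends x tensor y to y x. It is the passage from the inner
  bimodule structure of the dual to the ordinary one of CQ; \<open>eta\<close> and \<open>U\<close>
  are the contraction of a top column with \<Phi> and a section of it.\<close>

definition fm :: "(('v, 'e) qpath \<times> ('v, 'e) qpath \<Rightarrow>\<^sub>0 complex) => ('v, 'e) qelem" where "fm z = eact (swp z) unitT"
definition eta where "eta c = (\<Sum>j<m (Suc n). pscale (ka j) (fm (c j)))"
definition U where "U z j = pscale (1 / ka j) (EE (Suc n) j ** z)"

lemma pl_fm: "plin fm" unfolding fm_def by (rule pl_o[OF pl_eact_l pl_swp])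

lemma fm_ten: "x:T ==> y:T ==> fm (ten x y) = y *. x" by (simp add: fm_def swp_ten eact_unit_ten)

text \<open>The weights \<open>ka\<close> turn the coefficients of the basis elements into those of
  \<Phi>, for which left and right parts cancel. This is an equality in CQ, so it holds for A and
  for the deformation alike.\<close>

lemma eta_dcol: "eta (dcol n y) = 0"
proof -
 have fMM: "fm (MM n j l) = (\<Sum>a\<in>arcs Q. pscale (cL n l a (kb (Suc n) j) + cR n l a (kb (Suc n) j)) (av a))" if j: "j < m (Suc n)" "l < m n" for j l
 proof -
  have "fm (ten (av a) (ev (tl (Suc n) j))) = (if head Q a = hd (Suc n) j then av a else 0)"
   "fm (ten (ev (hd (Suc n) j)) (av a)) = (if tail Q a = tl (Suc n) j then av a else 0)" if "a:arcs Q" for a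
   using that ht_verts[OF j(1)] by (simp_all add: fm_ten ev_av top_ends(1)[OF j(1)] del: bm_bas ten_bas)
  note t = this
  show ?thesis
   unfolding MM_def pl_sum[OF pl_fm]
  proof (rule sum.cong[OF refl])
   fix a assume a: "a:arcs Q"
   show "fm (pscale (cL n l a (kb (Suc n) j)) (ten (av a) (ev (tl (Suc n) j))) + pscale (cR n l a (kb (Suc n) j)) (ten (ev (hd (Suc n) j)) (av a)))
    = pscale (cL n l a (kb (Suc n) j) + cR n l a (kb (Suc n) j)) (av a)"
    unfolding pl_add[OF pl_fm] pl_sc[OF pl_fm] t[OF a] using cL_nz(1)[OF j, of a] cR_nz(1)[OF j, of a]
    by (cases "cL n l a (kb (Suc n) j) = 0"; cases "cR n l a (kb (Suc n) j) = 0") (simp_all add: sc_distl)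
  qed
 qed
 have "eta (dcol n y) = (\<Sum>l<m n. eact (swp (y l)) (\<Sum>j<m (Suc n). pscale (ka j) (fm (MM n j l))))"
  unfolding eta_def dcol_def pl_sum[OF pl_fm] pl_sum[OF plin_eact_right] sc_sum pl_sc[OF plin_eact_right]
  by (subst sum.swap) (simp add: fm_def swp_emul eact_emul)
 also have "... = 0"
 proof (rule sum.neutral, rule ballI)
  fix l assume l: "l:{..<m n}"
  have "(\<Sum>j<m (Suc n). pscale (ka j) (fm (MM n j l)))
   = (\<Sum>a\<in>arcs Q. \<Sum>j<m (Suc n). pscale (ka j * cL n l a (kb (Suc n) j) + ka j * cR n l a (kb (Suc n) j)) (av a))"
   using l by (subst sum.swap) (simp add: fMM sc_sum distrib_left)
  also have "... = (\<Sum>a\<in>arcs Q. pscale (cL n l a \<Phi> + cR n l a \<Phi>) (av a))"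
   by (simp only: pm.scale_sum_left[symmetric] sum.distrib cL_Phi cR_Phi)
  also have "... = 0" by (simp add: cR_cL)
  finally show "eact (swp (y l)) (\<Sum>j<m (Suc n). pscale (ka j) (fm (MM n j l))) = 0" by (simp add: pl_zr[OF plin_eact_right])
 qed
 finally show ?thesis .
qed

lemma U_col: "z:Te ==> col (Suc n) (U z)"
 by (simp add: col_def U_def bm_sc_r emul_as[symmetric] sub_scale I.Te_mult)

lemma pl_U: "plin (%z. U z j)" unfolding U_def by (intro pl_pscale pl_bm_r)

text \<open>The functional of \<open>top_functional\<close> gives a column whose coboundary has b as
  its single left term; the cyclic symmetry then determines the right terms.\<close>

lemma U_boundary:
 assumes b: "b:arcs Q" and x: "x:T" and y: "y:T"
 shows "EX h. col n h & (ALL j<m (Suc n). U (ten (av b *. x) y) j - U (ten x (y *. av b)) j = dcol n h j)"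
proof -
 let ?D = "Suc n"
 obtain j0 et s where j0: "j0 < m ?D" "s ~= 0"
  and f: "!!a j. a:arcs Q ==> j < m ?D ==> (\<Sum>l<m n. et l * cL n l a (kb ?D j)) = (if a = b & j = j0 then s else 0)"
  using top_functional[OF b] by blast
 have hb: "head Q b = hd ?D j0"
 proof (rule ccontr)
  assume "head Q b ~= hd ?D j0"
  hence "(\<Sum>l<m n. et l * cL n l b (kb ?D j0)) = 0" using cL_nz(1)[OF j0(1)] by (intro sum.neutral) auto
  thus False using f[OF b j0(1)] j0(2) by simp
 qed
 let ?R = "%a j. \<Sum>l<m n. et l * cR n l a (kb ?D j)"
 \<comment> \<open>Only one top generator has its tail at the tail of the arrow. So the sum over all
   generators weighted by \<open>ka\<close>, which cyclic symmetry expresses through the left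
   coefficients, has a single term.\<close>
 have R: "?R a j = (if a = b & tl ?D j = tail Q b then - (ka j0 * s / ka j) else 0)" if a: "a:arcs Q" and j: "j < m ?D" for a j
 proof (cases "tail Q a = tl ?D j")
  case False
  hence "?R a j = 0" using cR_nz(1)[OF j] by (intro sum.neutral) auto
  thus ?thesis using False by auto
 next
  case True
  have "?R a i = 0" if "i < m ?D" "i ~= j" for i
   using cR_nz(1)[OF that(1), of _ a] True top_inj[OF that(1) j] top_ends(1)[OF that(1)] top_ends(1)[OF j] that(2) by (intro sum.neutral) auto
  hence "(\<Sum>i<m ?D. ka i * ?R a i) = (\<Sum>i<m ?D. if i = j then ka j * ?R a j else 0)" by (intro sum.cong) auto
  hence "ka j * ?R a j = (\<Sum>i<m ?D. ka i * ?R a i)" using j by simp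
  also have "... = (\<Sum>l<m n. et l * (\<Sum>i<m ?D. ka i * cR n l a (kb ?D i)))"
   unfolding sum_distrib_left by (subst sum.swap) (simp add: mult.left_commute)
  also have "... = - (\<Sum>l<m n. et l * (\<Sum>i<m ?D. ka i * cL n l a (kb ?D i)))" by (simp add: cR_Phi cL_Phi cR_cL[OF a] sum_negf)
  also have "(\<Sum>l<m n. et l * (\<Sum>i<m ?D. ka i * cL n l a (kb ?D i))) = (\<Sum>i<m ?D. ka i * (\<Sum>l<m n. et l * cL n l a (kb ?D i)))"
   unfolding sum_distrib_left by (subst sum.swap) (simp add: mult.left_commute)
  also have "... = (\<Sum>i<m ?D. if i = j0 then (if a = b then ka j0 * s else 0) else 0)" by (rule sum.cong) (auto simp: f[OF a])
  finally have "ka j * ?R a j = - (if a = b then ka j0 * s else 0)" using j0(1) by simp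
  thus ?thesis using True ka_nz[OF j] by (cases "a = b") (auto simp: field_simps)
 qed
 \<comment> \<open>Divided by \<open>ka j0 * s\<close>, so that the left term appears with the
   coefficient \<open>1 / ka j0\<close> that \<open>U\<close> prescribes.\<close>
 define h where "h = (%l. pscale (et l / (ka j0 * s)) (EE n l ** ten x y))"
 have xy: "ten x y:Te" by (rule I.ten_Te[OF x y])
 have "col n h" by (simp add: col_def h_def bm_sc_r emul_as[symmetric] sub_scale I.Te_mult xy)
 moreover have "U (ten (av b *. x) y) j - U (ten x (y *. av b)) j = dcol n h j" if j: "j < m ?D" for j
 proof -
  let ?t = "ten (av b) (ev (tl ?D j))" and ?u = "ten (ev (hd ?D j)) (av b)"
  have "(\<Sum>l<m n. pscale (et l) (MM n j l)) = (\<Sum>a\<in>arcs Q. pscale (\<Sum>l<m n. et l * cL n l a (kb ?D j)) (ten (av a) (ev (tl ?D j))) + pscale (?R a j) (ten (ev (hd ?D j)) (av a)))"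
   unfolding MM_def sc_sum sc_distr pm.scale_scale pm.scale_sum_left sum.distrib[symmetric] by (rule sum.swap)
  also have "... = (\<Sum>a\<in>arcs Q. if a = b then pscale (if j = j0 then s else 0) ?t + pscale (if tl ?D j = tail Q b then - (ka j0 * s / ka j) else 0) ?u else 0)"
   by (rule sum.cong) (auto simp: f j R)
  also have "... = pscale (if j = j0 then s else 0) ?t + pscale (if tl ?D j = tail Q b then - (ka j0 * s / ka j) else 0) ?u" using b by simp
  finally have M: "(\<Sum>l<m n. pscale (et l) (MM n j l)) = pscale (if j = j0 then s else 0) ?t + pscale (if tl ?D j = tail Q b then - (ka j0 * s / ka j) else 0) ?u" .
  have "dcol n h j = pscale (1 / (ka j0 * s)) ((\<Sum>l<m n. pscale (et l) (MM n j l)) ** ten x y)"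
   unfolding dcol_def h_def bm_sum_l sc_sum
   by (rule sum.cong) (simp_all add: bm_sc_l bm_sc_r emul_as[symmetric] MM_EE[OF j])
  also have "... = pscale (if j = j0 then 1 / ka j else 0) (?t ** ten x y) - pscale (if tl ?D j = tail Q b then 1 / ka j else 0) (?u ** ten x y)"
   using ka_nz[OF j0(1)] j0(2) unfolding M by (auto simp: bm_sc_l sc_distr bm_df_l sc_diff)
  also have "pscale (if j = j0 then 1 / ka j else 0) (?t ** ten x y) = U (ten (av b *. x) y) j"
   using top_inj[OF j j0(1)] hb by (auto simp: U_def EE_ten ten_emul tmul_as[symmetric] ev_av pl_zr[OF pl_ten_l] simp del: bm_bas ten_bas)
  also have "pscale (if tl ?D j = tail Q b then 1 / ka j else 0) (?u ** ten x y) = U (ten x (y *. av b)) j"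
   by (auto simp: U_def EE_ten ten_emul tmul_as ev_av pl_zr[OF plin_ten_right] simp del: bm_bas ten_bas)
  finally show ?thesis by simp
 qed
 ultimately show ?thesis by blast
qed

lemma dcol_add: "dcol i (%j. x j + y j) j' = dcol i x j' + dcol i y j'"
 and dcol_scale: "dcol i (%j. pscale c (x j)) j' = pscale c (dcol i x j')"
 and dcol_zr: "dcol i (%_. 0) j' = 0"
 by (simp_all add: dcol_def bm_add_r bm_sc_r sum.distrib sc_sum)

text \<open>As in degree zero of the resolution, but cyclically: arrows at the left of the first
  factor are moved, one at a time, to the right of the second factor.\<close>

lemma U_reduce:
 assumes z: "z:Te"
 shows "EX h. col n h & (ALL j<m (Suc n). U z j - U (ten unitT (fm z)) j = dcol n h j)"
proof -
 let ?f = "%z j. U z j - U (ten unitT (fm z)) j"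
 let ?S = "{z. EX h. col n h & (ALL j<m (Suc n). ?f z j = dcol n h j)}"
 have f: "plin (%z. ?f z j)" for j
  by (intro pl_sub pl_U pl_o[OF pl_U] pl_o[OF plin_ten_right' pl_fm])
 have z0: "col n (%_. 0)" by (simp add: col_def sub_0)
 have S: "subsp ?S"
 proof (rule pm.subspaceI)
  show "0:?S" using z0 dcol_zr[of n] pl_zr[OF f] by force
  show "x + y:?S" if xy: "x:?S" "y:?S" for x y
  proof -
   obtain v w where "col n v" "ALL j<m (Suc n). ?f x j = dcol n v j" "col n w" "ALL j<m (Suc n). ?f y j = dcol n w j" using xy by blast
   hence "col n (%j. v j + w j) & (ALL j<m (Suc n). ?f (x + y) j = dcol n (%j. v j + w j) j)"
    unfolding dcol_add pl_add[OF f] by (simp add: col_add)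
   thus ?thesis by blast
  qed
  show "pscale c x:?S" if xy: "x:?S" for c x
  proof -
   obtain v where "col n v" "ALL j<m (Suc n). ?f x j = dcol n v j" using xy by blast
   hence "col n (%j. pscale c (v j)) & (ALL j<m (Suc n). ?f (pscale c x) j = dcol n (%j. pscale c (v j)) j)"
    unfolding dcol_scale pl_sc[OF f] by (simp add: col_sc)
   thus ?thesis by blast
  qed
 qed
 have "ten (bas p) y:?S" if "y:T" "p:qpaths Q" for p y
  using that
 proof (induction "plen p" arbitrary: p y)
  case 0
  then obtain v where p: "p = triv v" "v:verts Q" using plen_0[of p] ends_in[of p] by auto
  have "?f (ten (bas p) y) j = dcol n (%_. 0) j" if j: "j < m (Suc n)" for j
   using top_ends(1)[OF j] uT_r[of "ev (hd (Suc n) j)"] 0(2) p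
   by (cases "v = hd (Suc n) j")
    (simp_all add: dcol_zr fm_ten U_def EE_ten ten_emul tmul_as pl_zr[OF pl_ten_l] pl_zr[OF plin_ten_right] ev_ev del: bm_bas ten_bas)
  thus ?case using z0 by blast
 next
  case (Suc k)
  obtain a q where a: "a:arcs Q" "q:qpaths Q" "plen q = k" "pcomp (ar a) q = Some p"
   using split_last[OF Suc(4) Suc(2)[symmetric]] by blast
  have p: "bas p = av a *. bas q" by (simp add: a(4))
  have ya: "y *. av a:T" using Suc(3) a(1) by (intro T_mult) simp_all
  have qT: "bas q:T" "av a *. bas q:T" using a(2) Suc(4) by (simp_all add: p[symmetric] del: bm_bas)
  obtain v where v: "col n v" "ALL j<m (Suc n). ?f (ten (bas q) (y *. av a)) j = dcol n v j" using Suc(1)[OF a(3)[symmetric] ya a(2)] by blast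
  obtain w where w: "col n w" "ALL j<m (Suc n). U (ten (av a *. bas q) y) j - U (ten (bas q) (y *. av a)) j = dcol n w j"
   using U_boundary[OF a(1) qT(1) Suc(3)] by auto
  have "?f (ten (bas p) y) j = dcol n (%j. v j + w j) j" if j: "j < m (Suc n)" for j
   unfolding dcol_add v(2)[rule_format, OF j, symmetric] w(2)[rule_format, OF j, symmetric] p fm_ten[OF qT(2) Suc(3)] fm_ten[OF qT(1) ya]
   by (simp add: tmul_as del: bm_bas)
  thus ?case using col_add[OF v(1) w(1)] by blast
 qed
 hence "z:?S"
  using pl_in_sub_sp[OF pl_id S z] by (metis (no_types, lifting) SigmaE sp_in_bas ten_bas)
 thus ?thesis by blast
qed

text \<open>Top generators belong to distinct vertices, so a column is \<open>U\<close> of the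
  weighted sum of its entries; \<open>U_reduce\<close> is applied to that sum.\<close>

lemma col_reduce:
 assumes c: "col (Suc n) c"
 shows "EX h. col n h & (ALL j<m (Suc n). c j - U (ten unitT (eta c)) j = dcol n h j)"
proof -
 let ?z = "\<Sum>i<m (Suc n). pscale (ka i) (c i)"
 have z: "?z:Te" using c by (intro sub_sum sub_scale sub_sp_in) (simp add: col_def)
 have "fm ?z = eta c" by (simp add: eta_def pl_sum[OF pl_fm] pl_sc[OF pl_fm])
 moreover have "U ?z j = c j" if j: "j < m (Suc n)" for j
 proof -
  have "EE (Suc n) j ** c i = (if i = j then c j else 0)" if i: "i < m (Suc n)" for i
  proof (cases "i = j")
   case False
   hence "hd (Suc n) j ~= hd (Suc n) i" using top_inj[OF j i] by auto
   hence "EE (Suc n) j ** (EE (Suc n) i ** c i) = 0"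
    unfolding emul_as[symmetric] by (simp add: EE_ten ten_emul ev_ev pl_zr[OF pl_ten_l] del: bm_bas ten_bas)
   thus ?thesis using c i False by (simp add: col_def)
  qed (use c i in \<open>simp add: col_def\<close>)
  hence "EE (Suc n) j ** ?z = (\<Sum>i<m (Suc n). if i = j then pscale (ka j) (c j) else 0)"
   unfolding bm_sum_r bm_sc_r by (intro sum.cong) auto
  thus ?thesis using j ka_nz[OF j] by (simp add: U_def)
 qed
 ultimately show ?thesis using U_reduce[OF z] by simp
qed

lemma eta_U: "t:T ==> eta (U (ten unitT t)) = t"
proof -
 assume t: "t:T"
 have "pscale (ka j) (fm (U (ten unitT t) j)) = t *. ev (hd (Suc n) j)" if j: "j < m (Suc n)" for j
  using ka_nz[OF j] top_ends(1)[OF j] ht_verts[OF j] t uT_r[of "ev (hd (Suc n) j)"]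
  by (simp add: U_def pl_sc[OF pl_fm] EE_ten ten_emul fm_ten T_mult tmul_as ev_ev del: bm_bas ten_bas)
 hence "eta (U (ten unitT t)) = t *. (\<Sum>j<m (Suc n). ev (hd (Suc n) j))" by (simp add: eta_def bm_sum_r)
 \<comment> \<open>The generators correspond to the vertices, so their trivial paths add up to the
   unit.\<close>
 also have "(\<Sum>j<m (Suc n). ev (hd (Suc n) j)) = unitT"
  unfolding unitT_def
 proof (rule sum.reindex_bij_betw)
  show "bij_betw (hd (Suc n)) {..<m (Suc n)} (verts Q)"
   using top_inj top_cover ht_verts by (fastforce simp: bij_betw_def inj_on_def)
 qed
 finally show ?thesis by (simp add: uT_r t)
qed

lemma eta_NN: "(!!j. j < m (Suc n) ==> c j:J.NN) ==> eta c:J.J"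
 unfolding eta_def fm_def by (intro sub_sum sub_scale J.J_sub J.eact_NN J.NN_swp uT_in) simp

lemma eta_df: "eta (%j. b j - c j) = eta b - eta c"
 by (simp add: eta_def pl_df[OF pl_fm] sc_diff sum_subtractf)

lemma eta_add: "eta (%j. b j + c j) = eta b + eta c"
 by (simp add: eta_def pl_add[OF pl_fm] sc_distr sum.distrib)

lemma eta_act: "eta (%j. c j ** swp z) = eact z (eta c)"
 by (simp add: eta_def fm_def swp_emul eact_emul pl_sum[OF plin_eact_right] pl_sc[OF plin_eact_right])

lemma eta_T: "col (Suc n) c ==> eta c:T"
 unfolding eta_def fm_def by (intro sub_sum sub_scale sub_sp_in I.eact_T swp_sp uT_in) (simp add: col_def)

text \<open>The reduction of a column holds in CQ tensor CQ, and only its remainder, built from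
  \<open>eta c\<close>, is taken modulo I(P). Conversely, \<open>eta\<close> kills coboundaries
  exactly.\<close>

lemma eta_kernel: "col (Suc n) c ==> eta c:J.J <-> CJ.excol n c"
proof
 assume c: "col (Suc n) c" and e: "eta c:J.J"
 obtain h where h: "col n h" "ALL j<m (Suc n). c j - U (ten unitT (eta c)) j = dcol n h j" using col_reduce[OF c] by blast
 have "c j - dcol n h j:J.NN" if j: "j < m (Suc n)" for j
 proof -
  have "c j - dcol n h j = U (ten unitT (eta c)) j" using h(2)[rule_format, OF j] by (simp add: algebra_simps)
  also have "... : J.NN" unfolding U_def using e j by (intro sub_scale J.NN_sub J.NN_l EE_Te J.ten_NN2) (simp_all add: uT_in)
  finally show ?thesis .
 qed
 thus "CJ.excol n c" using h(1) by (auto simp: CJ.excol_def)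
next
 assume "CJ.excol n c"
 then obtain h where "ALL j<m (Suc n). c j - dcol n h j:J.NN" by (auto simp: CJ.excol_def)
 hence "eta (%j. c j - dcol n h j):J.J" by (intro eta_NN) simp
 thus "eta c:J.J" by (simp add: eta_df eta_dcol)
qed

lemma columns_exact_J: "i ~= n ==> CJ.clcol (Suc i) c ==> CJ.excol i c"
 unfolding CJ.clcol_def CJ.excol_def
proof (rule col_exact_lift)
 fix x assume "i ~= n" "col (Suc i) x" "!!j. j < m (Suc (Suc i)) ==> dcol (Suc i) x j:I.NN"
 thus "EX y. col i y & (ALL j<m (Suc i). x j - dcol i y j:I.NN)"
  using exact[of i x] by (simp add: CI.clcol_def CI.excol_def)
qed simp_all

lemma columns_exact_J0: "CJ.clcol 0 c ==> j < m 0 ==> c j:J.NN"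
 unfolding CJ.clcol_def
proof (rule col_exact_lift_0)
 fix x j assume "col 0 x" "!!j. j < m (Suc 0) ==> dcol 0 x j:I.NN" "j < m 0"
 thus "x j:I.NN" using exact_0[of x j] by (simp add: CI.clcol_def)
qed simp_all

end

section \<open>The deformation is Calabi-Yau\<close>

lemma zero_submodule_simps [simp]: "cr (zero_submodule M) = {0[M]}" "add (zero_submodule M) = add M"
 "zero (zero_submodule M) = zero M" "smult (zero_submodule M) = smult M"
 by (simp_all add: zero_submodule_def)

lemma zr_submodule_mod: "left_module R M ==> left_module R (zero_submodule M)"
proof -
 assume "left_module R M"
 then interpret left_module R M .
 have "abelian_group (zero_submodule M)" by (rule abelian_groupI) simp_all
 thus ?thesis
  by (intro left_module.intro R.ring_axioms left_module_axioms.intro) (simp_all add: smult_zr)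
qed

lemma left_module_zero_neg: "left_module R M ==> -[M] 0[M] = 0[M]"
proof -
 assume "left_module R M"
 then interpret left_module R M .
 show ?thesis by (rule M.minus_equality) simp_all
qed

lemma lmod_hom_const_zr: "left_module R M ==> left_module R N ==> lmod_hom R M N (%_. 0[N])"
proof -
 assume "left_module R M" "left_module R N"
 then interpret M: left_module R M + N: left_module R N .
 show ?thesis by (rule lmod_homI) (simp_all add: N.smult_zr)
qed

lemma stalk_cochain: "left_module R M ==> cochain_complex R (stalk_complex M)"
proof -
 assume M: "left_module R M"
 have m: "left_module R (cob (stalk_complex M) i)" and z: "0[cob (stalk_complex M) i] = 0[M]" for i
  using M zr_submodule_mod[OF M] by (simp_all add: stalk_complex_def)
 have "lmod_hom R (cob (stalk_complex M) i) (cob (stalk_complex M) (i + 1)) (cdiff (stalk_complex M) i)" for i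
  using lmod_hom_const_zr[OF m[of i] m[of "i + 1"]] z by (simp add: stalk_complex_def)
 thus ?thesis unfolding cochain_complex_def using m by (simp add: stalk_complex_def)
qed

lemma dual_shift_complex:
 fixes A :: "(complex, 'a) module" and P d and n :: nat
 assumes E: "ring (env_alg A)" and P: "!!i. left_module (env_alg A) (P i)" and d: "!!i. lmod_hom (env_alg A) (P (Suc i)) (P i) (d i)"
  and dd: "!!i x. x:cr (P (Suc (Suc i))) ==> d i (d (Suc i) x) = 0[P i]"
  and D: "!!i. left_module (env_alg A) (env_dual A (P i))"
 shows "cochain_complex (env_alg A) (dual_shift n A P d)"
proof -
 let ?C = "dual_shift n A P d" and ?E = "env_alg A"
 interpret ring ?E by (rule E)
 note ab = lm_ab[OF D]
 note cd = du_shift_cdiff[where A = A and P = P and d = d and n = n, OF E P d ab]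
  and pl = du_pull[where A = A and P = P and d = d, OF E P d ab]
  and cyc = du_cyc[where A = A and P = P and d = d and n = n, OF E P d ab]
 \<comment> \<open>Every degree either belongs to some dual module or is one in which the complex is
   zero.\<close>
 have cs: "(EX i. k = int i - int n) | k + int n < 0" for k by (cases "k + int n < 0") (auto intro!: exI[of _ "nat (k + int n)"])
 have m: "left_module ?E (cob ?C k)" for k
  using cs[of k] D zr_submodule_mod[OF D] by (auto simp: du_shift_cob del: du_s)
 have sh: "cob ?C (int i - int n + 1) = env_dual A (P (Suc i))" for i
  using du_shift_cob(1)[of n A P d "Suc i"] by (simp add: algebra_simps)
 have hom: "lmod_hom ?E (cob ?C k) (cob ?C (k + 1)) (cdiff ?C k)" for k
 proof (cases "k + int n < 0")
  case True
  have "0[cob ?C (k + 1)] = 0[env_dual A (P 0)]"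
   using True by (cases "k + 1 + int n < 0") (auto simp: shift_complex_def env_dual_complex_def)
  hence "cdiff ?C k = (%x. 0[cob ?C (k + 1)])"
   using True left_module_zero_neg[OF m[of "k + 1"]]
   by (auto simp: shift_complex_def env_dual_complex_def fun_eq_iff add.commute add.left_commute simp del: du_s)
  thus ?thesis using lmod_hom_const_zr[OF m m] by simp
 next
  case False
  then obtain i where k: "k = int i - int n" using cs[of k] by auto
  show ?thesis
   unfolding k sh du_shift_cob
  proof (rule lmod_homI)
   fix qs chy z assume p: "qs:cr (env_dual A (P i))"
   hence ph: "lmod_hom ?E (P i) (rgm ?E) qs" by simp
   have pc: "qs (d i x):cr ?E" if "x:cr (P (Suc i))" for x
    using lhD(1)[OF ph lhD(1)[OF d that]] by simp
   have dc: "d i x:cr (P i)" if "x:cr (P (Suc i))" for x by (rule lhD(1)[OF d that])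
   interpret DS: abelian_group "env_dual A (P (Suc i))" by (rule ab)
   have pull: "(\<lambda>p\<in>cr (P (Suc i)). qs (d i p)):cr (env_dual A (P (Suc i)))" by (rule pl[OF p])
   have "(\<lambda>x\<in>cr (P (Suc i)). -[?E] qs (d i x)) = -[env_dual A (P (Suc i))] (\<lambda>p\<in>cr (P (Suc i)). qs (d i p))"
    unfolding env_du_neg[OF E P ab pull] by (rule restrict_ext) simp
   hence "(\<lambda>x\<in>cr (P (Suc i)). -[?E] qs (d i x)):cr (env_dual A (P (Suc i)))" using DS.a_inv_closed[OF pull] by metis
   thus "cdiff ?C (int i - int n) qs:cr (env_dual A (P (Suc i)))" unfolding cd[OF p] using pull by presburger
   show "cdiff ?C (int i - int n) (qs +[env_dual A (P i)] chy) = cdiff ?C (int i - int n) qs +[env_dual A (P (Suc i))] cdiff ?C (int i - int n) chy"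
    if c: "chy:cr (env_dual A (P i))"
   proof -
    have "lmod_hom ?E (P i) (rgm ?E) chy" using c by simp
    hence "chy (d i x):cr ?E" if "x:cr (P (Suc i))" for x using lhD(1)[OF _ dc[OF that]] by fastforce
    moreover have "qs +[env_dual A (P i)] chy:cr (env_dual A (P i))"
    using abelian_monoid.a_closed[OF abelian_group.axioms(1)[OF ab] p c] .
    ultimately show ?thesis unfolding cd[OF p] cd[OF c] cd[OF `qs +[env_dual A (P i)] chy:carrier (env_dual A (P i))`]
    using dc pc by (auto simp: minus_add fun_eq_iff restrict_def)
   qed
   show "cdiff ?C (int i - int n) (z *.[env_dual A (P i)] qs) = z *.[env_dual A (P (Suc i))] cdiff ?C (int i - int n) qs"
    if z: "z:cr ?E"
   proof -
    have s: "z *.[env_dual A (P i)] qs:cr (env_dual A (P i))" by (rule left_module.smult_closed[OF D z p])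
    have sz: "z *.[env_dual A (P (Suc i))] (\<ominus>\<^bsub>env_dual A (P (Suc i))\<^esub> (\<lambda>p\<in>cr (P (Suc i)). qs (d i p)))
    = -[env_dual A (P (Suc i))] (z *.[env_dual A (P (Suc i))] (\<lambda>p\<in>cr (P (Suc i)). qs (d i p)))"
    by (rule l_mod_neg_smult[OF D z pull])
    have e: "(\<lambda>p\<in>cr (P (Suc i)). (z *.[env_dual A (P i)] qs) (d i p)) = z *.[env_dual A (P (Suc i))] (\<lambda>p\<in>cr (P (Suc i)). qs (d i p))"
    using dc by (auto simp: fun_eq_iff)
    have n1: "(\<lambda>x\<in>cr (P (Suc i)). -[?E] chy (d i x)) = -[env_dual A (P (Suc i))] (\<lambda>p\<in>cr (P (Suc i)). chy (d i p))"
    if "chy:cr (env_dual A (P i))" for chy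
    unfolding env_du_neg[OF E P ab pl[OF that]] by (rule restrict_ext) simp
    show ?thesis unfolding cd[OF p] cd[OF s] n1[OF p] n1[OF s] using e sz by presburger
   qed
  qed
 qed
 have "cdiff ?C (k + 1) (cdiff ?C k qs) = 0[cob ?C (k + 2)]" if p: "qs:cr (cob ?C k)" for k qs
 proof (cases "k + int n < 0")
  case True
  hence "qs = 0[cob ?C k]" using p by (simp add: du_shift_cob(2))
  thus ?thesis using lmod_hom_zr[OF m m hom, of k] lmod_hom_zr[OF m m hom, of "k + 1"] by (simp add: add.assoc)
 next
  case False
  then obtain i where k: "k = int i - int n" using cs[of k] by auto
  have k1: "k + 1 = int (Suc i) - int n" by (simp add: k)
  have p': "qs:cr (env_dual A (P i))" using p by (simp add: k du_shift_cob)
  hence ph: "lmod_hom ?E (P i) (rgm ?E) qs" by simp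
  have c: "cdiff ?C k qs:cr (env_dual A (P (Suc i)))" using lhD(1)[OF hom p] sh by (simp add: k)
  have dc: "d (Suc i) x:cr (P (Suc i))" if "x:cr (P (Suc (Suc i)))" for x by (rule lhD(1)[OF d that])
  have "qs 0[P i] = 0[?E]" using lmod_hom_zr[OF P l_mod_regular[OF E] ph] by simp
  hence "cocyc ?E P d (Suc i) (cdiff ?C k qs)"
   using c dd dc unfolding cocyc_def k cd[OF p'] by (cases "even n") auto
  hence "cdiff ?C (k + 1) (cdiff ?C k qs) = 0[cob ?C (k + 1 + 1)]"
   using cyc[OF c] unfolding k1 by blast
  thus ?thesis by (simp add: add.assoc)
 qed
 thus ?thesis unfolding cochain_complex_def using m hom by blast
qed

lemma (in quiver_quotient) env_dual_module:
 assumes M: "left_module E M"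
 shows "left_module E (env_dual A M)"
proof -
 interpret ring E by (rule E_ring)
 interpret M: left_module E M by (rule M)
 note [simp] = E_def[symmetric]
 have fl: "env_flip z:cr E" "env_flip (z *[E] w) = env_flip w *[E] env_flip z" "env_flip (z +[E] w) = env_flip z +[E] env_flip w" "env_flip 1[E] = 1[E]"
  if zw: "z:cr E" "w:cr E" for z w
 proof -
  obtain a b where ab: "a:Te" "z = Psi a" "b:Te" "w = Psi b" using zw by (auto simp: Psi_image)
  have s: "Psi (swp a):cr E" if "a:Te" for a using swp_sp[OF that] by (simp add: Psi_image)
  show "env_flip z:cr E" using ab s by (simp add: env_flip_Psi)
  show "env_flip (z *[E] w) = env_flip w *[E] env_flip z" using ab swp_sp[OF ab(1)] swp_sp[OF ab(3)] by (simp add: Psi_mult env_flip_Psi Te_mult swp_emul)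
  show "env_flip (z +[E] w) = env_flip z +[E] env_flip w" using ab by (simp add: Psi_add env_flip_Psi sub_add pl_add[OF pl_swp])
  show "env_flip 1[E] = 1[E]" by (simp add: Psi_one env_flip_Psi) (simp add: unitE_def swp_ten)
 qed
 have h: "f m:cr E" "f (m +[M] m') = f m +[E] f m'" "f (r *.[M] m) = r *[E] f m"
  if "f:cr (env_dual A M)" "m:cr M" "m':cr M" "r:cr E" for f m m' r
  using that lhD[of E M "rgm E" f] by simp_all
 have hc: "restrict f (cr M):cr (env_dual A M)"
  if "!!m. m:cr M ==> f m:cr E" "!!m m'. m:cr M ==> m':cr M ==> f (m +[M] m') = f m +[E] f m'"
   "!!r m. r:cr E ==> m:cr M ==> f (r *.[M] m) = r *[E] f m" for f
  using that by (auto intro!: lmod_homI simp: M.smult_closed)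
 have eq: "(!!m. m:cr M ==> f m = g m) ==> g:cr (env_dual A M) ==> restrict f (cr M) = g" for f g
  by (auto simp: fun_eq_iff extensional_def)
 note z = zero_closed
 have ab: "abelian_group (env_dual A M)"
 proof (rule abelian_groupI)
  fix f g k assume f: "f:cr (env_dual A M)" and g: "g:cr (env_dual A M)" and k: "k:cr (env_dual A M)"
  note hf = h[OF f] and hg = h[OF g] and hk = h[OF k]
  show "f +[env_dual A M] g:cr (env_dual A M)"
   unfolding du_s(3) by (rule hc) (simp_all add: hf[OF _ _ z] hg[OF _ _ z] hf(3) hg(3) r_distr a_ac)
  show "f +[env_dual A M] g +[env_dual A M] k = f +[env_dual A M] (g +[env_dual A M] k)"
   unfolding du_s(3) by (rule restrict_ext) (simp add: hf(1)[OF _ _ z] hg(1)[OF _ _ z] hk(1)[OF _ _ z] a_assoc)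
  show "f +[env_dual A M] g = g +[env_dual A M] f"
   unfolding du_s(3) by (rule restrict_ext) (simp add: hf(1)[OF _ _ z] hg(1)[OF _ _ z] a_comm)
  show "0[env_dual A M] +[env_dual A M] f = f"
   unfolding du_s(2,3) by (rule eq[OF _ f]) (simp add: hf(1)[OF _ _ z])
  show "EX g:cr (env_dual A M). g +[env_dual A M] f = 0[env_dual A M]"
  proof (rule bexI)
   show "(\<lambda>m\<in>cr M. -[E] f m):cr (env_dual A M)"
    by (rule hc) (simp_all add: hf[OF _ _ z] hf(3) minus_add r_minus)
   show "(\<lambda>m\<in>cr M. -[E] f m) +[env_dual A M] f = 0[env_dual A M]"
    unfolding du_s(2,3) by (rule restrict_ext) (simp add: hf(1)[OF _ _ z] l_neg)
  qed
 next
  show "0[env_dual A M]:cr (env_dual A M)" unfolding du_s(2) by (rule hc) simp_all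
 qed
 show ?thesis
 proof (rule left_module.intro[OF E_ring ab left_module_axioms.intro])
  fix a b f g assume a: "a:cr E" and b: "b:cr E" and f: "f:cr (env_dual A M)" and g: "g:cr (env_dual A M)"
  note hf = h[OF f] and hg = h[OF g]
  show "a *.[env_dual A M] f:cr (env_dual A M)"
   unfolding du_s(4) by (rule hc) (simp_all add: hf[OF _ _ z] hf(3) fl[OF a z] l_distr m_assoc)
  show "(a +[E] b) *.[env_dual A M] f = a *.[env_dual A M] f +[env_dual A M] b *.[env_dual A M] f"
   unfolding du_s(3,4) by (rule restrict_ext) (simp add: hf(1)[OF _ _ z] fl[OF a b] fl(1)[OF b z] r_distr)
  show "a *.[env_dual A M] (f +[env_dual A M] g) = a *.[env_dual A M] f +[env_dual A M] a *.[env_dual A M] g"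
   unfolding du_s(3,4) by (rule restrict_ext) (simp add: hf(1)[OF _ _ z] hg(1)[OF _ _ z] fl[OF a z] l_distr)
  show "(a *[E] b) *.[env_dual A M] f = a *.[env_dual A M] (b *.[env_dual A M] f)"
   unfolding du_s(4) by (rule restrict_ext) (simp add: hf(1)[OF _ _ z] fl[OF a b] fl(1)[OF b z] m_assoc)
 next
  fix f assume f: "f:cr (env_dual A M)"
  show "1[E] *.[env_dual A M] f = f"
   unfolding du_s(4) by (rule eq[OF _ f]) (simp add: h(1)[OF f _ _ z] fl(4)[OF z z])
 qed
qed

section \<open>The roof for the deformation\<close>

context superpotential_class
begin

text \<open>The contraction as a map on homomorphisms: fi determines its column modulo
  \<open>J.NN\<close>, hence the contraction modulo I(P).\<close>

definition etaA where "etaA fi = J.cl (eta (SOME c. col (Suc n) c & (ALL x:cr (CJ.PC (Suc n)). fi x = CJ.phi (Suc n) c x)))"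

lemma etaA:
 assumes c: "col (Suc n) c" and p: "ALL x:cr (CJ.PC (Suc n)). fi x = CJ.phi (Suc n) c x"
 shows "etaA fi = J.cl (eta c)"
proof -
 define c' where "c' = (SOME c. col (Suc n) c & (ALL x:cr (CJ.PC (Suc n)). fi x = CJ.phi (Suc n) c x))"
 have s: "col (Suc n) c' & (ALL x:cr (CJ.PC (Suc n)). fi x = CJ.phi (Suc n) c' x)"
  unfolding c'_def by (rule someI[of _ c]) (intro conjI c p)
 have "CJ.phi (Suc n) c' x = CJ.phi (Suc n) c x" if "x:cr (CJ.PC (Suc n))" for x
  using trans[OF bspec[OF conjunct2[OF s] that, symmetric] bspec[OF p that]] .
 hence "ALL j<m (Suc n). c' j - c j:J.NN" using CJ.phi_eq_i[OF conjunct1[OF s] c] by blast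
 hence "eta (%j. c' j - c j):J.J" by (intro eta_NN) simp
 thus ?thesis by (simp add: etaA_def c'_def[symmetric] J.cl_eq eta_df)
qed

lemma du_phi:
 assumes "fi:cr (env_dual J.A (CJ.PC i))"
 obtains c where "col i c" "ALL x:cr (CJ.PC i). fi x = CJ.phi i c x"
proof -
 have h: "lmod_hom J.E (CJ.PC i) (rgm J.E) fi" using assms by (simp add: J.E_def)
 show thesis by (rule CJ.hom_phi[OF h]) (rule that, auto)
qed

text \<open>The shifted dual of the Koszul resolution is itself the apex of the roof, with the
  identity on one side and, on the other, \<open>etaA\<close> in degree zero and zero maps
  elsewhere.\<close>

lemma calabi_yau_J: "calabi_yau (Suc n) J.A"
proof -
 let ?D = "Suc n" and ?A = J.A and ?E = J.E and ?P = CJ.PC and ?d = CJ.dC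
 let ?Z = "dual_shift ?D ?A ?P ?d" and ?S = "stalk_complex (diag_module ?A)"
 let ?g = "%k fi. if k = 0 then etaA fi else 0[?A]"
 note of_nat_Suc [simp del] du_s [simp del]
 note res = fg_resD[OF CJ.kz_res]
 note E = J.E_ring[unfolded J.E_def] and PM = res(3)[unfolded J.E_def] and dh = res(4)[unfolded J.E_def]
 have D: "left_module ?E (env_dual ?A (?P i))" for i by (rule J.env_dual_module[OF res(3)])
 note ab = lm_ab[OF D]
 have Z: "cochain_complex ?E ?Z"
  unfolding J.E_def by (rule dual_shift_complex) (fact E, fact PM, fact dh, use res(10) in blast, fact D[unfolded J.E_def])
 have S: "cochain_complex ?E ?S" by (rule stalk_cochain[OF res(1)])
 note cyc = du_cyc[where A = ?A and P = ?P and d = ?d and n = ?D, OF E PM dh ab, folded J.E_def]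
  and cob = du_cob[where A = ?A and P = ?P and d = ?d and n = ?D, OF E PM dh ab, folded J.E_def]
 have cs: "(EX i. k = int i - int ?D) | k + int ?D < 0" for k by (cases "k + int ?D < 0") (auto intro!: exI[of _ "nat (k + int ?D)"])
 have Z0: "cob ?Z 0 = env_dual ?A (?P ?D)" using du_shift_cob(1)[of ?D ?A ?P ?d ?D] by simp
 have bS: "cobound ?S k = {0[?A]}" for k
  using abelian_monoid.zero_closed[OF abelian_group.axioms(1)[OF lm_ab[OF res(1)]]]
  by (force simp: cobound_def stalk_complex_def diag_module_def)
 have zA: "0[diag_module ?A] = 0[?A]" by (simp add: diag_module_def)
 \<comment> \<open>Degrees with a dual module use the exactness of columns lifted from A; in the
   remaining degrees the only cocycle is zero.\<close>
 have exact: "fi:cobound ?Z k" if k: "k ~= 0" and p: "fi:cocycles ?Z k" for k fi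
 proof (cases "k + int ?D < 0")
  case True
  hence "fi = 0[cob ?Z k]" using p by (simp add: cocycles_def[OF Z] du_shift_cob(2))
  thus ?thesis using additive_subgroup.zero_closed[OF cob_subgroup[OF Z]] by simp
 next
  case False
  then obtain i where i: "k = int i - int ?D" using cs[of k] by auto
  have ph: "fi:cr (env_dual ?A (?P i))" using p by (simp add: cocycles_def[OF Z] i du_shift_cob)
  hence "cocyc ?E ?P ?d i fi" using cyc[OF ph] p by (simp add: cocycles_def[OF Z] i)
  then obtain c where c: "CJ.clcol i c" "!!x. x:cr (?P i) ==> fi x = CJ.phi i c x" by (rule CJ.cocyc_clcol) (rule that)
  have "cobd ?E ?P ?d i (CJ.phi i c)"
  proof (cases i)
   case 0
   have z: "col 0 (%_. 0)" by (simp add: col_def sub_0)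
   have "ALL x:cr (?P 0). CJ.phi 0 c x = CJ.phi 0 (%_. 0) x"
    using CJ.phi_eq_i[of 0 c "%_. 0"] z c(1) columns_exact_J0[of c] by (simp add: 0 CJ.clcol_def)
   moreover have "CJ.phi 0 (%_. 0) x = 0[?E]" if "x:cr (?P 0)" for x
    using that CJ.phi_rowP[OF _ z] by (auto simp: CJ.PC_cr J.Psi_zr)
   ultimately show ?thesis by (simp add: cobd_def 0)
  next
   case (Suc i')
   hence "i' ~= n" using k i by auto
   from columns_exact_J[OF this] c(1) have "CJ.excol i' c" by (simp add: Suc)
   thus ?thesis using CJ.cobd_phi[of i' c] c(1) by (simp add: Suc CJ.clcol_def CJ.excol_def)
  qed
  hence "cobd ?E ?P ?d i fi" using c(2) by (auto simp: cobd_def split: nat.splits)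
  thus ?thesis using cob[OF ph] i by simp
 qed
 have eta_hom: "lmod_hom ?E (env_dual ?A (?P ?D)) (diag_module ?A) etaA"
 proof (rule lmod_homI)
  fix fi qs z assume p: "fi:cr (env_dual ?A (?P ?D))"
  obtain c where c: "col ?D c" "ALL x:cr (?P ?D). fi x = CJ.phi ?D c x" by (rule du_phi[OF p])
  show "etaA fi:cr (diag_module ?A)" by (simp add: etaA[OF c] diag_module_def eta_T[OF c(1)])
  show "etaA (fi +[env_dual ?A (?P ?D)] qs) = etaA fi +[diag_module ?A] etaA qs" if q: "qs:cr (env_dual ?A (?P ?D))"
  proof -
   obtain b where b: "col ?D b" "ALL x:cr (?P ?D). qs x = CJ.phi ?D b x" by (rule du_phi[OF q])
   have "ALL x:cr (?P ?D). (fi +[env_dual ?A (?P ?D)] qs) x = CJ.phi ?D (%j. c j + b j) x"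
    using c b by (simp add: J.E_def[symmetric] CJ.phi_add du_s)
   from etaA[OF col_add[OF c(1) b(1)] this] show ?thesis by (simp add: etaA[OF c] etaA[OF b] diag_module_def J.A_add eta_add)
  qed
  show "etaA (z *.[env_dual ?A (?P ?D)] fi) = z *.[diag_module ?A] etaA fi" if "z:cr ?E"
  proof -
   obtain w where w: "w:Te" "z = J.Psi w" using `z:carrier ?E` by (auto simp: J.Psi_image)
   have "ALL x:cr (?P ?D). (z *.[env_dual ?A (?P ?D)] fi) x = CJ.phi ?D (%j. c j ** swp w) x"
    using c w by (simp add: J.E_def[symmetric] CJ.phi_flip du_s)
   from etaA[OF col_smult[OF c(1) swp_sp[OF w(1)]] this]
   show ?thesis by (simp add: etaA[OF c] diag_module_def w J.env_act_Psi eta_T[OF c(1)] eta_act)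
  qed
 qed
 have eta_zero: "etaA fi = 0[?A] <-> fi:cobound ?Z 0" if p: "fi:cr (env_dual ?A (?P ?D))" for fi
 proof -
  obtain c where c: "col ?D c" "ALL x:cr (?P ?D). fi x = CJ.phi ?D c x" by (rule du_phi[OF p])
  have "etaA fi = 0[?A] <-> eta c:J.J" by (simp add: etaA[OF c] J.A_zero J.cl_eq del: qcos_zr)
  also have "... <-> cobd ?E ?P ?d ?D (CJ.phi ?D c)" using eta_kernel[OF c(1)] CJ.cobd_phi[OF c(1)] by (simp add: CJ.excol_def)
  also have "... <-> cobd ?E ?P ?d ?D fi" using c(2) by (auto simp: cobd_def)
  also have "... <-> fi:cobound ?Z 0" using cob[OF p] by simp
  finally show ?thesis .
 qed
 have gh: "lmod_hom ?E (cob ?Z k) (cob ?S k) (?g k)" for k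
 proof (cases "k = 0")
  case True
  thus ?thesis using eta_hom by (simp add: Z0 stalk_complex_def)
 next
  case False
  thus ?thesis using lmod_hom_const_zr[OF cob_mod[OF Z, of k] cob_mod[OF S, of k]] by (simp add: stalk_complex_def zA)
 qed
 have gd: "?g (k + 1) (cdiff ?Z k x) = cdiff ?S k (?g k x)" if x: "x:cr (cob ?Z k)" for k x
 proof (cases "k + 1 = 0")
  case True
  have "cdiff ?Z k x:cobound ?Z (k + 1)" using x by (simp add: cobound_def)
  moreover have "cdiff ?Z k x:cr (env_dual ?A (?P ?D))" using lhD(1)[OF cdiff_hom[OF Z] x] True Z0 by simp
  ultimately show ?thesis using True eta_zero[of "cdiff ?Z k x"] by (simp add: stalk_complex_def zA)
 qed (simp add: stalk_complex_def zA)
 have id_bij: "quasi_iso ?E ?Z ?Z (%_ x. x)"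
  unfolding quasi_iso_def
 proof (intro conjI Z allI ballI refl)
  have h: "lmod_hom ?E (cob ?Z i) (cob ?Z i) (%x. x)" for i by (rule lmod_homI) simp_all
  thus "lmod_hom ?E (cob ?Z i) (cob ?Z i) (%x. x)" for i .
  fix i
  interpret left_module ?E "cob ?Z i" by (rule cob_mod[OF Z])
  have w: "w -[cob ?Z i] w:cobound ?Z i" if "w:cocycles ?Z i" for w
   using that additive_subgroup.zero_closed[OF cob_subgroup[OF Z]] by (simp add: cocycles_def[OF Z] M.minus_eq M.r_neg)
  show "bij_betw (%X. \<Union>x\<in>X. cobound ?Z i +>\<^bsub>cob ?Z i\<^esub> x) (cr (cohomology ?Z i)) (cr (cohomology ?Z i))"
   by (rule iffD2[OF quasi_iso_bij[where f = "%_ x. x", OF Z Z h]]) (use w in auto)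
 qed
 have g_bij: "quasi_iso ?E ?Z ?S ?g"
  unfolding quasi_iso_def
 proof (intro conjI Z S allI ballI gh gd)
  fix k
  interpret SM: left_module ?E "cob ?S k" by (rule cob_mod[OF S])
  have z0: "0[cob ?S k] = 0[?A]" by (simp add: stalk_complex_def zA)
  show "bij_betw (%X. \<Union>x\<in>X. cobound ?S k +>\<^bsub>cob ?S k\<^esub> ?g k x) (cr (cohomology ?Z k)) (cr (cohomology ?S k))"
  proof (rule iffD2[OF quasi_iso_bij[where f = ?g, OF Z S gh]])
   show "(ALL z:cocycles ?Z k. ?g k z:cobound ?S k --> z:cobound ?Z k) &
    (ALL w:cocycles ?S k. EX z:cocycles ?Z k. ?g k z -[cob ?S k] w:cobound ?S k)"
   proof (intro conjI ballI impI)
    fix z assume z: "z:cocycles ?Z k" "?g k z:cobound ?S k"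
    show "z:cobound ?Z k"
    proof (cases "k = 0")
    case True
    thus ?thesis using z eta_zero[of z] by (simp add: bS cocycles_def[OF Z] Z0 del: du_s)
    qed (use exact z in blast)
   next
    fix w assume w: "w:cocycles ?S k"
    hence wc: "w:cr (cob ?S k)" by (simp add: cocycles_def[OF S])
    have "EX z:cocycles ?Z k. ?g k z = w"
    proof (cases "k = 0")
    case True
    then obtain t where t: "t:T" "w = J.cl t" using wc by (auto simp: stalk_complex_def diag_module_def J.A_cr)
    \<comment> \<open>A column that contracts to t; it is closed because there are no Koszul terms
      above the top.\<close>
    let ?c = "U (ten unitT t)"
    have c: "col ?D ?c" by (intro U_col I.ten_Te uT_in t)
    let ?z = "restrict (CJ.phi ?D ?c) (cr (?P ?D))"
    interpret PMi: left_module ?E "?P ?D" by (rule res(3))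
    have zc: "?z:cr (env_dual ?A (?P ?D))"
    using CJ.phi_hom[OF c] by (auto simp: J.E_def[symmetric] lmod_hom_def PMi.smult_closed du_s)
    have "cocyc ?E ?P ?d ?D (CJ.phi ?D ?c)" using CJ.cocyc_phi[OF c] by (simp add: m_zr)
    hence "cocyc ?E ?P ?d ?D ?z" using zc lhD(1)[OF res(4)] by (simp add: cocyc_def du_s J.E_def)
    hence "?z:cocycles ?Z k" using cyc[OF zc] zc True by (simp add: cocycles_def[OF Z] Z0 del: du_s)
    moreover have "etaA ?z = w" using etaA[OF c, of ?z] by (simp add: eta_U t)
    ultimately show ?thesis using True by auto
    next
    case False
    have "0[cob ?Z k]:cocycles ?Z k"
    proof -
    interpret ZM: left_module ?E "cob ?Z k" by (rule cob_mod[OF Z])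
    show ?thesis using lmod_hom_zr[OF cob_mod[OF Z] cob_mod[OF Z] cdiff_hom[OF Z]] by (simp add: cocycles_def[OF Z])
    qed
    moreover have "w = 0[?A]" using wc False by (simp add: stalk_complex_def zA)
    ultimately show ?thesis using False by (intro bexI[of _ "0[cob ?Z k]"]) simp_all
    qed
    then obtain z where z: "z:cocycles ?Z k" "?g k z = w" by (elim bexE) (rule that)
    have "?g k z -[cob ?S k] w:cobound ?S k" unfolding z(2) bS SM.M.minus_eq SM.M.r_neg[OF wc] z0 by (rule singletonI)
    thus "EX z:cocycles ?Z k. ?g k z -[cob ?S k] w:cobound ?S k" by (rule bexI[OF _ z(1)])
   qed
  qed (rule gd)
 qed
 have "fin_fgproj_resolution ?E (diag_module ?A) ?P ?d CJ.eC"
  unfolding fin_fg_res_i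
 proof (intro conjI CJ.kz_res exI[of _ ?D] allI impI)
  fix i assume "i > ?D"
  hence "m i = 0" using m_zr[of "i - 1"] by (cases i) auto
  thus "cr (?P i) = {0[?P i]}" by (auto simp: CJ.PC_cr CJ.PC_zr CJ.rowP_def row_def)
 qed
 thus ?thesis
  unfolding calabi_yau_def derived_iso_def J.E_def[symmetric] using id_bij g_bij by blast
qed

end

theorem theorem3p2p1:
  fixes Q :: "('v, 'e) pre_digraph" and n :: nat and \<Phi> :: "('v, 'e) qelem"
    and P :: "('v, 'e) qelem set" and \<theta>\<^sub>1 \<theta>\<^sub>0 :: "('v, 'e) qelem \<Rightarrow> ('v, 'e) qelem"
  assumes "fin_digraph Q"
    and "n \<ge> 2"
    and "superpotential Q n \<Phi>"
    and "calabi_yau n (superpot_alg Q \<Phi> (n - 2))"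
    and "two_koszul Q (superpot_rels Q \<Phi> (n - 2))"
    and "zeroPBW_deformation Q (superpot_rels Q \<Phi> (n - 2)) P \<theta>\<^sub>1 \<theta>\<^sub>0"
    and "\<forall>r \<in> superpot_rels Q \<Phi> (n - 2). \<theta>\<^sub>1 r = 0"
  shows "calabi_yau n (quiver_quot Q P)"
proof -
 define R where "R = superpot_rels Q \<Phi> (n - 2)"
 obtain n' where n': "n = Suc n'" "n' \<ge> 1" using assms(2) by (cases n) auto
 interpret quiver Q by (rule quiver.intro[OF assms(1)])
 have R: "S_subbimodule Q R" "R <= Vpow Q 2" using assms(5) by (simp_all add: two_koszul_def R_def)
 have pb: "PBW_deformation Q R P" and dm: "deformation_maps Q R P \<theta>\<^sub>1 \<theta>\<^sub>0" using assms(6) by (simp_all add: zeroPBW_deformation_def R_def)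
 have PT: "P <= T" using pb by (auto simp: PBW_deformation_def Filt_eq sp_in_def)
 \<comment> \<open>The class of x equals that of -y, which has lower degree; so x and 0 have the
   same image in the graded piece, and the PBW map is injective.\<close>
 have pbw: "x:quiver_ideal Q R" if x: "x:Vpow Q l" and y: "y:below plen l" and xy: "x + y:quiver_ideal Q P" for l x y
 proof -
  interpret QP: quiver_quotient Q P by unfold_locales (rule PT)
  interpret QR: quiver_quotient Q R by unfold_locales (use R(2) Vpow_T in blast)
  obtain fi where f: "!!x. x:Vpow Q l ==> fi (qclass Q R x) = alg_filt_below Q P l +>\<^bsub>quiver_quot Q P\<^esub> qclass Q P x"
   and b: "bij_betw fi (qclass Q R ` Vpow Q l) (cr (gr_part Q P l))" using pb unfolding PBW_deformation_def by (elim conjE allE[of _ l] exE, intro that) (erule bspec)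
  define F where "F = T \<inter> below plen l"
  have F: "subsp F" by (simp add: F_def pm.subspace_inter)
  have bel: "alg_filt_below Q P l = QP.cl ` F"
  proof (cases l)
   case 0
   hence "F = {0}" by (auto simp: F_def sp_in_def)
   thus ?thesis by (simp add: 0 alg_filt_below_def QP.A_def[symmetric] QP.A_zero)
  next
   case (Suc k)
   have "Filt Q k = F" by (auto simp: Filt_eq F_def below_def Suc sp_in_def)
   thus ?thesis by (simp add: alg_filt_below_def alg_filt_def Suc QP.qclass_eq)
  qed
  \<comment> \<open>A class that comes from lower degree represents the zero coset in the graded
    piece.\<close>
  have cs: "alg_filt_below Q P l +>\<^bsub>quiver_quot Q P\<^esub> QP.cl z = QP.cl ` F" if z: "QP.cl z:QP.cl ` F" for z
  proof -
   obtain u where u: "QP.cl z = QP.cl u" "u:F" using z by (elim imageE) (rule that)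
   have "alg_filt_below Q P l +>\<^bsub>quiver_quot Q P\<^esub> QP.cl z = (%v. QP.cl (v + u)) ` F"
    unfolding bel u(1) a_r_coset_def' QP.A_def[symmetric] by (auto simp: QP.A_add)
   also have "... = QP.cl ` (%v. v + u) ` F" by (simp add: image_image)
   also have "(%v. v + u) ` F = F"
   proof (intro equalityI subsetI)
    fix v assume "v:F"
    thus "v:(%v. v + u) ` F" using sub_diff[OF F _ u(2)] by (intro image_eqI[of _ _ "v - u"]) simp_all
   qed (use sub_add[OF F _ u(2)] in blast)
   finally show ?thesis .
  qed
  have J: "x + y:QP.J" using xy by (simp add: QP.J_def)
  have "y:T" using sub_diff[OF sub_sp_in subsetD[OF QP.J_T J] subsetD[OF Vpow_T x]] by simp
  hence "- y:F" using sub_neg[OF F, of y] y by (simp add: F_def)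
  moreover have "QP.cl x = QP.cl (- y)" using J by (simp add: QP.cl_eq)
  ultimately have "fi (qclass Q R x) = fi (qclass Q R 0)"
   using cs[of x] cs[of 0] sub_0[OF F] f[OF x] f[of 0] by (auto simp: QP.qclass_eq sub_0 simp del: qcos_zr)
  hence "qclass Q R x = qclass Q R 0"
   by (rule inj_onD[OF bij_betw_imp_inj_on[OF b]]) (intro imageI x sub_0[OF Vpow_sub])+
  hence "x - 0:QR.J" by (simp only: QR.qclass_eq QR.cl_eq)
  thus ?thesis by (simp add: QR.J_def)
 qed
 have PP: "P = (%r. r - \<theta>\<^sub>0 r) ` R" using dm assms(7) by (simp add: deformation_maps_def R_def[symmetric])
 interpret quadratic Q R by unfold_locales (rule R)+
 \<comment> \<open>All properties of a basis in degree i are packed into one predicate, so that five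
   applications of choice select the bases of all degrees.\<close>
 define B where "B i m kb kp hd tl <-> (ALL j<m. kb j:Kos Q R i) & (ALL j<m. ALL p. lk (kb j) p ~= 0 --> phead p = hd j & ptail p = tl j) &
   (ALL j<m. hd j:verts Q & tl j:verts Q) & (ALL j<m. ALL p. kp j p ~= 0 --> phead p = hd j & ptail p = tl j) &
   (ALL j<m. ALL j'<m. pairing (kp j) (kb j') = (if j = j' then 1 else 0)) & (ALL k:Kos Q R i. k = (\<Sum>j<m. pscale (pairing (kp j) k) (kb j)))"
  for i and m :: nat and kb :: "nat => ('v, 'e) qelem" and kp :: "nat => ('v, 'e) qpath => complex" and hd tl :: "nat => 'v"
 have "ALL i. EX m kb kp hd tl. B i m kb kp hd tl"
 proof
  fix i
  show "EX m kb kp hd tl. B i m kb kp hd tl"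
  proof (rule homogeneous_basis[of i])
  fix m :: nat and kb :: "nat => ('v, 'e) qelem" and hd tl :: "nat => 'v" and kp :: "nat => ('v, 'e) qpath => complex"
   assume h: "!!j. j < m ==> kb j:Kos Q R i"
   "!!j p. j < m ==> lk (kb j) p ~= 0 ==> phead p = hd j & ptail p = tl j"
   "!!j. j < m ==> hd j:verts Q & tl j:verts Q"
   "!!j p. j < m ==> kp j p ~= 0 ==> phead p = hd j & ptail p = tl j"
   "!!j j'. j < m ==> j' < m ==> pairing (kp j) (kb j') = (if j = j' then 1 else 0)"
   "!!k. k:Kos Q R i ==> k = (\<Sum>j<m. pscale (pairing (kp j) k) (kb j))"
  have "B i m kb kp hd tl" unfolding B_def by (intro conjI) (intro allI impI ballI, rule h, assumption+)+
  thus "EX m kb kp hd tl. B i m kb kp hd tl" by (intro exI, assumption)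
  qed
 qed
 from choice[OF this] obtain m where "ALL i. EX kb kp hd tl. B i (m i) kb kp hd tl" by (elim exE) (rule that)
 from choice[OF this] obtain kb where "ALL i. EX kp hd tl. B i (m i) (kb i) kp hd tl" by (elim exE) (rule that)
 from choice[OF this] obtain kp where "ALL i. EX hd tl. B i (m i) (kb i) (kp i) hd tl" by (elim exE) (rule that)
 from choice[OF this] obtain hd where "ALL i. EX tl. B i (m i) (kb i) (kp i) (hd i) tl" by (elim exE) (rule that)
 from choice[OF this] obtain tl where B: "ALL i. B i (m i) (kb i) (kp i) (hd i) (tl i)" by (elim exE) (rule that)
 note b = B[THEN spec, unfolded B_def]
 note b1 = b[THEN conjunct1] and b = b[THEN conjunct2]
 note b2 = b[THEN conjunct1] and b = b[THEN conjunct2]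
 note b3 = b[THEN conjunct1] and b = b[THEN conjunct2]
 note b4 = b[THEN conjunct1] and b = b[THEN conjunct2]
 note b5 = b[THEN conjunct1] and b6 = b[THEN conjunct2]
 interpret koszul_deformation Q R P \<theta>\<^sub>0 m kb kp hd tl
 proof unfold_locales
  show "\<theta>\<^sub>0 r:Vpow Q 0" if "r:R" for r using dm that by (auto simp: deformation_maps_def S_bimodule_hom_def)
  show "two_koszul Q R" using assms(5) by (simp add: R_def)
  show "P = (%r. r - \<theta>\<^sub>0 r) ` R" by (rule PP)
  show "x:quiver_ideal Q R" if "x:Vpow Q l" "y:below plen l" "x + y:quiver_ideal Q P" for x y l by (rule pbw[OF that])
  fix i j
  show "kb i j:Kos Q R i" if "j < m i" by (rule b1[rule_format, OF that])
  show "phead p = hd i j & ptail p = tl i j" if "j < m i" "lk (kb i j) p ~= 0" for p by (rule b2[rule_format, OF that])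
  show "hd i j:verts Q & tl i j:verts Q" if "j < m i" by (rule b3[rule_format, OF that])
  show "phead p = hd i j & ptail p = tl i j" if "j < m i" "kp i j p ~= 0" for p by (rule b4[rule_format, OF that])
  show "pairing (kp i j) (kb i j') = (if j = j' then 1 else 0)" if "j < m i" "j' < m i" for j' by (rule b5[rule_format, OF that])
  show "k = (\<Sum>j<m i. pscale (pairing (kp i j) k) (kb i j))" if "k:Kos Q R i" for k by (rule b6[rule_format, OF that])
 qed (rule R)+
 have "calabi_yau (Suc n') (quiver_quot Q R)" using assms(4) by (simp add: superpot_alg_def R_def n')
 hence "calabi_yau (Suc n') I.A" by (simp add: I.A_def)
 then obtain N TT where "top_class Q R P \<theta>\<^sub>0 m kb kp hd tl n' N TT"
  by (rule CI.cy_columns) (rule that, unfold_locales)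
 then interpret top_class Q R P \<theta>\<^sub>0 m kb kp hd tl n' N TT .
 interpret superpotential_class Q R P \<theta>\<^sub>0 m kb kp hd tl n' N TT \<Phi>
  by unfold_locales (use assms(3) n' R_def in simp_all)
 show ?thesis using calabi_yau_J by (simp add: n' J.A_def)
qed

end
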